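(* Let the standing assumptions (A1)–(A4) listed in the context be fulfilled, let $X=(X_t)_{t\in[0,T]}$ be the solution of the SPDE $dX_t=[AX_t+F(X_t)]\,dt+B\,dW_t$, $X_0=u_0$, and let $\mathbf{w}\in\mathbf{SW}'$ be an arbitrary stochastic wood. Then for each $p\in[1,\infty)$ there is a constant $C_p>0$ (depending on $p$, $\mathbf{w}$, $T$ and the coefficients of the SPDE, but independent of $t$ and $t_0$) such that for every $t_0\in[0,T)$ and every $t\in[t_0,T]$ $$X_t = X_{t_0}+\Phi(\mathbf{w})(t)$$ (equality of stochastic processes on $[t_0,T]$, up to indistinguishability) and $$\Bigl(\mathbb{E}\bigl[\,|X_t-X_{t_0}-\Psi(\mathbf{w})(t)|^p\,\bigr]\Bigr)^{1/p}\le C_p\,(t-t_0)^{\operatorname{ord}(\mathbf{w})}.$$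
   Context: **Setting.** $\mathbb{N}=\{1,2,\dots\}$. Fix $T>0$ and a probability space $(\Omega,\mathcal{F},\mathbb{P})$ with a normal filtration $(\mathcal{F}_t)_{t\in[0,T]}$. Let $(H,\langle\cdot,\cdot\rangle)$ (norm $|\cdot|$) and $K$ be separable real Hilbert spaces, $(W_t)_{t\in[0,T]}$ a cylindrical $I$-Wiener process on $K$ with respect to $(\mathcal{F}_t)$, and $B:K\to H$ a bounded linear operator. $|\cdot|_{\mathrm{HS}}$ is the Hilbert–Schmidt norm of operators $K\to H$; for a random variable $Z:\Omega\to H$, $|Z|_{L^p}=(\mathbb{E}|Z|^p)^{1/p}$. (A1) There are a countable or finite set $\mathcal{I}$, real numbers $(\lambda_i)_{i\in\mathcal{I}}$ with $\inf_i\lambda_i>-\infty$, and an orthonormal basis $(e_i)_{i\in\mathcal{I}}$ of $H$ such that $Av=\sum_{i}-\lambda_i\langle e_i,v\rangle e_i$ for $v\in D(A)=\{v\in H:\sum_i|\lambda_i|^2|\langle e_i,v\rangle|^2<\infty\}$. Write $e^{At}v=\sum_i e^{-\lambda_i t}\langle e_i,v\rangle e_i$ for $t\ge0$. Fix $\kappa\ge0$ with $\inf_{i}(\kappa+\lambda_i)>0$; $(\kappa-A)^r$, $r\in\mathbb{R}$, denotes the fractional powers of $\kappa-A$ (acting by multiplication by $(\kappa+\lambda_i)^r$ on $e_i$), with domain $D((\kappa-A)^r)$. (A2) $F:H\to H$ is infinitely often Fréchet differentiable and $\sup_{v\in H}|F^{(i)}(v)|<\infty$ for all $i\in\mathbb{N}$.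 (A3) There are $\gamma\in(0,1)$, $\delta\in(0,\frac12]$ and $C>0$ such that $\int_0^T|(\kappa-A)^\gamma e^{As}B|_{\mathrm{HS}}^2\,ds<\infty$ and $\int_0^t|e^{As}B|_{\mathrm{HS}}^2\,ds\le Ct^{2\delta}$ for all $t\in[0,1]$. (A4) $u_0:\Omega\to D((\kappa-A)^\gamma)$ is $\mathcal{F}_0/\mathcal{B}(D((\kappa-A)^\gamma))$-measurable with $\mathbb{E}|(\kappa-A)^\gamma u_0|^p<\infty$ for every $p\in[1,\infty)$, with $\gamma$ from (A3). Under these assumptions the stochastic convolution $\int_0^te^{A(t-s)}B\,dW_s$ has a version with continuous sample paths (unique up to indistinguishability), which is fixed, and there is a pathwise unique adapted $H$-valued process $X=(X_t)_{t\in[0,T]}$ with continuous sample paths (the solution of the SPDE) satisfying $X_t=e^{At}u_0+\int_0^te^{A(t-s)}F(X_s)\,ds+\int_0^te^{A(t-s)}B\,dW_s$ for all $t\in[0,T]$; moreover $\sup_{0\le t\le T}|(\kappa-A)^\gamma X_t|_{L^p}<\infty$ for all $p\ge1$. **Integral operators.** For $t_0\in[0,T)$ write $\Delta t=t-t_0$, $\Delta X_t=X_t-X_{t_0}$ for $t\in[t_0,T]$. $\mathcal{P}$ is the set of adapted processes $Y:\Omega\to C([t_0,T],H)$ (continuous paths) with $\sup_{t_0\le t\le T}|Y_t|_{L^p}<\infty$ for all $p\ge1$. For $t\in[t_0,T]$ put $\int_{t_0}^te^{A(t-s)}B\,dW_s:=\int_0^te^{A(t-s)}B\,dW_s-e^{A(t-t_0)}\int_0^{t_0}e^{A(t_0-s)}B\,dW_s$.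 The symbols $0,1,2,1^*$ are labels. Define elements of $\mathcal{P}$ by $I^0_0(t)=(e^{A\Delta t}-I)X_{t_0}$, $I^0_1(t)=\int_{t_0}^te^{A(t-s)}F(X_{t_0})\,ds$, $I^0_2(t)=\int_{t_0}^te^{A(t-s)}B\,dW_s$, $I^0_{1^*}(t)=\int_{t_0}^te^{A(t-s)}F(X_s)\,ds$. For $i\in\mathbb{N}$, $g_1,\dots,g_i\in\mathcal{P}$ define elements of $\mathcal{P}$ by $$I^i_1[g_1,\dots,g_i](t)=\frac1{i!}\int_{t_0}^te^{A(t-s)}F^{(i)}(X_{t_0})(g_1(s),\dots,g_i(s))\,ds,$$ $$I^i_{1^*}[g_1,\dots,g_i](t)=\int_{t_0}^te^{A(t-s)}\Bigl(\int_0^1F^{(i)}(X_{t_0}+r\Delta X_s)(g_1(s),\dots,g_i(s))\frac{(1-r)^{i-1}}{(i-1)!}\,dr\Bigr)ds.$$ **Stochastic trees and woods.** An S-tree (stochastic tree) of length $l(\mathbf{t})=N\in\mathbb{N}$ is a pair $\mathbf{t}=(\mathbf{t}',\mathbf{t}'')$ of maps $\mathbf{t}':\{2,\dots,N\}\to\{1,\dots,N-1\}$ with $\mathbf{t}'(j)<j$ for all $j$, and $\mathbf{t}'':\{1,\dots,N\}\to\{0,1,2,1^*\}$. Its nodes are $\operatorname{nd}(\mathbf{t})=\{1,\dots,N\}$; $\mathbf{t}'(j)$ is the parent of $j$, and $\mathbf{t}''(j)$ is the type of $j$. $\mathbf{ST}$ is the set of all S-trees and $\mathbf{SW}=\bigcup_{n\ge1}\mathbf{ST}^n$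 the set of S-woods. A tree is active if $\mathbf{t}''(j)=1^*$ for some node $j$. For $\mathbf{w}=(\mathbf{t}_1,\dots,\mathbf{t}_n)\in\mathbf{SW}$, $\operatorname{acn}(\mathbf{w})$ is the set of pairs $(i,j)$ with $1\le i\le n$, $1\le j\le l(\mathbf{t}_i)$, $\mathbf{t}_i''(j)=1^*$ (active nodes). For $(i,j)\in\operatorname{acn}(\mathbf{w})$ define $E_{(i,j)}\mathbf{w}=(\mathbf{t}_1,\dots,\mathbf{t}_{i-1},\tilde{\mathbf{t}},\mathbf{t}_{i+1},\dots,\mathbf{t}_n,\mathbf{t}_{n+1},\mathbf{t}_{n+2},\mathbf{t}_{n+3})$, where $\tilde{\mathbf{t}}$ equals $\mathbf{t}_i$ except that $\tilde{\mathbf{t}}''(j)=1$; and for $m=1,2,3$, $\mathbf{t}_{n+m}$ has length $l(\mathbf{t}_i)+1$, coincides with $\mathbf{t}_i$ (parents and types) on nodes $1,\dots,l(\mathbf{t}_i)$, and its additional node $l(\mathbf{t}_i)+1$ has parent $j$ and type $0$ if $m=1$, $1^*$ if $m=2$, $2$ if $m=3$. Let $\mathbf{w}_0=(\mathbf{t}_1,\mathbf{t}_2,\mathbf{t}_3)$ with all three trees of length $1$ and $\mathbf{t}_1''(1)=0$, $\mathbf{t}_2''(1)=1^*$, $\mathbf{t}_3''(1)=2$. $\mathbf{SW}'$ is the set consisting of $\mathbf{w}_0$ and all woods $E_{(i_n,j_n)}\cdots E_{(i_1,j_1)}\mathbf{w}_0$, $n\in\mathbb{N}$, where $(i_l,j_l)\in\operatorname{acn}(E_{(i_{l-1},j_{l-1})}\cdots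 E_{(i_1,j_1)}\mathbf{w}_0)$ for each $l=1,\dots,n$. **Subtrees.** Let $l(\mathbf{t})\ge2$ and let $j_1<\dots<j_n$ be the nodes with $\mathbf{t}'(j_i)=1$. For each $i$ let $j_i=j_{i,1}<j_{i,2}<\dots<j_{i,l_i}$ be all nodes that are $j_i$ itself or descendants of $j_i$ (i.e. reach $j_i$ by iterating $\mathbf{t}'$). The $i$-th subtree $\mathbf{t}_i$ has length $l_i$, with $j_{i,\mathbf{t}_i'(k)}=\mathbf{t}'(j_{i,k})$ for $k\in\{2,\dots,l_i\}$ and $\mathbf{t}_i''(k)=\mathbf{t}''(j_{i,k})$ for $k\in\{1,\dots,l_i\}$. **Order.** $\operatorname{ord}(\mathbf{t})=l(\mathbf{t})+(\gamma-1)\,|\{j\in\operatorname{nd}(\mathbf{t}):\mathbf{t}''(j)=0\}|+(\delta-1)\,|\{j\in\operatorname{nd}(\mathbf{t}):\mathbf{t}''(j)=2\}|$ with $\gamma,\delta$ from (A3). For $\mathbf{w}=(\mathbf{t}_1,\dots,\mathbf{t}_n)$, $\operatorname{ord}(\mathbf{w})=\min\{\operatorname{ord}(\mathbf{t}_i):1\le i\le n,\ \mathbf{t}_i\text{ active}\}$. **The maps $\Phi,\Psi$** (for given $t_0$). For $\mathbf{t}\in\mathbf{ST}$: $\Phi(\mathbf{t})=I^0_{\mathbf{t}''(1)}$ if $\mathbf{t}''(1)\in\{0,2\}$ or $l(\mathbf{t})=1$; and, if $l(\mathbf{t})\ge2$ and $\mathbf{t}''(1)\in\{1,1^*\}$,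 $\Phi(\mathbf{t})=I^n_{\mathbf{t}''(1)}[\Phi(\mathbf{t}_1),\dots,\Phi(\mathbf{t}_n)]$, where $\mathbf{t}_1,\dots,\mathbf{t}_n$ are the subtrees of $\mathbf{t}$. $\Psi(\mathbf{t})=0$ if $\mathbf{t}$ is active and $\Psi(\mathbf{t})=\Phi(\mathbf{t})$ otherwise. For a wood $\mathbf{w}=(\mathbf{t}_1,\dots,\mathbf{t}_n)$, $\Phi(\mathbf{w})=\sum_{i=1}^n\Phi(\mathbf{t}_i)$ and $\Psi(\mathbf{w})=\sum_{i=1}^n\Psi(\mathbf{t}_i)$. *)

theory Defs
  imports "HOL-Probability.Probability"
begin

section \<open>Filtrations and cylindrical Wiener processes\<close>

definition normal_filtration :: "'a measure \<Rightarrow> real \<Rightarrow> (real \<Rightarrow> 'a measure) \<Rightarrow> bool" where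
  "normal_filtration M T \<F> \<longleftrightarrow>
     (\<forall>t\<in>{0..T}. subalgebra M (\<F> t)) \<and>
     (\<forall>s\<in>{0..T}. \<forall>t\<in>{s..T}. sets (\<F> s) \<subseteq> sets (\<F> t)) \<and>
     null_sets M \<subseteq> sets (\<F> 0) \<and>
     (\<forall>t\<in>{0..<T}. sets (\<F> t) = (\<Inter>s\<in>{t<..T}. sets (\<F> s)))"

text \<open>A cylindrical \<open>I\<close>-Wiener process on \<open>K\<close> does not take values in \<open>K\<close>.  It is given by its
  coordinate functionals: \<open>W t k\<close> stands for the real random variable \<open>\<langle>k, W\<^sub>t\<rangle>\<close>.  For every \<open>k\<close>
  this is a Brownian motion with respect to the filtration with variance \<open>\<parallel>k\<parallel>\<^sup>2 t\<close>, and it depends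
  linearly on \<open>k\<close>; the covariance structure \<open>E (W s k) (W t l) = min s t * \<langle>k, l\<rangle>\<close> follows by
  polarization.  The condition \<open>k \<noteq> 0\<close> only excludes the degenerate normal distribution.\<close>

definition cylindrical_wiener ::
    "'a measure \<Rightarrow> (real \<Rightarrow> 'a measure) \<Rightarrow> real \<Rightarrow> (real \<Rightarrow> 'k::real_inner \<Rightarrow> 'a \<Rightarrow> real) \<Rightarrow> bool" where
  "cylindrical_wiener M \<F> T W \<longleftrightarrow>
     (\<forall>t\<in>{0..T}. \<forall>k. W t k \<in> borel_measurable (\<F> t)) \<and>
     (\<forall>k. AE \<omega> in M. W 0 k \<omega> = 0) \<and>
     (\<forall>k. AE \<omega> in M. continuous_on {0..T} (\<lambda>t. W t k \<omega>)) \<and>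
     (\<forall>t\<in>{0..T}. \<forall>a b k l. AE \<omega> in M. W t (a *\<^sub>R k + b *\<^sub>R l) \<omega> = a * W t k \<omega> + b * W t l \<omega>) \<and>
     (\<forall>s t k. 0 \<le> s \<and> s < t \<and> t \<le> T \<longrightarrow>
        prob_space.indep_set M (sets (\<F> s))
          (sets (vimage_algebra (space M) (\<lambda>\<omega>. W t k \<omega> - W s k \<omega>) borel))) \<and>
     (\<forall>s t k. 0 \<le> s \<and> s < t \<and> t \<le> T \<and> k \<noteq> 0 \<longrightarrow>
        distributed M lborel (\<lambda>\<omega>. W t k \<omega> - W s k \<omega>) (normal_density 0 (norm k * sqrt (t - s))))"


section \<open>Diagonal operators and Hilbert--Schmidt norms\<close>

definition is_onb :: "'i set \<Rightarrow> ('i \<Rightarrow> 'h::real_inner) \<Rightarrow> bool" where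
  "is_onb I e \<longleftrightarrow>
     (\<forall>i\<in>I. \<forall>j\<in>I. inner (e i) (e j) = (if i = j then 1 else 0)) \<and> closure (span (e ` I)) = UNIV"

definition diagonal_operator ::
    "'i set \<Rightarrow> ('i \<Rightarrow> real) \<Rightarrow> ('i \<Rightarrow> 'h::real_inner) \<Rightarrow> 'h set \<Rightarrow> ('h \<Rightarrow> 'h) \<Rightarrow> bool" where
  "diagonal_operator I lam e DA A \<longleftrightarrow>
     countable I \<and> bdd_below (lam ` I) \<and> is_onb I e \<and>
     DA = {v. (\<lambda>i. \<bar>lam i\<bar>\<^sup>2 * \<bar>inner (e i) v\<bar>\<^sup>2) summable_on I} \<and>
     (\<forall>v\<in>DA. A v = (\<Sum>\<^sub>\<infinity>i\<in>I. (- lam i * inner (e i) v) *\<^sub>R e i))"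

definition semigroup_exp ::
    "'i set \<Rightarrow> ('i \<Rightarrow> real) \<Rightarrow> ('i \<Rightarrow> 'h::real_inner) \<Rightarrow> real \<Rightarrow> 'h \<Rightarrow> 'h" where
  "semigroup_exp I lam e t v = (\<Sum>\<^sub>\<infinity>i\<in>I. (exp (- lam i * t) * inner (e i) v) *\<^sub>R e i)"

definition frac_pow ::
    "'i set \<Rightarrow> ('i \<Rightarrow> real) \<Rightarrow> ('i \<Rightarrow> 'h::real_inner) \<Rightarrow> real \<Rightarrow> real \<Rightarrow> 'h \<Rightarrow> 'h" where
  "frac_pow I lam e \<kappa> r v = (\<Sum>\<^sub>\<infinity>i\<in>I. ((\<kappa> + lam i) powr r * inner (e i) v) *\<^sub>R e i)"

definition frac_dom ::
    "'i set \<Rightarrow> ('i \<Rightarrow> real) \<Rightarrow> ('i \<Rightarrow> 'h::real_inner) \<Rightarrow> real \<Rightarrow> real \<Rightarrow> 'h set" where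
  "frac_dom I lam e \<kappa> r = {v. (\<lambda>i. ((\<kappa> + lam i) powr r * inner (e i) v)\<^sup>2) summable_on I}"

text \<open>The Borel \<open>\<sigma>\<close>-algebra of the Hilbert space \<open>D((\<kappa> - A)\<^sup>r)\<close> with norm \<open>\<parallel>(\<kappa> - A)\<^sup>r v\<parallel>\<close>.\<close>

definition frac_borel ::
    "'i set \<Rightarrow> ('i \<Rightarrow> real) \<Rightarrow> ('i \<Rightarrow> 'h::real_inner) \<Rightarrow> real \<Rightarrow> real \<Rightarrow> 'h measure" where
  "frac_borel I lam e \<kappa> r =
     sigma (frac_dom I lam e \<kappa> r)
       {U. openin (Metric_space.mtopology (frac_dom I lam e \<kappa> r)
                     (\<lambda>v w. norm (frac_pow I lam e \<kappa> r (v - w)))) U}"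

text \<open>The square of the Hilbert--Schmidt norm, with value \<open>\<infinity>\<close> for operators that are not
  Hilbert--Schmidt.  It does not depend on the chosen orthonormal basis.\<close>

definition hs_norm_sq :: "('k::real_inner \<Rightarrow> 'h::real_normed_vector) \<Rightarrow> ennreal" where
  "hs_norm_sq L =
     (\<integral>\<^sup>+x. ennreal ((norm (L x))\<^sup>2) \<partial>count_space (SOME E :: 'k set. is_onb E (\<lambda>x. x)))"


section \<open>The stochastic integral of deterministic operator-valued functions\<close>

text \<open>A list of quadruples \<open>(a, b, k, h)\<close> encodes the elementary function
  \<open>s \<mapsto> \<Sum> 1\<^bsub>(a,b]\<^esub>(s) \<langle>k, \<cdot>\<rangle> h\<close> with values in the finite rank operators from \<open>K\<close> to \<open>H\<close>.\<close>

type_synonym ('k, 'h) elem_fun = "(real \<times> real \<times> 'k \<times> 'h) list"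

definition elem_on :: "real \<Rightarrow> ('k, 'h) elem_fun \<Rightarrow> bool" where
  "elem_on t \<phi> \<longleftrightarrow> (\<forall>(a, b, k, h)\<in>set \<phi>. 0 \<le> a \<and> a \<le> b \<and> b \<le> t)"

definition elem_eval :: "('k::real_inner, 'h::real_vector) elem_fun \<Rightarrow> real \<Rightarrow> 'k \<Rightarrow> 'h" where
  "elem_eval \<phi> s x = (\<Sum>(a, b, k, h)\<leftarrow>\<phi>. (indicator {a<..b} s * inner k x) *\<^sub>R h)"

definition elem_integral ::
    "(real \<Rightarrow> 'k \<Rightarrow> 'a \<Rightarrow> real) \<Rightarrow> ('k, 'h::real_vector) elem_fun \<Rightarrow> 'a \<Rightarrow> 'h" where
  "elem_integral W \<phi> \<omega> = (\<Sum>(a, b, k, h)\<leftarrow>\<phi>. (W b k \<omega> - W a k \<omega>) *\<^sub>R h)"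

text \<open>\<open>Y = \<integral>\<^sub>0\<^sup>t G(s) dW\<^sub>s\<close> almost surely: the extension by the Ito isometry from elementary functions
  to their closure in \<open>L\<^sup>2([0,t]; HS(K,H))\<close>.\<close>

definition is_stochastic_integral ::
    "'a measure \<Rightarrow> (real \<Rightarrow> 'k::real_inner \<Rightarrow> 'a \<Rightarrow> real) \<Rightarrow> real \<Rightarrow>
     (real \<Rightarrow> 'k \<Rightarrow> 'h::real_normed_vector) \<Rightarrow> ('a \<Rightarrow> 'h) \<Rightarrow> bool" where
  "is_stochastic_integral M W t G Y \<longleftrightarrow>
     Y \<in> borel_measurable M \<and>
     (\<exists>\<phi> :: nat \<Rightarrow> ('k, 'h) elem_fun.
        (\<forall>n. elem_on t (\<phi> n)) \<and>
        (\<lambda>n. \<integral>\<^sup>+s\<in>{0..t}. hs_norm_sq (\<lambda>x. elem_eval (\<phi> n) s x - G s x) \<partial>lborel) \<longlonglongrightarrow> 0 \<and>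
        (\<lambda>n. \<integral>\<^sup>+\<omega>. ennreal ((norm (elem_integral W (\<phi> n) \<omega> - Y \<omega>))\<^sup>2) \<partial>M) \<longlonglongrightarrow> 0)"

definition continuous_stochastic_convolution ::
    "'a measure \<Rightarrow> real \<Rightarrow> (real \<Rightarrow> 'k::real_inner \<Rightarrow> 'a \<Rightarrow> real) \<Rightarrow> (real \<Rightarrow> 'h \<Rightarrow> 'h) \<Rightarrow>
     ('k \<Rightarrow> 'h::real_normed_vector) \<Rightarrow> (real \<Rightarrow> 'a \<Rightarrow> 'h) \<Rightarrow> bool" where
  "continuous_stochastic_convolution M T W S B Z \<longleftrightarrow>
     (\<forall>t\<in>{0..T}. is_stochastic_integral M W t (\<lambda>s x. S (t - s) (B x)) (Z t)) \<and>
     (\<forall>\<omega>\<in>space M. continuous_on {0..T} (\<lambda>t. Z t \<omega>))"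

text \<open>\<open>Z\<close> is the fixed continuous version of the stochastic convolution.\<close>

definition mild_solution ::
    "'a measure \<Rightarrow> (real \<Rightarrow> 'a measure) \<Rightarrow> real \<Rightarrow> (real \<Rightarrow> 'h \<Rightarrow> 'h) \<Rightarrow> ('h \<Rightarrow> 'h) \<Rightarrow>
     ('a \<Rightarrow> 'h::{real_inner, banach, second_countable_topology}) \<Rightarrow> (real \<Rightarrow> 'a \<Rightarrow> 'h) \<Rightarrow>
     (real \<Rightarrow> 'a \<Rightarrow> 'h) \<Rightarrow> bool" where
  "mild_solution M \<F> T S F u0 Z X \<longleftrightarrow>
     (\<forall>t\<in>{0..T}. X t \<in> borel_measurable (\<F> t)) \<and>
     (\<forall>\<omega>\<in>space M. continuous_on {0..T} (\<lambda>t. X t \<omega>)) \<and>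
     (\<forall>t\<in>{0..T}. AE \<omega> in M.
        X t \<omega> = S t (u0 \<omega>) + (LBINT s:{0..t}. S (t - s) (F (X s \<omega>))) + Z t \<omega>)"


section \<open>Higher Frechet derivatives\<close>

text \<open>Bounded \<open>n\<close>-linear maps are represented as functions on lists; only their values on lists of
  length \<open>n\<close> matter.\<close>

definition bounded_multilinear :: "nat \<Rightarrow> ('h::real_normed_vector list \<Rightarrow> 'h) \<Rightarrow> bool" where
  "bounded_multilinear n L \<longleftrightarrow>
     (\<forall>xs j. length xs = n \<and> j < n \<longrightarrow> linear (\<lambda>x. L (xs[j := x]))) \<and>
     (\<exists>C. \<forall>xs. length xs = n \<longrightarrow> norm (L xs) \<le> C * prod_list (map norm xs))"

definition multilinear_norm :: "nat \<Rightarrow> ('h::real_normed_vector list \<Rightarrow> 'h) \<Rightarrow> real" where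
  "multilinear_norm n L = (SUP xs\<in>{xs. length xs = n \<and> (\<forall>x\<in>set xs. norm x \<le> 1)}. norm (L xs))"

text \<open>\<open>D i v\<close> is the \<open>i\<close>-th Frechet derivative \<open>F\<^sup>(\<^sup>i\<^sup>)(v)\<close>: the map \<open>D i\<close> into the bounded \<open>i\<close>-linear maps
  with the operator norm is Frechet differentiable at every \<open>v\<close> with derivative
  \<open>h \<mapsto> D (i + 1) v (h, \<dots>)\<close>.\<close>

definition frechet_derivatives ::
    "('h::real_normed_vector \<Rightarrow> 'h) \<Rightarrow> (nat \<Rightarrow> 'h \<Rightarrow> 'h list \<Rightarrow> 'h) \<Rightarrow> bool" where
  "frechet_derivatives F D \<longleftrightarrow>
     (\<forall>v. D 0 v [] = F v) \<and>
     (\<forall>i v. bounded_multilinear i (D i v)) \<and>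
     (\<forall>i v. ((\<lambda>h. multilinear_norm i (\<lambda>xs. D i (v + h) xs - D i v xs - D (Suc i) v (h # xs)) / norm h)
              \<longlongrightarrow> 0) (at 0))"


section \<open>Stochastic trees and woods\<close>

datatype label = L0 | L1 | L2 | L1star

text \<open>Nodes are numbered from 1.  The values of \<open>par\<close> outside \<open>{2..len}\<close> and of \<open>ntype\<close> outside
  \<open>{1..len}\<close> carry no information.\<close>

datatype stree = STree (len: nat) (par: "nat \<Rightarrow> nat") (ntype: "nat \<Rightarrow> label")

definition ST :: "stree set" where
  "ST = {t. 1 \<le> len t \<and> (\<forall>j\<in>{2..len t}. 1 \<le> par t j \<and> par t j < j)}"

definition SW :: "stree list set" where
  "SW = {w. w \<noteq> [] \<and> set w \<subseteq> ST}"

definition nd :: "stree \<Rightarrow> nat set" where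
  "nd t = {1..len t}"

definition active :: "stree \<Rightarrow> bool" where
  "active t \<longleftrightarrow> (\<exists>j\<in>nd t. ntype t j = L1star)"

text \<open>The trees of a wood are numbered from 1 as well, so the \<open>i\<close>-th tree is \<open>w ! (i - 1)\<close>.\<close>

definition acn :: "stree list \<Rightarrow> (nat \<times> nat) set" where
  "acn w = {(i, j). i \<in> {1..length w} \<and> j \<in> nd (w ! (i - 1)) \<and> ntype (w ! (i - 1)) j = L1star}"

definition add_node :: "stree \<Rightarrow> nat \<Rightarrow> label \<Rightarrow> stree" where
  "add_node t j l = STree (len t + 1) ((par t)(len t + 1 := j)) ((ntype t)(len t + 1 := l))"

definition expand :: "nat \<times> nat \<Rightarrow> stree list \<Rightarrow> stree list" where
  "expand ij w = (case ij of (i, j) \<Rightarrow>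
     let t = w ! (i - 1) in
       w[i - 1 := STree (len t) (par t) ((ntype t)(j := L1))]
         @ [add_node t j L0, add_node t j L1star, add_node t j L2])"

definition single_node :: "label \<Rightarrow> stree" where
  "single_node l = STree 1 (\<lambda>_. 0) (\<lambda>_. l)"

definition wood0 :: "stree list" where
  "wood0 = [single_node L0, single_node L1star, single_node L2]"

inductive_set SW' :: "stree list set" where
  base: "wood0 \<in> SW'"
| step: "w \<in> SW' \<Longrightarrow> ij \<in> acn w \<Longrightarrow> expand ij w \<in> SW'"

lemma SW'_subset_SW: "SW' \<subseteq> SW"
proof
  fix w assume "w \<in> SW'"
  then show "w \<in> SW"
  proof induction
    case base
    then show ?case by (auto simp: wood0_def SW_def ST_def single_node_def)
  next
    case (step w ij)
    obtain i j where ij: "ij = (i, j)" by fastforce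
    have t: "w ! (i - 1) \<in> ST" and j: "j \<in> nd (w ! (i - 1))"
      using step.hyps(2) step.IH by (auto simp: ij acn_def SW_def)
    have "add_node (w ! (i - 1)) j l \<in> ST" for l
      using t j by (auto simp: ST_def add_node_def nd_def)
    moreover have "STree (len (w ! (i - 1))) (par (w ! (i - 1))) ((ntype (w ! (i - 1)))(j := L1)) \<in> ST"
      using t by (auto simp: ST_def)
    ultimately show ?case
      using step.IH set_update_subset_insert[of w "i - 1"]
      by (fastforce simp: ij expand_def Let_def SW_def)
  qed
qed

lemma SW'_active: "w \<in> SW' \<Longrightarrow> \<exists>t\<in>set w. active t"
proof (induction rule: SW'.induct)
  case base
  then show ?case by (auto simp: wood0_def active_def single_node_def nd_def)
next
  case (step w ij)
  obtain i j where ij: "ij = (i, j)" by fastforce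
  have "add_node (w ! (i - 1)) j L1star \<in> set (expand ij w)"
    by (simp add: ij expand_def Let_def)
  moreover have "active (add_node (w ! (i - 1)) j L1star)"
    by (auto simp: active_def add_node_def nd_def)
  ultimately show ?case by blast
qed

text \<open>The root has no parent, so pairs starting at node 1 are excluded from the parent relation.\<close>

definition parent_rel :: "stree \<Rightarrow> (nat \<times> nat) set" where
  "parent_rel t = {(k, par t k) | k. k \<in> {2..len t}}"

definition descendants :: "stree \<Rightarrow> nat \<Rightarrow> nat set" where
  "descendants t j = {k \<in> nd t. (k, j) \<in> (parent_rel t)\<^sup>*}"

definition subtree :: "stree \<Rightarrow> nat \<Rightarrow> stree" where
  "subtree t j =
     (let js = sorted_list_of_set (descendants t j) in
      STree (length js)
        (\<lambda>k. THE m. m \<in> {1..length js} \<and> js ! (m - 1) = par t (js ! (k - 1)))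
        (\<lambda>k. ntype t (js ! (k - 1))))"

definition subtrees :: "stree \<Rightarrow> stree list" where
  "subtrees t = map (subtree t) (sorted_list_of_set {j \<in> {2..len t}. par t j = 1})"

lemma len_subtrees: "s \<in> set (subtrees t) \<Longrightarrow> len s < len t"
proof -
  assume "s \<in> set (subtrees t)"
  then obtain j where j: "j \<in> {2..len t}" and s: "s = subtree t j"
    by (auto simp: subtrees_def)
  have "1 \<notin> descendants t j"
    using j by (auto simp: descendants_def parent_rel_def elim: converse_rtranclE)
  then have "descendants t j \<subseteq> {2..len t}"
    by (force simp: descendants_def nd_def Suc_le_eq le_less)
  then have "card (descendants t j) \<le> card {2..len t}"
    by (intro card_mono) auto
  then show "len s < len t"
    using j by (auto simp: s subtree_def Let_def)
qed

definition ord_tree :: "real \<Rightarrow> real \<Rightarrow> stree \<Rightarrow> real" where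
  "ord_tree \<gamma> \<delta> t = real (len t) + (\<gamma> - 1) * real (card {j \<in> nd t. ntype t j = L0})
                              + (\<delta> - 1) * real (card {j \<in> nd t. ntype t j = L2})"

definition ord_wood :: "real \<Rightarrow> real \<Rightarrow> stree list \<Rightarrow> real" where
  "ord_wood \<gamma> \<delta> w = Min (ord_tree \<gamma> \<delta> ` {t \<in> set w. active t})"


section \<open>Integral operators and the maps \<open>\<Phi>\<close> and \<open>\<Psi>\<close>\<close>

text \<open>\<open>S\<close> is the semigroup, \<open>D\<close> the family of derivatives of \<open>F\<close>, \<open>X\<close> the solution and \<open>Z\<close> the fixed
  version of the stochastic convolution; processes are functions of time and \<open>\<omega>\<close>.\<close>

primrec I0 ::
    "(real \<Rightarrow> 'h \<Rightarrow> 'h) \<Rightarrow> ('h \<Rightarrow> 'h) \<Rightarrow> (real \<Rightarrow> 'a \<Rightarrow> 'h) \<Rightarrow> (real \<Rightarrow> 'a \<Rightarrow> 'h) \<Rightarrow> real \<Rightarrow>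
     label \<Rightarrow> real \<Rightarrow> 'a \<Rightarrow> 'h::{real_inner, banach, second_countable_topology}" where
  "I0 S F X Z t0 L0 = (\<lambda>t \<omega>. S (t - t0) (X t0 \<omega>) - X t0 \<omega>)"
| "I0 S F X Z t0 L1 = (\<lambda>t \<omega>. LBINT s:{t0..t}. S (t - s) (F (X t0 \<omega>)))"
| "I0 S F X Z t0 L2 = (\<lambda>t \<omega>. Z t \<omega> - S (t - t0) (Z t0 \<omega>))"
| "I0 S F X Z t0 L1star = (\<lambda>t \<omega>. LBINT s:{t0..t}. S (t - s) (F (X s \<omega>)))"

definition I1 ::
    "(real \<Rightarrow> 'h \<Rightarrow> 'h) \<Rightarrow> (nat \<Rightarrow> 'h \<Rightarrow> 'h list \<Rightarrow> 'h) \<Rightarrow> (real \<Rightarrow> 'a \<Rightarrow> 'h) \<Rightarrow> real \<Rightarrow>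
     (real \<Rightarrow> 'a \<Rightarrow> 'h) list \<Rightarrow> real \<Rightarrow> 'a \<Rightarrow> 'h::{real_inner, banach, second_countable_topology}" where
  "I1 S D X t0 gs t \<omega> =
     (1 / fact (length gs)) *\<^sub>R
       (LBINT s:{t0..t}. S (t - s) (D (length gs) (X t0 \<omega>) (map (\<lambda>g. g s \<omega>) gs)))"

definition I1star ::
    "(real \<Rightarrow> 'h \<Rightarrow> 'h) \<Rightarrow> (nat \<Rightarrow> 'h \<Rightarrow> 'h list \<Rightarrow> 'h) \<Rightarrow> (real \<Rightarrow> 'a \<Rightarrow> 'h) \<Rightarrow> real \<Rightarrow>
     (real \<Rightarrow> 'a \<Rightarrow> 'h) list \<Rightarrow> real \<Rightarrow> 'a \<Rightarrow> 'h::{real_inner, banach, second_countable_topology}" where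
  "I1star S D X t0 gs t \<omega> =
     (LBINT s:{t0..t}. S (t - s)
        (LBINT r:{0..1}. ((1 - r) ^ (length gs - 1) / fact (length gs - 1)) *\<^sub>R
           D (length gs) (X t0 \<omega> + r *\<^sub>R (X s \<omega> - X t0 \<omega>)) (map (\<lambda>g. g s \<omega>) gs)))"

function Phi ::
    "(real \<Rightarrow> 'h \<Rightarrow> 'h) \<Rightarrow> ('h \<Rightarrow> 'h) \<Rightarrow> (nat \<Rightarrow> 'h \<Rightarrow> 'h list \<Rightarrow> 'h) \<Rightarrow>
     (real \<Rightarrow> 'a \<Rightarrow> 'h) \<Rightarrow> (real \<Rightarrow> 'a \<Rightarrow> 'h) \<Rightarrow> real \<Rightarrow> stree \<Rightarrow>
     real \<Rightarrow> 'a \<Rightarrow> 'h::{real_inner, banach, second_countable_topology}" where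
  "Phi S F D X Z t0 t =
     (if ntype t 1 \<in> {L0, L2} \<or> len t = 1 then I0 S F X Z t0 (ntype t 1)
      else if ntype t 1 = L1 then I1 S D X t0 (map (\<lambda>s. Phi S F D X Z t0 s) (subtrees t))
      else I1star S D X t0 (map (\<lambda>s. Phi S F D X Z t0 s) (subtrees t)))"
  by pat_completeness auto
termination
  by (relation "Wellfounded.measure (\<lambda>(S, F, D, X, Z, t0, t). len t)") (auto simp: len_subtrees)

declare Phi.simps [simp del]

definition Psi ::
    "(real \<Rightarrow> 'h \<Rightarrow> 'h) \<Rightarrow> ('h \<Rightarrow> 'h) \<Rightarrow> (nat \<Rightarrow> 'h \<Rightarrow> 'h list \<Rightarrow> 'h) \<Rightarrow>
     (real \<Rightarrow> 'a \<Rightarrow> 'h) \<Rightarrow> (real \<Rightarrow> 'a \<Rightarrow> 'h) \<Rightarrow> real \<Rightarrow> stree \<Rightarrow>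
     real \<Rightarrow> 'a \<Rightarrow> 'h::{real_inner, banach, second_countable_topology}" where
  "Psi S F D X Z t0 t = (if active t then (\<lambda>_ _. 0) else Phi S F D X Z t0 t)"

definition Phi_wood ::
    "(real \<Rightarrow> 'h \<Rightarrow> 'h) \<Rightarrow> ('h \<Rightarrow> 'h) \<Rightarrow> (nat \<Rightarrow> 'h \<Rightarrow> 'h list \<Rightarrow> 'h) \<Rightarrow>
     (real \<Rightarrow> 'a \<Rightarrow> 'h) \<Rightarrow> (real \<Rightarrow> 'a \<Rightarrow> 'h) \<Rightarrow> real \<Rightarrow> stree list \<Rightarrow>
     real \<Rightarrow> 'a \<Rightarrow> 'h::{real_inner, banach, second_countable_topology}" where
  "Phi_wood S F D X Z t0 w t \<omega> = (\<Sum>tr\<leftarrow>w. Phi S F D X Z t0 tr t \<omega>)"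

definition Psi_wood ::
    "(real \<Rightarrow> 'h \<Rightarrow> 'h) \<Rightarrow> ('h \<Rightarrow> 'h) \<Rightarrow> (nat \<Rightarrow> 'h \<Rightarrow> 'h list \<Rightarrow> 'h) \<Rightarrow>
     (real \<Rightarrow> 'a \<Rightarrow> 'h) \<Rightarrow> (real \<Rightarrow> 'a \<Rightarrow> 'h) \<Rightarrow> real \<Rightarrow> stree list \<Rightarrow>
     real \<Rightarrow> 'a \<Rightarrow> 'h::{real_inner, banach, second_countable_topology}" where
  "Psi_wood S F D X Z t0 w t \<omega> = (\<Sum>tr\<leftarrow>w. Psi S F D X Z t0 tr t \<omega>)"

end

theory Submission
  imports Defs
begin

text \<open>
  The theorem combines an exact identity with an estimate of each of its terms.

  The identity is pathwise. By the mild equation, the increment of \<open>X\<close> over \<open>[t0, t]\<close> is the sum of the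
  increment of the semigroup, the convolution with \<open>F\<close> along the path, and a stochastic integral, and these
  are the processes of the three trees of \<open>wood0\<close>. A node of type \<open>1\<^sup>*\<close> with \<open>n\<close> children carries the
  Taylor remainder of order \<open>n\<close> of \<open>F\<close> at \<open>X t0\<close>. One step of Taylor's formula splits it into the term of
  order \<open>n\<close>, a node of type \<open>1\<close>, and the remainder of order \<open>n + 1\<close>, in which the increment of \<open>X\<close> is
  an additional direction; inserting the three terms for that increment and using multilinearity gives
  three trees in which the node has one child more. So expanding an active node does not change the value
  of a wood (\<open>taylor_step\<close>, \<open>tree_value_expand\<close>, \<open>wood_expansion\<close>). The new child comes last, whereas the
  new direction of a Frechet derivative comes first; hence the derivatives must be known to be symmetric
  (\<open>D_rotate\<close>). To argue by recursion on subtrees, the numbered trees are translated into their shapes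
  (\<open>rose\<close>), and \<open>expand\<close> into a relation between shapes (\<open>tree_expansion\<close>).

  By the identity, the error is the sum of the processes of the active trees. The estimate shows that the
  process of a tree has moments of the order of the tree, by recursion: orders add up under products and
  increase by one under integration in time (\<open>moment_order_mult\<close>, \<open>moment_order_integral\<close>), so that only
  the leaves matter. The stochastic integral over \<open>[t0, t]\<close> has order \<open>\<delta>\<close> (\<open>moment_order_Z_delta\<close>): it is
  Gaussian, and all its moments are controlled by the integral of the squared Hilbert--Schmidt norm
  (\<open>wiener_integral_moment\<close>). For elementary integrands this is seen from the moment generating function
  of the coordinates, computed from the independence of Brownian increments (\<open>wiener_sum_mgf\<close>).
  The increment of the semigroup applied to \<open>X t0\<close> has order \<open>\<gamma>\<close> (\<open>moment_order_L0\<close>), because each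
  term of the mild equation takes values in the domain of the fractional power with exponent \<open>\<gamma>\<close>, in a
  quantitative sense; the moments of \<open>X\<close> themselves, which enter here and in the linear growth of \<open>F\<close>,
  come from a pathwise Gronwall argument (\<open>mild_gronwall\<close>, \<open>moment_order_X\<close>).
\<close>

section \<open>Orthonormal families in Hilbert spaces\<close>

definition orthonormal :: "'i set \<Rightarrow> ('i \<Rightarrow> 'h::real_inner) \<Rightarrow> bool" where
  "orthonormal I e \<longleftrightarrow> (\<forall>i\<in>I. \<forall>j\<in>I. inner (e i) (e j) = (if i = j then 1 else 0))"

lemma is_onb_orthonormal: "is_onb I e \<Longrightarrow> orthonormal I e"
  by (simp add: is_onb_def orthonormal_def)

lemma orthonormal_inner_sum:
  assumes "orthonormal I e" "finite J" "J \<subseteq> I" "j \<in> I"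
  shows "inner (e j) (\<Sum>i\<in>J. c i *\<^sub>R e i) = (if j \<in> J then c j else 0)"
proof -
  have "inner (e j) (\<Sum>i\<in>J. c i *\<^sub>R e i) = (\<Sum>i\<in>J. c i * inner (e j) (e i))"
    by (simp add: inner_sum_right)
  also have "\<dots> = (\<Sum>i\<in>J. if i = j then c i else 0)"
    using assms by (intro sum.cong) (auto simp: orthonormal_def subset_iff)
  finally show ?thesis using assms(2) by (simp add: sum.delta')
qed

lemma orthonormal_norm_sum:
  assumes "orthonormal I e" "finite J" "J \<subseteq> I"
  shows "(norm (\<Sum>i\<in>J. c i *\<^sub>R e i))\<^sup>2 = (\<Sum>i\<in>J. (c i)\<^sup>2)"
proof -
  have "(norm (\<Sum>i\<in>J. c i *\<^sub>R e i))\<^sup>2 = (\<Sum>j\<in>J. c j * inner (e j) (\<Sum>i\<in>J. c i *\<^sub>R e i))"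
    by (simp add: dot_square_norm[symmetric] inner_sum_left)
  also have "\<dots> = (\<Sum>i\<in>J. (c i)\<^sup>2)"
    using assms by (intro sum.cong) (auto simp: orthonormal_inner_sum power2_eq_square subset_iff)
  finally show ?thesis .
qed

text \<open>The partial sums form a Cauchy net: the squared distance between a partial sum and a fixed one is
  the sum of \<open>c i\<^sup>2\<close> over the indices in which they differ.\<close>

lemma orthonormal_summable:
  fixes e :: "'i \<Rightarrow> 'h::{real_inner, banach}"
  assumes e: "orthonormal I e" and c: "(\<lambda>i. (c i)\<^sup>2) summable_on I"
  shows "(\<lambda>i. c i *\<^sub>R e i) summable_on I"
proof -
  let ?f = "\<lambda>J. \<Sum>i\<in>J. c i *\<^sub>R e i"
  have "cauchy_filter (filtermap ?f (finite_subsets_at_top I))"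
    unfolding cauchy_filter_iff
  proof (intro allI impI)
    fix P :: "'h \<times> 'h \<Rightarrow> bool" assume "eventually P uniformity"
    then obtain r where r: "r > 0" "\<And>x y. dist x y < r \<Longrightarrow> P (x, y)"
      unfolding eventually_uniformity_metric by auto
    have "(r/2)\<^sup>2 > 0" using r by simp
    then obtain J where J: "finite J" "J \<subseteq> I" "dist (\<Sum>i\<in>J. (c i)\<^sup>2) (infsum (\<lambda>i. (c i)\<^sup>2) I) \<le> (r/2)\<^sup>2 / 2"
      using infsum_finite_approximation[OF c, of "(r/2)\<^sup>2 / 2"] by auto
    have near: "norm (?f K - ?f J) < r / 2" if K: "finite K" "J \<subseteq> K" "K \<subseteq> I" for K
    proof -
      have "?f K - ?f J = ?f (K - J)"
        using K by (simp add: sum_diff)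
      then have "(norm (?f K - ?f J))\<^sup>2 = (\<Sum>i\<in>K-J. (c i)\<^sup>2)"
        using orthonormal_norm_sum[OF e, of "K - J" c] K by auto
      also have "\<dots> = (\<Sum>i\<in>K. (c i)\<^sup>2) - (\<Sum>i\<in>J. (c i)\<^sup>2)"
        using K by (simp add: sum_diff)
      also have "\<dots> \<le> infsum (\<lambda>i. (c i)\<^sup>2) I - (\<Sum>i\<in>J. (c i)\<^sup>2)"
        using finite_sum_le_infsum[OF c K(1) K(3)] by simp
      also have "\<dots> < (r/2)\<^sup>2"
        using J(3) \<open>(r/2)\<^sup>2 > 0\<close> unfolding dist_real_def by linarith
      finally show ?thesis using r by (meson less_eq_real_def half_gt_zero power2_less_imp_less)
    qed
    show "\<exists>X. (\<forall>\<^sub>F x in filtermap ?f (finite_subsets_at_top I). x \<in> X) \<and> (\<forall>z\<in>X \<times> X. P z)"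
    proof (intro exI conjI)
      show "\<forall>\<^sub>F x in filtermap ?f (finite_subsets_at_top I). x \<in> ?f ` {K. finite K \<and> J \<subseteq> K \<and> K \<subseteq> I}"
        unfolding eventually_filtermap eventually_finite_subsets_at_top
        using J by (intro exI[of _ J]) auto
      show "\<forall>z\<in>?f ` {K. finite K \<and> J \<subseteq> K \<and> K \<subseteq> I} \<times> ?f ` {K. finite K \<and> J \<subseteq> K \<and> K \<subseteq> I}. P z"
      proof (clarsimp)
        fix K L assume "finite K" "J \<subseteq> K" "K \<subseteq> I" "finite L" "J \<subseteq> L" "L \<subseteq> I"
        then have "norm (?f K - ?f J) < r / 2" "norm (?f L - ?f J) < r / 2" using near by auto
        then show "P (?f K, ?f L)"
          unfolding dist_norm[symmetric] by (intro r(2)) (rule dist_triangle_half_l)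
      qed
    qed
  qed
  moreover have "filtermap ?f (finite_subsets_at_top I) \<noteq> bot"
    by (simp add: filtermap_bot_iff)
  ultimately have "convergent_filter (filtermap ?f (finite_subsets_at_top I))"
    by (simp add: convergent_filter_iff_cauchy)
  then show ?thesis
    by (auto simp: convergent_filter_iff summable_on_def has_sum_def filterlim_def)
qed

lemma orthonormal_series:
  fixes e :: "'i \<Rightarrow> 'h::{real_inner, banach}"
  assumes e: "orthonormal I e" and c: "(\<lambda>i. (c i)\<^sup>2) summable_on I"
  shows "j \<in> I \<Longrightarrow> inner (e j) (\<Sum>\<^sub>\<infinity>i\<in>I. c i *\<^sub>R e i) = c j"
    and "((\<lambda>i. (c i)\<^sup>2) has_sum (norm (\<Sum>\<^sub>\<infinity>i\<in>I. c i *\<^sub>R e i))\<^sup>2) I"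
    and "(\<Sum>\<^sub>\<infinity>i\<in>I. c i *\<^sub>R e i) \<in> closure (span (e ` I))"
proof -
  have hs: "((\<lambda>i. c i *\<^sub>R e i) has_sum (\<Sum>\<^sub>\<infinity>i\<in>I. c i *\<^sub>R e i)) I"
    using orthonormal_summable[OF e c] by (rule has_sum_infsum)
  show "inner (e j) (\<Sum>\<^sub>\<infinity>i\<in>I. c i *\<^sub>R e i) = c j" if j: "j \<in> I"
  proof -
    have "((\<lambda>i. inner (e j) (c i *\<^sub>R e i)) has_sum inner (e j) (\<Sum>\<^sub>\<infinity>i\<in>I. c i *\<^sub>R e i)) I"
      using hs by (intro has_sum_bounded_linear[OF bounded_linear_inner_right])
    moreover have "((\<lambda>i. inner (e j) (c i *\<^sub>R e i)) has_sum c j) I \<longleftrightarrow> ((\<lambda>i. c i) has_sum c j) {j}"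
      using e j by (intro has_sum_cong_neutral) (auto simp: orthonormal_def)
    moreover have "((\<lambda>i. c i) has_sum c j) {j}" by (rule has_sum_finiteI) auto
    ultimately show ?thesis by (blast intro: has_sum_unique)
  qed
  have lim: "(sum (\<lambda>i. c i *\<^sub>R e i) \<longlongrightarrow> (\<Sum>\<^sub>\<infinity>i\<in>I. c i *\<^sub>R e i)) (finite_subsets_at_top I)"
    using hs by (simp add: has_sum_def)
  have "((\<lambda>J. (norm (sum (\<lambda>i. c i *\<^sub>R e i) J))\<^sup>2) \<longlongrightarrow> (norm (\<Sum>\<^sub>\<infinity>i\<in>I. c i *\<^sub>R e i))\<^sup>2) (finite_subsets_at_top I)"
    by (intro tendsto_intros lim)
  then show "((\<lambda>i. (c i)\<^sup>2) has_sum (norm (\<Sum>\<^sub>\<infinity>i\<in>I. c i *\<^sub>R e i))\<^sup>2) I"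
    unfolding has_sum_def
  proof (rule Lim_transform_eventually)
    show "\<forall>\<^sub>F J in finite_subsets_at_top I. (norm (sum (\<lambda>i. c i *\<^sub>R e i) J))\<^sup>2 = sum (\<lambda>i. (c i)\<^sup>2) J"
      by (rule eventually_finite_subsets_at_top_weakI) (simp add: orthonormal_norm_sum[OF e])
  qed
  show "(\<Sum>\<^sub>\<infinity>i\<in>I. c i *\<^sub>R e i) \<in> closure (span (e ` I))"
  proof (rule Lim_in_closed_set[OF closed_closure _ _ lim])
    show "\<forall>\<^sub>F J in finite_subsets_at_top I. sum (\<lambda>i. c i *\<^sub>R e i) J \<in> closure (span (e ` I))"
      by (rule eventually_finite_subsets_at_top_weakI, rule subsetD[OF closure_subset],
          intro span_sum span_scale span_base) auto
  qed simp
qed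

lemma bessel:
  fixes e :: "'i \<Rightarrow> 'h::real_inner"
  assumes e: "orthonormal I e"
  shows "(\<lambda>i. (inner (e i) v)\<^sup>2) summable_on I"
proof (rule nonneg_bdd_above_summable_on)
  have "(\<Sum>i\<in>J. (inner (e i) v)\<^sup>2) \<le> (norm v)\<^sup>2" if J: "finite J" "J \<subseteq> I" for J
  proof -
    let ?x = "\<Sum>i\<in>J. inner (e i) v *\<^sub>R e i"
    have "inner v ?x = (\<Sum>i\<in>J. (inner (e i) v)\<^sup>2)"
      by (simp add: inner_sum_right power2_eq_square inner_commute)
    moreover have "inner ?x ?x = (\<Sum>i\<in>J. (inner (e i) v)\<^sup>2)"
      using orthonormal_norm_sum[OF e J] by (simp add: dot_square_norm)
    moreover have "0 \<le> inner (v - ?x) (v - ?x)" by simp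
    ultimately show ?thesis
      unfolding inner_diff_left inner_diff_right power2_norm_eq_inner inner_commute[of ?x v] by linarith
  qed
  then show "bdd_above (sum (\<lambda>i. (inner (e i) v)\<^sup>2) ` {F. F \<subseteq> I \<and> finite F})"
    by (intro bdd_aboveI[of _ "(norm v)\<^sup>2"]) auto
qed simp

lemma orthonormal_residual:
  fixes e :: "'i \<Rightarrow> 'h::{real_inner, banach}"
  assumes e: "orthonormal I e" and j: "j \<in> I"
  shows "inner (e j) (v - (\<Sum>\<^sub>\<infinity>i\<in>I. inner (e i) v *\<^sub>R e i)) = 0"
  using orthonormal_series(1)[OF e bessel[OF e, of v] j] by (simp add: inner_diff_right)

text \<open>A Hilbert space vector is determined by its coordinates; the operator identities below (semigroup
  law, commutation with fractional powers, linearity) are all checked coordinatewise with this rule.\<close>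

lemma onb_eqI:
  fixes e :: "'i \<Rightarrow> 'h::real_inner"
  assumes e: "is_onb I e" and eq: "\<And>i. i \<in> I \<Longrightarrow> inner (e i) x = inner (e i) y"
  shows "x = y"
proof -
  have "span (e ` I) \<subseteq> {z. inner z (x - y) = 0}"
    by (rule span_minimal) (auto simp: subspace_def inner_add_left inner_diff_right eq)
  moreover have "closed {z. inner z (x - y) = 0}"
    by (intro closed_Collect_eq continuous_intros)
  ultimately have "closure (span (e ` I)) \<subseteq> {z. inner z (x - y) = 0}"
    by (rule closure_minimal)
  moreover have "x - y \<in> closure (span (e ` I))" using e by (simp add: is_onb_def)
  ultimately have "inner (x - y) (x - y) = 0" by blast
  then show ?thesis by simp
qed

lemma onb_expansion:
  fixes e :: "'i \<Rightarrow> 'h::{real_inner, banach}"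
  assumes e: "is_onb I e"
  shows "(\<Sum>\<^sub>\<infinity>i\<in>I. inner (e i) v *\<^sub>R e i) = v"
    and parseval: "((\<lambda>i. (inner (e i) v)\<^sup>2) has_sum (norm v)\<^sup>2) I"
proof -
  note o = is_onb_orthonormal[OF e]
  show *: "(\<Sum>\<^sub>\<infinity>i\<in>I. inner (e i) v *\<^sub>R e i) = v"
    by (rule onb_eqI[OF e]) (simp add: orthonormal_series(1)[OF o bessel[OF o]])
  show "((\<lambda>i. (inner (e i) v)\<^sup>2) has_sum (norm v)\<^sup>2) I"
    using orthonormal_series(2)[OF o bessel[OF o, of v]] by (simp add: *)
qed

text \<open>The Hilbert--Schmidt norm is defined with a basis picked by \<open>SOME\<close>, so a basis must exist before
  anything can be said about it. A maximal orthonormal set is total, since the residual of the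
  orthogonal expansion of a vector outside its closed span could be normalised and added.\<close>

lemma ex_onb: "\<exists>E :: 'k::{real_inner, banach} set. is_onb E (\<lambda>x. x)"
proof -
  let ?A = "{E :: 'k set. orthonormal E (\<lambda>x. x)}"
  have "\<exists>M\<in>?A. \<forall>X\<in>?A. M \<subseteq> X \<longrightarrow> X = M"
  proof (rule subset_Zorn')
    fix C assume C: "subset.chain ?A C"
    show "\<Union>C \<in> ?A"
    proof (simp add: orthonormal_def, intro ballI)
      fix X Y x y assume "X \<in> C" "x \<in> X" "Y \<in> C" "y \<in> Y"
      moreover have "X \<subseteq> Y \<or> Y \<subseteq> X"
        using C \<open>X \<in> C\<close> \<open>Y \<in> C\<close> by (auto simp: subset_chain_def)
      ultimately obtain Z where "Z \<in> C" "x \<in> Z" "y \<in> Z" by blast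
      then show "(x = y \<longrightarrow> y \<bullet> y = 1) \<and> (x \<noteq> y \<longrightarrow> x \<bullet> y = 0)"
        using C by (auto simp: subset_chain_def orthonormal_def)
    qed
  qed
  then obtain E where E: "orthonormal E (\<lambda>x::'k. x)"
    and max: "\<And>X. orthonormal X (\<lambda>x. x) \<Longrightarrow> E \<subseteq> X \<Longrightarrow> X = E" by auto
  have "v \<in> closure (span E)" for v
  proof -
    let ?x = "\<Sum>\<^sub>\<infinity>i\<in>E. inner i v *\<^sub>R i"
    have x: "?x \<in> closure (span E)"
      using orthonormal_series(3)[OF E bessel[OF E, of v]] by simp
    show ?thesis
    proof (cases "v = ?x")
      case False
      define r where "r = v - ?x"
      define u where "u = (1 / norm r) *\<^sub>R r"
      have r: "r \<noteq> 0" using False by (simp add: r_def)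
      have u: "inner u u = 1" using r by (simp add: u_def dot_square_norm power2_eq_square)
      have ort: "inner j u = 0" if "j \<in> E" for j
        using orthonormal_residual[OF E that, of v] by (simp add: u_def r_def)
      have "orthonormal (insert u E) (\<lambda>x. x)"
        using E u ort by (auto simp: orthonormal_def inner_commute)
      then have "u \<in> E" using max by blast
      then show ?thesis using ort u by fastforce
    qed (use x in simp)
  qed
  then have "is_onb E (\<lambda>x. x)" using E by (auto simp: is_onb_def orthonormal_def)
  then show ?thesis by blast
qed

text \<open>Distinct orthonormal vectors have distance \<open>sqrt 2\<close>. Countability makes Hilbert--Schmidt norms of
  measurable operator functions measurable.\<close>

lemma orthonormal_countable:
  fixes E :: "'k::{real_inner, second_countable_topology} set"
  assumes "orthonormal E (\<lambda>x. x)"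
  shows "countable E"
proof -
  have d: "dist x y > 1" if "x \<in> E" "y \<in> E" "x \<noteq> y" for x y
  proof -
    have "(dist x y)\<^sup>2 = 2"
      using assms that by (simp add: dist_norm dot_square_norm[symmetric] inner_diff_left inner_diff_right orthonormal_def)
    then show ?thesis using power_le_one[of "dist x y" 2] by (cases "dist x y \<le> 1") auto
  qed
  have "countable ((\<lambda>x. ball x (1/2)) ` E)"
  proof (rule countable_disjoint_open_subsets)
    show "disjoint ((\<lambda>x. ball x (1/2)) ` E)"
      unfolding disjoint_def
    proof clarify
      fix x y assume "x \<in> E" "y \<in> E" "ball x (1/2) \<noteq> ball y (1/2)"
      then have "dist x y > 1" by (intro d) auto
      then show "ball x (1/2) \<inter> ball y (1/2) = {}" by (intro disjoint_ballI) auto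
    qed
  qed auto
  moreover have "inj_on (\<lambda>x. ball x (1/2)) E"
  proof (rule inj_onI)
    fix x y assume xy: "x \<in> E" "y \<in> E" "ball x (1/2) = ball y (1/2)"
    then have "x \<in> ball y (1/2)" by (metis centre_in_ball half_gt_zero zero_less_one)
    then show "x = y" using d[of y x] xy by (fastforce simp: dist_commute)
  qed
  ultimately show ?thesis by (rule countable_image_inj_on)
qed


section \<open>Diagonal semigroups and fractional powers\<close>

text \<open>The constant \<open>c\<close> is a positive lower bound of the spectrum of \<open>\<kappa> - A\<close>.\<close>

locale diag_semigroup =
  fixes I :: "'i set" and lam :: "'i \<Rightarrow> real" and e :: "'i \<Rightarrow> 'h::{real_inner, banach}"
    and \<kappa> c :: real
  assumes onb: "is_onb I e" and kappa: "\<kappa> \<ge> 0" and c: "c > 0"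
    and lam: "\<And>i. i \<in> I \<Longrightarrow> c \<le> \<kappa> + lam i"
begin

abbreviation S where "S \<equiv> semigroup_exp I lam e"
abbreviation fpow where "fpow \<equiv> frac_pow I lam e \<kappa>"
abbreviation fdom where "fdom \<equiv> frac_dom I lam e \<kappa>"

text \<open>All norm bounds for functions of the diagonal operator reduce, by Parseval, to bounds of the
  multiplier on each coordinate.\<close>

lemma norm_le_of_coeffs:
  assumes "\<And>i. i \<in> I \<Longrightarrow> \<bar>inner (e i) x\<bar> \<le> C * \<bar>inner (e i) y\<bar>" "C \<ge> 0"
  shows "norm x \<le> C * norm y"
proof -
  have "(norm x)\<^sup>2 \<le> C\<^sup>2 * (norm y)\<^sup>2"
  proof (rule has_sum_mono[OF parseval[OF onb] has_sum_cmult_right[OF parseval[OF onb]]])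
    fix i assume "i \<in> I"
    then have "\<bar>inner (e i) x\<bar>\<^sup>2 \<le> (C * \<bar>inner (e i) y\<bar>)\<^sup>2"
      by (intro power_mono assms) auto
    then show "(inner (e i) x)\<^sup>2 \<le> C\<^sup>2 * (inner (e i) y)\<^sup>2" by (simp add: power_mult_distrib)
  qed
  then have "(norm x)\<^sup>2 \<le> (C * norm y)\<^sup>2" by (simp add: power_mult_distrib)
  then show ?thesis by (rule power2_le_imp_le) (simp add: assms(2))
qed

lemma multiplier_summable:
  assumes "\<And>i. i \<in> I \<Longrightarrow> \<bar>m i\<bar> \<le> C"
  shows "(\<lambda>i. (m i * inner (e i) v)\<^sup>2) summable_on I"
proof (rule summable_on_comparison_test)
  show "(\<lambda>i. C\<^sup>2 * (inner (e i) v)\<^sup>2) summable_on I"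
    by (intro summable_on_cmult_right bessel is_onb_orthonormal onb)
  fix i assume "i \<in> I"
  then have "\<bar>m i\<bar>\<^sup>2 \<le> C\<^sup>2" by (intro power_mono assms) auto
  then show "(m i * inner (e i) v)\<^sup>2 \<le> C\<^sup>2 * (inner (e i) v)\<^sup>2"
    by (simp add: power_mult_distrib mult_right_mono)
qed simp

lemma exp_multiplier_le:
  assumes "i \<in> I" "t \<ge> 0"
  shows "exp (- lam i * t) \<le> exp (\<kappa> * t)"
proof -
  have "- lam i \<le> \<kappa>" using lam[OF assms(1)] c by linarith
  then show ?thesis using assms(2) by (simp only: exp_le_cancel_iff mult_right_mono)
qed

lemma S_coeff:
  assumes "i \<in> I" "t \<ge> 0"
  shows "inner (e i) (S t v) = exp (- lam i * t) * inner (e i) v"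
  unfolding semigroup_exp_def
  by (rule orthonormal_series(1)[OF is_onb_orthonormal[OF onb] multiplier_summable assms(1)])
    (use exp_multiplier_le assms in auto)

lemma S_norm: "t \<ge> 0 \<Longrightarrow> norm (S t v) \<le> exp (\<kappa> * t) * norm v"
  by (rule norm_le_of_coeffs) (auto simp: S_coeff abs_mult intro!: mult_right_mono exp_multiplier_le[simplified])

lemma S_bounded_linear: assumes "t \<ge> 0" shows "bounded_linear (S t)"
proof (rule bounded_linear_intro[where K = "exp (\<kappa> * t)"])
  show "S t (x + y) = S t x + S t y" for x y
    by (rule onb_eqI[OF onb]) (simp add: S_coeff assms inner_add_right ring_distribs)
  show "S t (r *\<^sub>R x) = r *\<^sub>R S t x" for r x
    by (rule onb_eqI[OF onb]) (simp add: S_coeff assms)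
  show "norm (S t x) \<le> norm x * exp (\<kappa> * t)" for x
    using S_norm[OF assms, of x] by (simp add: mult.commute)
qed

lemma S_add: "s \<ge> 0 \<Longrightarrow> t \<ge> 0 \<Longrightarrow> S s (S t v) = S (s + t) v"
  by (rule onb_eqI[OF onb]) (simp add: S_coeff ring_distribs exp_add[symmetric] exp_diff field_simps)

lemma S_zero [simp]: "S 0 v = v"
  by (rule onb_eqI[OF onb]) (simp add: S_coeff)

lemma S_diff: "t \<ge> 0 \<Longrightarrow> S t (x - y) = S t x - S t y"
  using S_bounded_linear by (rule bounded_linear.linear[THEN linear_diff])

text \<open>On a finite combination of basis vectors the semigroup is a finite sum of exponentials; these
  combinations approximate \<open>v\<close>, uniformly in time since the semigroup is bounded on \<open>[0, b]\<close>.\<close>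

lemma S_continuous_on: "continuous_on {0..b} (\<lambda>t. S t v)"
proof -
  let ?P = "\<lambda>J. \<Sum>i\<in>J. inner (e i) v *\<^sub>R e i"
  have lim: "(?P \<longlongrightarrow> v) (finite_subsets_at_top I)"
    using has_sum_infsum[OF orthonormal_summable[OF is_onb_orthonormal[OF onb] bessel[OF is_onb_orthonormal[OF onb]]], of v]
    by (simp add: has_sum_def onb_expansion(1)[OF onb])
  have "uniform_limit {0..b} (\<lambda>J t. S t (?P J)) (\<lambda>t. S t v) (finite_subsets_at_top I)"
  proof (rule uniform_limitI)
    fix \<epsilon> :: real assume "\<epsilon> > 0"
    then have "\<forall>\<^sub>F J in finite_subsets_at_top I. dist (?P J) v < \<epsilon> / exp (\<kappa> * b)"
      using lim by (intro tendstoD) auto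
    then show "\<forall>\<^sub>F J in finite_subsets_at_top I. \<forall>t\<in>{0..b}. dist (S t (?P J)) (S t v) < \<epsilon>"
    proof (eventually_elim, intro ballI)
      fix J t assume J: "dist (?P J) v < \<epsilon> / exp (\<kappa> * b)" and t: "t \<in> {0..b}"
      have "dist (S t (?P J)) (S t v) \<le> exp (\<kappa> * t) * norm (?P J - v)"
        using S_norm[of t "?P J - v"] t by (simp add: dist_norm S_diff)
      also have "\<dots> \<le> exp (\<kappa> * b) * norm (?P J - v)"
        using t kappa by (intro mult_right_mono) (auto intro: mult_left_mono)
      also have "\<dots> < \<epsilon>" using J by (simp add: dist_norm field_simps)
      finally show "dist (S t (?P J)) (S t v) < \<epsilon>" .
    qed
  qed
  moreover have "\<forall>\<^sub>F J in finite_subsets_at_top I. continuous_on {0..b} (\<lambda>t. S t (?P J))"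
  proof (rule eventually_finite_subsets_at_top_weakI)
    fix J assume J: "finite J" "J \<subseteq> I"
    have "S t (?P J) = (\<Sum>i\<in>J. (exp (- lam i * t) * inner (e i) v) *\<^sub>R e i)" if "t \<in> {0..b}" for t
      using J that
      by (intro onb_eqI[OF onb]) (simp add: S_coeff orthonormal_inner_sum[OF is_onb_orthonormal[OF onb]])
    moreover have "continuous_on {0..b} (\<lambda>t. \<Sum>i\<in>J. (exp (- lam i * t) * inner (e i) v) *\<^sub>R e i)"
      by (intro continuous_intros)
    ultimately show "continuous_on {0..b} (\<lambda>t. S t (?P J))" by (metis (no_types, lifting) continuous_on_cong)
  qed
  ultimately show ?thesis by (intro uniform_limit_theorem) auto
qed

text \<open>Joint continuity in time and space, for an arbitrary filter: it serves both for continuity of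
  integrands along a path and for limits in dominated convergence.\<close>

lemma S_tendsto:
  assumes f: "(f \<longlongrightarrow> t) F" and fb: "\<forall>\<^sub>F x in F. f x \<in> {0..b}" and t: "t \<in> {0..b}" and g: "(g \<longlongrightarrow> v) F"
  shows "((\<lambda>x. S (f x) (g x)) \<longlongrightarrow> S t v) F"
proof -
  have 1: "((\<lambda>x. S (f x) v) \<longlongrightarrow> S t v) F"
    using continuous_on_tendsto_compose[OF S_continuous_on f t fb] .
  have 2: "((\<lambda>x. S (f x) (g x) - S (f x) v) \<longlongrightarrow> 0) F"
  proof (rule Lim_null_comparison)
    show "\<forall>\<^sub>F x in F. norm (S (f x) (g x) - S (f x) v) \<le> exp (\<kappa> * b) * norm (g x - v)"
      using fb
    proof eventually_elim
      case (elim x)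
      have "norm (S (f x) (g x) - S (f x) v) \<le> exp (\<kappa> * f x) * norm (g x - v)"
        using S_norm[of "f x" "g x - v"] elim by (simp add: S_diff)
      also have "\<dots> \<le> exp (\<kappa> * b) * norm (g x - v)"
        using elim kappa by (intro mult_right_mono) (auto intro: mult_left_mono)
      finally show ?case .
    qed
    show "((\<lambda>x. exp (\<kappa> * b) * norm (g x - v)) \<longlongrightarrow> 0) F"
      using g by (intro tendsto_mult_right_zero tendsto_norm_zero) (simp add: LIM_zero)
  qed
  show ?thesis using tendsto_add[OF 2 1] by simp
qed

lemma fpow_coeff:
  assumes "v \<in> fdom r" "i \<in> I"
  shows "inner (e i) (fpow r v) = (\<kappa> + lam i) powr r * inner (e i) v"
  using orthonormal_series(1)[OF is_onb_orthonormal[OF onb] _ assms(2), of "\<lambda>i. (\<kappa> + lam i) powr r * inner (e i) v"]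
    assms(1) by (simp add: frac_pow_def frac_dom_def)

lemma powr_le_exp: "x \<ge> 0 \<Longrightarrow> 0 \<le> r \<Longrightarrow> r \<le> 1 \<Longrightarrow> x powr r \<le> exp (x::real)"
proof (cases "x \<le> 1")
  case True
  assume "x \<ge> 0" "0 \<le> r"
  then have "x powr r \<le> 1" using True by (simp add: powr_le1)
  also have "1 \<le> exp x" using \<open>x \<ge> 0\<close> by simp
  finally show ?thesis .
next
  case False
  assume "r \<le> 1"
  then have "x powr r \<le> x powr 1" using False by (intro powr_mono) auto
  also have "\<dots> \<le> exp x" using False exp_ge_add_one_self[of x] by (simp only: powr_one split: if_splits)
  finally show ?thesis .
qed

text \<open>The analytic smoothing estimate: with \<open>m = \<kappa> + lam i\<close>, the factor \<open>m\<^sup>r exp (- m t)\<close> equals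
  \<open>t\<close> to the power \<open>- r\<close> times \<open>(m t)\<^sup>r exp (- m t)\<close>, and the last product is at most 1.\<close>

lemma smoothing_multiplier:
  assumes i: "i \<in> I" and t: "0 < t" "t \<le> b" and r: "0 \<le> r" "r \<le> 1"
  shows "(\<kappa> + lam i) powr r * exp (- lam i * t) \<le> exp (\<kappa> * b) * t powr (- r)"
proof -
  let ?m = "\<kappa> + lam i"
  have m: "?m > 0" using lam[OF i] c by simp
  have "?m powr r * exp (- lam i * t) = (?m * t) powr r * t powr (- r) * exp (- (?m * t)) * exp (\<kappa> * t)"
    using m t by (simp add: powr_mult powr_minus exp_add[symmetric]) (simp add: algebra_simps exp_add)
  also have "\<dots> \<le> exp (?m * t) * t powr (- r) * exp (- (?m * t)) * exp (\<kappa> * b)"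
    using m t r kappa powr_le_exp[of "?m * t" r]
    by (intro mult_mono) (auto intro: mult_left_mono)
  also have "\<dots> = exp (\<kappa> * b) * t powr (- r)" by (simp add: exp_minus)
  finally show ?thesis .
qed

lemma S_in_fdom:
  assumes t: "0 < t" and r: "0 \<le> r" "r \<le> 1"
  shows "S t v \<in> fdom r"
proof -
  have "(\<lambda>i. ((\<kappa> + lam i) powr r * exp (- lam i * t) * inner (e i) v)\<^sup>2) summable_on I"
    by (rule multiplier_summable[where C = "exp (\<kappa> * t) * t powr (- r)"])
      (use smoothing_multiplier[OF _ t order_refl r] in \<open>auto simp: abs_mult\<close>)
  then show ?thesis
    using t by (simp add: frac_dom_def S_coeff mult.assoc cong: summable_on_cong)
qed

lemma fpow_S_norm:
  assumes t: "0 < t" "t \<le> b" and r: "0 \<le> r" "r \<le> 1"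
  shows "norm (fpow r (S t v)) \<le> exp (\<kappa> * b) * t powr (- r) * norm v"
proof (rule norm_le_of_coeffs)
  fix i assume i: "i \<in> I"
  have "\<bar>inner (e i) (fpow r (S t v))\<bar> = ((\<kappa> + lam i) powr r * exp (- lam i * t)) * \<bar>inner (e i) v\<bar>"
    using i t by (simp add: fpow_coeff[OF S_in_fdom[OF t(1) r]] S_coeff abs_mult)
  then show "\<bar>inner (e i) (fpow r (S t v))\<bar> \<le> exp (\<kappa> * b) * t powr (- r) * \<bar>inner (e i) v\<bar>"
    using smoothing_multiplier[OF i t r] by (simp add: mult_right_mono)
qed simp

lemma S_fdom: assumes "v \<in> fdom r" "t \<ge> 0" shows "S t v \<in> fdom r"
proof -
  have "(\<lambda>i. (exp (- lam i * t) * inner (e i) (fpow r v))\<^sup>2) summable_on I"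
    by (rule multiplier_summable[where C = "exp (\<kappa> * t)"]) (use exp_multiplier_le assms in auto)
  then show ?thesis
    using assms by (simp add: frac_dom_def fpow_coeff S_coeff mult.left_commute cong: summable_on_cong)
qed

lemma fpow_S_commute:
  assumes "v \<in> fdom r" "t \<ge> 0" shows "fpow r (S t v) = S t (fpow r v)"
  by (rule onb_eqI[OF onb]) (simp add: fpow_coeff S_fdom assms S_coeff)

lemma norm_le_fpow:
  assumes v: "v \<in> fdom r" and r: "r \<ge> 0"
  shows "norm v \<le> c powr (- r) * norm (fpow r v)"
proof (rule norm_le_of_coeffs)
  fix i assume i: "i \<in> I"
  have "1 \<le> c powr (- r) * (\<kappa> + lam i) powr r"
    using lam[OF i] c powr_mono2[of r c "\<kappa> + lam i"] r by (simp add: powr_minus field_simps)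
  then have "\<bar>inner (e i) v\<bar> * 1 \<le> \<bar>inner (e i) v\<bar> * (c powr (- r) * (\<kappa> + lam i) powr r)"
    by (intro mult_left_mono) auto
  then show "\<bar>inner (e i) v\<bar> \<le> c powr (- r) * \<bar>inner (e i) (fpow r v)\<bar>"
    using i by (simp add: fpow_coeff v abs_mult algebra_simps)
qed simp

text \<open>Why the increment of the semigroup has order \<open>r\<close>: \<open>1 - exp (- x) \<le> x\<^sup>r\<close> for \<open>x = m t\<close>, whatever the
  size of \<open>x\<close>. The shift by \<open>\<kappa>\<close> contributes an increment of order \<open>t\<close>, which is absorbed because
  \<open>t\<close> is bounded and \<open>m\<close> is bounded away from 0.\<close>

lemma increment_multiplier:
  assumes i: "i \<in> I" and t: "0 < t" "t \<le> b" and r: "0 \<le> r" "r \<le> 1"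
  shows "\<bar>exp (- lam i * t) - 1\<bar>
    \<le> exp (\<kappa> * b) * (1 + \<kappa> * b powr (1 - r) * c powr (- r)) * t powr r * (\<kappa> + lam i) powr r"
proof -
  let ?m = "\<kappa> + lam i"
  have m: "?m > 0" using lam[OF i] c by simp
  have e1: "1 - exp (- (?m * t)) \<le> (?m * t) powr r"
  proof (cases "?m * t \<le> 1")
    case True
    have "1 - exp (- (?m * t)) \<le> ?m * t" using exp_ge_add_one_self[of "- (?m * t)"] by simp
    also have "?m * t = (?m * t) powr 1" using m t by simp
    also have "\<dots> \<le> (?m * t) powr r" using True m t r by (intro powr_mono') auto
    finally show ?thesis .
  next
    case False
    then have "1 \<le> (?m * t) powr r" using r by (simp add: ge_one_powr_ge_zero)
    then show ?thesis by (smt (verit) exp_gt_zero)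
  qed
  have e2: "exp (\<kappa> * t) - 1 \<le> exp (\<kappa> * t) * (\<kappa> * t)"
  proof -
    have "1 - exp (- (\<kappa> * t)) \<le> \<kappa> * t" using exp_ge_add_one_self[of "- (\<kappa> * t)"] by simp
    then have "exp (\<kappa> * t) * (1 - exp (- (\<kappa> * t))) \<le> exp (\<kappa> * t) * (\<kappa> * t)" by (intro mult_left_mono) auto
    then show ?thesis by (simp add: right_diff_distrib exp_minus)
  qed
  have e3: "t \<le> t powr r * b powr (1 - r)"
  proof -
    have "t = t powr r * t powr (1 - r)" using t by (simp add: powr_add[symmetric])
    also have "\<dots> \<le> t powr r * b powr (1 - r)" using t r by (intro mult_left_mono powr_mono2) auto
    finally show ?thesis .
  qed
  have e4: "1 \<le> c powr (- r) * ?m powr r"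
    using lam[OF i] c powr_mono2[of r c ?m] r by (simp add: powr_minus field_simps)
  have ek: "exp (\<kappa> * t) \<le> exp (\<kappa> * b)" using t kappa by (simp add: mult_left_mono)
  have "exp (- lam i * t) - 1 = - (exp (\<kappa> * t) * (1 - exp (- (?m * t)))) + (exp (\<kappa> * t) - 1)"
    by (simp add: right_diff_distrib exp_add[symmetric]) (simp add: algebra_simps)
  moreover have p1: "0 \<le> exp (\<kappa> * t) * (1 - exp (- (?m * t)))" using m t by (intro mult_nonneg_nonneg) auto
  moreover have p2: "0 \<le> exp (\<kappa> * t) - 1" using kappa t by simp
  ultimately have "\<bar>exp (- lam i * t) - 1\<bar> \<le> exp (\<kappa> * t) * (1 - exp (- (?m * t))) + (exp (\<kappa> * t) - 1)"
    using p1 p2 by linarith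
  also have "\<dots> \<le> exp (\<kappa> * t) * (?m * t) powr r + exp (\<kappa> * t) * (\<kappa> * t)"
    using e1 e2 by (intro add_mono mult_left_mono) auto
  also have "\<dots> = exp (\<kappa> * t) * (t powr r * ?m powr r + \<kappa> * (t * 1))"
    unfolding powr_mult by (simp add: algebra_simps)
  also have "\<dots> \<le> exp (\<kappa> * b) * (t powr r * ?m powr r + \<kappa> * ((t powr r * b powr (1 - r)) * (c powr (- r) * ?m powr r)))"
    using ek e3 e4 t kappa m by (intro mult_mono add_mono order_refl) auto
  also have "\<dots> = exp (\<kappa> * b) * (1 + \<kappa> * b powr (1 - r) * c powr (- r)) * t powr r * ?m powr r"
    by (simp add: algebra_simps)
  finally show ?thesis .
qed

lemma S_increment_norm:
  assumes r: "0 \<le> r" "r \<le> 1"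
  shows "\<exists>C>0. \<forall>t v. 0 \<le> t \<longrightarrow> t \<le> b \<longrightarrow> v \<in> fdom r \<longrightarrow> norm (S t v - v) \<le> C * t powr r * norm (fpow r v)"
proof (intro exI conjI allI impI)
  let ?C = "exp (\<kappa> * b) * (1 + \<kappa> * b powr (1 - r) * c powr (- r))"
  show "?C > 0" using kappa by (intro mult_pos_pos add_pos_nonneg) auto
  fix t v assume t: "0 \<le> t" "t \<le> b" and v: "v \<in> fdom r"
  show "norm (S t v - v) \<le> ?C * t powr r * norm (fpow r v)"
  proof (cases "t = 0")
    case False
    show ?thesis
    proof (rule norm_le_of_coeffs)
      fix i assume i: "i \<in> I"
      have "\<bar>inner (e i) (S t v - v)\<bar> = \<bar>exp (- lam i * t) - 1\<bar> * \<bar>inner (e i) v\<bar>"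
        using i t by (simp add: inner_diff_right S_coeff abs_mult[symmetric] left_diff_distrib)
      also have "\<dots> \<le> (?C * t powr r * (\<kappa> + lam i) powr r) * \<bar>inner (e i) v\<bar>"
        using increment_multiplier[OF i _ t(2) r] t False by (intro mult_right_mono) auto
      also have "\<dots> = ?C * t powr r * \<bar>inner (e i) (fpow r v)\<bar>"
        using i by (simp add: fpow_coeff v abs_mult)
      finally show "\<bar>inner (e i) (S t v - v)\<bar> \<le> ?C * t powr r * \<bar>inner (e i) (fpow r v)\<bar>" .
    qed (use \<open>?C > 0\<close> in simp)
  qed simp
qed

end


section \<open>Bounded multilinear maps and symmetry of derivatives\<close>

lemma bounded_multilinear_head:
  assumes "bounded_multilinear (Suc n) L" "length xs = n"
  shows "linear (\<lambda>x. L (x # xs))"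
proof -
  have "linear (\<lambda>x. L ((undefined # xs)[0 := x]))"
    using assms unfolding bounded_multilinear_def by (metis length_Cons zero_less_Suc)
  then show ?thesis by simp
qed

lemma bounded_multilinear_Cons:
  assumes "bounded_multilinear (Suc n) L"
  shows "bounded_multilinear n (\<lambda>xs. L (x # xs))"
proof -
  obtain C where C: "\<And>xs. length xs = Suc n \<Longrightarrow> norm (L xs) \<le> C * prod_list (map norm xs)"
    using assms by (auto simp: bounded_multilinear_def)
  have "linear (\<lambda>y. L (x # xs[j := y]))" if "length xs = n" "j < n" for xs j
  proof -
    have "linear (\<lambda>y. L ((x # xs)[Suc j := y]))"
      using assms that unfolding bounded_multilinear_def by (metis length_Cons Suc_less_eq)
    then show ?thesis by simp
  qed
  moreover have "norm (L (x # xs)) \<le> (C * norm x) * prod_list (map norm xs)" if "length xs = n" for xs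
    using C[of "x # xs"] that by (simp add: mult.assoc)
  ultimately show ?thesis unfolding bounded_multilinear_def by blast
qed

lemma bounded_multilinear_diff:
  assumes "bounded_multilinear n L" "bounded_multilinear n M"
  shows "bounded_multilinear n (\<lambda>xs. L xs - M xs)"
proof -
  obtain C C' where C: "\<And>xs. length xs = n \<Longrightarrow> norm (L xs) \<le> C * prod_list (map norm xs)"
    "\<And>xs. length xs = n \<Longrightarrow> norm (M xs) \<le> C' * prod_list (map norm xs)"
    using assms unfolding bounded_multilinear_def by blast
  have "norm (L xs - M xs) \<le> (C + C') * prod_list (map norm xs)" if "length xs = n" for xs
    using C[OF that] norm_triangle_ineq4[of "L xs" "M xs"] by (simp add: algebra_simps)
  moreover have "linear (\<lambda>x. L (xs[j := x]) - M (xs[j := x]))" if "length xs = n" "j < n" for xs j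
    using assms that by (intro linear_compose_sub) (auto simp: bounded_multilinear_def)
  ultimately show ?thesis unfolding bounded_multilinear_def by blast
qed

lemma bounded_multilinear_scale:
  assumes "bounded_multilinear n L" "length xs = n"
  shows "L (map (\<lambda>x. c x *\<^sub>R x) xs) = prod_list (map c xs) *\<^sub>R L xs"
  using assms
proof (induction xs arbitrary: n L)
  case (Cons x xs)
  then obtain m where n: "n = Suc m" "length xs = m" by auto
  have "L (c x *\<^sub>R x # map (\<lambda>x. c x *\<^sub>R x) xs) = c x *\<^sub>R L (x # map (\<lambda>x. c x *\<^sub>R x) xs)"
    using bounded_multilinear_head[of m L "map (\<lambda>x. c x *\<^sub>R x) xs"] Cons.prems n
    by (simp add: linear_cmul[of "\<lambda>x. L (x # map (\<lambda>x. c x *\<^sub>R x) xs)"])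
  also have "L (x # map (\<lambda>x. c x *\<^sub>R x) xs) = prod_list (map c xs) *\<^sub>R L (x # xs)"
    using Cons.IH[OF bounded_multilinear_Cons[of m L x]] Cons.prems n by simp
  finally show ?case by simp
qed simp

lemma prod_list_norm_le_one: "(\<forall>x\<in>set xs. norm x \<le> 1) \<Longrightarrow> prod_list (map norm xs) \<le> 1"
  by (induction xs) (auto intro!: mult_le_one prod_list_nonneg)

lemma prod_list_norm_nonneg: "0 \<le> prod_list (map norm xs)"
  by (rule prod_list_nonneg) auto

lemma bounded_multilinear_bdd_above:
  assumes "bounded_multilinear n L"
  shows "bdd_above ((\<lambda>xs. norm (L xs)) ` {xs. length xs = n \<and> (\<forall>x\<in>set xs. norm x \<le> 1)})"
proof -
  obtain C where C: "\<And>xs. length xs = n \<Longrightarrow> norm (L xs) \<le> C * prod_list (map norm xs)"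
    using assms by (auto simp: bounded_multilinear_def)
  have "norm (L xs) \<le> \<bar>C\<bar>" if "length xs = n" "\<forall>x\<in>set xs. norm x \<le> 1" for xs
  proof -
    have "norm (L xs) \<le> C * prod_list (map norm xs)" using C that by simp
    also have "\<dots> \<le> \<bar>C\<bar> * 1"
      using prod_list_norm_le_one[OF that(2)] by (intro mult_mono) (auto simp: prod_list_norm_nonneg)
    finally show ?thesis by simp
  qed
  then show ?thesis by (intro bdd_aboveI[of _ "\<bar>C\<bar>"]) auto
qed

text \<open>The operator norm is a supremum over unit vectors; homogeneity in each argument reduces to it,
  except when an argument vanishes, where both sides are 0.\<close>

lemma norm_le_multilinear_norm:
  assumes L: "bounded_multilinear n L" and n: "length xs = n"
  shows "norm (L xs) \<le> multilinear_norm n L * prod_list (map norm xs)"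
proof (cases "0 \<in> set xs")
  case True
  obtain C where C: "norm (L xs) \<le> C * prod_list (map norm xs)"
    using L n by (auto simp: bounded_multilinear_def)
  have "prod_list (map norm xs) = 0" using True by (auto simp: prod_list_zero_iff)
  then show ?thesis using C by simp
next
  case False
  let ?ys = "map (\<lambda>x. inverse (norm x) *\<^sub>R x) xs"
  have pos: "prod_list (map norm xs) \<noteq> 0" using False by (auto simp: prod_list_zero_iff)
  have inv: "prod_list (map (\<lambda>x. inverse (norm x)) xs) = inverse (prod_list (map norm xs))" for xs :: "'a list"
    by (induction xs) auto
  have "norm (L ?ys) \<le> multilinear_norm n L"
    unfolding multilinear_norm_def
    using n by (intro cSUP_upper bounded_multilinear_bdd_above[OF L]) (auto simp: field_simps)
  moreover have "norm (L ?ys) = inverse (prod_list (map norm xs)) * norm (L xs)"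
    using bounded_multilinear_scale[OF L n, of "\<lambda>x. inverse (norm x)"]
    by (simp add: inv prod_list_norm_nonneg)
  ultimately show ?thesis
  proof -
    have p: "prod_list (map norm xs) > 0" using pos prod_list_norm_nonneg[of xs] by linarith
    assume "norm (L ?ys) \<le> multilinear_norm n L"
      "norm (L ?ys) = inverse (prod_list (map norm xs)) * norm (L xs)"
    then have "norm (L xs) / prod_list (map norm xs) \<le> multilinear_norm n L" by (simp add: field_simps)
    then show ?thesis using p by (simp only: pos_divide_le_eq)
  qed
qed

lemma multilinear_norm_nonneg:
  assumes "bounded_multilinear n L" shows "0 \<le> multilinear_norm n L"
proof -
  have "norm (L (replicate n 0)) \<le> multilinear_norm n L"
    unfolding multilinear_norm_def
    by (intro cSUP_upper bounded_multilinear_bdd_above[OF assms]) (auto)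
  then show ?thesis using norm_ge_zero order_trans by blast
qed

text \<open>Arguments are replaced by their limits one after the other; the uniform bound controls each
  replacement. Only convergence at the fixed limit arguments has to be known for \<open>L\<close>.\<close>

lemma bounded_multilinear_tendsto:
  assumes "\<And>k. bounded_multilinear n (L k)"
    and "\<And>k xs. length xs = n \<Longrightarrow> norm (L k xs) \<le> C * prod_list (map norm xs)"
    and "list_all2 (\<lambda>g x. (g \<longlongrightarrow> x) G) gs xs" and "length xs = n"
    and "((\<lambda>k. L k xs) \<longlongrightarrow> l) G"
  shows "((\<lambda>k. L k (map (\<lambda>g. g k) gs)) \<longlongrightarrow> l) G"
  using assms
proof (induction n arbitrary: L C gs xs)
  case 0
  then show ?case by simp
next
  case (Suc n)
  obtain x ys g hs where eq: "xs = x # ys" "gs = g # hs" "length ys = n" "length hs = n"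
    using Suc.prems(3,4) by (metis length_Suc_conv list_all2_Cons2 list_all2_lengthD)
  have g: "(g \<longlongrightarrow> x) G" and hs: "list_all2 (\<lambda>g x. (g \<longlongrightarrow> x) G) hs ys"
    using Suc.prems(3) eq by auto
  have 1: "((\<lambda>k. L k (x # map (\<lambda>g. g k) hs)) \<longlongrightarrow> l) G"
  proof (rule Suc.IH[where C = "C * norm x", OF _ _ hs eq(3)])
    show "norm (L k (x # zs)) \<le> C * norm x * prod_list (map norm zs)" if "length zs = n" for k zs
      using Suc.prems(2)[of "x # zs" k] that by (simp add: mult.assoc)
  qed (use Suc.prems(1,5) eq in \<open>auto intro: bounded_multilinear_Cons\<close>)
  have "((\<lambda>k. prod_list (map (\<lambda>g. norm (g k)) hs)) \<longlongrightarrow> prod_list (map norm ys)) G"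
    using hs by (induction hs ys rule: list_all2_induct) (auto intro!: tendsto_intros)
  then have "((\<lambda>k. C * norm (g k - x) * prod_list (map (\<lambda>g. norm (g k)) hs)) \<longlongrightarrow> C * norm (x - x) * prod_list (map norm ys)) G"
    by (intro tendsto_intros g)
  then have lim0: "((\<lambda>k. C * norm (g k - x) * prod_list (map (\<lambda>g. norm (g k)) hs)) \<longlongrightarrow> 0) G" by simp
  have 2: "((\<lambda>k. L k (g k # map (\<lambda>g. g k) hs) - L k (x # map (\<lambda>g. g k) hs)) \<longlongrightarrow> 0) G"
  proof (rule Lim_null_comparison[OF always_eventually lim0], intro allI)
    fix k
    have "L k (g k # map (\<lambda>g. g k) hs) - L k (x # map (\<lambda>g. g k) hs) = L k ((g k - x) # map (\<lambda>g. g k) hs)"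
      using linear_diff[OF bounded_multilinear_head[OF Suc.prems(1), of "map (\<lambda>g. g k) hs" k]] eq by simp
    then show "norm (L k (g k # map (\<lambda>g. g k) hs) - L k (x # map (\<lambda>g. g k) hs))
      \<le> C * norm (g k - x) * prod_list (map (\<lambda>g. norm (g k)) hs)"
      using Suc.prems(2)[of "(g k - x) # map (\<lambda>g. g k) hs" k] eq by (simp add: mult.assoc comp_def)
  qed
  show ?case using tendsto_add[OF 2 1] eq by simp
qed

text \<open>Schwarz's theorem. The second difference of \<open>f\<close> over a parallelogram does not depend on the order of
  its sides. Applying the mean value theorem twice in either order, to the function paired with a
  vector \<open>y\<close>, expresses it by \<open>f''\<close> at two points near \<open>v\<close>, with the directions exchanged.\<close>

lemma symmetric_second_derivative:
  fixes f :: "'a::real_normed_vector \<Rightarrow> 'b::real_inner"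
  assumes f: "\<And>v. (f has_derivative f' v) (at v)"
    and f': "\<And>v k. ((\<lambda>v. f' v k) has_derivative (\<lambda>h. f'' v h k)) (at v)"
    and lip: "\<And>v w h k. norm (f'' v h k - f'' w h k) \<le> B h k * norm (v - w)"
  shows "f'' v h k = f'' v k h"
proof -
  \<comment> \<open>the second difference over the parallelogram spanned by \<open>s h\<close> and \<open>s k\<close>\<close>
  define \<Delta> where "\<Delta> y s h k = inner y (f (v + s *\<^sub>R h + s *\<^sub>R k) - f (v + s *\<^sub>R h) - f (v + s *\<^sub>R k) + f v)" for y s h k
  have mvt: "\<exists>p. norm (p - v) \<le> s * (norm h + norm k) \<and> \<Delta> y s h k = s * s * inner y (f'' p k h)"
    if s: "s > 0" for y s h k
  proof -
    define u where "u \<sigma> = inner y (f (v + \<sigma> *\<^sub>R h + s *\<^sub>R k) - f (v + \<sigma> *\<^sub>R h))" for \<sigma>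
    define u' where "u' \<sigma> = inner y (f' (v + \<sigma> *\<^sub>R h + s *\<^sub>R k) h - f' (v + \<sigma> *\<^sub>R h) h)" for \<sigma>
    have lin: "linear (f' p)" for p using has_derivative_linear[OF f] .
    have "(u has_real_derivative u' \<sigma>) (at \<sigma>)" for \<sigma>
      unfolding has_field_derivative_def u_def u'_def
      apply (rule has_derivative_eq_rhs)
       apply (rule has_derivative_inner_right has_derivative_diff)+
        apply (rule has_derivative_compose[OF _ f], (rule derivative_eq_intros refl)+)
       apply (rule has_derivative_compose[OF _ f], (rule derivative_eq_intros refl)+)
      apply (simp add: fun_eq_iff linear_cmul[OF lin] inner_diff_right algebra_simps)
      done
    then obtain \<xi> where \<xi>: "0 < \<xi>" "\<xi> < s" "u s - u 0 = (s - 0) * u' \<xi>"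
      using MVT2[of 0 s u u'] s by auto
    define w where "w \<tau> = inner y (f' (v + \<xi> *\<^sub>R h + \<tau> *\<^sub>R k) h)" for \<tau>
    have lin2: "linear (\<lambda>k. f'' p k h)" for p using has_derivative_linear[OF f'] .
    have "(w has_real_derivative inner y (f'' (v + \<xi> *\<^sub>R h + \<tau> *\<^sub>R k) k h)) (at \<tau>)" for \<tau>
      unfolding has_field_derivative_def w_def
      apply (rule has_derivative_eq_rhs)
       apply (rule has_derivative_inner_right)
       apply (rule has_derivative_compose[OF _ f'], (rule derivative_eq_intros refl)+)
      apply (simp add: fun_eq_iff linear_cmul[OF lin2] algebra_simps)
      done
    then obtain \<eta> where \<eta>: "0 < \<eta>" "\<eta> < s" "w s - w 0 = (s - 0) * inner y (f'' (v + \<xi> *\<^sub>R h + \<eta> *\<^sub>R k) k h)"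
      using MVT2[of 0 s w "\<lambda>\<tau>. inner y (f'' (v + \<xi> *\<^sub>R h + \<tau> *\<^sub>R k) k h)"] s by auto
    have "\<Delta> y s h k = u s - u 0" by (simp add: \<Delta>_def u_def algebra_simps)
    also have "\<dots> = s * (w s - w 0)" using \<xi>(3) by (simp add: u'_def w_def inner_diff_right)
    also have "\<dots> = s * s * inner y (f'' (v + \<xi> *\<^sub>R h + \<eta> *\<^sub>R k) k h)" using \<eta>(3) by simp
    finally have "\<Delta> y s h k = s * s * inner y (f'' (v + \<xi> *\<^sub>R h + \<eta> *\<^sub>R k) k h)" .
    moreover have "norm (v + \<xi> *\<^sub>R h + \<eta> *\<^sub>R k - v) \<le> s * (norm h + norm k)"
    proof -
      have "norm (\<xi> *\<^sub>R h + \<eta> *\<^sub>R k) \<le> \<xi> * norm h + \<eta> * norm k"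
        using norm_triangle_ineq[of "\<xi> *\<^sub>R h" "\<eta> *\<^sub>R k"] \<xi> \<eta> by simp
      also have "\<dots> \<le> s * norm h + s * norm k" using \<xi> \<eta> by (intro add_mono mult_right_mono) auto
      finally show ?thesis by (simp add: algebra_simps)
    qed
    ultimately show ?thesis by blast
  qed
  have "inner y (f'' v h k - f'' v k h) = 0" for y
  proof -
    define K where "K = norm y * ((\<bar>B h k\<bar> + \<bar>B k h\<bar>) * (norm h + norm k))"
    have "\<bar>inner y (f'' v h k - f'' v k h)\<bar> \<le> K * s" if s: "s > 0" for s
    proof -
      obtain p q where p: "norm (p - v) \<le> s * (norm h + norm k)" "\<Delta> y s h k = s * s * inner y (f'' p k h)"
        and q: "norm (q - v) \<le> s * (norm k + norm h)" "\<Delta> y s k h = s * s * inner y (f'' q h k)"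
        using mvt[OF s] by metis
      have "\<Delta> y s h k = \<Delta> y s k h" by (simp add: \<Delta>_def algebra_simps)
      then have "inner y (f'' p k h) = inner y (f'' q h k)" using p q s by simp
      then have "inner y (f'' v h k - f'' v k h) = inner y ((f'' p k h - f'' v k h) - (f'' q h k - f'' v h k))"
        by (simp add: inner_diff_right)
      also have "\<bar>\<dots>\<bar> \<le> norm y * norm ((f'' p k h - f'' v k h) - (f'' q h k - f'' v h k))"
        by (rule Cauchy_Schwarz_ineq2)
      also have "\<dots> \<le> norm y * (norm (f'' p k h - f'' v k h) + norm (f'' q h k - f'' v h k))"
        by (intro mult_left_mono norm_triangle_ineq4) auto
      also have "\<dots> \<le> norm y * (\<bar>B k h\<bar> * (s * (norm h + norm k)) + \<bar>B h k\<bar> * (s * (norm k + norm h)))"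
        by (intro mult_left_mono add_mono order_trans[OF lip] mult_mono p q) auto
      also have "\<dots> = K * s" by (simp add: K_def algebra_simps)
      finally show ?thesis .
    qed
    note bd = this
    have "((\<lambda>s. K * s) \<longlongrightarrow> K * 0) (at_right 0)" by (intro tendsto_intros)
    moreover have "\<forall>\<^sub>F s in at_right 0. \<bar>inner y (f'' v h k - f'' v k h)\<bar> \<le> K * s"
      using bd by (auto simp: eventually_at_right_less eventually_at_filter)
    ultimately have "\<bar>inner y (f'' v h k - f'' v k h)\<bar> \<le> K * 0"
      by (intro tendsto_lowerbound[of "\<lambda>s. K * s"]) auto
    then show ?thesis by simp
  qed
  from this[of "f'' v h k - f'' v k h"] show ?thesis by simp
qed

lemma set_integrable_continuous_Icc:
  fixes f :: "real \<Rightarrow> 'b::{banach, second_countable_topology}"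
  shows "continuous_on {a..b} f \<Longrightarrow> set_integrable lborel {a..b} f"
  by (rule borel_integrable_atLeastAtMost')

lemma inner_set_integral:
  fixes f :: "real \<Rightarrow> 'b::{real_inner, banach, second_countable_topology}"
  assumes "set_integrable M A f"
  shows "inner y (LINT s:A|M. f s) = (LINT s:A|M. inner y (f s))"
  using integral_inner_right[of y M "\<lambda>s. indicator A s *\<^sub>R f s"] assms
  unfolding set_lebesgue_integral_def set_integrable_def by simp

text \<open>The fundamental theorem for the Bochner integral in a Hilbert space follows from the scalar one by
  pairing with each vector.\<close>

lemma set_integral_FTC:
  fixes G g :: "real \<Rightarrow> 'b::{real_inner, banach, second_countable_topology}"
  assumes "a \<le> b" and G: "\<And>r. r \<in> {a..b} \<Longrightarrow> (G has_vector_derivative g r) (at r within {a..b})"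
    and g: "continuous_on {a..b} g"
  shows "(LBINT r:{a..b}. g r) = G b - G a"
proof -
  have "inner y (LBINT r:{a..b}. g r) = inner y (G b - G a)" for y
  proof -
    have "inner y (LBINT r:{a..b}. g r) = (LBINT r:{a..b}. inner y (g r))"
      by (intro inner_set_integral set_integrable_continuous_Icc g)
    also have "\<dots> = inner y (G b) - inner y (G a)"
      unfolding set_lebesgue_integral_def
      by (intro integral_FTC_Icc assms(1) bounded_linear.has_vector_derivative[OF bounded_linear_inner_right] G continuous_intros g) auto
    finally show ?thesis by (simp add: inner_diff_right)
  qed
  then show ?thesis using vector_eq_ldot by blast
qed


section \<open>Taylor expansion of a smooth vector field\<close>

locale smooth_field =
  fixes F :: "'h::{real_inner, banach, second_countable_topology} \<Rightarrow> 'h" and D :: "nat \<Rightarrow> 'h \<Rightarrow> 'h list \<Rightarrow> 'h"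
  assumes derivs: "frechet_derivatives F D"
    and bdd: "\<forall>i\<ge>1. bdd_above (range (\<lambda>v. multilinear_norm i (D i v)))"
begin

definition deriv_bound :: "nat \<Rightarrow> real" where "deriv_bound i = (SUP v. multilinear_norm i (D i v))"

lemma D_0: "D 0 v [] = F v"
  using derivs by (simp add: frechet_derivatives_def)

lemma D_multilinear: "bounded_multilinear i (D i v)"
  using derivs by (simp add: frechet_derivatives_def)

lemma deriv_bound_nonneg: "i \<ge> 1 \<Longrightarrow> 0 \<le> deriv_bound i"
  unfolding deriv_bound_def using multilinear_norm_nonneg[OF D_multilinear[of i 0]] bdd
  by (meson UNIV_I cSUP_upper2)

lemma D_bound:
  assumes "i \<ge> 1" "length xs = i"
  shows "norm (D i v xs) \<le> deriv_bound i * prod_list (map norm xs)"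
proof -
  have "norm (D i v xs) \<le> multilinear_norm i (D i v) * prod_list (map norm xs)"
    by (rule norm_le_multilinear_norm[OF D_multilinear assms(2)])
  also have "\<dots> \<le> deriv_bound i * prod_list (map norm xs)"
    unfolding deriv_bound_def using bdd assms(1)
    by (intro mult_right_mono cSUP_upper prod_list_norm_nonneg) auto
  finally show ?thesis .
qed

lemma D_derivative:
  assumes xs: "length xs = i"
  shows "((\<lambda>v. D i v xs) has_derivative (\<lambda>h. D (Suc i) v (h # xs))) (at v)"
  unfolding has_derivative_at
proof (intro conjI)
  have lin: "linear (\<lambda>h. D (Suc i) v (h # xs))"
    using bounded_multilinear_head[OF D_multilinear xs] .
  have "norm (D (Suc i) v (h # xs)) \<le> norm h * (deriv_bound (Suc i) * prod_list (map norm xs))" for h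
    using D_bound[of "Suc i" "h # xs" v] xs by (simp add: algebra_simps)
  then show "bounded_linear (\<lambda>h. D (Suc i) v (h # xs))"
    using lin by (auto simp: bounded_linear_def bounded_linear_axioms_def)
  define L where "L h ys = D i (v + h) ys - D i v ys - D (Suc i) v (h # ys)" for h ys
  have L: "bounded_multilinear i (L h)" for h
    unfolding L_def by (intro bounded_multilinear_diff D_multilinear bounded_multilinear_Cons)
  have "((\<lambda>h. multilinear_norm i (L h) / norm h) \<longlongrightarrow> 0) (at 0)"
    using derivs by (simp add: frechet_derivatives_def L_def[abs_def])
  then have lim: "((\<lambda>h. multilinear_norm i (L h) / norm h * prod_list (map norm xs)) \<longlongrightarrow> 0) (at 0)"
    by (rule tendsto_mult_left_zero)
  show "((\<lambda>h. norm (D i (v + h) xs - D i v xs - D (Suc i) v (h # xs)) / norm h) \<longlongrightarrow> 0) (at 0)"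
  proof (rule Lim_null_comparison[OF always_eventually lim], intro allI)
    fix h
    have "norm (L h xs) \<le> multilinear_norm i (L h) * prod_list (map norm xs)"
      by (rule norm_le_multilinear_norm[OF L xs])
    then show "norm (norm (D i (v + h) xs - D i v xs - D (Suc i) v (h # xs)) / norm h)
       \<le> multilinear_norm i (L h) / norm h * prod_list (map norm xs)"
      by (simp add: L_def divide_right_mono)
  qed
qed

lemma D_lipschitz:
  assumes xs: "length xs = i"
  shows "norm (D i v xs - D i w xs) \<le> deriv_bound (Suc i) * prod_list (map norm xs) * norm (v - w)"
proof (rule differentiable_bound[of UNIV "\<lambda>v. D i v xs" "\<lambda>v h. D (Suc i) v (h # xs)"])
  show "onorm (\<lambda>h. D (Suc i) u (h # xs)) \<le> deriv_bound (Suc i) * prod_list (map norm xs)" for u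
  proof (rule onorm_bound)
    fix x show "norm (D (Suc i) u (x # xs)) \<le> deriv_bound (Suc i) * prod_list (map norm xs) * norm x"
      using D_bound[of "Suc i" "x # xs" u] xs by (simp add: algebra_simps)
  qed (simp add: deriv_bound_nonneg prod_list_norm_nonneg)
qed (auto intro: D_derivative[OF xs])

lemma F_growth: "norm (F v) \<le> norm (F 0) + deriv_bound 1 * norm v"
  using D_lipschitz[of "[]" 0 v 0] norm_triangle_ineq2[of "F v" "F 0"] by (simp add: D_0)

lemma D_swap:
  assumes xs: "length xs = i"
  shows "D (Suc (Suc i)) v (h # k # xs) = D (Suc (Suc i)) v (k # h # xs)"
proof (rule symmetric_second_derivative[where f = "\<lambda>v. D i v xs" and f' = "\<lambda>v h. D (Suc i) v (h # xs)"
    and f'' = "\<lambda>v h k. D (Suc (Suc i)) v (h # k # xs)"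
    and B = "\<lambda>h k. deriv_bound (Suc (Suc (Suc i))) * prod_list (map norm (h # k # xs))"])
  show "norm (D (Suc (Suc i)) v (h # k # xs) - D (Suc (Suc i)) w (h # k # xs))
     \<le> deriv_bound (Suc (Suc (Suc i))) * prod_list (map norm (h # k # xs)) * norm (v - w)" for v w h k
    using xs by (intro D_lipschitz) simp
qed (use xs in \<open>auto intro!: D_derivative\<close>)

text \<open>The definition of higher derivatives puts the newest direction first, whereas a tree grows by
  appending its newest child last; symmetry of the derivatives reconciles the two.\<close>

lemma D_rotate: "length xs = i \<Longrightarrow> D (Suc i) v (xs @ [h]) = D (Suc i) v (h # xs)"
proof (induction i arbitrary: xs v)
  case (Suc i)
  then obtain x ys where xs: "xs = x # ys" "length ys = i" by (auto simp: length_Suc_conv)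
  have "(\<lambda>v. D (Suc i) v (ys @ [h])) = (\<lambda>v. D (Suc i) v (h # ys))" using Suc.IH xs by auto
  then have "((\<lambda>v. D (Suc i) v (h # ys)) has_derivative (\<lambda>x. D (Suc (Suc i)) v (x # ys @ [h]))) (at v)"
    using D_derivative[of "ys @ [h]" "Suc i" v] xs by simp
  moreover have "((\<lambda>v. D (Suc i) v (h # ys)) has_derivative (\<lambda>x. D (Suc (Suc i)) v (x # h # ys))) (at v)"
    using D_derivative[of "h # ys" "Suc i" v] xs by simp
  ultimately have "(\<lambda>x. D (Suc (Suc i)) v (x # ys @ [h])) = (\<lambda>x. D (Suc (Suc i)) v (x # h # ys))"
    by (rule has_derivative_unique)
  then have "D (Suc (Suc i)) v (x # ys @ [h]) = D (Suc (Suc i)) v (x # h # ys)" by metis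
  then show ?case using D_swap[OF xs(2)] xs by simp
qed simp

lemma D_line_derivative:
  assumes "length xs = i"
  shows "((\<lambda>r. D i (v + r *\<^sub>R d) xs) has_vector_derivative D (Suc i) (v + r *\<^sub>R d) (d # xs)) (at r within A)"
  unfolding has_vector_derivative_def
  apply (rule has_derivative_eq_rhs)
   apply (rule has_derivative_compose[OF _ D_derivative[OF assms]], (rule derivative_eq_intros refl)+)
  using linear_cmul[OF has_derivative_linear[OF D_derivative[OF assms]]] by (simp add: fun_eq_iff)

lemma D_line_continuous: "length xs = i \<Longrightarrow> continuous_on A (\<lambda>r. D i (v + r *\<^sub>R d) xs)"
  using has_vector_derivative_continuous[OF D_line_derivative]
  by (auto simp: continuous_on_eq_continuous_within)

text \<open>The integrand of a tree whose root has type \<open>1\<close> or \<open>1\<^sup>*\<close> with \<open>n\<close> children: \<open>v\<close> is the value of the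
  path at the initial time, \<open>d\<close> its increment and \<open>xs\<close> the values of the subtrees. For \<open>1\<^sup>*\<close> it is the
  remainder in Taylor's formula of order \<open>n\<close>, in integral form. The case of no children, where the
  operators are given by \<open>F\<close> itself, fits the same scheme with \<open>D 0 v [] = F v\<close>.\<close>

fun kernel :: "label \<Rightarrow> nat \<Rightarrow> 'h \<Rightarrow> 'h \<Rightarrow> 'h list \<Rightarrow> 'h" where
  "kernel L1star 0 v d xs = F (v + d)"
| "kernel L1star (Suc n) v d xs = (LBINT r:{0..1}. ((1 - r) ^ n / fact n) *\<^sub>R D (Suc n) (v + r *\<^sub>R d) xs)"
| "kernel _ n v d xs = (1 / fact n) *\<^sub>R D n v xs"

lemma weight_integrable:
  assumes "length xs = i"
  shows "set_integrable lborel {0..1} (\<lambda>r. ((1 - r) ^ n / fact n) *\<^sub>R D i (v + r *\<^sub>R d) xs)"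
  by (intro set_integrable_continuous_Icc continuous_intros D_line_continuous assms) auto

lemma weight_bound: "r \<in> {0..1} \<Longrightarrow> \<bar>(1 - r) ^ n / fact n\<bar> \<le> (1::real)"
proof -
  assume "r \<in> {0..1}"
  then have "(1 - r) ^ n \<le> 1" by (intro power_le_one) auto
  moreover have "fact n \<ge> (1::real)" by simp
  ultimately have "(1 - r) ^ n \<le> fact n" by linarith
  then show "\<bar>(1 - r) ^ n / fact n\<bar> \<le> (1::real)" using \<open>r \<in> {0..1}\<close> by (simp add: abs_mult)
qed

lemma weighted_integral_norm_le:
  assumes "set_integrable lborel {0..1} (\<lambda>r. ((1 - r) ^ n / fact n) *\<^sub>R f r)" and "\<And>r. r \<in> {0..1} \<Longrightarrow> norm (f r :: 'h) \<le> B"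
  shows "norm (LBINT r:{0..1}. ((1 - r) ^ n / fact n) *\<^sub>R f r) \<le> B"
proof -
  have B: "0 \<le> B" using order_trans[OF norm_ge_zero assms(2)[of 0]] by simp
  have "norm (LBINT r:{0..1}. ((1 - r) ^ n / fact n) *\<^sub>R f r) \<le> (LBINT r:{0..1}. norm (((1 - r) ^ n / fact n) *\<^sub>R f r))"
    by (rule set_integral_norm_bound[OF assms(1)])
  also have "\<dots> \<le> (LBINT r:{0..1::real}. B)"
  proof (rule set_integral_mono)
    fix r :: real assume r: "r \<in> {0..1}"
    show "norm (((1 - r) ^ n / fact n) *\<^sub>R f r) \<le> B"
      using mult_mono[OF weight_bound[OF r, of n] assms(2)[OF r]] B by simp
  qed (rule set_integrable_norm[OF assms(1)], auto intro: set_integrable_continuous_Icc)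
  also have "\<dots> = B" unfolding set_lebesgue_integral_def by simp
  finally show ?thesis .
qed

text \<open>One step of Taylor's formula: integration by parts turns the remainder of order \<open>n\<close> into the term of
  order \<open>n\<close> and the remainder of order \<open>n + 1\<close>. This is the only place where an active node is
  resolved.\<close>

lemma taylor_step:
  assumes xs: "length xs = n"
  shows "kernel L1star n v d xs = kernel L1 n v d xs + kernel L1star (Suc n) v d (xs @ [d])"
proof -
  let ?R = "LBINT r:{0..1}. ((1 - r) ^ n / fact n) *\<^sub>R D (Suc n) (v + r *\<^sub>R d) (d # xs)"
  have R: "kernel L1star (Suc n) v d (xs @ [d]) = ?R" using D_rotate[OF xs] by simp
  show ?thesis
  proof (cases n)
    case 0
    have "?R = D 0 (v + 1 *\<^sub>R d) [] - D 0 (v + 0 *\<^sub>R d) []"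
      using 0 xs D_line_derivative[of "[]" 0 v d] D_line_continuous[of "[d]" 1]
      by (simp add: set_integral_FTC[of 0 1 "\<lambda>r. D 0 (v + r *\<^sub>R d) []"])
    then show ?thesis using R 0 xs by (simp add: D_0)
  next
    case (Suc m)
    let ?G = "\<lambda>r. - ((1 - r) ^ n / fact n) *\<^sub>R D n (v + r *\<^sub>R d) xs"
    let ?A = "\<lambda>r. ((1 - r) ^ m / fact m) *\<^sub>R D n (v + r *\<^sub>R d) xs"
    let ?B = "\<lambda>r. ((1 - r) ^ n / fact n) *\<^sub>R D (Suc n) (v + r *\<^sub>R d) (d # xs)"
    have "((\<lambda>r. - ((1 - r) ^ n / fact n)) has_real_derivative ((1 - r) ^ m / fact m)) (at r within {0..1})" for r :: real
    proof -
      have f: "fact n = real (Suc m) * fact m" using Suc by simp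
      show ?thesis
        unfolding Suc
        by (rule DERIV_cong, (rule derivative_intros refl)+) (simp_all del: of_nat_Suc fact_Suc add: fact_Suc)
    qed
    from has_vector_derivative_scaleR[OF this D_line_derivative[OF xs]]
    have "(?G has_vector_derivative (?A r - ?B r)) (at r within {0..1})" for r
      by simp
    moreover have "continuous_on {0..1} (\<lambda>r. ?A r - ?B r)"
      by (intro continuous_intros D_line_continuous) (use xs in auto)
    ultimately have "(LBINT r:{0..1}. ?A r - ?B r) = ?G 1 - ?G 0"
      by (intro set_integral_FTC) auto
    also have "(LBINT r:{0..1}. ?A r - ?B r) = (LBINT r:{0..1}. ?A r) - (LBINT r:{0..1}. ?B r)"
      by (intro set_integral_diff weight_integrable) (use xs in auto)
    also have "?G 1 - ?G 0 = kernel L1 n v d xs" using Suc by simp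
    finally show ?thesis using Suc R by (simp add: algebra_simps)
  qed
qed

lemma kernel_multilinear:
  assumes q: "q \<in> {L1, L1star}" and n: "n \<ge> 1"
  shows "bounded_multilinear n (kernel q n v d)"
    and kernel_bound: "length xs = n \<Longrightarrow> norm (kernel q n v d xs) \<le> deriv_bound n * prod_list (map norm xs)"
proof -
  obtain m where m: "n = Suc m" using n by (cases n) auto
  show *: "norm (kernel q n v d xs) \<le> deriv_bound n * prod_list (map norm xs)" if xs: "length xs = n" for xs
  proof (cases "q = L1")
    case True
    have "norm (kernel q n v d xs) \<le> 1 * norm (D n v xs)"
      using True divide_left_mono[of 1 "fact n" "norm (D n v xs)"] by simp
    then show ?thesis using D_bound[OF n xs, of v] by simp
  next
    case False
    then show ?thesis using q m
      by (auto intro!: weighted_integral_norm_le weight_integrable D_bound simp: xs simp del: power_Suc)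
  qed
  have "linear (\<lambda>x. kernel q n v d (xs[j := x]))" if xs: "length xs = n" "j < n" for xs j
  proof -
    have l: "linear (\<lambda>x. D n v (xs[j := x]))" for v
      using D_multilinear[of n v] xs by (simp add: bounded_multilinear_def)
    show ?thesis
    proof (cases "q = L1")
      case True
      then show ?thesis using l by (simp add: linear_compose_scale_right)
    next
      case False
      have q: "q = L1star" using False q by auto
      have i: "set_integrable lborel {0..1} (\<lambda>r. ((1 - r) ^ m / fact m) *\<^sub>R D (Suc m) (v + r *\<^sub>R d) (xs[j := x]))" for x
        using xs m by (intro weight_integrable) simp
      show ?thesis
      proof (rule linearI)
        fix x y
        show "kernel q n v d (xs[j := x + y]) = kernel q n v d (xs[j := x]) + kernel q n v d (xs[j := y])"
          using set_integral_add(2)[OF i i, of x y] m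
          by (simp add: q linear_add[OF l[unfolded m]] scaleR_add_right)
      next
        fix c x
        show "kernel q n v d (xs[j := c *\<^sub>R x]) = c *\<^sub>R kernel q n v d (xs[j := x])"
          using m by (simp add: q linear_cmul[OF l[unfolded m]] scaleR_left_commute[of _ c] del: scaleR_scaleR)
      qed
    qed
  qed
  then show "bounded_multilinear n (kernel q n v d)" using * unfolding bounded_multilinear_def by blast
qed

lemma kernel_0_bound:
  assumes "q \<in> {L1, L1star}"
  shows "norm (kernel q 0 v d []) \<le> norm (F 0) + deriv_bound 1 * (norm v + norm (v + d))"
  using assms F_growth[of v] F_growth[of "v + d"] deriv_bound_nonneg[of 1] mult_nonneg_nonneg[of "deriv_bound 1" "norm v"] mult_nonneg_nonneg[of "deriv_bound 1" "norm (v + d)"]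
  by (auto simp: D_0 distrib_left simp del: mult_nonneg_nonneg)

text \<open>Continuity of the kernels in the base point and the increment, for fixed directions; with
  boundedness in the directions it gives joint continuity.\<close>

lemma kernel_lipschitz:
  assumes q: "q \<in> {L1, L1star}" and xs: "length xs = n"
  shows "norm (kernel q n v d xs - kernel q n v' d' xs) \<le> deriv_bound (Suc n) * prod_list (map norm xs) * (norm (v - v') + norm (d - d'))"
proof -
  let ?K = "deriv_bound (Suc n) * prod_list (map norm xs)"
  have K: "?K \<ge> 0" by (intro mult_nonneg_nonneg deriv_bound_nonneg prod_list_norm_nonneg) auto
  have D: "norm (D n (v + r *\<^sub>R d) xs - D n (v' + r *\<^sub>R d') xs) \<le> ?K * (norm (v - v') + norm (d - d'))"
    if r: "r \<in> {0..1}" for r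
  proof -
    have "norm ((v + r *\<^sub>R d) - (v' + r *\<^sub>R d')) = norm ((v - v') + r *\<^sub>R (d - d'))" by (simp add: algebra_simps)
    also have "\<dots> \<le> norm (v - v') + r * norm (d - d')" using r norm_triangle_ineq[of "v - v'" "r *\<^sub>R (d - d')"] by simp
    also have "\<dots> \<le> norm (v - v') + 1 * norm (d - d')" using r by (intro add_mono mult_right_mono) auto
    finally have "?K * norm ((v + r *\<^sub>R d) - (v' + r *\<^sub>R d')) \<le> ?K * (norm (v - v') + norm (d - d'))"
      using K by (intro mult_left_mono) auto
    then show ?thesis using D_lipschitz[OF xs, of "v + r *\<^sub>R d" "v' + r *\<^sub>R d'"] by linarith
  qed
  show ?thesis
  proof (cases "q = L1")
    case True
    have "norm (kernel q n v d xs - kernel q n v' d' xs) = (1 / fact n) * norm (D n v xs - D n v' xs)"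
      using True by (simp add: scaleR_diff_right[symmetric])
    also have "\<dots> \<le> 1 * norm (D n v xs - D n v' xs)" by (intro mult_right_mono) auto
    finally show ?thesis using D_lipschitz[OF xs, of v v'] K mult_left_mono[OF _ K, of "norm (v - v')" "norm (v - v') + norm (d - d')"] by simp
  next
    case False
    then have q: "q = L1star" using q by auto
    show ?thesis
    proof (cases n)
      case 0
      then show ?thesis using D[of 1] xs by (simp add: q D_0)
    next
      case (Suc m)
      have i: "set_integrable lborel {0..1} (\<lambda>r. ((1 - r) ^ m / fact m) *\<^sub>R D (Suc m) (v + r *\<^sub>R d) xs)" for v d
        using xs Suc by (intro weight_integrable) simp
      have "kernel q n v d xs - kernel q n v' d' xs = (LBINT r:{0..1}. ((1 - r) ^ m / fact m) *\<^sub>R (D n (v + r *\<^sub>R d) xs - D n (v' + r *\<^sub>R d') xs))"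
        using set_integral_diff(2)[OF i i, of v d v' d'] Suc by (simp add: q scaleR_diff_right)
      also have "norm \<dots> \<le> ?K * (norm (v - v') + norm (d - d'))"
        using D set_integral_diff(1)[OF i i, of v d v' d'] Suc
        by (intro weighted_integral_norm_le) (auto simp: scaleR_diff_right)
      finally show ?thesis .
    qed
  qed
qed

lemma kernel_tendsto:
  assumes q: "q \<in> {L1, L1star}" and n: "length xs = n"
    and v: "(v \<longlongrightarrow> v0) G" and d: "(d \<longlongrightarrow> d0) G" and gs: "list_all2 (\<lambda>g x. (g \<longlongrightarrow> x) G) gs xs"
  shows "((\<lambda>k. kernel q n (v k) (d k) (map (\<lambda>g. g k) gs)) \<longlongrightarrow> kernel q n v0 d0 xs) G"
proof -
  have lim: "((\<lambda>k. kernel q n (v k) (d k) xs) \<longlongrightarrow> kernel q n v0 d0 xs) G"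
  proof (rule LIM_zero_cancel, rule Lim_null_comparison[OF always_eventually])
    show "\<forall>k. norm (kernel q n (v k) (d k) xs - kernel q n v0 d0 xs)
       \<le> deriv_bound (Suc n) * prod_list (map norm xs) * (norm (v k - v0) + norm (d k - d0))"
      using kernel_lipschitz[OF q n] by blast
    show "((\<lambda>k. deriv_bound (Suc n) * prod_list (map norm xs) * (norm (v k - v0) + norm (d k - d0))) \<longlongrightarrow> 0) G"
      using v d by (auto intro!: tendsto_mult_right_zero tendsto_add_zero tendsto_norm_zero LIM_zero)
  qed
  show ?thesis
  proof (cases "n = 0")
    case True
    then have "xs = []" "gs = []" using n gs by auto
    then show ?thesis using lim by simp
  next
    case False
    then show ?thesis
      by (intro bounded_multilinear_tendsto[of n "\<lambda>k. kernel q n (v k) (d k)" "deriv_bound n", OF _ _ gs n lim] kernel_multilinear(1) kernel_bound q) auto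
  qed
qed

lemma kernel_add:
  assumes q: "q \<in> {L1, L1star}" and n: "n = Suc (length xs + length ys)"
  shows "kernel q n v d (xs @ (x + y) # ys) = kernel q n v d (xs @ x # ys) + kernel q n v d (xs @ y # ys)"
proof -
  have "bounded_multilinear n (kernel q n v d)" using kernel_multilinear(1)[OF q, of n v d] n by simp
  then have "linear (\<lambda>z. kernel q n v d ((xs @ x # ys)[length xs := z]))"
    using n unfolding bounded_multilinear_def by (elim conjE allE[of _ "xs @ x # ys"] allE[of _ "length xs"] impE) auto
  then show ?thesis using linear_add[of "\<lambda>z. kernel q n v d (xs @ z # ys)" x y] by simp
qed

end


section \<open>Stochastic trees and their shapes\<close>

text \<open>Woods are described by parent maps on numbered nodes, which is awkward for recursion because every
  subtree is renumbered. The shape of a tree, with ordered children, forgets the numbering.\<close>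

datatype rtree = RNode label "rtree list"

text \<open>The condition \<open>j < k\<close> holds for all trees in \<open>ST\<close>; it makes the recursion below terminate
  on arbitrary parent maps.\<close>

definition children :: "stree \<Rightarrow> nat \<Rightarrow> nat list" where
  "children t j = sorted_list_of_set {k \<in> {2..len t}. par t k = j \<and> j < k}"

lemma set_children: "set (children t j) = {k \<in> {2..len t}. par t k = j \<and> j < k}"
  by (simp add: children_def)

function rose :: "stree \<Rightarrow> nat \<Rightarrow> rtree" where
  "rose t j = RNode (ntype t j) (map (rose t) (children t j))"
  by pat_completeness auto
termination
  by (relation "Wellfounded.measure (\<lambda>(t, j). len t - j)") (auto simp: set_children)

declare rose.simps [simp del]

lemma parent_rel_less: "t \<in> ST \<Longrightarrow> (k, j) \<in> parent_rel t \<Longrightarrow> 1 \<le> j \<and> j < k"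
  by (auto simp: ST_def parent_rel_def)

lemma parent_rtrancl_le: "t \<in> ST \<Longrightarrow> (k, j) \<in> (parent_rel t)\<^sup>* \<Longrightarrow> j \<le> k"
  by (rotate_tac 1, induction rule: rtrancl_induct) (auto dest!: parent_rel_less)

lemma sorted_list_of_set_image_strict_mono:
  assumes "finite A" "strict_mono_on A g"
  shows "sorted_list_of_set (g ` A) = map g (sorted_list_of_set A)"
proof -
  have "sorted_wrt (<) (map g (sorted_list_of_set A))"
    unfolding sorted_wrt_map
    by (rule sorted_wrt_mono_rel[OF _ strict_sorted_list_of_set[of A]])
      (use assms in \<open>auto simp: strict_mono_on_def\<close>)
  then show ?thesis
    using assms by (intro sorted_list_of_set_unique[THEN iffD1])
      (auto simp: distinct_card strict_sorted_iff intro!: card_image[symmetric] strict_mono_on_imp_inj_on)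
qed

text \<open>The node of \<open>t\<close> that becomes node \<open>k\<close> of the subtree rooted at \<open>j\<close>.\<close>

definition subnode :: "stree \<Rightarrow> nat \<Rightarrow> nat \<Rightarrow> nat" where
  "subnode t j k = sorted_list_of_set (descendants t j) ! (k - 1)"

context
  fixes t :: stree and j :: nat
  assumes t: "t \<in> ST" and j: "j \<in> nd t"
begin

private abbreviation "js \<equiv> sorted_list_of_set (descendants t j)"
private abbreviation "s \<equiv> subtree t j"
private abbreviation "g \<equiv> subnode t j"

lemma finite_descendants: "finite (descendants t j)"
  by (simp add: descendants_def nd_def)

lemma descendants_ge: "k \<in> descendants t j \<Longrightarrow> j \<le> k"
  using parent_rtrancl_le[OF t] by (auto simp: descendants_def)

lemma descendants_par:
  assumes "k \<in> descendants t j" "k \<noteq> j"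
  shows "k \<in> {2..len t}" "par t k \<in> descendants t j"
proof -
  have "(k, j) \<in> (parent_rel t)\<^sup>*" using assms by (simp add: descendants_def)
  then obtain l where l: "(k, l) \<in> parent_rel t" "(l, j) \<in> (parent_rel t)\<^sup>*"
    using assms(2) by (auto elim: converse_rtranclE)
  then show "k \<in> {2..len t}" by (auto simp: parent_rel_def)
  have "l = par t k" "1 \<le> l" "l < k" "k \<le> len t"
    using l parent_rel_less[OF t l(1)] by (auto simp: parent_rel_def)
  then show "par t k \<in> descendants t j" using l by (simp add: descendants_def nd_def)
qed

lemma descendants_child:
  assumes "k \<in> {2..len t}" "par t k \<in> descendants t j"
  shows "k \<in> descendants t j"
proof -
  have "(k, par t k) \<in> parent_rel t" using assms by (auto simp: parent_rel_def)
  then show ?thesis using assms by (auto simp: descendants_def nd_def intro: converse_rtrancl_into_rtrancl)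
qed

lemma len_subtree: "len s = length js"
  by (simp add: subtree_def Let_def)

lemma js_mono: "strict_mono_on {1..length js} g"
proof (rule strict_mono_onI)
  fix a b assume "a \<in> {1..length js}" "b \<in> {1..length js}" "a < b"
  then show "g a < g b"
    using sorted_wrt_nth_less[OF strict_sorted_list_of_set[of "descendants t j"], of "a - 1" "b - 1"]
    by (auto simp: subnode_def)
qed

lemma js_image: "g ` {1..length js} = descendants t j"
proof -
  have "(\<lambda>k. k - 1) ` {1..length js} = {..<length js}"
    by (force simp: image_iff intro: bexI[of _ "Suc _"])
  then have "g ` {1..length js} = (\<lambda>k. js ! k) ` {..<length js}"
    unfolding subnode_def by (subst image_image[symmetric]) simp
  also have "\<dots> = set js" by (force simp: set_conv_nth image_iff)
  finally show ?thesis using finite_descendants by simp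
qed

lemma js_inj: "inj_on g {1..length js}"
  using js_mono by (rule strict_mono_on_imp_inj_on)

lemma self_descendant: "j \<in> descendants t j"
  using j by (simp add: descendants_def)

lemma js_first: "1 \<in> {1..length js}" "g 1 = j"
proof -
  have "j \<in> g ` {1..length js}" using js_image self_descendant by simp
  then obtain k where k: "k \<in> {1..length js}" "g k = j" by auto
  then show one: "1 \<in> {1..length js}" by auto
  have "k = 1"
  proof (rule ccontr)
    assume "k \<noteq> 1"
    then have "g 1 < g k" using k one strict_mono_onD[OF js_mono one k(1)] by auto
    moreover have "g 1 \<in> descendants t j" using js_image one by blast
    ultimately show False using descendants_ge[of "g 1"] k by simp
  qed
  then show "g 1 = j" using k by simp
qed

lemma js_not_first:
  assumes "k \<in> {2..length js}" shows "g k \<in> descendants t j" "g k \<noteq> j"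
proof -
  have k: "k \<in> {1..length js}" "1 < k" using assms by auto
  show "g k \<in> descendants t j" using js_image k by blast
  show "g k \<noteq> j" using strict_mono_onD[OF js_mono js_first(1) k] js_first(2) by simp
qed

lemma par_subtree:
  assumes k: "k \<in> {2..length js}"
  shows "par s k \<in> {1..length js}" "g (par s k) = par t (g k)"
proof -
  have "par t (g k) \<in> descendants t j" using js_not_first[OF k] by (rule descendants_par(2))
  then have "par t (g k) \<in> g ` {1..length js}" using js_image by simp
  then obtain m where m: "m \<in> {1..length js}" "g m = par t (g k)" by auto
  have "par s k = (THE m. m \<in> {1..length js} \<and> g m = par t (g k))"
    by (simp add: subtree_def Let_def subnode_def)
  also have "\<dots> = m"
  proof (rule the_equality)
    show "m' = m" if "m' \<in> {1..length js} \<and> g m' = par t (g k)" for m'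
      using that m inj_onD[OF js_inj, of m' m] by simp
  qed (use m in simp)
  finally show "par s k \<in> {1..length js}" "g (par s k) = par t (g k)" using m by auto
qed

lemma subtree_in_ST: "s \<in> ST"
proof -
  have "par s k < k" if k: "k \<in> {2..length js}" for k
  proof -
    have "g k \<in> {2..len t}" using js_not_first[OF k] by (rule descendants_par(1))
    then have "par t (g k) < g k" using t by (auto simp: ST_def)
    then have "g (par s k) < g k" using par_subtree[OF k] by simp
    then show ?thesis using strict_mono_on_less[OF js_mono par_subtree(1)[OF k], of k] k by auto
  qed
  then show ?thesis using par_subtree(1) js_first(1) by (auto simp: ST_def len_subtree)
qed

lemma children_subtree:
  assumes k: "k \<in> {1..length js}"
  shows "children t (g k) = map g (children s k)"
proof -
  let ?A = "{c \<in> {2..len s}. par s c = k \<and> k < c}"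
  have "g ` ?A = {c \<in> {2..len t}. par t c = g k \<and> g k < c}" (is "_ = ?B")
  proof (intro equalityI subsetI)
    fix x assume "x \<in> g ` ?A"
    then obtain c where c: "c \<in> {2..length js}" "par s c = k" "k < c" "x = g c"
      by (auto simp: len_subtree)
    then show "x \<in> ?B"
      using descendants_par(1)[OF js_not_first[OF c(1)]] par_subtree(2)[OF c(1)]
        strict_mono_onD[OF js_mono k _ c(3)] by auto
  next
    fix x assume x: "x \<in> ?B"
    have "par t x \<in> descendants t j" using x k js_image by blast
    then have "x \<in> descendants t j" using x descendants_child[of x] by simp
    then have "x \<in> g ` {1..length js}" using js_image by simp
    then obtain c where c: "c \<in> {1..length js}" "x = g c" by auto
    have kc: "k < c" using x c strict_mono_on_less[OF js_mono k c(1)] by auto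
    then have c2: "c \<in> {2..length js}" using k c by auto
    have "par s c = k" using par_subtree[OF c2] x c k inj_onD[OF js_inj, of "par s c" k] by simp
    then show "x \<in> g ` ?A" using c c2 kc by (auto simp: len_subtree)
  qed
  moreover have "sorted_list_of_set (g ` ?A) = map g (sorted_list_of_set ?A)"
    by (rule sorted_list_of_set_image_strict_mono)
      (auto simp: len_subtree intro: monotone_on_subset[OF js_mono])
  ultimately show ?thesis by (simp add: children_def)
qed

text \<open>The renumbering of a subtree is strictly increasing and respects parents, so it preserves the
  ordered lists of children.\<close>

lemma rose_subtree_node: "k \<in> {1..length js} \<Longrightarrow> rose s k = rose t (g k)"
proof (induction "length js - k" arbitrary: k rule: less_induct)
  case less
  have "rose s c = rose t (g c)" if "c \<in> set (children s k)" for c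
    using that less.prems by (intro less.hyps) (auto simp: set_children len_subtree)
  moreover have "ntype s k = ntype t (g k)" by (simp add: subtree_def Let_def subnode_def)
  ultimately show ?case
    unfolding rose.simps[of s k] rose.simps[of t "g k"] children_subtree[OF less.prems] by simp
qed

lemma rose_subtree: "rose (subtree t j) 1 = rose t j"
  using rose_subtree_node[OF js_first(1)] js_first(2) by simp

end

lemma subtrees_eq: "subtrees t = map (subtree t) (children t 1)"
proof -
  have "{j \<in> {2..len t}. par t j = 1} = {k \<in> {2..len t}. par t k = 1 \<and> 1 < k}" by auto
  then show ?thesis by (simp add: subtrees_def children_def)
qed

lemma children_root_Nil_iff: "t \<in> ST \<Longrightarrow> children t 1 = [] \<longleftrightarrow> len t = 1"
proof
  assume t: "t \<in> ST" and c: "children t 1 = []"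
  show "len t = 1"
  proof (rule ccontr)
    assume "len t \<noteq> 1"
    then have "2 \<in> {2..len t}" using t by (auto simp: ST_def)
    moreover have "1 \<le> par t 2 \<and> par t 2 < 2" using t \<open>2 \<in> {2..len t}\<close> unfolding ST_def by blast
    then have "par t 2 = 1" by linarith
    ultimately have "2 \<in> set (children t 1)" by (auto simp: set_children)
    then show False using c by simp
  qed
qed (simp add: children_def)

text \<open>The effect of \<open>expand\<close> on one tree of a wood: an active node of the first tree becomes inactive in the
  second, and in the remaining three it receives a new last child of type \<open>0\<close>, \<open>1\<^sup>*\<close> and \<open>2\<close>. The
  rule \<open>below\<close> requires integral operators above the expanded node, since a root of type \<open>0\<close> or \<open>2\<close>
  would hide everything below it.\<close>

inductive tree_expansion :: "rtree \<Rightarrow> rtree \<Rightarrow> rtree \<Rightarrow> rtree \<Rightarrow> rtree \<Rightarrow> bool" where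
  root: "tree_expansion (RNode L1star cs) (RNode L1 cs) (RNode L1star (cs @ [RNode L0 []]))
           (RNode L1star (cs @ [RNode L1star []])) (RNode L1star (cs @ [RNode L2 []]))"
| below: "tree_expansion c c' c0 c1 c2 \<Longrightarrow> q \<in> {L1, L1star} \<Longrightarrow>
    tree_expansion (RNode q (as @ c # bs)) (RNode q (as @ c' # bs)) (RNode q (as @ c0 # bs))
      (RNode q (as @ c1 # bs)) (RNode q (as @ c2 # bs))"

text \<open>Every node with a child has type \<open>1\<close> or \<open>1\<^sup>*\<close>. This invariant of the woods in \<open>SW'\<close> is essential both
  for the expansion identity and for the order, where descendants of a node of type \<open>0\<close> or \<open>2\<close> would
  be counted without contributing.\<close>

definition inner_nodes_integral :: "stree \<Rightarrow> bool" where
  "inner_nodes_integral t \<longleftrightarrow> (\<forall>k\<in>{2..len t}. ntype t (par t k) \<in> {L1, L1star})"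

fun leaves_wf :: "rtree \<Rightarrow> bool" where
  "leaves_wf (RNode q cs) \<longleftrightarrow> (q \<in> {L0, L2} \<longrightarrow> cs = []) \<and> (\<forall>c\<in>set cs. leaves_wf c)"

fun weight :: "real \<Rightarrow> real \<Rightarrow> label \<Rightarrow> real" where
  "weight \<gamma> \<delta> L0 = \<gamma>"
| "weight \<gamma> \<delta> L2 = \<delta>"
| "weight \<gamma> \<delta> _ = 1"

fun tree_order :: "real \<Rightarrow> real \<Rightarrow> rtree \<Rightarrow> real" where
  "tree_order \<gamma> \<delta> (RNode q cs) = weight \<gamma> \<delta> q + sum_list (map (tree_order \<gamma> \<delta>) cs)"

lemma tree_expansion_order:
  "tree_expansion r r' r0 r1 r2 \<Longrightarrow> tree_order \<gamma> \<delta> r' = tree_order \<gamma> \<delta> r \<and> tree_order \<gamma> \<delta> r0 = tree_order \<gamma> \<delta> r + \<gamma> \<and>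
     tree_order \<gamma> \<delta> r1 = tree_order \<gamma> \<delta> r + 1 \<and> tree_order \<gamma> \<delta> r2 = tree_order \<gamma> \<delta> r + \<delta>"
  by (induction rule: tree_expansion.induct) auto

lemma leaves_wf_rose:
  assumes "inner_nodes_integral t" shows "leaves_wf (rose t k)"
proof (induction "len t - k" arbitrary: k rule: less_induct)
  case less
  have "children t k = []" if "ntype t k \<in> {L0, L2}"
  proof -
    have "c \<notin> set (children t k)" for c
    proof
      assume "c \<in> set (children t k)"
      then have "ntype t k \<in> {L1, L1star}"
        using assms unfolding set_children inner_nodes_integral_def by blast
      then show False using that by auto
    qed
    then show ?thesis by (metis list.set_intros(1) neq_Nil_conv)
  qed
  moreover have "leaves_wf (rose t c)" if "c \<in> set (children t k)" for c
    using that by (intro less) (auto simp: set_children)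
  ultimately show ?case by (subst rose.simps) auto
qed

definition relabel :: "stree \<Rightarrow> nat \<Rightarrow> stree" where
  "relabel t j = STree (len t) (par t) ((ntype t)(j := L1))"

lemma relabel_sel [simp]: "len (relabel t j) = len t" "par (relabel t j) = par t"
    "ntype (relabel t j) = (ntype t)(j := L1)" "nd (relabel t j) = nd t"
  by (simp_all add: relabel_def nd_def)

context
  fixes t :: stree and j :: nat
  assumes t: "t \<in> ST" and j: "j \<in> nd t" and act: "ntype t j = L1star" and wf: "inner_nodes_integral t"
begin

lemma children_relabel: "children (relabel t j) k = children t k"
  by (simp add: children_def)

lemma children_add_node:
  assumes "k \<in> nd t"
  shows "children (add_node t j l) k = children t k @ (if k = j then [len t + 1] else [])"
proof -
  let ?A = "{c \<in> {2..len t}. par t c = k \<and> k < c}"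
  have "{c \<in> {2..len (add_node t j l)}. par (add_node t j l) c = k \<and> k < c}
      = (if k = j then insert (len t + 1) ?A else ?A)"
    using assms t by (auto simp: add_node_def nd_def ST_def)
  moreover have "sorted_list_of_set (insert (len t + 1) ?A) = sorted_list_of_set ?A @ [len t + 1]"
    by (intro sorted_list_of_set_insert_remove[THEN trans])
      (auto simp: sorted_insort_is_snoc)
  ultimately show ?thesis unfolding children_def by (cases "k = j") (simp_all only: if_True if_False append_Nil2 refl)
qed

lemma rose_new_node: "rose (add_node t j l) (len t + 1) = RNode l []"
proof -
  have "children (add_node t j l) (len t + 1) = []"
    by (auto simp: children_def add_node_def sorted_list_of_set_eq_Nil_iff)
  then show ?thesis by (simp add: rose.simps add_node_def)
qed

lemma ntype_add_node: "k \<in> nd t \<Longrightarrow> ntype (add_node t j l) k = ntype t k"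
  by (auto simp: add_node_def nd_def)

lemma child_nd: "c \<in> set (children t k) \<Longrightarrow> c \<in> nd t \<and> (c, k) \<in> parent_rel t"
  by (auto simp: set_children nd_def parent_rel_def)

text \<open>A modification at \<open>j\<close>, or a new child of \<open>j\<close>, is invisible from nodes that are not ancestors of \<open>j\<close>.\<close>

lemma rose_unaffected:
  assumes "k \<in> nd t" "(j, k) \<notin> (parent_rel t)\<^sup>*"
  shows "rose (relabel t j) k = rose t k \<and> rose (add_node t j l) k = rose t k"
  using assms
proof (induction "len t - k" arbitrary: k rule: less_induct)
  case less
  have kj: "k \<noteq> j" using less.prems by auto
  have "rose (relabel t j) c = rose t c \<and> rose (add_node t j l) c = rose t c" if "c \<in> set (children t k)" for c
  proof (rule less.hyps)
    show "len t - c < len t - k" using that by (auto simp: set_children)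
    show "c \<in> nd t" using child_nd[OF that] by simp
    show "(j, c) \<notin> (parent_rel t)\<^sup>*"
      using less.prems(2) child_nd[OF that] by (auto intro: rtrancl_into_rtrancl)
  qed
  then show ?case
    using kj less.prems(1)
    by (simp add: rose.simps[of t k] rose.simps[of "relabel t j" k] rose.simps[of "add_node t j l" k]
        children_relabel children_add_node ntype_add_node)
qed

text \<open>Climbing from \<open>j\<close> towards the root: each node has a single parent, hence at most one child of any node
  is an ancestor of \<open>j\<close>, and the other children are unaffected.\<close>

lemma tree_expansion_ancestor:
  assumes "(j, k) \<in> (parent_rel t)\<^sup>*"
  shows "k \<in> nd t \<and> tree_expansion (rose t k) (rose (relabel t j) k) (rose (add_node t j L0) k)
    (rose (add_node t j L1star) k) (rose (add_node t j L2) k)"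
  using assms
proof (induction rule: rtrancl_induct)
  case base
  have "(j, c) \<notin> (parent_rel t)\<^sup>*" if "c \<in> set (children t j)" for c
    using that parent_rtrancl_le[OF t, of j c] by (auto simp: set_children)
  then have "rose (relabel t j) c = rose t c" "rose (add_node t j l) c = rose t c"
    if "c \<in> set (children t j)" for c l
    using rose_unaffected[of c l] child_nd[of c j] that by auto
  then have "map (rose (relabel t j)) (children t j) = map (rose t) (children t j)"
     "map (rose (add_node t j l)) (children t j) = map (rose t) (children t j)" for l
    by (simp_all cong: map_cong)
  then show ?case
    using tree_expansion.root[of "map (rose t) (children t j)"] j act
    by (simp add: rose.simps[of t j] rose.simps[of "relabel t j" j] rose.simps[of "add_node t j _" j]
        children_relabel children_add_node ntype_add_node rose_new_node[simplified] del: map_eq_conv)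
next
  case (step k q)
  have kq: "k \<in> {2..len t}" "q = par t k" "1 \<le> q" "q < k"
    using step.hyps(2) parent_rel_less[OF t step.hyps(2)] by (auto simp: parent_rel_def)
  have q: "q \<in> nd t" using kq by (auto simp: nd_def)
  have qj: "q \<noteq> j" using parent_rtrancl_le[OF t step.hyps(1)] kq by auto
  have "k \<in> set (children t q)" using kq by (auto simp: set_children)
  then obtain as bs where cs: "children t q = as @ k # bs" by (auto simp: in_set_conv_decomp)
  have dist: "distinct (children t q)" by (simp add: children_def)
  have "(j, c) \<notin> (parent_rel t)\<^sup>*" if c: "c \<in> set as \<union> set bs" for c
  proof
    assume jc: "(j, c) \<in> (parent_rel t)\<^sup>*"
    have ck: "c \<noteq> k" using dist c cs by auto
    have cq: "c \<in> set (children t q)" using c cs by auto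
    have sv: "single_valued (parent_rel t)" by (auto simp: single_valued_def parent_rel_def)
    have up: "False" if "(a, b) \<in> (parent_rel t)\<^sup>*" "a \<noteq> b" "par t a = q" "q < b" for a b
    proof -
      obtain a' where a': "(a, a') \<in> parent_rel t" "(a', b) \<in> (parent_rel t)\<^sup>*"
        using \<open>(a, b) \<in> (parent_rel t)\<^sup>*\<close> \<open>a \<noteq> b\<close> by (auto elim: converse_rtranclE)
      then have "a' = q" using \<open>par t a = q\<close> by (simp add: parent_rel_def)
      then have "b \<le> q" using parent_rtrancl_le[OF t a'(2)] by simp
      then show False using \<open>q < b\<close> by simp
    qed
    show False
      using single_valued_confluent[OF sv step.hyps(1) jc] up[of k c] up[of c k] ck cq kq
      by (auto simp: set_children)
  qed
  then have un: "rose (relabel t j) c = rose t c" "rose (add_node t j l) c = rose t c"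
    if "c \<in> set as \<union> set bs" for c l
    using rose_unaffected[of c l] child_nd[of c q] that cs by auto
  have "map (rose (relabel t j)) as = map (rose t) as" "map (rose (relabel t j)) bs = map (rose t) bs"
    "map (rose (add_node t j l)) as = map (rose t) as" "map (rose (add_node t j l)) bs = map (rose t) bs" for l
    using un by auto
  moreover have "ntype t q \<in> {L1, L1star}" using wf kq by (auto simp: inner_nodes_integral_def)
  ultimately show ?case
    using tree_expansion.below[of _ _ _ _ _ "ntype t q" "map (rose t) as" "map (rose t) bs"] step.IH q qj
    by (simp add: rose.simps[of t q] rose.simps[of "relabel t j" q] rose.simps[of "add_node t j _" q]
        children_relabel children_add_node ntype_add_node cs del: map_eq_conv)
qed

lemma root_ancestor: "k \<in> nd t \<Longrightarrow> (k, 1) \<in> (parent_rel t)\<^sup>*"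
proof (induction k rule: less_induct)
  case (less k)
  show ?case
  proof (cases "k = 1")
    case False
    then have k: "k \<in> {2..len t}" using less.prems by (auto simp: nd_def)
    then have "1 \<le> par t k \<and> par t k < k" using t by (auto simp: ST_def)
    then have "(par t k, 1) \<in> (parent_rel t)\<^sup>*" using k by (intro less.IH) (auto simp: nd_def)
    moreover have "(k, par t k) \<in> parent_rel t" using k by (auto simp: parent_rel_def)
    ultimately show ?thesis by (rule converse_rtrancl_into_rtrancl[rotated])
  qed simp
qed

lemma tree_expansion_expand:
  "tree_expansion (rose t 1) (rose (relabel t j) 1) (rose (add_node t j L0) 1)
    (rose (add_node t j L1star) 1) (rose (add_node t j L2) 1)"
  using tree_expansion_ancestor[OF root_ancestor[OF j]] by simp

lemma ord_relabel: "ord_tree \<gamma> \<delta> (relabel t j) = ord_tree \<gamma> \<delta> t"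
proof -
  have "{k \<in> nd (relabel t j). ntype (relabel t j) k = l} = {k \<in> nd t. ntype t k = l}" if "l \<in> {L0, L2}" for l
    using act that by (auto simp: nd_def)
  then show ?thesis by (simp add: ord_tree_def)
qed

lemma ord_add_node: "ord_tree \<gamma> \<delta> (add_node t j l) = ord_tree \<gamma> \<delta> t + weight \<gamma> \<delta> l"
proof -
  have eq: "{k \<in> nd (add_node t j l). ntype (add_node t j l) k = m} =
      (if m = l then insert (len t + 1) {k \<in> nd t. ntype t k = m} else {k \<in> nd t. ntype t k = m})" for m
    by (auto simp: nd_def add_node_def)
  have "card (insert (len t + 1) {k \<in> nd t. ntype t k = m}) = card {k \<in> nd t. ntype t k = m} + 1" for m
    by (subst card_insert_disjoint) (auto simp: nd_def)
  then have c: "card {k \<in> nd (add_node t j l). ntype (add_node t j l) k = m} =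
      card {k \<in> nd t. ntype t k = m} + (if m = l then 1 else 0)" for m
    unfolding eq by auto
  show ?thesis
    unfolding ord_tree_def c by (cases l) (auto simp: add_node_def algebra_simps)
qed

lemma wf_relabel: "relabel t j \<in> ST" "inner_nodes_integral (relabel t j)"
  using t wf by (auto simp: ST_def inner_nodes_integral_def)

lemma wf_add_node: "add_node t j l \<in> ST" "inner_nodes_integral (add_node t j l)"
proof -
  show "add_node t j l \<in> ST" using t j by (auto simp: ST_def add_node_def nd_def)
  have "ntype (add_node t j l) (par (add_node t j l) k) \<in> {L1, L1star}" if "k \<in> {2..len t + 1}" for k
  proof (cases "k = len t + 1")
    case True
    then show ?thesis using j act by (auto simp: add_node_def nd_def)
  next
    case False
    then have k: "k \<in> {2..len t}" using that by auto
    then have "par t k < k" using t by (auto simp: ST_def)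
    then show ?thesis using wf k unfolding inner_nodes_integral_def by (auto simp: add_node_def)
  qed
  then show "inner_nodes_integral (add_node t j l)"
    by (auto simp: inner_nodes_integral_def add_node_def simp del: fun_upd_apply)
qed

end

text \<open>The invariant of the trees in \<open>SW'\<close>; in particular the order counted over numbered nodes agrees with
  the one defined by recursion on the shape.\<close>

definition good_tree :: "real \<Rightarrow> real \<Rightarrow> stree \<Rightarrow> bool" where
  "good_tree \<gamma> \<delta> t \<longleftrightarrow> t \<in> ST \<and> inner_nodes_integral t \<and> ord_tree \<gamma> \<delta> t = tree_order \<gamma> \<delta> (rose t 1)"

lemma good_single: "good_tree \<gamma> \<delta> (single_node l)" "rose (single_node l) 1 = RNode l []"
proof -
  show r: "rose (single_node l) 1 = RNode l []"
    by (simp add: rose.simps single_node_def children_def)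
  have "{j \<in> {1..Suc 0}. l = m} = (if l = m then {1} else {})" for m :: label by auto
  then have "ord_tree \<gamma> \<delta> (single_node l) = weight \<gamma> \<delta> l"
    by (cases l) (simp_all add: ord_tree_def single_node_def nd_def)
  then show "good_tree \<gamma> \<delta> (single_node l)"
    by (simp only: good_tree_def r) (auto simp: single_node_def ST_def inner_nodes_integral_def)
qed

lemma acnD:
  assumes "(i, j) \<in> acn w"
  shows "i - 1 < length w" "j \<in> nd (w ! (i - 1))" "ntype (w ! (i - 1)) j = L1star"
  using assms by (auto simp: acn_def)

lemma good_expand:
  assumes "good_tree \<gamma> \<delta> t" "j \<in> nd t" "ntype t j = L1star"
  shows "good_tree \<gamma> \<delta> (relabel t j)" "l \<noteq> L1 \<Longrightarrow> good_tree \<gamma> \<delta> (add_node t j l)"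
proof -
  have t: "t \<in> ST" "inner_nodes_integral t" "ord_tree \<gamma> \<delta> t = tree_order \<gamma> \<delta> (rose t 1)"
    using assms by (auto simp: good_tree_def)
  note a = t(1) assms(2,3) t(2)
  note x = tree_expansion_order[OF tree_expansion_expand[OF a], of \<gamma> \<delta>]
  show "good_tree \<gamma> \<delta> (relabel t j)"
    using x t ord_relabel[OF a, of \<gamma> \<delta>] wf_relabel[OF a] by (simp add: good_tree_def)
  show "good_tree \<gamma> \<delta> (add_node t j l)" if "l \<noteq> L1"
    using x t ord_add_node[OF a, of \<gamma> \<delta> l] wf_add_node[OF a, of l] that
    by (cases l) (auto simp: good_tree_def)
qed

lemma SW'_good: "w \<in> SW' \<Longrightarrow> \<forall>t\<in>set w. good_tree \<gamma> \<delta> t"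
proof (induction rule: SW'.induct)
  case base
  then show ?case by (simp add: wood0_def good_single)
next
  case (step w ij)
  obtain i j where ij: "ij = (i, j)" by fastforce
  note a = acnD[OF step.hyps(2)[unfolded ij]]
  have "good_tree \<gamma> \<delta> (w ! (i - 1))" using step.IH a(1) by simp
  note g = good_expand[OF this a(2,3)]
  show ?case
    using step.IH g(1) g(2)[of L0] g(2)[of L1star] g(2)[of L2] set_update_subset_insert[of w "i - 1"]
    by (fastforce simp: ij expand_def Let_def relabel_def)
qed


section \<open>Hilbert--Schmidt norms\<close>

text \<open>Parseval's identity as an integral over the counting measure, so that Tonelli's theorem applies.\<close>

lemma parseval_nn_integral:
  fixes e :: "'i \<Rightarrow> 'h::{real_inner, banach}"
  assumes "is_onb I e"
  shows "(\<integral>\<^sup>+i. ennreal ((inner (e i) v)\<^sup>2) \<partial>count_space I) = ennreal ((norm v)\<^sup>2)"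
proof -
  have hs: "((\<lambda>i. (inner (e i) v)\<^sup>2) has_sum (norm v)\<^sup>2) I" by (rule parseval[OF assms])
  then have "(\<lambda>i. (inner (e i) v)\<^sup>2) summable_on I" by (rule has_sum_imp_summable)
  then have "Infinite_Set_Sum.abs_summable_on (\<lambda>i. (inner (e i) v)\<^sup>2) I"
    by (simp add: abs_summable_equivalent[symmetric])
  moreover have "infsetsum (\<lambda>i. (inner (e i) v)\<^sup>2) I = (norm v)\<^sup>2"
    using calculation hs infsetsum_infsum[of "\<lambda>i. (inner (e i) v)\<^sup>2" I] by (metis infsumI)
  ultimately show ?thesis by (subst nn_integral_conv_infsetsum) auto
qed

definition hs_basis :: "'k::{real_inner, banach, second_countable_topology} set" where
  "hs_basis = (SOME E. is_onb E (\<lambda>x. x))"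

lemma hs_basis: "is_onb hs_basis (\<lambda>x::'k::{real_inner, banach, second_countable_topology}. x)"
  unfolding hs_basis_def by (rule someI_ex) (rule ex_onb)

lemma countable_hs_basis: "countable hs_basis"
  by (rule orthonormal_countable[OF is_onb_orthonormal[OF hs_basis]])

lemma hs_norm_sq_eq:
  fixes L :: "'k::{real_inner, banach, second_countable_topology} \<Rightarrow> 'h::real_normed_vector"
  shows "hs_norm_sq L = (\<integral>\<^sup>+x. ennreal ((norm (L x))\<^sup>2) \<partial>count_space hs_basis)"
  by (simp add: hs_norm_sq_def hs_basis_def)

lemma hs_norm_sq_mono:
  fixes L L' :: "'k::{real_inner, banach, second_countable_topology} \<Rightarrow> 'h::real_normed_vector"
  assumes "\<And>x. norm (L x) \<le> C * norm (L' x)" "C \<ge> 0"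
  shows "hs_norm_sq L \<le> ennreal (C\<^sup>2) * hs_norm_sq L'"
proof -
  have "ennreal ((norm (L x))\<^sup>2) \<le> ennreal (C\<^sup>2) * ennreal ((norm (L' x))\<^sup>2)" for x
    using power_mono[OF assms(1), of x 2] by (simp add: ennreal_mult'[symmetric] power_mult_distrib)
  then have "hs_norm_sq L \<le> (\<integral>\<^sup>+x. ennreal (C\<^sup>2) * ennreal ((norm (L' x))\<^sup>2) \<partial>count_space hs_basis)"
    unfolding hs_norm_sq_eq by (intro nn_integral_mono) auto
  then show ?thesis by (simp add: hs_norm_sq_eq nn_integral_cmult)
qed

lemma norm_add_sq_le: "(norm (x + y :: 'h::real_normed_vector))\<^sup>2 \<le> 2 * (norm x)\<^sup>2 + 2 * (norm y)\<^sup>2"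
proof -
  have "(norm (x + y))\<^sup>2 \<le> (norm x + norm y)\<^sup>2" by (intro power_mono norm_triangle_ineq) auto
  also have "\<dots> \<le> 2 * (norm x)\<^sup>2 + 2 * (norm y)\<^sup>2"
    using zero_le_power2[of "norm x - norm y"] by (simp add: power2_eq_square algebra_simps)
  finally show ?thesis .
qed

lemma hs_norm_sq_add:
  fixes L L' :: "'k::{real_inner, banach, second_countable_topology} \<Rightarrow> 'h::real_normed_vector"
  shows "hs_norm_sq (\<lambda>x. L x + L' x) \<le> 2 * hs_norm_sq L + 2 * hs_norm_sq L'"
proof -
  have "ennreal ((norm (L x + L' x))\<^sup>2) \<le> 2 * ennreal ((norm (L x))\<^sup>2) + 2 * ennreal ((norm (L' x))\<^sup>2)" for x
    using norm_add_sq_le[of "L x" "L' x"]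
    by (simp add: ennreal_mult'[symmetric] ennreal_plus[symmetric] ennreal_numeral[symmetric] del: ennreal_plus ennreal_numeral)
  then have "hs_norm_sq (\<lambda>x. L x + L' x) \<le>
      (\<integral>\<^sup>+x. 2 * ennreal ((norm (L x))\<^sup>2) + 2 * ennreal ((norm (L' x))\<^sup>2) \<partial>count_space hs_basis)"
    unfolding hs_norm_sq_eq by (intro nn_integral_mono) auto
  then show ?thesis by (simp add: hs_norm_sq_eq nn_integral_cmult nn_integral_add)
qed

lemma borel_measurable_hs_norm_sq:
  fixes G :: "'a \<Rightarrow> 'k::{real_inner, banach, second_countable_topology} \<Rightarrow> 'h::{real_normed_vector, second_countable_topology}"
  assumes "\<And>x. (\<lambda>s. G s x) \<in> borel_measurable M"
  shows "(\<lambda>s. hs_norm_sq (G s)) \<in> borel_measurable M"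
proof -
  interpret sigma_finite_measure "count_space hs_basis :: 'k measure"
    by (rule sigma_finite_measure_count_space_countable[OF countable_hs_basis])
  have [measurable]: "(\<lambda>w. G (fst w) x) \<in> borel_measurable (M \<Otimes>\<^sub>M count_space hs_basis)" for x
    by (rule measurable_compose[OF measurable_fst assms])
  have "(\<lambda>(s, x). ennreal ((norm (G s x))\<^sup>2)) \<in> borel_measurable (M \<Otimes>\<^sub>M count_space hs_basis)"
    unfolding split_beta'
    by (rule measurable_compose_countable'[where g = snd and I = "hs_basis" and f = "\<lambda>x w. ennreal ((norm (G (fst w) x))\<^sup>2)"])
      (use countable_hs_basis in auto)
  then show ?thesis
    unfolding hs_norm_sq_eq by (rule borel_measurable_nn_integral)
qed

section \<open>Moment inequalities\<close>

text \<open>The tangent to \<open>t\<^sup>m\<close> at \<open>c\<close> lies below it, in a form without subtraction.\<close>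

lemma bernoulli_scaled:
  fixes c t :: real
  assumes "c > 0" "t \<ge> 0"
  shows "real m * c ^ (m - 1) * t \<le> t ^ m + real (m - 1) * c ^ m"
proof (cases m)
  case (Suc k)
  have "1 + real m * (t / c - 1) \<le> (1 + (t / c - 1)) ^ m"
    using assms by (intro Bernoulli_inequality) (auto simp: field_simps)
  then have "c ^ m * (1 + real m * (t / c - 1)) \<le> c ^ m * (t / c) ^ m"
    using assms by (intro mult_left_mono) auto
  then have "c * (real m * c ^ k * t) \<le> c * (t ^ m + real k * c ^ m)"
    using assms Suc by (simp add: power_divide field_simps)
  then show ?thesis using assms Suc by (simp only: mult_le_cancel_left_pos) simp
qed simp

text \<open>Jensen's inequality for powers: integrate the tangent inequality with \<open>c\<close> the mean of \<open>f\<close>.\<close>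

lemma nn_integral_power_le:
  fixes f :: "'a \<Rightarrow> ennreal"
  assumes f: "f \<in> borel_measurable N" and fin: "emeasure N (space N) < \<infinity>" and m: "m \<ge> 1"
  shows "(\<integral>\<^sup>+x. f x \<partial>N) ^ m \<le> emeasure N (space N) ^ (m - 1) * (\<integral>\<^sup>+x. f x ^ m \<partial>N)"
proof (cases "emeasure N (space N) = 0 \<or> (\<integral>\<^sup>+x. f x ^ m \<partial>N) = \<infinity>")
  case True
  then show ?thesis
  proof
    assume "emeasure N (space N) = 0"
    then have "(\<integral>\<^sup>+x. f x \<partial>N) = 0"
      using f by (simp add: nn_integral_0_iff) (metis (no_types, lifting) emeasure_eq_0 f measurable_sets sets.top sets.sets_into_space Collect_mem_eq emeasure_mono le_zero_eq mem_Collect_eq subsetI)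
    then show ?thesis using m by (simp add: power_0_left)
  next
    assume inf: "(\<integral>\<^sup>+x. f x ^ m \<partial>N) = \<infinity>"
    show ?thesis
    proof (cases "emeasure N (space N) = 0")
      case True
      have "(\<integral>\<^sup>+x. f x ^ m \<partial>N) = 0"
        using f True by (intro nn_integral_null_measure[THEN trans[rotated]])
          (simp add: nn_integral_0_iff emeasure_eq_0[OF sets.top])
      then show ?thesis using inf by simp
    next
      case False
      then show ?thesis using inf by (simp add: ennreal_mult_top)
    qed
  qed
next
  case False
  define \<mu> where "\<mu> = enn2real (emeasure N (space N))"
  define B where "B = enn2real (\<integral>\<^sup>+x. f x ^ m \<partial>N)"
  have \<mu>: "emeasure N (space N) = ennreal \<mu>" "\<mu> > 0"
    using False fin by (auto simp: \<mu>_def ennreal_enn2real_if enn2real_positive_iff less_top zero_less_iff_neq_zero)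
  have B: "(\<integral>\<^sup>+x. f x ^ m \<partial>N) = ennreal B" "B \<ge> 0"
    using False by (auto simp: B_def ennreal_enn2real_if)
  have young: "ennreal (real m * c ^ (m - 1)) * (\<integral>\<^sup>+x. f x \<partial>N) \<le> ennreal (B + real (m - 1) * c ^ m * \<mu>)"
    if c: "c > 0" for c
  proof -
    have "ennreal (real m * c ^ (m - 1)) * (\<integral>\<^sup>+x. f x \<partial>N) = (\<integral>\<^sup>+x. ennreal (real m * c ^ (m - 1)) * f x \<partial>N)"
      by (rule nn_integral_cmult[symmetric, OF f])
    also have "\<dots> \<le> (\<integral>\<^sup>+x. f x ^ m + ennreal (real (m - 1) * c ^ m) \<partial>N)"
    proof (rule nn_integral_mono)
      fix x
      show "ennreal (real m * c ^ (m - 1)) * f x \<le> f x ^ m + ennreal (real (m - 1) * c ^ m)"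
      proof (cases "f x" rule: ennreal_cases)
        case (real t)
        then show ?thesis using bernoulli_scaled[OF c real(1), of m] c
          by (simp add: ennreal_mult'[symmetric] ennreal_power ennreal_plus[symmetric] del: ennreal_plus)
      qed (use m in \<open>simp add: top_power_ennreal\<close>)
    qed
    also have "\<dots> = (\<integral>\<^sup>+x. f x ^ m \<partial>N) + ennreal (real (m - 1) * c ^ m) * emeasure N (space N)"
      using f by (simp add: nn_integral_add)
    also have "\<dots> = ennreal (B + real (m - 1) * c ^ m * \<mu>)"
      using c \<mu> B by (simp add: ennreal_mult'[symmetric] ennreal_plus[symmetric] del: ennreal_plus)
    finally show ?thesis .
  qed
  have "(\<integral>\<^sup>+x. f x \<partial>N) < \<infinity>"
  proof -
    have "ennreal (real m * 1) * (\<integral>\<^sup>+x. f x \<partial>N) < \<infinity>"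
      using young[of 1] by (simp add: order_le_less_trans[OF _ ennreal_less_top])
    then show ?thesis using m by (auto simp: ennreal_mult_less_top)
  qed
  then obtain a where a: "(\<integral>\<^sup>+x. f x \<partial>N) = ennreal a" "a \<ge> 0"
    by (cases "(\<integral>\<^sup>+x. f x \<partial>N)" rule: ennreal_cases) auto
  have "a ^ m \<le> \<mu> ^ (m - 1) * B"
  proof (cases "a = 0")
    case False
    then have c: "a / \<mu> > 0" using a \<mu> by simp
    obtain k where k: "m = Suc k" using m by (cases m) auto
    have "real m * (a / \<mu>) ^ (m - 1) * a \<le> B + real (m - 1) * (a / \<mu>) ^ m * \<mu>"
      using young[OF c] a B \<mu> c by (simp add: ennreal_mult'[symmetric] ennreal_le_iff del: ennreal_plus)
    also have "real (m - 1) * (a / \<mu>) ^ m * \<mu> = real k * (a / \<mu>) ^ k * a"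
      using \<mu> k by (simp add: field_simps)
    finally have "(a / \<mu>) ^ k * a \<le> B" using k by (simp add: algebra_simps)
    then have "\<mu> ^ k * ((a / \<mu>) ^ k * a) \<le> \<mu> ^ k * B" using \<mu> by (intro mult_left_mono) auto
    then show ?thesis using \<mu> k by (simp add: power_divide field_simps)
  qed (use m B \<mu> in \<open>simp add: power_0_left\<close>)
  then show ?thesis
    using a B \<mu> by (simp add: ennreal_power ennreal_mult'[symmetric])
qed

lemma nn_integral_weighted_power_le:
  fixes f w :: "'a \<Rightarrow> ennreal"
  assumes f: "f \<in> borel_measurable N" and w: "w \<in> borel_measurable N"
    and fin: "(\<integral>\<^sup>+x. w x \<partial>N) < \<infinity>" and m: "m \<ge> 1"
  shows "(\<integral>\<^sup>+x. w x * f x \<partial>N) ^ m \<le> (\<integral>\<^sup>+x. w x \<partial>N) ^ (m - 1) * (\<integral>\<^sup>+x. w x * f x ^ m \<partial>N)"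
proof -
  have e: "emeasure (density N w) (space (density N w)) = (\<integral>\<^sup>+x. w x \<partial>N)"
    using w by (subst emeasure_density) (auto intro!: nn_integral_cong)
  show ?thesis
    using nn_integral_power_le[of f "density N w" m] f fin m w
    by (simp only: e) (simp add: nn_integral_density)
qed

lemma power_le_fact_exp: "(x::real) ^ (2 * m) \<le> fact (2 * m) * (exp x + exp (- x))"
proof -
  have "\<bar>x\<bar> ^ n / fact n \<le> exp \<bar>x\<bar>" for n
  proof -
    have "(\<Sum>i\<in>{n}. \<bar>x\<bar> ^ i /\<^sub>R fact i) \<le> (\<Sum>i. \<bar>x\<bar> ^ i /\<^sub>R fact i)"
      by (rule sum_le_suminf) (use summable_exp[of "\<bar>x\<bar>"] in \<open>auto simp: inverse_eq_divide field_simps\<close>)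
    then show ?thesis by (simp add: exp_def field_simps)
  qed
  from this[of "2 * m"] have "x ^ (2 * m) \<le> fact (2 * m) * exp \<bar>x\<bar>"
    by (simp add: pos_divide_le_eq power_even_abs mult.commute)
  also have "exp \<bar>x\<bar> \<le> exp x + exp (- x)" by (cases "x \<ge> 0") auto
  finally show ?thesis by simp
qed

text \<open>Not the sharp Gaussian moment: it is what the bound of \<open>x\<close> to the power \<open>2 m\<close> by exponentials yields.\<close>

definition gauss_const :: "nat \<Rightarrow> real" where
  "gauss_const m = 2 * exp (1/2) * fact (2 * m)"

lemma gauss_const_pos: "gauss_const m > 0"
  by (simp add: gauss_const_def)

text \<open>The moment generating function at \<open>\<theta>\<close> and \<open>- \<theta>\<close>, with \<open>\<theta>\<close> the inverse standard deviation, bounds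
  even moments. Working with an upper bound \<open>u > 0\<close> of the variance covers degenerate variables by
  letting \<open>u\<close> tend to 0.\<close>

lemma moment_of_mgf:
  assumes meas: "\<xi> \<in> borel_measurable M" and v: "v \<ge> 0" and m: "m \<ge> 1"
    and mgf: "\<And>\<theta>::real. (\<integral>\<^sup>+\<omega>. ennreal (exp (\<theta> * \<xi> \<omega>)) \<partial>M) = ennreal (exp (\<theta>\<^sup>2 * v / 2))"
  shows "(\<integral>\<^sup>+\<omega>. ennreal (\<xi> \<omega> ^ (2 * m)) \<partial>M) \<le> ennreal (gauss_const m * v ^ m)"
proof -
  have bound: "(\<integral>\<^sup>+\<omega>. ennreal (\<xi> \<omega> ^ (2 * m)) \<partial>M) \<le> ennreal (gauss_const m * u ^ m)" if u: "u > 0" "v \<le> u" for u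
  proof -
    define \<theta> where "\<theta> = 1 / sqrt u"
    have sq: "\<theta>\<^sup>2 = 1 / u" using u by (simp add: \<theta>_def power_divide)
    have \<theta>: "\<theta> > 0" "\<theta>\<^sup>2 * v \<le> 1" "\<theta> ^ (2 * m) = 1 / u ^ m"
      using u v unfolding power_mult sq by (auto simp: \<theta>_def power_divide field_simps)
    have "ennreal (\<xi> \<omega> ^ (2 * m)) \<le> ennreal (fact (2 * m) * u ^ m) * (ennreal (exp (\<theta> * \<xi> \<omega>)) + ennreal (exp (- \<theta> * \<xi> \<omega>)))" for \<omega>
    proof -
      have "\<xi> \<omega> ^ (2 * m) = u ^ m * (\<theta> * \<xi> \<omega>) ^ (2 * m)" using \<theta> u by (simp add: power_mult_distrib)
      also have "\<dots> \<le> u ^ m * (fact (2 * m) * (exp (\<theta> * \<xi> \<omega>) + exp (- \<theta> * \<xi> \<omega>)))"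
        using u power_le_fact_exp[of "\<theta> * \<xi> \<omega>" m] by (intro mult_left_mono) auto
      finally have "\<xi> \<omega> ^ (2 * m) \<le> (fact (2 * m) * u ^ m) * (exp (\<theta> * \<xi> \<omega>) + exp (- \<theta> * \<xi> \<omega>))"
        by (simp add: mult_ac)
      then show ?thesis using u
        by (simp add: ennreal_mult'[symmetric] ennreal_plus[symmetric] del: ennreal_plus)
    qed
    then have "(\<integral>\<^sup>+\<omega>. ennreal (\<xi> \<omega> ^ (2 * m)) \<partial>M) \<le> (\<integral>\<^sup>+\<omega>. ennreal (fact (2 * m) * u ^ m) * (ennreal (exp (\<theta> * \<xi> \<omega>)) + ennreal (exp (- \<theta> * \<xi> \<omega>))) \<partial>M)"
      by (intro nn_integral_mono)
    also have "\<dots> = ennreal (fact (2 * m) * u ^ m) * (ennreal (exp (\<theta>\<^sup>2 * v / 2)) + ennreal (exp ((- \<theta>)\<^sup>2 * v / 2)))"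
    proof -
      have [measurable]: "\<xi> \<in> borel_measurable M" by (rule meas)
      have "(\<integral>\<^sup>+\<omega>. ennreal (exp (\<theta> * \<xi> \<omega>)) + ennreal (exp (- \<theta> * \<xi> \<omega>)) \<partial>M)
          = (\<integral>\<^sup>+\<omega>. ennreal (exp (\<theta> * \<xi> \<omega>)) \<partial>M) + (\<integral>\<^sup>+\<omega>. ennreal (exp (- \<theta> * \<xi> \<omega>)) \<partial>M)"
        by (rule nn_integral_add) measurable
      then show ?thesis by (subst nn_integral_cmult) (measurable, simp only: mgf)
    qed
    also have "\<dots> = ennreal ((fact (2 * m) * u ^ m) * (2 * exp (\<theta>\<^sup>2 * v / 2)))"
      using u by (simp add: ennreal_mult'[symmetric] ennreal_plus[symmetric] del: ennreal_plus)
    also have "\<dots> \<le> ennreal ((fact (2 * m) * u ^ m) * (2 * exp (1 / 2)))"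
      using u \<theta> by (intro ennreal_leI mult_left_mono) auto
    finally show ?thesis by (simp add: gauss_const_def mult_ac)
  qed
  show ?thesis
  proof (cases "v = 0")
    case True
    have "(\<lambda>u. gauss_const m * u ^ m) \<midarrow>0\<rightarrow> gauss_const m * 0 ^ m" by (intro tendsto_intros)
    then have "((\<lambda>u. gauss_const m * u ^ m) \<longlongrightarrow> gauss_const m * 0 ^ m) (at_right 0)"
      by (rule filterlim_mono) (auto simp: at_le)
    then have "((\<lambda>u. ennreal (gauss_const m * u ^ m)) \<longlongrightarrow> ennreal (gauss_const m * 0 ^ m)) (at_right 0)"
      by (rule tendsto_ennrealI)
    then have "(\<integral>\<^sup>+\<omega>. ennreal (\<xi> \<omega> ^ (2 * m)) \<partial>M) \<le> ennreal (gauss_const m * 0 ^ m)"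
      by (rule tendsto_lowerbound) (use bound True in \<open>auto simp: eventually_at_filter\<close>)
    then show ?thesis using True by simp
  qed (use bound v in auto)
qed

lemma mgf_normal:
  assumes X: "distributed M lborel X (normal_density 0 \<sigma>)" and \<sigma>: "\<sigma> > 0"
  shows "(\<integral>\<^sup>+\<omega>. ennreal (exp (\<theta> * X \<omega>)) \<partial>M) = ennreal (exp (\<theta>\<^sup>2 * \<sigma>\<^sup>2 / 2))"
proof -
  have sq: "- (x\<^sup>2) / (2 * \<sigma>\<^sup>2) + \<theta> * x = \<theta>\<^sup>2 * \<sigma>\<^sup>2 / 2 + - ((x - \<theta> * \<sigma>\<^sup>2)\<^sup>2) / (2 * \<sigma>\<^sup>2)" for x
    using \<sigma> by (simp add: field_simps power2_eq_square)
  have "normal_density 0 \<sigma> x * exp (\<theta> * x) = exp (\<theta>\<^sup>2 * \<sigma>\<^sup>2 / 2) * normal_density (\<theta> * \<sigma>\<^sup>2) \<sigma> x" for x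
    using sq[of x] by (simp add: normal_density_def exp_add[symmetric])
  then have eq: "ennreal (normal_density 0 \<sigma> x) * ennreal (exp (\<theta> * x)) = ennreal (exp (\<theta>\<^sup>2 * \<sigma>\<^sup>2 / 2)) * ennreal (normal_density (\<theta> * \<sigma>\<^sup>2) \<sigma> x)" for x
    by (simp add: ennreal_mult'[symmetric])
  interpret N: prob_space "density lborel (normal_density (\<theta> * \<sigma>\<^sup>2) \<sigma>)"
    by (rule prob_space_normal_density[OF \<sigma>])
  have one: "(\<integral>\<^sup>+x. ennreal (normal_density (\<theta> * \<sigma>\<^sup>2) \<sigma> x) \<partial>lborel) = 1"
    using N.emeasure_space_1 by (simp add: emeasure_density)
  have "(\<integral>\<^sup>+\<omega>. ennreal (exp (\<theta> * X \<omega>)) \<partial>M) = (\<integral>\<^sup>+x. ennreal (normal_density 0 \<sigma> x) * ennreal (exp (\<theta> * x)) \<partial>lborel)"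
    by (rule distributed_nn_integral[OF X, symmetric]) simp
  also have "\<dots> = ennreal (exp (\<theta>\<^sup>2 * \<sigma>\<^sup>2 / 2))"
    unfolding eq by (subst nn_integral_cmult) (auto simp: one)
  finally show ?thesis .
qed

lemma (in prob_space) nn_integral_indep_mult:
  assumes G: "subalgebra M G" and X: "X \<in> borel_measurable M" and Y: "Y \<in> borel_measurable G"
    and ind: "indep_set (sets G) (sets (vimage_algebra (space M) X borel))"
    and f: "f \<in> borel_measurable borel" and g: "g \<in> borel_measurable borel"
  shows "(\<integral>\<^sup>+\<omega>. f (Y \<omega> :: real) * g (X \<omega> :: real) \<partial>M) = (\<integral>\<^sup>+\<omega>. f (Y \<omega>) \<partial>M) * (\<integral>\<^sup>+\<omega>. g (X \<omega>) \<partial>M :: ennreal)"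
proof -
  have YM: "Y \<in> borel_measurable M" using Y G by (rule measurable_from_subalg[rotated])
  have sp: "space G = space M" using G by (simp add: subalgebra_def)
  have "sigma_sets (space M) {Y -` A \<inter> space M |A. A \<in> sets borel} \<subseteq> sets G"
    using Y by (subst sp[symmetric], intro sets.sigma_sets_subset) (use measurable_sets[OF Y, unfolded sp] in auto)
  moreover have "sigma_sets (space M) {X -` A \<inter> space M |A. A \<in> sets borel} = sets (vimage_algebra (space M) X borel)"
    by (simp add: sets_vimage_algebra)
  ultimately have "indep_set (sigma_sets (space M) {Y -` A \<inter> space M |A. A \<in> sets borel})
      (sigma_sets (space M) {X -` A \<inter> space M |A. A \<in> sets borel})"
    unfolding indep_set_def
  proof (intro indep_sets_mono_sets[OF ind[unfolded indep_set_def]])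
    fix i :: bool
    assume "sigma_sets (space M) {Y -` A \<inter> space M |A. A \<in> sets borel} \<subseteq> sets G"
      "sigma_sets (space M) {X -` A \<inter> space M |A. A \<in> sets borel} = sets (vimage_algebra (space M) X borel)"
    then show "(case i of True \<Rightarrow> sigma_sets (space M) {Y -` A \<inter> space M |A. A \<in> sets borel}
        | False \<Rightarrow> sigma_sets (space M) {X -` A \<inter> space M |A. A \<in> sets borel})
        \<subseteq> (case i of True \<Rightarrow> sets G | False \<Rightarrow> sets (vimage_algebra (space M) X borel))"
      by (cases i) simp_all
  qed
  then have "indep_var borel Y borel X"
    unfolding indep_var_eq using YM X by blast
  then have eq: "distr M borel Y \<Otimes>\<^sub>M distr M borel X = distr M (borel \<Otimes>\<^sub>M borel) (\<lambda>x. (Y x, X x))"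
    by (simp add: indep_var_distribution_eq)
  interpret PX: prob_space "distr M borel X" by (rule prob_space_distr[OF X])
  have "(\<integral>\<^sup>+\<omega>. f (Y \<omega>) * g (X \<omega>) \<partial>M) = (\<integral>\<^sup>+p. f (fst p) * g (snd p) \<partial>distr M (borel \<Otimes>\<^sub>M borel) (\<lambda>x. (Y x, X x)))"
    using X YM f g by (subst nn_integral_distr) auto
  also have "\<dots> = (\<integral>\<^sup>+p. f (fst p) * g (snd p) \<partial>(distr M borel Y \<Otimes>\<^sub>M distr M borel X))"
    by (simp only: eq)
  also have "\<dots> = (\<integral>\<^sup>+y. \<integral>\<^sup>+x. f y * g x \<partial>distr M borel X \<partial>distr M borel Y)"
    using f g by (subst PX.nn_integral_fst[symmetric]) auto
  also have "\<dots> = (\<integral>\<^sup>+y. f y \<partial>distr M borel Y) * (\<integral>\<^sup>+x. g x \<partial>distr M borel X)"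
    using f g by (simp add: nn_integral_cmult nn_integral_multc)
  also have "\<dots> = (\<integral>\<^sup>+\<omega>. f (Y \<omega>) \<partial>M) * (\<integral>\<^sup>+\<omega>. g (X \<omega>) \<partial>M)"
    using X YM f g by (simp add: nn_integral_distr)
  finally show ?thesis .
qed


section \<open>Moments of Wiener integrals\<close>

text \<open>A list of triples \<open>(a, b, k)\<close> stands for the step function with value \<open>k\<close> on \<open>(a, b]\<close>, added up over the
  list; \<open>wiener_sum\<close> is its Wiener integral. These are the coordinates of the integrals of elementary
  operator functions.\<close>

definition wiener_sum :: "(real \<Rightarrow> 'k \<Rightarrow> 'a \<Rightarrow> real) \<Rightarrow> (real \<times> real \<times> 'k) list \<Rightarrow> 'a \<Rightarrow> real" where
  "wiener_sum W L \<omega> = (\<Sum>(a, b, k)\<leftarrow>L. W b k \<omega> - W a k \<omega>)"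

definition step_function :: "(real \<times> real \<times> 'k::real_vector) list \<Rightarrow> real \<Rightarrow> 'k" where
  "step_function L s = (\<Sum>(a, b, k)\<leftarrow>L. indicator {a<..b} s *\<^sub>R k)"

lemma borel_measurable_sum_list:
  fixes f :: "'x \<Rightarrow> 'a \<Rightarrow> 'b::{second_countable_topology, topological_comm_monoid_add}"
  shows "(\<And>x. x \<in> set L \<Longrightarrow> f x \<in> borel_measurable N) \<Longrightarrow> (\<lambda>\<omega>. \<Sum>x\<leftarrow>L. f x \<omega>) \<in> borel_measurable N"
  by (induction L) auto

lemma step_function_measurable [measurable]:
  "step_function L \<in> borel_measurable (borel :: real measure)" for L :: "(real \<times> real \<times> 'k::{real_normed_vector, second_countable_topology}) list"
  unfolding step_function_def [abs_def] by (rule borel_measurable_sum_list) (auto simp: split_beta)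

locale wiener = prob_space M for M :: "'a measure" +
  fixes \<F> :: "real \<Rightarrow> 'a measure" and T :: real
    and W :: "real \<Rightarrow> 'k::{real_inner, banach, second_countable_topology} \<Rightarrow> 'a \<Rightarrow> real"
  assumes T: "T > 0" and filt: "normal_filtration M T \<F>" and wiener: "cylindrical_wiener M \<F> T W"
begin

lemma subalg: "t \<in> {0..T} \<Longrightarrow> subalgebra M (\<F> t)"
  using filt by (simp add: normal_filtration_def)

lemma filtration_mono: "0 \<le> s \<Longrightarrow> s \<le> t \<Longrightarrow> t \<le> T \<Longrightarrow> subalgebra (\<F> t) (\<F> s)"
  using filt by (auto simp: normal_filtration_def subalgebra_def)

lemma W_adapted: "s \<in> {0..t} \<Longrightarrow> t \<in> {0..T} \<Longrightarrow> W s k \<in> borel_measurable (\<F> t)"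
  using wiener filtration_mono[of s t]
  by (intro measurable_from_subalg[of "\<F> t" "\<F> s"]) (auto simp: cylindrical_wiener_def)

lemma W_measurable: "t \<in> {0..T} \<Longrightarrow> W t k \<in> borel_measurable M"
  using measurable_from_subalg[OF subalg W_adapted[of t t]] by simp

lemma W_linear:
  assumes "t \<in> {0..T}"
  shows "AE \<omega> in M. W t (a *\<^sub>R k + b *\<^sub>R l) \<omega> = a * W t k \<omega> + b * W t l \<omega>"
proof -
  have "\<forall>t\<in>{0..T}. \<forall>a b k l. AE \<omega> in M. W t (a *\<^sub>R k + b *\<^sub>R l) \<omega> = a * W t k \<omega> + b * W t l \<omega>"
    using wiener unfolding cylindrical_wiener_def by (elim conjE)
  then show ?thesis using assms by blast
qed

lemma W_zero: "t \<in> {0..T} \<Longrightarrow> AE \<omega> in M. W t 0 \<omega> = 0"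
  using W_linear[of t 0 0 0 0] by simp

lemma W_scale: "t \<in> {0..T} \<Longrightarrow> AE \<omega> in M. W t (a *\<^sub>R k) \<omega> = a * W t k \<omega>"
  using W_linear[of t a k 0 0] by simp

lemma W_sum_list:
  assumes "t \<in> {0..T}"
  shows "AE \<omega> in M. W t (\<Sum>x\<leftarrow>L. f x) \<omega> = (\<Sum>x\<leftarrow>L. W t (f x) \<omega>)"
proof (induction L)
  case Nil
  then show ?case using W_zero[OF assms] by simp
next
  case (Cons x L)
  then show ?case using W_linear[OF assms, of 1 "f x" 1 "\<Sum>x\<leftarrow>L. f x"] by eventually_elim simp
qed

lemma increment_mgf:
  assumes "0 \<le> s" "s \<le> t" "t \<le> T"
  shows "(\<integral>\<^sup>+\<omega>. ennreal (exp (\<theta> * (W t k \<omega> - W s k \<omega>))) \<partial>M) = ennreal (exp (\<theta>\<^sup>2 * ((t - s) * (norm k)\<^sup>2) / 2))"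
proof (cases "s = t \<or> k = 0")
  case True
  have "AE \<omega> in M. W t k \<omega> - W s k \<omega> = 0"
  proof (cases "s = t")
    case False
    then have k: "k = 0" using True by simp
    have "AE \<omega> in M. W t 0 \<omega> = 0" "AE \<omega> in M. W s 0 \<omega> = 0" using assms by (auto intro!: W_zero)
    then show ?thesis unfolding k by eventually_elim simp
  qed simp
  then have "(\<integral>\<^sup>+\<omega>. ennreal (exp (\<theta> * (W t k \<omega> - W s k \<omega>))) \<partial>M) = (\<integral>\<^sup>+\<omega>. 1 \<partial>M)"
    by (intro nn_integral_cong_AE) (auto elim: eventually_mono)
  then show ?thesis using True emeasure_space_1 by auto
next
  case False
  then have "distributed M lborel (\<lambda>\<omega>. W t k \<omega> - W s k \<omega>) (normal_density 0 (norm k * sqrt (t - s)))"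
    using wiener assms unfolding cylindrical_wiener_def by auto
  from mgf_normal[OF this, of \<theta>] show ?thesis
    using False assms by (simp add: power_mult_distrib mult_ac)
qed

lemma wiener_sum_measurable:
  assumes "t \<in> {0..T}" "\<forall>(a, b, k)\<in>set L. a \<in> {0..t} \<and> b \<in> {0..t}"
  shows "wiener_sum W L \<in> borel_measurable (\<F> t)"
  unfolding wiener_sum_def [abs_def]
proof (rule borel_measurable_sum_list, clarify)
  fix a b k assume "(a, b, k) \<in> set L"
  then have "a \<in> {0..t}" "b \<in> {0..t}" using assms(2) by auto
  from W_adapted[OF this(1) assms(1), of k] W_adapted[OF this(2) assms(1), of k]
  show "(\<lambda>\<omega>. W b k \<omega> - W a k \<omega>) \<in> borel_measurable (\<F> t)" by simp
qed

text \<open>A linear combination of Brownian increments is Gaussian: cut all intervals at the largest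
  endpoint but one; the last increment is independent of the past.\<close>

lemma wiener_sum_mgf:
  assumes "finite P" "P \<subseteq> {0..T}" "\<forall>(a, b, k)\<in>set L. a \<in> P \<and> b \<in> P \<and> a \<le> b"
  shows "\<exists>v\<ge>0. (\<integral>\<^sup>+s. ennreal ((norm (step_function L s))\<^sup>2) \<partial>lborel) = ennreal v \<and>
     (\<forall>\<theta>. (\<integral>\<^sup>+\<omega>. ennreal (exp (\<theta> * wiener_sum W L \<omega>)) \<partial>M) = ennreal (exp (\<theta>\<^sup>2 * v / 2)))"
  using assms
proof (induction P arbitrary: L rule: finite_linorder_max_induct)
  case empty
  then have "L = []" by (cases L) auto
  then show ?case using emeasure_space_1 by (intro exI[of _ 0]) (auto simp: wiener_sum_def step_function_def)
next
  case (insert u' A)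
  show ?case
  proof (cases "A = {}")
    case True
    have "(\<Sum>(a, b, k)\<leftarrow>L. W b k \<omega> - W a k \<omega>) = (\<Sum>x\<leftarrow>L. 0)" for \<omega>
      using insert.prems(2) True by (intro arg_cong[of _ _ sum_list] map_cong) auto
    moreover have "(\<Sum>(a, b, k)\<leftarrow>L. indicator {a<..b} s *\<^sub>R k) = (\<Sum>x\<leftarrow>L. 0)" for s
      using insert.prems(2) True by (intro arg_cong[of _ _ sum_list] map_cong) auto
    ultimately show ?thesis
      using emeasure_space_1 by (intro exI[of _ 0]) (simp add: wiener_sum_def step_function_def)
  next
    case False
    define u where "u = Max A"
    have uA: "u \<in> A" and u_max: "\<And>x. x \<in> A \<Longrightarrow> x \<le> u" using insert.hyps(1) False by (auto simp: u_def)
    have uu': "u < u'" "0 \<le> u" "u' \<le> T" "u \<le> T" using insert.hyps(2) insert.prems(1) uA by auto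
    define L' where "L' = map (\<lambda>(a, b, k). (min a u, min b u, k)) L"
    define \<kappa> where "\<kappa> = (\<Sum>(a, b, k)\<leftarrow>L. if a \<le> u \<and> b = u' then k else 0)"
    have cases: "(a \<le> u \<and> a \<in> A \<or> a = u') \<and> (b \<le> u \<and> b \<in> A \<or> b = u') \<and> a \<le> b" if "(a, b, k) \<in> set L" for a b k
      using insert.prems(2) that u_max by auto
    have min_in: "min a u \<in> A" if "a \<le> u \<and> a \<in> A \<or> a = u'" for a
      using that uA uu' by (auto simp: min_def)
    have L': "\<forall>(a, b, k)\<in>set L'. a \<in> A \<and> b \<in> A \<and> a \<le> b"
    proof -
      have "min a u \<in> A \<and> min b u \<in> A \<and> min a u \<le> min b u" if "(a, b, k) \<in> set L" for a b k
        using cases[OF that] min_in[of a] min_in[of b] by (auto simp: min_def)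
      then show ?thesis by (fastforce simp: L'_def)
    qed
    obtain v where v: "v \<ge> 0" "(\<integral>\<^sup>+s. ennreal ((norm (step_function L' s))\<^sup>2) \<partial>lborel) = ennreal v"
      "\<And>\<theta>. (\<integral>\<^sup>+\<omega>. ennreal (exp (\<theta> * wiener_sum W L' \<omega>)) \<partial>M) = ennreal (exp (\<theta>\<^sup>2 * v / 2))"
      using insert.IH[OF _ L'] insert.prems(1) by auto
    \<comment> \<open>the integrand splits into its part before \<open>u\<close> and the constant \<open>\<kappa>\<close> on \<open>(u, u']\<close>\<close>
    have step: "ennreal ((norm (step_function L s))\<^sup>2) = ennreal ((norm (step_function L' s))\<^sup>2) + ennreal ((norm \<kappa>)\<^sup>2) * indicator {u<..u'} s" for s
    proof -
      have w': "step_function L' s = (\<Sum>(a, b, k)\<leftarrow>L. indicator {min a u<..min b u} s *\<^sub>R k)"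
        by (simp add: step_function_def L'_def comp_def case_prod_unfold)
      consider "s \<le> u" | "u < s" "s \<le> u'" | "u' < s" by linarith
      then show ?thesis
      proof cases
        case 1
        have "step_function L s = step_function L' s"
          unfolding w' unfolding step_function_def
          using 1 by (intro arg_cong[of _ _ sum_list] map_cong) (auto simp: indicator_def)
        then show ?thesis using 1 by (simp add: indicator_def)
      next
        case 2
        have "step_function L' s = (\<Sum>x\<leftarrow>L. 0)"
          unfolding w' using 2 by (intro arg_cong[of _ _ sum_list] map_cong) (auto simp: indicator_def)
        moreover have "step_function L s = \<kappa>"
          unfolding \<kappa>_def step_function_def
        proof (intro arg_cong[of _ _ sum_list] map_cong refl, clarify)
          fix a b k assume "(a, b, k) \<in> set L"
          from cases[OF this] show "indicator {a<..b} s *\<^sub>R k = (if a \<le> u \<and> b = u' then k else 0)"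
            using 2 by (auto simp: indicator_def)
        qed
        ultimately show ?thesis using 2 by (simp add: indicator_def)
      next
        case 3
        have "step_function L' s = (\<Sum>x\<leftarrow>L. 0)"
          unfolding w' using 3 uu' by (intro arg_cong[of _ _ sum_list] map_cong) (auto simp: indicator_def)
        moreover have "step_function L s = (\<Sum>x\<leftarrow>L. 0)"
          unfolding step_function_def
        proof (intro arg_cong[of _ _ sum_list] map_cong refl, clarify)
          fix a b k assume "(a, b, k) \<in> set L"
          from cases[OF this] show "indicator {a<..b} s *\<^sub>R k = 0"
            using 3 uu' by (auto simp: indicator_def)
        qed
        ultimately show ?thesis using 3 by (simp add: indicator_def)
      qed
    qed
    have "(\<integral>\<^sup>+s. ennreal ((norm (step_function L s))\<^sup>2) \<partial>lborel) = ennreal v + ennreal ((norm \<kappa>)\<^sup>2) * emeasure lborel {u<..u'}"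
      unfolding step by (simp add: nn_integral_add v nn_integral_cmult)
    also have "\<dots> = ennreal (v + (u' - u) * (norm \<kappa>)\<^sup>2)"
      using v uu' by (simp add: ennreal_mult'[symmetric] ennreal_plus[symmetric] mult.commute del: ennreal_plus)
    finally have V: "(\<integral>\<^sup>+s. ennreal ((norm (step_function L s))\<^sup>2) \<partial>lborel) = ennreal (v + (u' - u) * (norm \<kappa>)\<^sup>2)" .
    have split: "AE \<omega> in M. wiener_sum W L \<omega> = wiener_sum W L' \<omega> + (W u' \<kappa> \<omega> - W u \<kappa> \<omega>)"
    proof -
      let ?f = "\<lambda>(a, b, k). if a \<le> u \<and> b = u' then k else 0"
      have "AE \<omega> in M. W u' (\<Sum>x\<leftarrow>L. ?f x) \<omega> = (\<Sum>x\<leftarrow>L. W u' (?f x) \<omega>)"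
        "AE \<omega> in M. W u (\<Sum>x\<leftarrow>L. ?f x) \<omega> = (\<Sum>x\<leftarrow>L. W u (?f x) \<omega>)"
        "AE \<omega> in M. W u' 0 \<omega> = 0" "AE \<omega> in M. W u 0 \<omega> = 0"
        using uu' by (intro W_sum_list W_zero; simp)+
      then show ?thesis
      proof eventually_elim
        case (elim \<omega>)
        have "wiener_sum W L \<omega> = (\<Sum>x\<leftarrow>L. (case x of (a, b, k) \<Rightarrow> W (min b u) k \<omega> - W (min a u) k \<omega>) + (W u' (?f x) \<omega> - W u (?f x) \<omega>))"
          unfolding wiener_sum_def
        proof (intro arg_cong[of _ _ sum_list] map_cong refl, clarify)
          fix a b k assume "(a, b, k) \<in> set L"
          from cases[OF this] show "W b k \<omega> - W a k \<omega> = W (min b u) k \<omega> - W (min a u) k \<omega> +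
            (W u' (if a \<le> u \<and> b = u' then k else 0) \<omega> - W u (if a \<le> u \<and> b = u' then k else 0) \<omega>)"
            using uu' elim(3,4) by (auto simp: min_def)
        qed
        also have "\<dots> = wiener_sum W L' \<omega> + ((\<Sum>x\<leftarrow>L. W u' (?f x) \<omega>) - (\<Sum>x\<leftarrow>L. W u (?f x) \<omega>))"
          by (simp add: wiener_sum_def L'_def sum_list_addf sum_list_subtractf comp_def case_prod_unfold)
        finally show ?case using elim by (simp add: \<kappa>_def)
      qed
    qed
    have meas: "wiener_sum W L' \<in> borel_measurable (\<F> u)"
      using L' insert.prems(1) u_max uu' by (intro wiener_sum_measurable) fastforce+
    have ind: "indep_set (sets (\<F> u)) (sets (vimage_algebra (space M) (\<lambda>\<omega>. W u' \<kappa> \<omega> - W u \<kappa> \<omega>) borel))"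
      using wiener uu' unfolding cylindrical_wiener_def by auto
    have "(\<integral>\<^sup>+\<omega>. ennreal (exp (\<theta> * wiener_sum W L \<omega>)) \<partial>M) = ennreal (exp (\<theta>\<^sup>2 * (v + (u' - u) * (norm \<kappa>)\<^sup>2) / 2))" for \<theta>
    proof -
      have "(\<integral>\<^sup>+\<omega>. ennreal (exp (\<theta> * wiener_sum W L \<omega>)) \<partial>M)
          = (\<integral>\<^sup>+\<omega>. ennreal (exp (\<theta> * wiener_sum W L' \<omega>)) * ennreal (exp (\<theta> * (W u' \<kappa> \<omega> - W u \<kappa> \<omega>))) \<partial>M)"
        using split by (intro nn_integral_cong_AE)
          (auto elim!: eventually_mono simp: ennreal_mult'[symmetric] exp_add[symmetric] distrib_left)
      also have "\<dots> = (\<integral>\<^sup>+\<omega>. ennreal (exp (\<theta> * wiener_sum W L' \<omega>)) \<partial>M) * (\<integral>\<^sup>+\<omega>. ennreal (exp (\<theta> * (W u' \<kappa> \<omega> - W u \<kappa> \<omega>))) \<partial>M)"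
        using uu' W_measurable[of u \<kappa>] W_measurable[of u' \<kappa>]
        by (intro nn_integral_indep_mult[OF subalg _ meas ind, of "\<lambda>y. ennreal (exp (\<theta> * y))" "\<lambda>x. ennreal (exp (\<theta> * x))"]) auto
      also have "\<dots> = ennreal (exp (\<theta>\<^sup>2 * v / 2)) * ennreal (exp (\<theta>\<^sup>2 * ((u' - u) * (norm \<kappa>)\<^sup>2) / 2))"
        using uu' by (simp add: v increment_mgf)
      also have "\<dots> = ennreal (exp (\<theta>\<^sup>2 * (v + (u' - u) * (norm \<kappa>)\<^sup>2) / 2))"
        by (simp add: ennreal_mult'[symmetric] exp_add[symmetric] distrib_left add_divide_distrib)
      finally show ?thesis .
    qed
    then show ?thesis using V v(1) uu' by (intro exI[of _ "v + (u' - u) * (norm \<kappa>)\<^sup>2"]) auto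
  qed
qed


text \<open>Gaussian moments in a Hilbert space. The coordinates of the integral are Gaussian and their variances
  add up to the integral of the squared Hilbert--Schmidt norm. Jensen's inequality with the variances as
  weights reduces the moment of the norm to those of the normalised coordinates.\<close>

lemma elem_integral_moment:
  fixes \<phi> :: "('k, 'h::{real_inner, banach, second_countable_topology}) elem_fun" and e :: "'i \<Rightarrow> 'h"
  assumes onb: "is_onb I e" and cI: "countable I" and \<phi>: "elem_on t \<phi>" and t: "t \<in> {0..T}" and m: "m \<ge> 1"
  shows "(\<integral>\<^sup>+\<omega>. ennreal (norm (elem_integral W \<phi> \<omega>) ^ (2 * m)) \<partial>M)
    \<le> ennreal (gauss_const m) * (\<integral>\<^sup>+s. hs_norm_sq (elem_eval \<phi> s) \<partial>lborel) ^ m"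
proof -
  define L where "L i = map (\<lambda>(a, b, k, h). (a, b, inner (e i) h *\<^sub>R k)) \<phi>" for i
  define P where "P = (\<Union>(a, b, k, h)\<in>set \<phi>. {a, b})"
  have P: "finite P" "P \<subseteq> {0..T}" using \<phi> t by (fastforce simp: P_def elem_on_def)+
  have L: "\<forall>(a, b, k)\<in>set (L i). a \<in> P \<and> b \<in> P \<and> a \<le> b" for i
    using \<phi> by (force simp: L_def P_def elem_on_def)
  have coord: "AE \<omega> in M. inner (e i) (elem_integral W \<phi> \<omega>) = wiener_sum W (L i) \<omega>" for i
  proof -
    have "AE \<omega> in M. \<forall>x\<in>set \<phi>. case x of (a, b, k, h) \<Rightarrow>
        W a (inner (e i) h *\<^sub>R k) \<omega> = inner (e i) h * W a k \<omega> \<and> W b (inner (e i) h *\<^sub>R k) \<omega> = inner (e i) h * W b k \<omega>"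
    proof (intro AE_finite_allI, simp, clarify)
      fix a b k h assume "(a, b, k, h) \<in> set \<phi>"
      then have "a \<in> {0..T}" "b \<in> {0..T}" using P(2) by (auto simp: P_def)
      from W_scale[OF this(1), of "inner (e i) h" k] W_scale[OF this(2), of "inner (e i) h" k]
      show "AE \<omega> in M. W a (inner (e i) h *\<^sub>R k) \<omega> = inner (e i) h * W a k \<omega> \<and> W b (inner (e i) h *\<^sub>R k) \<omega> = inner (e i) h * W b k \<omega>"
        by eventually_elim simp
    qed
    then show ?thesis
    proof eventually_elim
      case (elim \<omega>)
      have "inner (e i) (elem_integral W \<phi> \<omega>) = (\<Sum>(a, b, k, h)\<leftarrow>\<phi>. inner (e i) ((W b k \<omega> - W a k \<omega>) *\<^sub>R h))"
        unfolding elem_integral_def by (induction \<phi>) (auto simp: inner_add_right)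
      also have "\<dots> = wiener_sum W (L i) \<omega>"
        unfolding wiener_sum_def L_def map_map
        by (intro arg_cong[of _ _ sum_list] map_cong refl) (use elim in \<open>auto simp: algebra_simps\<close>)
      finally show ?case .
    qed
  qed
  obtain v where v: "\<And>i. v i \<ge> 0" "\<And>i. (\<integral>\<^sup>+s. ennreal ((norm (step_function (L i) s))\<^sup>2) \<partial>lborel) = ennreal (v i)"
    "\<And>i \<theta>. (\<integral>\<^sup>+\<omega>. ennreal (exp (\<theta> * wiener_sum W (L i) \<omega>)) \<partial>M) = ennreal (exp (\<theta>\<^sup>2 * v i / 2))"
    using wiener_sum_mgf[OF P L] by metis
  have T': "T \<in> {0..T}" using T by simp
  have LT: "\<forall>(a, b, k)\<in>set (L i). a \<in> {0..T} \<and> b \<in> {0..T}" for i using L[of i] P(2) by fastforce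
  have wm: "wiener_sum W (L i) \<in> borel_measurable M" for i
    by (rule measurable_from_subalg[OF subalg[OF T'] wiener_sum_measurable[OF T' LT]])
  have mom: "(\<integral>\<^sup>+\<omega>. ennreal (wiener_sum W (L i) \<omega> ^ (2 * n)) \<partial>M) \<le> ennreal (gauss_const n * v i ^ n)" if "n \<ge> 1" for i n
    by (rule moment_of_mgf[OF wm v(1) that v(3)])
  \<comment> \<open>the variances of the coordinates add up to the integral of the squared Hilbert--Schmidt norm\<close>
  have V: "(\<integral>\<^sup>+s. hs_norm_sq (elem_eval \<phi> s) \<partial>lborel) = (\<integral>\<^sup>+i. ennreal (v i) \<partial>count_space I)"
  proof -
    have ev: "inner (e i) (elem_eval \<phi> s x) = inner x (step_function (L i) s)" for i s x
      unfolding elem_eval_def step_function_def L_def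
      by (induction \<phi>) (auto simp: inner_add_right inner_commute mult_ac)
    have "hs_norm_sq (elem_eval \<phi> s) = (\<integral>\<^sup>+i. ennreal ((norm (step_function (L i) s))\<^sup>2) \<partial>count_space I)" for s
    proof -
      have "hs_norm_sq (elem_eval \<phi> s) = (\<integral>\<^sup>+x. \<integral>\<^sup>+i. ennreal ((inner x (step_function (L i) s))\<^sup>2) \<partial>count_space I \<partial>count_space hs_basis)"
        unfolding hs_norm_sq_eq parseval_nn_integral[OF onb, symmetric] ev ..
      also have "\<dots> = (\<integral>\<^sup>+i. \<integral>\<^sup>+x. ennreal ((inner x (step_function (L i) s))\<^sup>2) \<partial>count_space hs_basis \<partial>count_space I)"
        by (intro nn_integral_count_space_nn_integral cI) auto
      also have "\<dots> = (\<integral>\<^sup>+i. ennreal ((norm (step_function (L i) s))\<^sup>2) \<partial>count_space I)"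
        by (simp add: parseval_nn_integral[OF hs_basis])
      finally show ?thesis .
    qed
    then have "(\<integral>\<^sup>+s. hs_norm_sq (elem_eval \<phi> s) \<partial>lborel) = (\<integral>\<^sup>+s. \<integral>\<^sup>+i. ennreal ((norm (step_function (L i) s))\<^sup>2) \<partial>count_space I \<partial>lborel)"
      by simp
    also have "\<dots> = (\<integral>\<^sup>+i. \<integral>\<^sup>+s. ennreal ((norm (step_function (L i) s))\<^sup>2) \<partial>lborel \<partial>count_space I)"
      by (intro nn_integral_count_space_nn_integral cI) auto
    finally show ?thesis by (simp add: v(2))
  qed
  let ?V = "\<integral>\<^sup>+i. ennreal (v i) \<partial>count_space I"
  show ?thesis
  proof (cases "?V < \<infinity>")
    case False
    then have "?V = \<infinity>" by (simp add: less_top[symmetric])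
    then show ?thesis using m gauss_const_pos[of m] by (simp add: V top_power_ennreal ennreal_mult_top)
  next
    case True
    \<comment> \<open>a coordinate of zero variance vanishes almost surely\<close>
    have zero: "AE \<omega> in M. \<forall>i\<in>I. v i = 0 \<longrightarrow> wiener_sum W (L i) \<omega> = 0"
    proof (subst AE_ball_countable[OF cI], intro ballI)
      fix i
      show "AE \<omega> in M. v i = 0 \<longrightarrow> wiener_sum W (L i) \<omega> = 0"
      proof (cases "v i = 0")
        case True
        then have "(\<integral>\<^sup>+\<omega>. ennreal ((wiener_sum W (L i) \<omega>)\<^sup>2) \<partial>M) = 0"
          using mom[of 1 i] by simp
        then show ?thesis using wm[of i] by (subst (asm) nn_integral_0_iff_AE) auto
      qed simp
    qed
    have cc: "AE \<omega> in M. \<forall>i\<in>I. inner (e i) (elem_integral W \<phi> \<omega>) = wiener_sum W (L i) \<omega>"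
      using coord by (subst AE_ball_countable[OF cI]) auto
    define q where "q i \<omega> = (wiener_sum W (L i) \<omega>)\<^sup>2 / v i" for i \<omega>
    have qm: "q i \<in> borel_measurable M" for i unfolding q_def [abs_def] using wm[of i] by measurable
    have "AE \<omega> in M. ennreal (norm (elem_integral W \<phi> \<omega>) ^ (2 * m))
        \<le> ?V ^ (m - 1) * (\<integral>\<^sup>+i. ennreal (v i) * ennreal (q i \<omega> ^ m) \<partial>count_space I)"
      using zero cc
    proof eventually_elim
      case (elim \<omega>)
      have "ennreal ((norm (elem_integral W \<phi> \<omega>))\<^sup>2) = (\<integral>\<^sup>+i. ennreal (v i) * ennreal (q i \<omega>) \<partial>count_space I)"
        unfolding parseval_nn_integral[OF onb, symmetric]
        by (intro nn_integral_cong) (use elim v(1) in \<open>auto simp: q_def ennreal_mult'[symmetric]\<close>)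
      then have "ennreal (norm (elem_integral W \<phi> \<omega>) ^ (2 * m)) = (\<integral>\<^sup>+i. ennreal (v i) * ennreal (q i \<omega>) \<partial>count_space I) ^ m"
        by (simp add: power_mult ennreal_power[symmetric])
      also have "\<dots> \<le> ?V ^ (m - 1) * (\<integral>\<^sup>+i. ennreal (v i) * ennreal (q i \<omega>) ^ m \<partial>count_space I)"
        by (rule nn_integral_weighted_power_le) (use True m in auto)
      also have "(\<integral>\<^sup>+i. ennreal (v i) * ennreal (q i \<omega>) ^ m \<partial>count_space I) = (\<integral>\<^sup>+i. ennreal (v i) * ennreal (q i \<omega> ^ m) \<partial>count_space I)"
        using v(1) by (simp add: ennreal_power q_def)
      finally show ?case .
    qed
    then have "(\<integral>\<^sup>+\<omega>. ennreal (norm (elem_integral W \<phi> \<omega>) ^ (2 * m)) \<partial>M)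
        \<le> (\<integral>\<^sup>+\<omega>. ?V ^ (m - 1) * (\<integral>\<^sup>+i. ennreal (v i) * ennreal (q i \<omega> ^ m) \<partial>count_space I) \<partial>M)"
      by (rule nn_integral_mono_AE)
    also have "\<dots> = ?V ^ (m - 1) * (\<integral>\<^sup>+\<omega>. \<integral>\<^sup>+i. ennreal (v i) * ennreal (q i \<omega> ^ m) \<partial>count_space I \<partial>M)"
    proof (rule nn_integral_cmult)
      interpret C: sigma_finite_measure "count_space I" by (rule sigma_finite_measure_count_space_countable[OF cI])
      have "(\<lambda>(\<omega>, i). ennreal (v i) * ennreal (q i \<omega> ^ m)) \<in> borel_measurable (M \<Otimes>\<^sub>M count_space I)"
        unfolding split_beta'
        by (rule measurable_compose_countable'[where g = snd and I = I and f = "\<lambda>i w. ennreal (v i) * ennreal (q i (fst w) ^ m)"])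
          (use cI qm in \<open>auto intro!: borel_measurable_times measurable_compose[OF measurable_compose[OF measurable_fst qm]]\<close>)
      then show "(\<lambda>\<omega>. \<integral>\<^sup>+i. ennreal (v i) * ennreal (q i \<omega> ^ m) \<partial>count_space I) \<in> borel_measurable M"
        by (rule C.borel_measurable_nn_integral)
    qed
    also have "(\<integral>\<^sup>+\<omega>. \<integral>\<^sup>+i. ennreal (v i) * ennreal (q i \<omega> ^ m) \<partial>count_space I \<partial>M) = (\<integral>\<^sup>+i. \<integral>\<^sup>+\<omega>. ennreal (v i) * ennreal (q i \<omega> ^ m) \<partial>M \<partial>count_space I)"
      by (intro nn_integral_count_space_nn_integral cI) (use qm in auto)
    also have "\<dots> \<le> (\<integral>\<^sup>+i. ennreal (v i) * ennreal (gauss_const m) \<partial>count_space I)"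
    proof (rule nn_integral_mono)
      fix i
      have "(\<integral>\<^sup>+\<omega>. ennreal (v i) * ennreal (q i \<omega> ^ m) \<partial>M) = ennreal (v i) * (\<integral>\<^sup>+\<omega>. ennreal (q i \<omega> ^ m) \<partial>M)"
        using qm by (intro nn_integral_cmult) auto
      also have "\<dots> \<le> ennreal (v i) * ennreal (gauss_const m)"
      proof (cases "v i = 0")
        case False
        then have vi: "v i > 0" using v(1)[of i] by simp
        have "(\<integral>\<^sup>+\<omega>. ennreal (q i \<omega> ^ m) \<partial>M) = (\<integral>\<^sup>+\<omega>. ennreal (1 / v i ^ m) * ennreal (wiener_sum W (L i) \<omega> ^ (2 * m)) \<partial>M)"
          using vi by (intro nn_integral_cong) (simp add: q_def ennreal_mult'[symmetric] power_divide power_mult)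
        also have "\<dots> \<le> ennreal (1 / v i ^ m) * ennreal (gauss_const m * v i ^ m)"
          using wm[of i] mom[OF m, of i] by (subst nn_integral_cmult) (auto intro: mult_left_mono)
        also have "\<dots> = ennreal (gauss_const m)"
          using vi gauss_const_pos[of m] by (simp add: ennreal_mult'[symmetric])
        finally show ?thesis by (intro mult_left_mono) auto
      qed simp
      finally show "(\<integral>\<^sup>+\<omega>. ennreal (v i) * ennreal (q i \<omega> ^ m) \<partial>M) \<le> ennreal (v i) * ennreal (gauss_const m)" .
    qed
    also have "\<dots> = ?V * ennreal (gauss_const m)" by (simp add: nn_integral_multc)
    finally have "(\<integral>\<^sup>+\<omega>. ennreal (norm (elem_integral W \<phi> \<omega>) ^ (2 * m)) \<partial>M) \<le> ?V ^ (m - 1) * (?V * ennreal (gauss_const m))"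
      by (simp add: mult_left_mono)
    also have "\<dots> = ennreal (gauss_const m) * ?V ^ m"
      using m by (cases m) (simp_all add: mult_ac)
    finally show ?thesis by (simp add: V)
  qed
qed


text \<open>The measurability under which integrals of Hilbert--Schmidt norms over \<open>[0, t]\<close> are additive.\<close>

definition hs_integrand :: "real \<Rightarrow> (real \<Rightarrow> 'k \<Rightarrow> 'h::{real_inner, banach, second_countable_topology}) \<Rightarrow> bool" where
  "hs_integrand t G \<longleftrightarrow> (\<forall>x. (\<lambda>s. indicator {0..t} s *\<^sub>R G s x) \<in> borel_measurable borel)"

lemma elem_eval_measurable [measurable]:
  "(\<lambda>s. elem_eval \<phi> s x) \<in> borel_measurable borel"
  for \<phi> :: "('k, 'h::{real_inner, banach, second_countable_topology}) elem_fun"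
  unfolding elem_eval_def by (rule borel_measurable_sum_list) (auto simp: split_beta)

lemma hs_indicator: "hs_norm_sq (\<lambda>x. indicator A s *\<^sub>R (L x :: 'h::{real_inner, banach, second_countable_topology}))
    = hs_norm_sq (L :: 'k \<Rightarrow> 'h) * indicator A s"
  by (cases "s \<in> A") (auto simp: hs_norm_sq_eq)

lemma hs_integrand_measurable:
  assumes "hs_integrand t G"
  shows "(\<lambda>s. hs_norm_sq (G s) * indicator {0..t} s) \<in> borel_measurable borel"
  unfolding hs_indicator[symmetric]
  by (rule borel_measurable_hs_norm_sq) (use assms in \<open>simp add: hs_integrand_def\<close>)

lemma hs_integrand_diff:
  assumes "hs_integrand t G" shows "hs_integrand t (\<lambda>s x. elem_eval \<phi> s x - G s x)"
  using assms unfolding hs_integrand_def scaleR_diff_right by (auto intro!: borel_measurable_diff)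

lemma hs_integrand_linear:
  assumes "hs_integrand t G" "bounded_linear R"
  shows "hs_integrand t (\<lambda>s x. R (G s x))"
  unfolding hs_integrand_def
proof
  fix x
  have "(\<lambda>s. R (indicator {0..t} s *\<^sub>R G s x)) \<in> borel_measurable borel"
    using assms(1) linear_continuous_on[OF assms(2), of UNIV]
    by (intro measurable_compose[where f = "\<lambda>s. indicator {0..t} s *\<^sub>R G s x" and g = R and N = borel and M = borel and L = borel])
      (simp_all add: hs_integrand_def borel_measurable_continuous_onI)
  then show "(\<lambda>s. indicator {0..t} s *\<^sub>R R (G s x)) \<in> borel_measurable borel"
    by (simp add: linear_cmul[OF bounded_linear.linear[OF assms(2)]])
qed

lemma elem_integral_measurable:
  fixes \<phi> :: "('k, 'h::{real_inner, banach, second_countable_topology}) elem_fun"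
  assumes "elem_on t \<phi>" "t \<in> {0..T}"
  shows "elem_integral W \<phi> \<in> borel_measurable M"
  unfolding elem_integral_def [abs_def]
proof (rule borel_measurable_sum_list, clarify)
  fix a b k and h :: 'h assume "(a, b, k, h) \<in> set \<phi>"
  then have "a \<in> {0..T}" "b \<in> {0..T}" using assms by (auto simp: elem_on_def)
  from W_measurable[OF this(1), of k] W_measurable[OF this(2), of k]
  show "(\<lambda>\<omega>. (W b k \<omega> - W a k \<omega>) *\<^sub>R h) \<in> borel_measurable M" by simp
qed

lemma elem_eval_outside:
  assumes "elem_on t \<phi>" "s \<notin> {0<..t}" shows "elem_eval \<phi> s x = 0"
proof -
  have "elem_eval \<phi> s x = (\<Sum>x\<leftarrow>\<phi>. 0)"
    unfolding elem_eval_def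
    by (intro arg_cong[of _ _ sum_list] map_cong refl) (use assms in \<open>force simp: elem_on_def indicator_def\<close>)
  then show ?thesis by simp
qed

text \<open>The two squared distances in which an elementary function approximates an integrand and its integral.\<close>

abbreviation hs_dist where
  "hs_dist t \<phi> G \<equiv> \<integral>\<^sup>+s\<in>{0..t}. hs_norm_sq (\<lambda>x. elem_eval \<phi> s x - G s x) \<partial>lborel"

abbreviation sq_dist where
  "sq_dist \<phi> Y \<equiv> \<integral>\<^sup>+\<omega>. ennreal ((norm (elem_integral W \<phi> \<omega> - Y \<omega>))\<^sup>2) \<partial>M"

text \<open>The class of stochastic integrals is closed under bounded operators, extension of the time interval and
  addition. This produces the integral over \<open>[t0, t]\<close> from the stochastic convolutions at
  \<open>t0\<close> and \<open>t\<close>, without an integration theory over general intervals.\<close>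

lemma wiener_integral_linear:
  fixes G :: "real \<Rightarrow> 'k \<Rightarrow> 'h::{real_inner, banach, second_countable_topology}"
    and R :: "'h \<Rightarrow> 'h"
  assumes si: "is_stochastic_integral M W t G Y" and G: "hs_integrand t G" and t: "t \<in> {0..T}" and R: "bounded_linear R"
  shows "is_stochastic_integral M W t (\<lambda>s x. R (G s x)) (\<lambda>\<omega>. R (Y \<omega>))"
proof -
  obtain \<phi> :: "nat \<Rightarrow> ('k, 'h) elem_fun" where \<phi>: "\<And>n. elem_on t (\<phi> n)"
    "(\<lambda>n. hs_dist t (\<phi> n) G) \<longlonglongrightarrow> 0"
    "(\<lambda>n. sq_dist (\<phi> n) Y) \<longlonglongrightarrow> 0"
    and Y: "Y \<in> borel_measurable M"
    using si by (auto simp: is_stochastic_integral_def)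
  obtain B where B: "B > 0" "\<And>x. norm (R x) \<le> norm x * B"
    using bounded_linear.pos_bounded[OF R] by auto
  note lin = bounded_linear.linear[OF R]
  define \<psi> where "\<psi> n = map (\<lambda>(a, b, k, h). (a, b, k, R h)) (\<phi> n)" for n
  have ev: "elem_eval (\<psi> n) s x = R (elem_eval (\<phi> n) s x)" for n s x
  proof -
    have "elem_eval (map (\<lambda>(a, b, k, h). (a, b, k, R h)) l) s x = R (elem_eval l s x)" for l :: "('k, 'h) elem_fun"
      unfolding elem_eval_def by (induction l) (auto simp: linear_add[OF lin] linear_cmul[OF lin] linear_0[OF lin])
    then show ?thesis by (simp add: \<psi>_def)
  qed
  have int: "elem_integral W (\<psi> n) \<omega> = R (elem_integral W (\<phi> n) \<omega>)" for n \<omega>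
  proof -
    have "elem_integral W (map (\<lambda>(a, b, k, h). (a, b, k, R h)) l) \<omega> = R (elem_integral W l \<omega>)" for l :: "('k, 'h) elem_fun"
      unfolding elem_integral_def by (induction l) (auto simp: linear_add[OF lin] linear_cmul[OF lin] linear_0[OF lin])
    then show ?thesis by (simp add: \<psi>_def)
  qed
  have on: "elem_on t (\<psi> n)" for n using \<phi>(1)[of n] by (fastforce simp: elem_on_def \<psi>_def)
  have hs: "hs_norm_sq (\<lambda>x. elem_eval (\<psi> n) s x - R (G s x)) \<le> ennreal (B\<^sup>2) * hs_norm_sq (\<lambda>x. elem_eval (\<phi> n) s x - G s x)" for n s
    unfolding ev using B by (intro hs_norm_sq_mono) (simp_all add: linear_diff[OF lin, symmetric] mult.commute)
  have l1: "(\<lambda>n. hs_dist t (\<psi> n) (\<lambda>s x. R (G s x))) \<longlonglongrightarrow> 0"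
  proof (rule tendsto_sandwich[OF _ _ tendsto_const])
    show "\<forall>\<^sub>F n in sequentially. hs_dist t (\<psi> n) (\<lambda>s x. R (G s x))
        \<le> ennreal (B\<^sup>2) * hs_dist t (\<phi> n) G"
    proof (intro always_eventually allI)
      fix n
      have "hs_dist t (\<psi> n) (\<lambda>s x. R (G s x))
         \<le> (\<integral>\<^sup>+s. ennreal (B\<^sup>2) * (hs_norm_sq (\<lambda>x. elem_eval (\<phi> n) s x - G s x) * indicator {0..t} s) \<partial>lborel)"
        using hs by (intro nn_integral_mono) (auto simp: indicator_def)
      then show "hs_dist t (\<psi> n) (\<lambda>s x. R (G s x))
         \<le> ennreal (B\<^sup>2) * hs_dist t (\<phi> n) G"
        using hs_integrand_measurable[OF hs_integrand_diff[OF G]] by (subst (asm) nn_integral_cmult) auto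
    qed
    show "(\<lambda>n. ennreal (B\<^sup>2) * hs_dist t (\<phi> n) G) \<longlonglongrightarrow> 0"
      using ennreal_tendsto_cmult[OF _ \<phi>(2), of "ennreal (B\<^sup>2)"] by simp
  qed auto
  have sq: "ennreal ((norm (elem_integral W (\<psi> n) \<omega> - R (Y \<omega>)))\<^sup>2) \<le> ennreal (B\<^sup>2) * ennreal ((norm (elem_integral W (\<phi> n) \<omega> - Y \<omega>))\<^sup>2)" for n \<omega>
    using power_mono[OF B(2)[of "elem_integral W (\<phi> n) \<omega> - Y \<omega>"], of 2]
    by (simp add: int linear_diff[OF lin] ennreal_mult'[symmetric] power_mult_distrib mult.commute)
  have l2: "(\<lambda>n. sq_dist (\<psi> n) (\<lambda>\<omega>. R (Y \<omega>))) \<longlonglongrightarrow> 0"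
  proof (rule tendsto_sandwich[OF _ _ tendsto_const])
    show "\<forall>\<^sub>F n in sequentially. sq_dist (\<psi> n) (\<lambda>\<omega>. R (Y \<omega>))
        \<le> ennreal (B\<^sup>2) * sq_dist (\<phi> n) Y"
    proof (intro always_eventually allI)
      fix n
      have "sq_dist (\<psi> n) (\<lambda>\<omega>. R (Y \<omega>))
          \<le> (\<integral>\<^sup>+\<omega>. ennreal (B\<^sup>2) * ennreal ((norm (elem_integral W (\<phi> n) \<omega> - Y \<omega>))\<^sup>2) \<partial>M)"
        using sq by (intro nn_integral_mono)
      then show "sq_dist (\<psi> n) (\<lambda>\<omega>. R (Y \<omega>))
          \<le> ennreal (B\<^sup>2) * sq_dist (\<phi> n) Y"
        using Y elem_integral_measurable[OF \<phi>(1) t] by (subst (asm) nn_integral_cmult) auto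
    qed
    show "(\<lambda>n. ennreal (B\<^sup>2) * sq_dist (\<phi> n) Y) \<longlonglongrightarrow> 0"
      using ennreal_tendsto_cmult[OF _ \<phi>(3), of "ennreal (B\<^sup>2)"] by simp
  qed auto
  have "(\<lambda>\<omega>. R (Y \<omega>)) \<in> borel_measurable M"
    by (intro measurable_compose[OF Y borel_measurable_continuous_onI] linear_continuous_on R)
  then show ?thesis unfolding is_stochastic_integral_def using on l1 l2 by blast
qed

lemma wiener_integral_extend:
  fixes G :: "real \<Rightarrow> 'k \<Rightarrow> 'h::{real_inner, banach, second_countable_topology}"
  assumes si: "is_stochastic_integral M W t0 G Y" and t: "0 \<le> t0" "t0 \<le> t"
  shows "is_stochastic_integral M W t (\<lambda>s x. if s \<le> t0 then G s x else 0) Y"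
proof -
  obtain \<phi> :: "nat \<Rightarrow> ('k, 'h) elem_fun" where \<phi>: "\<And>n. elem_on t0 (\<phi> n)"
    "(\<lambda>n. \<integral>\<^sup>+s\<in>{0..t0}. hs_norm_sq (\<lambda>x. elem_eval (\<phi> n) s x - G s x) \<partial>lborel) \<longlonglongrightarrow> 0"
    "(\<lambda>n. sq_dist (\<phi> n) Y) \<longlonglongrightarrow> 0"
    and Y: "Y \<in> borel_measurable M"
    using si by (auto simp: is_stochastic_integral_def)
  have "(\<integral>\<^sup>+s\<in>{0..t}. hs_norm_sq (\<lambda>x. elem_eval (\<phi> n) s x - (if s \<le> t0 then G s x else 0)) \<partial>lborel)
      = (\<integral>\<^sup>+s\<in>{0..t0}. hs_norm_sq (\<lambda>x. elem_eval (\<phi> n) s x - G s x) \<partial>lborel)" for n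
    using t elem_eval_outside[OF \<phi>(1)]
    by (intro nn_integral_cong) (auto simp: indicator_def hs_norm_sq_eq)
  moreover have "elem_on t (\<phi> n)" for n using \<phi>(1)[of n] t by (fastforce simp: elem_on_def)
  ultimately show ?thesis
    unfolding is_stochastic_integral_def using Y \<phi>(2,3) by (intro conjI exI[of _ \<phi>] allI) simp_all
qed

lemma wiener_integral_add:
  fixes G G' :: "real \<Rightarrow> 'k \<Rightarrow> 'h::{real_inner, banach, second_countable_topology}"
  assumes si: "is_stochastic_integral M W t G Y" "is_stochastic_integral M W t G' Y'"
    and G: "hs_integrand t G" "hs_integrand t G'" and t: "t \<in> {0..T}"
  shows "is_stochastic_integral M W t (\<lambda>s x. G s x + G' s x) (\<lambda>\<omega>. Y \<omega> + Y' \<omega>)"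
proof -
  obtain \<phi> :: "nat \<Rightarrow> ('k, 'h) elem_fun" where \<phi>: "\<And>n. elem_on t (\<phi> n)"
    "(\<lambda>n. hs_dist t (\<phi> n) G) \<longlonglongrightarrow> 0"
    "(\<lambda>n. sq_dist (\<phi> n) Y) \<longlonglongrightarrow> 0"
    and Y: "Y \<in> borel_measurable M"
    using si(1) by (auto simp: is_stochastic_integral_def)
  obtain \<psi> :: "nat \<Rightarrow> ('k, 'h) elem_fun" where \<psi>: "\<And>n. elem_on t (\<psi> n)"
    "(\<lambda>n. hs_dist t (\<psi> n) G') \<longlonglongrightarrow> 0"
    "(\<lambda>n. sq_dist (\<psi> n) Y') \<longlonglongrightarrow> 0"
    and Y': "Y' \<in> borel_measurable M"
    using si(2) by (auto simp: is_stochastic_integral_def)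
  define \<rho> where "\<rho> n = \<phi> n @ \<psi> n" for n
  have ev: "elem_eval (\<rho> n) s x = elem_eval (\<phi> n) s x + elem_eval (\<psi> n) s x" for n s x
    by (simp add: elem_eval_def \<rho>_def)
  have int: "elem_integral W (\<rho> n) \<omega> = elem_integral W (\<phi> n) \<omega> + elem_integral W (\<psi> n) \<omega>" for n \<omega>
    by (simp add: elem_integral_def \<rho>_def)
  have on: "elem_on t (\<rho> n)" for n using \<phi>(1)[of n] \<psi>(1)[of n] by (auto simp: elem_on_def \<rho>_def)
  let ?a = "\<lambda>n. hs_dist t (\<phi> n) G"
  let ?b = "\<lambda>n. hs_dist t (\<psi> n) G'"
  have lim2: "(\<lambda>n. 2 * a n + 2 * b n) \<longlonglongrightarrow> 0" if "a \<longlonglongrightarrow> 0" "b \<longlonglongrightarrow> 0" for a b :: "nat \<Rightarrow> ennreal"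
    using tendsto_add[OF ennreal_tendsto_cmult[OF _ that(1), of 2] ennreal_tendsto_cmult[OF _ that(2), of 2]] by simp
  have l1: "(\<lambda>n. hs_dist t (\<rho> n) (\<lambda>s x. G s x + G' s x)) \<longlonglongrightarrow> 0"
  proof (rule tendsto_sandwich[OF _ _ tendsto_const lim2[OF \<phi>(2) \<psi>(2)]])
    show "\<forall>\<^sub>F n in sequentially. hs_dist t (\<rho> n) (\<lambda>s x. G s x + G' s x) \<le> 2 * ?a n + 2 * ?b n"
    proof (intro always_eventually allI)
      fix n
      have hs: "hs_norm_sq (\<lambda>x. elem_eval (\<rho> n) s x - (G s x + G' s x))
         \<le> 2 * hs_norm_sq (\<lambda>x. elem_eval (\<phi> n) s x - G s x) + 2 * hs_norm_sq (\<lambda>x. elem_eval (\<psi> n) s x - G' s x)" for s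
        using hs_norm_sq_add[of "\<lambda>x. elem_eval (\<phi> n) s x - G s x" "\<lambda>x. elem_eval (\<psi> n) s x - G' s x"]
        by (simp add: ev algebra_simps)
      have "hs_dist t (\<rho> n) (\<lambda>s x. G s x + G' s x)
         \<le> (\<integral>\<^sup>+s. 2 * (hs_norm_sq (\<lambda>x. elem_eval (\<phi> n) s x - G s x) * indicator {0..t} s)
              + 2 * (hs_norm_sq (\<lambda>x. elem_eval (\<psi> n) s x - G' s x) * indicator {0..t} s) \<partial>lborel)"
        using hs by (intro nn_integral_mono) (auto simp: indicator_def)
      then show "hs_dist t (\<rho> n) (\<lambda>s x. G s x + G' s x) \<le> 2 * ?a n + 2 * ?b n"
        using hs_integrand_measurable[OF hs_integrand_diff[OF G(1), of "\<phi> n"]]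
          hs_integrand_measurable[OF hs_integrand_diff[OF G(2), of "\<psi> n"]]
        by (simp add: nn_integral_add nn_integral_cmult)
    qed
  qed auto
  let ?c = "\<lambda>n. sq_dist (\<phi> n) Y"
  let ?d = "\<lambda>n. sq_dist (\<psi> n) Y'"
  have l2: "(\<lambda>n. sq_dist (\<rho> n) (\<lambda>\<omega>. Y \<omega> + Y' \<omega>)) \<longlonglongrightarrow> 0"
  proof (rule tendsto_sandwich[OF _ _ tendsto_const lim2[OF \<phi>(3) \<psi>(3)]])
    show "\<forall>\<^sub>F n in sequentially. sq_dist (\<rho> n) (\<lambda>\<omega>. Y \<omega> + Y' \<omega>) \<le> 2 * ?c n + 2 * ?d n"
    proof (intro always_eventually allI)
      fix n
      have sq: "ennreal ((norm (elem_integral W (\<rho> n) \<omega> - (Y \<omega> + Y' \<omega>)))\<^sup>2)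
         \<le> 2 * ennreal ((norm (elem_integral W (\<phi> n) \<omega> - Y \<omega>))\<^sup>2) + 2 * ennreal ((norm (elem_integral W (\<psi> n) \<omega> - Y' \<omega>))\<^sup>2)" for \<omega>
        using norm_add_sq_le[of "elem_integral W (\<phi> n) \<omega> - Y \<omega>" "elem_integral W (\<psi> n) \<omega> - Y' \<omega>"]
        by (simp add: int add_diff_add ennreal_mult'[symmetric] ennreal_plus[symmetric] ennreal_numeral[symmetric] del: ennreal_plus ennreal_numeral)
      have "sq_dist (\<rho> n) (\<lambda>\<omega>. Y \<omega> + Y' \<omega>)
         \<le> (\<integral>\<^sup>+\<omega>. 2 * ennreal ((norm (elem_integral W (\<phi> n) \<omega> - Y \<omega>))\<^sup>2) + 2 * ennreal ((norm (elem_integral W (\<psi> n) \<omega> - Y' \<omega>))\<^sup>2) \<partial>M)"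
        using sq by (intro nn_integral_mono)
      then show "sq_dist (\<rho> n) (\<lambda>\<omega>. Y \<omega> + Y' \<omega>) \<le> 2 * ?c n + 2 * ?d n"
        using Y Y' elem_integral_measurable[OF \<phi>(1) t] elem_integral_measurable[OF \<psi>(1) t]
        by (simp add: nn_integral_add nn_integral_cmult)
    qed
  qed auto
  have "(\<lambda>\<omega>. Y \<omega> + Y' \<omega>) \<in> borel_measurable M" using Y Y' by simp
  then show ?thesis unfolding is_stochastic_integral_def using on l1 l2 by blast
qed

text \<open>The bound for elementary integrands passes to the limit by Fatou's lemma along an almost surely
  convergent subsequence. The elementary integrands have eventually at most \<open>4 V\<close> as squared norm, which
  is enough and avoids continuity of the norm.\<close>

lemma wiener_integral_moment:
  fixes G :: "real \<Rightarrow> 'k \<Rightarrow> 'h::{real_inner, banach, second_countable_topology}"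
  assumes si: "is_stochastic_integral M W t G Y" and G: "hs_integrand t G" and t: "t \<in> {0..T}"
    and V: "V > 0" "(\<integral>\<^sup>+s\<in>{0..t}. hs_norm_sq (G s) \<partial>lborel) \<le> ennreal V" and m: "m \<ge> 1"
  shows "(\<integral>\<^sup>+\<omega>. ennreal (norm (Y \<omega>) ^ (2 * m)) \<partial>M) \<le> ennreal (gauss_const m * (4 * V) ^ m)"
proof -
  obtain \<phi> :: "nat \<Rightarrow> ('k, 'h) elem_fun" where \<phi>: "\<And>n. elem_on t (\<phi> n)"
    "(\<lambda>n. hs_dist t (\<phi> n) G) \<longlonglongrightarrow> 0"
    "(\<lambda>n. sq_dist (\<phi> n) Y) \<longlonglongrightarrow> 0"
    and Y[measurable]: "Y \<in> borel_measurable M"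
    using si by (auto simp: is_stochastic_integral_def)
  have [measurable]: "elem_integral W (\<phi> n) \<in> borel_measurable M" for n by (rule elem_integral_measurable[OF \<phi>(1) t])
  have "\<forall>\<^sub>F n in sequentially. hs_dist t (\<phi> n) G < ennreal V"
    "\<forall>\<^sub>F n in sequentially. sq_dist (\<phi> n) Y < 1"
    using V by (auto intro!: order_tendstoD(2)[OF \<phi>(2)] order_tendstoD(2)[OF \<phi>(3)])
  then have "\<forall>\<^sub>F n in sequentially. hs_dist t (\<phi> n) G < ennreal V \<and>
     sq_dist (\<phi> n) Y < 1"
    by (rule eventually_conj)
  then obtain N where N: "\<And>n. n \<ge> N \<Longrightarrow> hs_dist t (\<phi> n) G < ennreal V"
    "\<And>n. n \<ge> N \<Longrightarrow> sq_dist (\<phi> n) Y < 1"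
    unfolding eventually_sequentially by blast
  have bound: "(\<integral>\<^sup>+\<omega>. ennreal (norm (elem_integral W (\<phi> n) \<omega>) ^ (2 * m)) \<partial>M) \<le> ennreal (gauss_const m * (4 * V) ^ m)" if n: "n \<ge> N" for n
  proof -
    have hs: "hs_norm_sq (elem_eval (\<phi> n) s) \<le> 2 * (hs_norm_sq (\<lambda>x. elem_eval (\<phi> n) s x - G s x) * indicator {0..t} s)
        + 2 * (hs_norm_sq (G s) * indicator {0..t} s)" for s
    proof (cases "s \<in> {0..t}")
      case True
      then show ?thesis using hs_norm_sq_add[of "\<lambda>x. elem_eval (\<phi> n) s x - G s x" "G s"] by simp
    next
      case False
      then have "elem_eval (\<phi> n) s x = 0" for x by (intro elem_eval_outside[OF \<phi>(1)]) auto
      then show ?thesis by (simp add: hs_norm_sq_eq)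
    qed
    have "(\<integral>\<^sup>+s. hs_norm_sq (elem_eval (\<phi> n) s) \<partial>lborel) \<le>
       (\<integral>\<^sup>+s. 2 * (hs_norm_sq (\<lambda>x. elem_eval (\<phi> n) s x - G s x) * indicator {0..t} s)
        + 2 * (hs_norm_sq (G s) * indicator {0..t} s) \<partial>lborel)"
      using hs by (intro nn_integral_mono)
    also have "\<dots> = 2 * hs_dist t (\<phi> n) G
        + 2 * (\<integral>\<^sup>+s\<in>{0..t}. hs_norm_sq (G s) \<partial>lborel)"
      using hs_integrand_measurable[OF G] hs_integrand_measurable[OF hs_integrand_diff[OF G, of "\<phi> n"]]
      by (simp add: nn_integral_add nn_integral_cmult)
    also have "\<dots> \<le> 2 * ennreal V + 2 * ennreal V"
      using N(1)[OF n] V(2) by (intro add_mono mult_left_mono) auto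
    also have "\<dots> = ennreal (4 * V)"
      using V by (simp add: ennreal_mult'[symmetric] ennreal_plus[symmetric] ennreal_numeral[symmetric] del: ennreal_plus ennreal_numeral)
    finally have "(\<integral>\<^sup>+s. hs_norm_sq (elem_eval (\<phi> n) s) \<partial>lborel) \<le> ennreal (4 * V)" .
    then have "ennreal (gauss_const m) * (\<integral>\<^sup>+s. hs_norm_sq (elem_eval (\<phi> n) s) \<partial>lborel) ^ m
        \<le> ennreal (gauss_const m) * ennreal (4 * V) ^ m"
      by (intro mult_left_mono power_mono) auto
    also have "\<dots> = ennreal (gauss_const m * (4 * V) ^ m)"
      using V gauss_const_pos[of m] by (simp add: ennreal_power ennreal_mult'[symmetric])
    finally show ?thesis
      using elem_integral_moment[OF hs_basis countable_hs_basis \<phi>(1)[of n] t m] by (rule order_trans[rotated])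
  qed
  define f where "f n \<omega> = (norm (elem_integral W (\<phi> (n + N)) \<omega> - Y \<omega>))\<^sup>2" for n \<omega>
  have fi: "integrable M (f n)" for n
    using N(2)[of "n + N"] unfolding f_def [abs_def]
    by (intro integrableI_bounded) (auto intro: order_less_trans[OF _ ennreal_one_less_top] simp: less_top[symmetric])
  have "(\<lambda>n. \<integral>\<omega>. norm (f n \<omega>) \<partial>M) \<longlonglongrightarrow> 0"
  proof -
    have "(\<lambda>n. ennreal (\<integral>\<omega>. norm (f n \<omega>) \<partial>M)) \<longlonglongrightarrow> ennreal 0"
    proof -
      have "ennreal (\<integral>\<omega>. norm (f n \<omega>) \<partial>M) = (\<integral>\<^sup>+\<omega>. ennreal (norm (f n \<omega>)) \<partial>M)" for n
        using fi by (intro nn_integral_eq_integral[symmetric]) auto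
      then show ?thesis using LIMSEQ_ignore_initial_segment[OF \<phi>(3), of N] by (simp add: f_def)
    qed
    then show ?thesis by (subst (asm) tendsto_ennreal_iff) auto
  qed
  from tendsto_L1_AE_subseq[OF fi this]
  obtain r where r: "strict_mono r" "AE \<omega> in M. (\<lambda>n. f (r n) \<omega>) \<longlonglongrightarrow> 0" by auto
  have "AE \<omega> in M. ennreal (norm (Y \<omega>) ^ (2 * m)) \<le> liminf (\<lambda>n. ennreal (norm (elem_integral W (\<phi> (r n + N)) \<omega>) ^ (2 * m)))"
    using r(2)
  proof eventually_elim
    case (elim \<omega>)
    have "(\<lambda>n. sqrt (f (r n) \<omega>)) \<longlonglongrightarrow> sqrt 0" by (intro tendsto_intros elim)
    then have "(\<lambda>n. elem_integral W (\<phi> (r n + N)) \<omega> - Y \<omega>) \<longlonglongrightarrow> 0"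
      by (simp add: f_def tendsto_norm_zero_iff)
    then have "(\<lambda>n. elem_integral W (\<phi> (r n + N)) \<omega>) \<longlonglongrightarrow> Y \<omega>" by (simp add: LIM_zero_iff)
    then have "(\<lambda>n. ennreal (norm (elem_integral W (\<phi> (r n + N)) \<omega>) ^ (2 * m))) \<longlonglongrightarrow> ennreal (norm (Y \<omega>) ^ (2 * m))"
      by (intro tendsto_intros)
    from lim_imp_Liminf[OF _ this] show ?case by simp
  qed
  then have "(\<integral>\<^sup>+\<omega>. ennreal (norm (Y \<omega>) ^ (2 * m)) \<partial>M) \<le> (\<integral>\<^sup>+\<omega>. liminf (\<lambda>n. ennreal (norm (elem_integral W (\<phi> (r n + N)) \<omega>) ^ (2 * m))) \<partial>M)"
    by (rule nn_integral_mono_AE)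
  also have "\<dots> \<le> liminf (\<lambda>n. \<integral>\<^sup>+\<omega>. ennreal (norm (elem_integral W (\<phi> (r n + N)) \<omega>) ^ (2 * m)) \<partial>M)"
    by (rule nn_integral_liminf) measurable
  also have "\<dots> \<le> ennreal (gauss_const m * (4 * V) ^ m)"
    by (rule Liminf_le) (use bound in auto)
  finally show ?thesis .
qed

end


section \<open>Convolution with the semigroup\<close>

locale mild_setting = diag_semigroup I lam e \<kappa> c + smooth_field F D
  for I :: "'i set" and lam and e :: "'i \<Rightarrow> 'h::{real_inner, banach, second_countable_topology}" and \<kappa> c
    and F :: "'h \<Rightarrow> 'h" and D
begin

definition conv :: "real \<Rightarrow> (real \<Rightarrow> 'h) \<Rightarrow> real \<Rightarrow> 'h" where
  "conv a G t = (LBINT s:{a..t}. S (t - s) (G s))"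

lemma conv_integrand_continuous:
  assumes "continuous_on {a..t} G"
  shows "continuous_on {a..t} (\<lambda>s. S (t - s) (G s))"
  unfolding continuous_on_def
proof
  fix s assume s: "s \<in> {a..t}"
  show "((\<lambda>s. S (t - s) (G s)) \<longlongrightarrow> S (t - s) (G s)) (at s within {a..t})"
  proof (rule S_tendsto[where b = "t - a"])
    show "\<forall>\<^sub>F x in at s within {a..t}. t - x \<in> {0..t - a}"
      by (auto simp: eventually_at_filter)
    show "(G \<longlongrightarrow> G s) (at s within {a..t})" using assms s by (simp add: continuous_on_def)
  qed (use s in \<open>auto intro!: tendsto_intros\<close>)
qed

lemma conv_integrable: "continuous_on {a..t} G \<Longrightarrow> set_integrable lborel {a..t} (\<lambda>s. S (t - s) (G s))"
  by (intro set_integrable_continuous_Icc conv_integrand_continuous)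

lemma S_norm_le: "0 \<le> t \<Longrightarrow> t \<le> b \<Longrightarrow> norm (S t v) \<le> exp (\<kappa> * b) * norm v"
  using S_norm[of t v] kappa mult_right_mono[of "exp (\<kappa> * t)" "exp (\<kappa> * b)" "norm v"]
  by (force simp: mult_left_mono)

lemma conv_cong:
  "(\<And>s. s \<in> {a..t} \<Longrightarrow> G s = H s) \<Longrightarrow> conv a G t = conv a H t"
  unfolding conv_def by (intro set_lebesgue_integral_cong) auto

lemma conv_add:
  assumes "continuous_on {a..t} G" "continuous_on {a..t} H"
  shows "conv a (\<lambda>s. G s + H s) t = conv a G t + conv a H t"
proof -
  have "conv a (\<lambda>s. G s + H s) t = (LBINT s:{a..t}. S (t - s) (G s) + S (t - s) (H s))"
    unfolding conv_def
    by (intro set_lebesgue_integral_cong) (auto simp: linear_add[OF bounded_linear.linear[OF S_bounded_linear]])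
  then show ?thesis
    unfolding conv_def by (simp add: set_integral_add(2) conv_integrable assms)
qed

lemma conv_norm_le:
  assumes G: "continuous_on {a..t} G" and b: "t - a \<le> b"
  shows "norm (conv a G t) \<le> exp (\<kappa> * b) * (LBINT s:{a..t}. norm (G s))"
proof -
  have "norm (conv a G t) \<le> (LBINT s:{a..t}. norm (S (t - s) (G s)))"
    unfolding conv_def by (rule set_integral_norm_bound[OF conv_integrable[OF G]])
  also have "\<dots> \<le> (LBINT s:{a..t}. exp (\<kappa> * b) * norm (G s))"
    using b by (intro set_integral_mono set_integrable_continuous_Icc continuous_intros
        conv_integrand_continuous G S_norm_le) auto
  finally show ?thesis by simp
qed

text \<open>Dominated convergence, with the integrands extended by 0 to a common interval.\<close>

lemma conv_continuous:
  assumes G: "continuous_on {a..b} G"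
  shows "continuous_on {a..b} (conv a G)"
  unfolding continuous_on_sequentially
proof (intro allI ballI impI, elim conjE)
  fix X x assume x: "x \<in> {a..b}" and X: "\<forall>n. X n \<in> {a..b}" "X \<longlonglongrightarrow> x"
  obtain B where B: "\<And>s. s \<in> {a..b} \<Longrightarrow> norm (G s) \<le> B"
    using compact_imp_bounded[OF compact_continuous_image[OF G compact_Icc]]
    unfolding bounded_iff by blast
  have cG: "continuous_on {a..y} G" if "y \<in> {a..b}" for y
    using G that by (auto intro: continuous_on_subset)
  show "(conv a G \<circ> X) \<longlonglongrightarrow> conv a G x"
    unfolding comp_def conv_def set_lebesgue_integral_def
  proof (rule integral_dominated_convergence)
    show "(\<lambda>s. indicator {a..x} s *\<^sub>R S (x - s) (G s)) \<in> borel_measurable lborel"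
      using conv_integrable[OF cG[OF x]] by (auto simp: set_integrable_def)
    show "(\<lambda>s. indicator {a..X n} s *\<^sub>R S (X n - s) (G s)) \<in> borel_measurable lborel" for n
      using conv_integrable[OF cG] X(1) by (auto simp: set_integrable_def)
    show "integrable lborel (\<lambda>s. indicator {a..b} s *\<^sub>R (exp (\<kappa> * (b - a)) * B))"
      using set_integrable_continuous_Icc[of a b "\<lambda>_. exp (\<kappa> * (b - a)) * B"] by (simp add: set_integrable_def)
    have "norm (indicator {a..X n} s *\<^sub>R S (X n - s) (G s)) \<le> indicator {a..b} s *\<^sub>R (exp (\<kappa> * (b - a)) * B)" for n s
    proof (cases "s \<in> {a..X n}")
      case True
      then have s: "s \<in> {a..b}" using X(1)[rule_format, of n] by auto
      have "norm (S (X n - s) (G s)) \<le> exp (\<kappa> * (b - a)) * norm (G s)"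
        using True X(1)[rule_format, of n] by (intro S_norm_le) auto
      also have "\<dots> \<le> exp (\<kappa> * (b - a)) * B" using B[OF s] by simp
      finally show ?thesis using True s by simp
    next
      case False
      have "0 \<le> B" using order_trans[OF norm_ge_zero B[OF x]] .
      then show ?thesis using False by (simp del: atLeastAtMost_iff)
    qed
    then show "AE s in lborel. norm (indicator {a..X n} s *\<^sub>R S (X n - s) (G s)) \<le> indicator {a..b} s *\<^sub>R (exp (\<kappa> * (b - a)) * B)" for n
      by simp
    have "(\<lambda>n. indicator {a..X n} s *\<^sub>R S (X n - s) (G s)) \<longlonglongrightarrow> indicator {a..x} s *\<^sub>R S (x - s) (G s)"
      if "s \<noteq> x" for s
    proof (cases "a \<le> s \<and> s < x")
      case True
      then have ev: "\<forall>\<^sub>F n in sequentially. s < X n" using X(2) by (intro order_tendstoD) auto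
      have "(\<lambda>n. S (X n - s) (G s)) \<longlonglongrightarrow> S (x - s) (G s)"
      proof (rule S_tendsto[where b = "b - a"])
        show "\<forall>\<^sub>F n in sequentially. X n - s \<in> {0..b - a}"
          using ev
        proof eventually_elim
          case (elim n)
          then show ?case using X(1)[rule_format, of n] True by auto
        qed
        show "(\<lambda>n. X n - s) \<longlonglongrightarrow> x - s" by (intro tendsto_intros X)
      qed (use True x in auto)
      moreover have "\<forall>\<^sub>F n in sequentially. S (X n - s) (G s) = indicator {a..X n} s *\<^sub>R S (X n - s) (G s)"
        using ev by eventually_elim (use True in auto)
      ultimately show ?thesis using True by (auto intro: Lim_transform_eventually)
    next
      case False
      have "\<forall>\<^sub>F n in sequentially. 0 = indicator {a..X n} s *\<^sub>R S (X n - s) (G s)"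
      proof (cases "s < a")
        case False
        then have "x < s" using \<open>\<not> (a \<le> s \<and> s < x)\<close> that by linarith
        then have "\<forall>\<^sub>F n in sequentially. X n < s" using X(2) by (intro order_tendstoD) auto
        then show ?thesis by eventually_elim auto
      qed auto
      then have "(\<lambda>n. indicator {a..X n} s *\<^sub>R S (X n - s) (G s)) \<longlonglongrightarrow> 0"
        by (rule Lim_transform_eventually[OF tendsto_const])
      then show ?thesis using False that by (auto simp: indicator_def)
    qed
    then show "AE s in lborel. (\<lambda>n. indicator {a..X n} s *\<^sub>R S (X n - s) (G s)) \<longlonglongrightarrow> indicator {a..x} s *\<^sub>R S (x - s) (G s)"
      using AE_lborel_singleton[of x] by (auto elim: eventually_mono)
  qed
qed

text \<open>The semigroup law for the convolution: it turns the mild equation started at 0 into the one started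
  at \<open>t0\<close>.\<close>

lemma conv_split:
  assumes G: "continuous_on {a..t} G" and t0: "a \<le> t0" "t0 \<le> t"
  shows "conv a G t = S (t - t0) (conv a G t0) + conv t0 G t"
proof -
  have i: "set_integrable lborel {a..t} (\<lambda>s. S (t - s) (G s))" by (rule conv_integrable[OF G])
  have "{a..t} = {a..t0} \<union> {t0..t}" using t0 by auto
  then have "conv a G t = (LBINT s:{a..t0} \<union> {t0..t}. S (t - s) (G s))" by (simp add: conv_def)
  also have "\<dots> = (LBINT s:{a..t0}. S (t - s) (G s)) + conv t0 G t"
    unfolding conv_def
  proof (rule set_integral_Un_AE)
    show "AE x in lborel. \<not> (x \<in> {a..t0} \<and> x \<in> {t0..t})"
      using AE_lborel_singleton[of t0] by (auto elim: eventually_mono)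
  qed (use i t0 in \<open>auto intro: set_integrable_subset\<close>)
  also have "(LBINT s:{a..t0}. S (t - s) (G s)) = (LBINT s:{a..t0}. S (t - t0) (S (t0 - s) (G s)))"
    by (intro set_lebesgue_integral_cong) (use t0 in \<open>auto simp: S_add\<close>)
  also have "\<dots> = S (t - t0) (conv a G t0)"
  proof -
    have bl: "bounded_linear (S (t - t0))" using t0 by (intro S_bounded_linear) simp
    have "integrable lborel (\<lambda>s. indicator {a..t0} s *\<^sub>R S (t0 - s) (G s))"
      using conv_integrable[OF continuous_on_subset[OF G], of a t0] t0 by (simp add: set_integrable_def)
    then show ?thesis
      unfolding conv_def set_lebesgue_integral_def
      by (subst integral_bounded_linear[OF bl, symmetric])
        (simp_all add: linear_cmul[OF bounded_linear.linear[OF bl]])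
  qed
  finally show ?thesis .
qed

lemma conv_same [simp]: "conv t0 G t0 = 0"
  unfolding conv_def set_lebesgue_integral_def
proof (rule integral_eq_zero_AE)
  show "AE s in lborel. indicator {t0..t0} s *\<^sub>R S (t0 - s) (G s) = 0"
    using AE_lborel_singleton[of t0] by eventually_elim auto
qed

section \<open>Values of trees and woods along a path\<close>

text \<open>The process \<open>\<Phi>\<close> of a tree along a fixed path \<open>x\<close> of the solution and a fixed path \<open>z\<close> of the stochastic
  convolution; all identities between such processes are pathwise.\<close>

fun tree_value :: "(real \<Rightarrow> 'h) \<Rightarrow> (real \<Rightarrow> 'h) \<Rightarrow> real \<Rightarrow> rtree \<Rightarrow> real \<Rightarrow> 'h" where
  "tree_value x z t0 (RNode L0 cs) = (\<lambda>t. S (t - t0) (x t0) - x t0)"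
| "tree_value x z t0 (RNode L2 cs) = (\<lambda>t. z t - S (t - t0) (z t0))"
| "tree_value x z t0 (RNode q cs) =
     conv t0 (\<lambda>s. kernel q (length cs) (x t0) (x s - x t0) (map (\<lambda>c. tree_value x z t0 c s) cs))"

lemma tree_value_integral:
  "q \<in> {L1, L1star} \<Longrightarrow> tree_value x z t0 (RNode q cs) =
     conv t0 (\<lambda>s. kernel q (length cs) (x t0) (x s - x t0) (map (\<lambda>c. tree_value x z t0 c s) cs))"
  by auto

lemma kernel_continuous:
  assumes q: "q \<in> {L1, L1star}" and v: "continuous_on A v" and d: "continuous_on A d"
    and gs: "\<And>c. c \<in> set cs \<Longrightarrow> continuous_on A (g c)"
  shows "continuous_on A (\<lambda>s. kernel q (length cs) (v s) (d s) (map (\<lambda>c. g c s) cs))"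
  unfolding continuous_on_def
proof
  fix s assume s: "s \<in> A"
  have "((\<lambda>k. kernel q (length cs) (v k) (d k) (map (\<lambda>g. g k) (map g cs))) \<longlongrightarrow>
      kernel q (length cs) (v s) (d s) (map (\<lambda>c. g c s) cs)) (at s within A)"
    by (rule kernel_tendsto[OF q])
      (use assms s in \<open>auto simp: continuous_on_def list_all2_map1 list_all2_map2 list_all2_same\<close>)
  then show "((\<lambda>s. kernel q (length cs) (v s) (d s) (map (\<lambda>c. g c s) cs)) \<longlongrightarrow>
      kernel q (length cs) (v s) (d s) (map (\<lambda>c. g c s) cs)) (at s within A)"
    by (simp add: comp_def)
qed

context
  fixes x z :: "real \<Rightarrow> 'h" and t0 b :: real
  assumes x: "continuous_on {t0..b} x" and z: "continuous_on {t0..b} z"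
begin

lemma tree_value_continuous: "continuous_on {t0..b} (tree_value x z t0 r)"
proof (induction r)
  case (RNode q cs)
  consider "q = L0" | "q = L2" | "q \<in> {L1, L1star}" by (cases q) auto
  then show ?case
  proof cases
    case 1
    have "continuous_on {t0..b} (\<lambda>t. S (t - t0) (x t0))"
      by (rule continuous_on_compose2[OF S_continuous_on[of "b - t0"]]) (auto intro!: continuous_intros)
    then show ?thesis using 1 by (auto intro!: continuous_intros)
  next
    case 2
    have "continuous_on {t0..b} (\<lambda>t. S (t - t0) (z t0))"
      by (rule continuous_on_compose2[OF S_continuous_on[of "b - t0"]]) (auto intro!: continuous_intros)
    then show ?thesis using 2 z by (auto intro!: continuous_intros)
  next
    case 3
    then show ?thesis
      unfolding tree_value_integral[OF 3]
      by (intro conv_continuous kernel_continuous continuous_intros x RNode.IH) auto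
  qed
qed

lemma tree_value_integrand_continuous:
  "q \<in> {L1, L1star} \<Longrightarrow> continuous_on {t0..b}
     (\<lambda>s. kernel q (length cs) (x t0) (x s - x t0) (map (\<lambda>c. tree_value x z t0 c s) cs))"
  by (intro kernel_continuous continuous_intros x tree_value_continuous)

text \<open>The heart of the expansion. At the expanded node, \<open>taylor_step\<close> produces a remainder with the increment
  of \<open>x\<close> as additional direction; the mild equation splits this increment into three terms, and
  multilinearity distributes the remainder over them. Above the node, multilinearity of the kernels
  carries the resulting sum up to the root.\<close>

lemma tree_value_expand:
  assumes inc: "\<And>t. t \<in> {t0..b} \<Longrightarrow>
      x t - x t0 = tree_value x z t0 (RNode L0 []) t + tree_value x z t0 (RNode L1star []) t + tree_value x z t0 (RNode L2 []) t"
    and "tree_expansion r r' r0 r1 r2" and "t \<in> {t0..b}"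
  shows "tree_value x z t0 r t = tree_value x z t0 r' t + tree_value x z t0 r0 t + tree_value x z t0 r1 t + tree_value x z t0 r2 t"
  using assms(2,3)
proof (induction arbitrary: t rule: tree_expansion.induct)
  case (root cs)
  let ?n = "length cs"
  let ?v = "x t0" and ?d = "\<lambda>s. x s - x t0" and ?xs = "\<lambda>s. map (\<lambda>c. tree_value x z t0 c s) cs"
  let ?k = "\<lambda>q s. kernel L1star (Suc ?n) ?v (?d s) (?xs s @ [tree_value x z t0 (RNode q []) s])"
  have k: "kernel L1star ?n ?v (?d s) (?xs s) = kernel L1 ?n ?v (?d s) (?xs s) + ?k L0 s + ?k L1star s + ?k L2 s"
    if s: "s \<in> {t0..b}" for s
  proof -
    let ?p = "\<lambda>q. tree_value x z t0 (RNode q []) s"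
    have add: "kernel L1star (Suc ?n) ?v d (?xs s @ [a + b]) =
        kernel L1star (Suc ?n) ?v d (?xs s @ [a]) + kernel L1star (Suc ?n) ?v d (?xs s @ [b])" for a b d
      using kernel_add[of L1star "Suc ?n" "?xs s" "[]" ?v d a b] by simp
    have "kernel L1star ?n ?v (?d s) (?xs s) = kernel L1 ?n ?v (?d s) (?xs s) + kernel L1star (Suc ?n) ?v (?d s) (?xs s @ [?d s])"
      by (rule taylor_step) simp
    also have "kernel L1star (Suc ?n) ?v (?d s) (?xs s @ [?d s]) = kernel L1star (Suc ?n) ?v (?d s) (?xs s @ [(?p L0 + ?p L1star) + ?p L2])"
      by (subst (2) inc[OF s]) (rule refl)
    finally show ?thesis unfolding add by (simp only: add.assoc)
  qed
  have c1: "continuous_on {t0..t} (\<lambda>s. kernel L1 ?n ?v (?d s) (?xs s))"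
    using tree_value_integrand_continuous[of L1 cs] root by (auto intro: continuous_on_subset)
  have c2: "continuous_on {t0..t} (?k q)" for q
    using tree_value_integrand_continuous[of L1star "cs @ [RNode q []]"] root by (auto intro: continuous_on_subset)
  have e: "tree_value x z t0 (RNode L1star (cs @ [RNode q []])) t = conv t0 (?k q) t" for q
    by simp
  have e1: "tree_value x z t0 (RNode L1 cs) t = conv t0 (\<lambda>s. kernel L1 ?n ?v (?d s) (?xs s)) t"
    by simp
  have "tree_value x z t0 (RNode L1star cs) t = conv t0 (\<lambda>s. kernel L1 ?n ?v (?d s) (?xs s) + ?k L0 s + ?k L1star s + ?k L2 s) t"
    unfolding tree_value.simps by (rule conv_cong) (use k root in auto)
  also have "\<dots> = conv t0 (\<lambda>s. kernel L1 ?n ?v (?d s) (?xs s)) t + conv t0 (?k L0) t + conv t0 (?k L1star) t + conv t0 (?k L2) t"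
    by (simp only: conv_add continuous_on_add c1 c2)
  finally show ?case by (simp only: e e1)
next
  case (below c c' c0 c1 c2 q as bs)
  let ?n = "Suc (length as + length bs)"
  let ?A = "\<lambda>s. map (\<lambda>c. tree_value x z t0 c s) as" and ?B = "\<lambda>s. map (\<lambda>c. tree_value x z t0 c s) bs"
  let ?k = "\<lambda>c s. kernel q ?n (x t0) (x s - x t0) (?A s @ tree_value x z t0 c s # ?B s)"
  have e: "tree_value x z t0 (RNode q (as @ c # bs)) t = conv t0 (?k c) t" for c
    unfolding tree_value_integral[OF below.hyps(2)] by simp
  have k: "?k c s = ?k c' s + ?k c0 s + ?k c1 s + ?k c2 s" if s: "s \<in> {t0..b}" for s
    using below.IH[OF s] by (simp add: kernel_add[OF below.hyps(2)])
  have cc: "continuous_on {t0..t} (?k c)" for c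
    using tree_value_integrand_continuous[OF below.hyps(2), of "as @ c # bs"] below.prems
    by (auto intro: continuous_on_subset)
  have "conv t0 (?k c) t = conv t0 (\<lambda>s. ?k c' s + ?k c0 s + ?k c1 s + ?k c2 s) t"
    by (rule conv_cong) (use k below.prems in auto)
  also have "\<dots> = conv t0 (?k c') t + conv t0 (?k c0) t + conv t0 (?k c1) t + conv t0 (?k c2) t"
    by (simp only: conv_add continuous_on_add cc)
  finally show ?case by (simp only: e)
qed

text \<open>The value of the initial wood is the increment of \<open>x\<close>, and expanding a node does not change the value
  of a wood.\<close>

lemma wood_expansion:
  assumes inc: "\<And>t. t \<in> {t0..b} \<Longrightarrow>
      x t - x t0 = tree_value x z t0 (RNode L0 []) t + tree_value x z t0 (RNode L1star []) t + tree_value x z t0 (RNode L2 []) t"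
    and w: "w \<in> SW'" and t: "t \<in> {t0..b}"
  shows "(\<Sum>tr\<leftarrow>w. tree_value x z t0 (rose tr 1) t) = x t - x t0"
  using w
proof (induction rule: SW'.induct)
  case base
  then show ?case using inc[OF t] by (simp add: wood0_def good_single(2) add.assoc del: One_nat_def)
next
  case (step w ij)
  obtain i j where ij: "ij = (i, j)" by fastforce
  note a = acnD[OF step.hyps(2)[unfolded ij]]
  let ?f = "\<lambda>tr. tree_value x z t0 (rose tr 1) t"
  let ?t = "w ! (i - 1)"
  have "good_tree 0 0 ?t" using SW'_good[OF step.hyps(1)] a(1) by simp
  then have "tree_expansion (rose ?t 1) (rose (relabel ?t j) 1) (rose (add_node ?t j L0) 1)
      (rose (add_node ?t j L1star) 1) (rose (add_node ?t j L2) 1)"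
    using a by (intro tree_expansion_expand) (auto simp: good_tree_def)
  from tree_value_expand[OF inc this t]
  have e: "?f ?t = ?f (relabel ?t j) + ?f (add_node ?t j L0) + ?f (add_node ?t j L1star) + ?f (add_node ?t j L2)" .
  have "sum_list (map ?f w) = sum_list (map ?f (take (i - 1) w)) + ?f ?t + sum_list (map ?f (drop (Suc (i - 1)) w))"
    by (subst id_take_nth_drop[OF a(1)]) (simp add: add.assoc)
  moreover have "sum_list (map ?f (expand ij w)) = sum_list (map ?f (take (i - 1) w)) + ?f (relabel ?t j)
      + sum_list (map ?f (drop (Suc (i - 1)) w)) + (?f (add_node ?t j L0) + ?f (add_node ?t j L1star) + ?f (add_node ?t j L2))"
    using a(1) by (simp add: ij expand_def Let_def relabel_def upd_conv_take_nth_drop add.assoc)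
  ultimately show ?case using step.IH e by (simp add: algebra_simps)
qed

end

lemma tree_value_start [simp]: "tree_value x z t0 r t0 = 0"
  by (cases "(x, z, t0, r)" rule: tree_value.cases) auto

lemma Phi_eq_tree_value:
  assumes "t \<in> ST"
  shows "Phi S F D X Z t0 t s \<omega> = tree_value (\<lambda>t. X t \<omega>) (\<lambda>t. Z t \<omega>) t0 (rose t 1) s"
  using assms
proof (induction "len t" arbitrary: t s rule: less_induct)
  case less
  let ?p = "tree_value (\<lambda>t. X t \<omega>) (\<lambda>t. Z t \<omega>) t0"
  have child: "j \<in> nd t" if "j \<in> set (children t 1)" for j
    using that by (auto simp: set_children nd_def)
  have sub: "Phi S F D X Z t0 (subtree t j) s \<omega> = ?p (rose t j) s" if "j \<in> set (children t 1)" for j s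
  proof -
    have "len (subtree t j) < len t" using that by (intro len_subtrees) (simp add: subtrees_eq)
    then show ?thesis
      using less.hyps subtree_in_ST[OF less.prems child[OF that]] rose_subtree[OF less.prems child[OF that]] by simp
  qed
  let ?cs = "children t 1"
  have rose: "rose t 1 = RNode (ntype t 1) (map (rose t) ?cs)" by (rule rose.simps)
  have lmap: "map (\<lambda>g. g s \<omega>) (map (\<lambda>s. Phi S F D X Z t0 s) (subtrees t)) = map (\<lambda>c. ?p c s) (map (rose t) ?cs)" for s
    by (simp add: subtrees_eq sub)
  have lin: "linear (S (s - r))" if "r \<in> {t0..s}" for r
    using that by (intro bounded_linear.linear S_bounded_linear) auto
  show ?case
  proof (cases "ntype t 1 \<in> {L0, L2}")
    case True
    then show ?thesis by (subst Phi.simps) (auto simp: rose simp del: One_nat_def)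
  next
    case False
    show ?thesis
    proof (cases "len t = 1")
      case True
      then have "?cs = []" using children_root_Nil_iff[OF less.prems] by simp
      then show ?thesis
        using False True by (subst Phi.simps) (cases "ntype t 1"; simp add: rose conv_def D_0 del: One_nat_def)
    next
      case l: False
      have ne: "?cs \<noteq> []" using children_root_Nil_iff[OF less.prems] l by simp
      show ?thesis
      proof (cases "ntype t 1 = L1")
        case True
        have "Phi S F D X Z t0 t s \<omega> = (1 / fact (length ?cs)) *\<^sub>R
            (LBINT r:{t0..s}. S (s - r) (D (length ?cs) (X t0 \<omega>) (map (\<lambda>c. ?p c r) (map (rose t) ?cs))))"
          using True l unfolding lmap[symmetric]
          by (subst Phi.simps) (simp add: I1_def subtrees_eq del: One_nat_def map_map)
        also have "\<dots> = (LBINT r:{t0..s}. (1 / fact (length ?cs)) *\<^sub>R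
            S (s - r) (D (length ?cs) (X t0 \<omega>) (map (\<lambda>c. ?p c r) (map (rose t) ?cs))))"
          by (rule set_integral_scaleR_right[symmetric])
        also have "\<dots> = ?p (rose t 1) s"
          unfolding rose True tree_value.simps conv_def
          by (rule set_lebesgue_integral_cong) (auto simp: linear_cmul[OF lin])
        finally show ?thesis .
      next
        case False
        then have q: "ntype t 1 = L1star" using \<open>ntype t 1 \<notin> {L0, L2}\<close> by (cases "ntype t 1") auto
        obtain m where m: "length ?cs = Suc m" using ne by (cases ?cs) auto
        have "Phi S F D X Z t0 t s \<omega> = (LBINT r:{t0..s}. S (s - r)
          (LBINT y:{0..1}. ((1 - y) ^ m / fact m) *\<^sub>R
             D (Suc m) (X t0 \<omega> + y *\<^sub>R (X r \<omega> - X t0 \<omega>)) (map (\<lambda>c. ?p c r) (map (rose t) ?cs))))"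
          using q l m unfolding lmap[symmetric]
          by (subst Phi.simps) (simp add: I1star_def subtrees_eq del: One_nat_def map_map)
        then show ?thesis unfolding rose q tree_value.simps conv_def length_map m by simp
      qed
    qed
  qed
qed

end


section \<open>Measurability of the tree processes\<close>

definition continuous_process :: "'a measure \<Rightarrow> real \<Rightarrow> real \<Rightarrow> (real \<Rightarrow> 'a \<Rightarrow> 'b::topological_space) \<Rightarrow> bool" where
  "continuous_process M a b g \<longleftrightarrow> (\<forall>s\<in>{a..b}. g s \<in> borel_measurable M) \<and> (\<forall>\<omega>\<in>space M. continuous_on {a..b} (\<lambda>s. g s \<omega>))"

lemma continuous_process_subset: "continuous_process M a b g \<Longrightarrow> a \<le> a' \<Longrightarrow> b' \<le> b \<Longrightarrow> continuous_process M a' b' g"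
  unfolding continuous_process_def by (auto intro: continuous_on_subset)

text \<open>Such a process is the pointwise limit of its discretisations in time, which are measurable
  because they involve only countably many times.\<close>

lemma continuous_process_joint:
  fixes g :: "real \<Rightarrow> 'a \<Rightarrow> 'b::{real_normed_vector, second_countable_topology}"
  assumes "a \<le> b" and g: "continuous_process M a b g"
  shows "(\<lambda>w. indicator {a..b} (snd w) *\<^sub>R g (snd w) (fst w)) \<in> borel_measurable (M \<Otimes>\<^sub>M lborel)"
proof (rule borel_measurable_LIMSEQ_metric)
  define p where "p n s = max a (min b (of_int \<lfloor>s * real (Suc n)\<rfloor> / real (Suc n)))" for n s
  have p: "p n s \<in> {a..b}" for n s using assms(1) by (auto simp: p_def)
  show "(\<lambda>w. indicator {a..b} (snd w) *\<^sub>R g (p n (snd w)) (fst w)) \<in> borel_measurable (M \<Otimes>\<^sub>M lborel)" for n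
  proof -
    have "(\<lambda>w. g (max a (min b (of_int \<lfloor>snd w * real (Suc n)\<rfloor> / real (Suc n)))) (fst w)) \<in> borel_measurable (M \<Otimes>\<^sub>M lborel)"
    proof (rule measurable_compose_countable[where g = "\<lambda>w. \<lfloor>snd w * real (Suc n)\<rfloor>"
          and f = "\<lambda>i w. g (max a (min b (of_int i / real (Suc n)))) (fst w)"])
      show "(\<lambda>w. g (max a (min b (of_int i / real (Suc n)))) (fst w)) \<in> borel_measurable (M \<Otimes>\<^sub>M lborel)" for i :: int
        using g assms(1) by (intro measurable_compose[OF measurable_fst]) (auto simp: continuous_process_def)
    qed measurable
    then have [measurable]: "(\<lambda>w. g (p n (snd w)) (fst w)) \<in> borel_measurable (M \<Otimes>\<^sub>M lborel)" by (simp add: p_def)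
    show ?thesis by measurable
  qed
  fix w assume w: "w \<in> space (M \<Otimes>\<^sub>M (lborel :: real measure))"
  obtain \<omega> s where ws: "w = (\<omega>, s)" "\<omega> \<in> space M" using w by (auto simp: space_pair_measure)
  show "(\<lambda>n. indicator {a..b} (snd w) *\<^sub>R g (p n (snd w)) (fst w)) \<longlonglongrightarrow> indicator {a..b} (snd w) *\<^sub>R g (snd w) (fst w)"
  proof (cases "s \<in> {a..b}")
    case True
    have "(\<lambda>n. of_int \<lfloor>s * real (Suc n)\<rfloor> / real (Suc n)) \<longlonglongrightarrow> s"
    proof (rule LIM_zero_cancel, rule Lim_null_comparison)
      show "(\<lambda>n. 1 / real (Suc n)) \<longlonglongrightarrow> 0" by (rule LIMSEQ_Suc[OF lim_1_over_n])
      show "\<forall>\<^sub>F n in sequentially. norm (of_int \<lfloor>s * real (Suc n)\<rfloor> / real (Suc n) - s) \<le> 1 / real (Suc n)"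
      proof (intro always_eventually allI)
        fix n
        have "\<bar>of_int \<lfloor>s * real (Suc n)\<rfloor> - s * real (Suc n)\<bar> \<le> 1" by linarith
        moreover have "of_int \<lfloor>s * real (Suc n)\<rfloor> / real (Suc n) - s = (of_int \<lfloor>s * real (Suc n)\<rfloor> - s * real (Suc n)) / real (Suc n)"
          by (simp add: field_simps)
        ultimately show "norm (of_int \<lfloor>s * real (Suc n)\<rfloor> / real (Suc n) - s) \<le> 1 / real (Suc n)"
          by (simp add: divide_right_mono abs_divide)
      qed
    qed
    then have "(\<lambda>n. p n s) \<longlonglongrightarrow> max a (min b s)" unfolding p_def by (intro tendsto_intros)
    then have "(\<lambda>n. g (p n s) \<omega>) \<longlonglongrightarrow> g s \<omega>"
      using g ws True p by (intro continuous_on_tendsto_compose[of "{a..b}" "\<lambda>s. g s \<omega>"]) (auto simp: continuous_process_def)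
    then show ?thesis using True ws by simp
  qed (simp add: ws)
qed

context mild_setting
begin

lemma continuous_process_conv_integrand:
  assumes G: "continuous_process M a t G"
  shows "continuous_process M a t (\<lambda>s \<omega>. S (t - s) (G s \<omega>))"
  unfolding continuous_process_def
proof (intro conjI ballI)
  fix s assume s: "s \<in> {a..t}"
  show "(\<lambda>\<omega>. S (t - s) (G s \<omega>)) \<in> borel_measurable M"
    using G s by (intro measurable_compose[of "G s" M borel "S (t - s)"] borel_measurable_continuous_onI
        linear_continuous_on S_bounded_linear) (auto simp: continuous_process_def)
qed (use G in \<open>auto simp: continuous_process_def intro: conv_integrand_continuous\<close>)

lemma conv_measurable:
  assumes G: "continuous_process M a b G" and t: "t \<in> {a..b}"
  shows "(\<lambda>\<omega>. conv a (\<lambda>s. G s \<omega>) t) \<in> borel_measurable M"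
proof -
  have "continuous_process M a t G" using continuous_process_subset[OF G, of a t] t by simp
  then have "(\<lambda>w. indicator {a..t} (snd w) *\<^sub>R S (t - snd w) (G (snd w) (fst w))) \<in> borel_measurable (M \<Otimes>\<^sub>M lborel)"
    using t by (intro continuous_process_joint[OF _ continuous_process_conv_integrand]) auto
  then show ?thesis
    unfolding conv_def set_lebesgue_integral_def
    by (intro lborel.borel_measurable_lebesgue_integral) (simp add: split_beta')
qed

text \<open>The arguments form a list, and lists carry no \<open>\<sigma>\<close>-algebra here. Simple functions make sense with values
  in any type, and the kernels are continuous, so approximation by simple functions avoids one.\<close>

lemma kernel_measurable:
  assumes q: "q \<in> {L1, L1star}" and v: "v \<in> borel_measurable M" and d: "d \<in> borel_measurable M"
    and g: "\<And>c. c \<in> set cs \<Longrightarrow> g c \<in> borel_measurable M"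
  shows "(\<lambda>\<omega>. kernel q (length cs) (v \<omega>) (d \<omega>) (map (\<lambda>c. g c \<omega>) cs)) \<in> borel_measurable M"
proof -
  have approx: "\<exists>s. (\<forall>i. simple_function M (s i)) \<and> (\<forall>\<omega>\<in>space M. (\<lambda>i. s i \<omega>) \<longlonglongrightarrow> f \<omega>)"
    if "f \<in> borel_measurable M" for f :: "_ \<Rightarrow> 'h"
    using borel_measurable_implies_sequence_metric[OF that, of 0] by blast
  obtain sv where sv: "\<And>i. simple_function M (sv i)" "\<And>\<omega>. \<omega> \<in> space M \<Longrightarrow> (\<lambda>i. sv i \<omega>) \<longlonglongrightarrow> v \<omega>" using approx[OF v] by auto
  obtain sd where sd: "\<And>i. simple_function M (sd i)" "\<And>\<omega>. \<omega> \<in> space M \<Longrightarrow> (\<lambda>i. sd i \<omega>) \<longlonglongrightarrow> d \<omega>" using approx[OF d] by auto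
  have "\<forall>c\<in>set cs. \<exists>s. (\<forall>i. simple_function M (s i)) \<and> (\<forall>\<omega>\<in>space M. (\<lambda>i. s i \<omega>) \<longlonglongrightarrow> g c \<omega>)"
    using approx[OF g] by blast
  then obtain sg where sg: "\<And>c i. c \<in> set cs \<Longrightarrow> simple_function M (sg c i)"
    "\<And>c \<omega>. c \<in> set cs \<Longrightarrow> \<omega> \<in> space M \<Longrightarrow> (\<lambda>i. sg c i \<omega>) \<longlonglongrightarrow> g c \<omega>"
    by (metis (no_types) bchoice)
  show ?thesis
  proof (rule borel_measurable_LIMSEQ_metric)
    fix i
    have "simple_function M (\<lambda>\<omega>. map (\<lambda>c. sg c i \<omega>) cs')" if "set cs' \<subseteq> set cs" for cs'
      using that
    proof (induction cs')
      case (Cons c cs')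
      then show ?case using simple_function_compose2[of M "sg c i" "\<lambda>\<omega>. map (\<lambda>c. sg c i \<omega>) cs'" "(#)"] sg(1) by simp
    qed simp
    then have "simple_function M (\<lambda>\<omega>. map (\<lambda>c. sg c i \<omega>) cs)" by simp
    from simple_function_compose2[OF simple_function_compose2[OF sv(1) sd(1), of Pair i i] this,
        of "\<lambda>p xs. kernel q (length cs) (fst p) (snd p) xs"]
    have "simple_function M (\<lambda>\<omega>. kernel q (length cs) (sv i \<omega>) (sd i \<omega>) (map (\<lambda>c. sg c i \<omega>) cs))" by simp
    then show "(\<lambda>\<omega>. kernel q (length cs) (sv i \<omega>) (sd i \<omega>) (map (\<lambda>c. sg c i \<omega>) cs)) \<in> borel_measurable M"
      by (rule borel_measurable_simple_function)
  next
    fix \<omega> assume \<omega>: "\<omega> \<in> space M"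
    have "(\<lambda>i. kernel q (length cs) (sv i \<omega>) (sd i \<omega>) (map (\<lambda>g. g i) (map (\<lambda>c i. sg c i \<omega>) cs)))
       \<longlonglongrightarrow> kernel q (length cs) (v \<omega>) (d \<omega>) (map (\<lambda>c. g c \<omega>) cs)"
      by (rule kernel_tendsto[OF q])
        (use sv sd sg \<omega> in \<open>auto simp: list_all2_map1 list_all2_map2 list_all2_same\<close>)
    then show "(\<lambda>i. kernel q (length cs) (sv i \<omega>) (sd i \<omega>) (map (\<lambda>c. sg c i \<omega>) cs))
       \<longlonglongrightarrow> kernel q (length cs) (v \<omega>) (d \<omega>) (map (\<lambda>c. g c \<omega>) cs)"
      by (simp add: comp_def)
  qed
qed

abbreviation tree_process :: "(real \<Rightarrow> 'w \<Rightarrow> 'h) \<Rightarrow> (real \<Rightarrow> 'w \<Rightarrow> 'h) \<Rightarrow> real \<Rightarrow> rtree \<Rightarrow> real \<Rightarrow> 'w \<Rightarrow> 'h" where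
  "tree_process X Z t0 r t \<omega> \<equiv> tree_value (\<lambda>t. X t \<omega>) (\<lambda>t. Z t \<omega>) t0 r t"

lemma continuous_process_tree_process:
  assumes X: "continuous_process M t0 b X" and Z: "continuous_process M t0 b Z"
  shows "continuous_process M t0 b (tree_process X Z t0 r)"
proof -
  have cont: "continuous_on {t0..b} (\<lambda>t. tree_process X Z t0 r t \<omega>)" if "\<omega> \<in> space M" for r \<omega>
    using X Z that by (intro tree_value_continuous) (auto simp: continuous_process_def)
  have "tree_process X Z t0 r t \<in> borel_measurable M" if "t \<in> {t0..b}" for t
    using that
  proof (induction r arbitrary: t)
    case (RNode q cs)
    have [measurable]: "X t \<in> borel_measurable M" "Z t \<in> borel_measurable M" if "t \<in> {t0..b}" for t
      using X Z that by (auto simp: continuous_process_def)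
    have t0: "t0 \<in> {t0..b}" using RNode.prems by auto
    have [measurable]: "S (t - t0) \<in> borel_measurable borel"
      using RNode.prems by (intro borel_measurable_continuous_onI linear_continuous_on S_bounded_linear) auto
    consider "q = L0" | "q = L2" | "q \<in> {L1, L1star}" by (cases q) auto
    then show ?case
    proof cases
      case 3
      have "continuous_process M t0 b (\<lambda>s \<omega>. kernel q (length cs) (X t0 \<omega>) (X s \<omega> - X t0 \<omega>) (map (\<lambda>c. tree_process X Z t0 c s \<omega>) cs))"
        unfolding continuous_process_def
      proof (intro conjI ballI)
        fix s assume s: "s \<in> {t0..b}"
        show "(\<lambda>\<omega>. kernel q (length cs) (X t0 \<omega>) (X s \<omega> - X t0 \<omega>) (map (\<lambda>c. tree_process X Z t0 c s \<omega>) cs)) \<in> borel_measurable M"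
          using s t0 by (intro kernel_measurable 3 RNode.IH borel_measurable_diff) auto
      next
        fix \<omega> assume "\<omega> \<in> space M"
        then show "continuous_on {t0..b} (\<lambda>s. kernel q (length cs) (X t0 \<omega>) (X s \<omega> - X t0 \<omega>) (map (\<lambda>c. tree_process X Z t0 c s \<omega>) cs))"
          using X Z by (intro tree_value_integrand_continuous 3) (auto simp: continuous_process_def)
      qed
      then show ?thesis
        unfolding tree_value_integral[OF 3] by (rule conv_measurable[OF _ RNode.prems])
    qed (use RNode.prems t0 in \<open>simp_all\<close>)
  qed
  then show ?thesis using cont by (auto simp: continuous_process_def)
qed

end

section \<open>The calculus of moment orders\<close>

text \<open>Jensen's inequality inside the expectation, then Tonelli's theorem. With the constant weight it gives
  the order of time integrals, with a singular weight the regularity of the drift.\<close>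

lemma moment_weighted_integral:
  fixes f :: "'a \<Rightarrow> real \<Rightarrow> ennreal" and w :: "real \<Rightarrow> ennreal"
  assumes "sigma_finite_measure M" and f: "(\<lambda>p. f (fst p) (snd p)) \<in> borel_measurable (M \<Otimes>\<^sub>M lborel)" and w: "w \<in> borel_measurable borel"
    and A: "(\<integral>\<^sup>+s. w s \<partial>lborel) \<le> A" "A < \<infinity>" and K: "\<And>s. w s \<noteq> 0 \<Longrightarrow> (\<integral>\<^sup>+\<omega>. f \<omega> s ^ n \<partial>M) \<le> K" and n: "n \<ge> 1"
  shows "(\<integral>\<^sup>+\<omega>. (\<integral>\<^sup>+s. w s * f \<omega> s \<partial>lborel) ^ n \<partial>M) \<le> A ^ n * K"
proof -
  interpret sigma_finite_measure M by fact
  interpret pair_sigma_finite M "lborel :: real measure" ..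
  have [measurable]: "(\<lambda>s. f \<omega> s) \<in> borel_measurable lborel" if "\<omega> \<in> space M" for \<omega>
    using measurable_compose[OF measurable_Pair1'[OF that] f] by simp
  note f[measurable] and w[measurable]
  have "(\<integral>\<^sup>+\<omega>. (\<integral>\<^sup>+s. w s * f \<omega> s \<partial>lborel) ^ n \<partial>M) \<le> (\<integral>\<^sup>+\<omega>. A ^ (n - 1) * (\<integral>\<^sup>+s. w s * f \<omega> s ^ n \<partial>lborel) \<partial>M)"
  proof (rule nn_integral_mono)
    fix \<omega> assume \<omega>: "\<omega> \<in> space M"
    have "(\<integral>\<^sup>+s. w s * f \<omega> s \<partial>lborel) ^ n \<le> (\<integral>\<^sup>+s. w s \<partial>lborel) ^ (n - 1) * (\<integral>\<^sup>+s. w s * f \<omega> s ^ n \<partial>lborel)"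
      using \<omega> A n by (intro nn_integral_weighted_power_le) (auto intro: order_le_less_trans)
    also have "\<dots> \<le> A ^ (n - 1) * (\<integral>\<^sup>+s. w s * f \<omega> s ^ n \<partial>lborel)"
      using A by (intro mult_right_mono power_mono) auto
    finally show "(\<integral>\<^sup>+s. w s * f \<omega> s \<partial>lborel) ^ n \<le> A ^ (n - 1) * (\<integral>\<^sup>+s. w s * f \<omega> s ^ n \<partial>lborel)" .
  qed
  also have "\<dots> = A ^ (n - 1) * (\<integral>\<^sup>+\<omega>. (\<integral>\<^sup>+s. w s * f \<omega> s ^ n \<partial>lborel) \<partial>M)"
    by (rule nn_integral_cmult) (rule lborel.borel_measurable_nn_integral, simp add: split_beta')
  also have "(\<integral>\<^sup>+\<omega>. (\<integral>\<^sup>+s. w s * f \<omega> s ^ n \<partial>lborel) \<partial>M) = (\<integral>\<^sup>+s. (\<integral>\<^sup>+\<omega>. w s * f \<omega> s ^ n \<partial>M) \<partial>lborel)"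
    by (rule Fubini'[symmetric]) (simp add: split_beta')
  also have "\<dots> \<le> (\<integral>\<^sup>+s. w s * K \<partial>lborel)"
  proof (rule nn_integral_mono)
    fix s :: real
    have "(\<lambda>\<omega>. f \<omega> s) \<in> borel_measurable M" using measurable_compose[OF measurable_Pair2'[of s lborel M] f] by simp
    then have "(\<integral>\<^sup>+\<omega>. w s * f \<omega> s ^ n \<partial>M) = w s * (\<integral>\<^sup>+\<omega>. f \<omega> s ^ n \<partial>M)"
      by (intro nn_integral_cmult) auto
    also have "\<dots> \<le> w s * K" using K[of s] by (cases "w s = 0") (auto intro: mult_left_mono)
    finally show "(\<integral>\<^sup>+\<omega>. w s * f \<omega> s ^ n \<partial>M) \<le> w s * K" .
  qed
  also have "\<dots> = (\<integral>\<^sup>+s. w s \<partial>lborel) * K" by (simp add: nn_integral_multc)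
  also have "\<dots> \<le> A * K" using A by (intro mult_right_mono) auto
  finally have "(\<integral>\<^sup>+\<omega>. (\<integral>\<^sup>+s. w s * f \<omega> s \<partial>lborel) ^ n \<partial>M) \<le> A ^ (n - 1) * (A * K)"
    by (simp add: mult_left_mono)
  also have "\<dots> = A ^ n * K" using n by (cases n) (simp_all add: mult_ac)
  finally show ?thesis .
qed

text \<open>Moments as extended nonnegative numbers, so that bounds precede integrability.\<close>

abbreviation moment where
  "moment M n f \<equiv> \<integral>\<^sup>+\<omega>. ennreal (f \<omega> ^ n) \<partial>M"

text \<open>\<open>g t0 t\<close> has order \<open>a\<close>: each of its \<open>L\<^sup>n\<close> norms is at most a constant times the power \<open>a\<close> of \<open>t - t0\<close>,
  with the constant uniform in \<open>t0\<close> and \<open>t\<close>. Natural exponents suffice, and \<open>t = t0\<close> is left out because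
  tree processes vanish there.\<close>

definition moment_order :: "'a measure \<Rightarrow> real \<Rightarrow> real \<Rightarrow> (real \<Rightarrow> real \<Rightarrow> 'a \<Rightarrow> real) \<Rightarrow> bool" where
  "moment_order M T a g \<longleftrightarrow>
     (\<forall>t0 t. 0 \<le> t0 \<and> t0 < t \<and> t \<le> T \<longrightarrow> g t0 t \<in> borel_measurable M \<and> (\<forall>\<omega>\<in>space M. 0 \<le> g t0 t \<omega>)) \<and>
     (\<forall>n\<ge>1. \<exists>C\<ge>0. \<forall>t0 t. 0 \<le> t0 \<and> t0 < t \<and> t \<le> T \<longrightarrow>
        moment M n (g t0 t) \<le> ennreal (C * (t - t0) powr (a * real n)))"

lemma moment_orderD:
  assumes "moment_order M T a g" "0 \<le> t0" "t0 < t" "t \<le> T"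
  shows "g t0 t \<in> borel_measurable M" "\<omega> \<in> space M \<Longrightarrow> 0 \<le> g t0 t \<omega>"
  using assms by (auto simp: moment_order_def)

lemma moment_order_bound:
  assumes "moment_order M T a g" "n \<ge> 1"
  obtains C where "C \<ge> 0" "\<And>t0 t. 0 \<le> t0 \<Longrightarrow> t0 < t \<Longrightarrow> t \<le> T \<Longrightarrow>
        moment M n (g t0 t) \<le> ennreal (C * (t - t0) powr (a * real n))"
proof -
  obtain C where "C \<ge> 0" "\<forall>t0 t. 0 \<le> t0 \<and> t0 < t \<and> t \<le> T \<longrightarrow>
        moment M n (g t0 t) \<le> ennreal (C * (t - t0) powr (a * real n))"
    using assms(1)[unfolded moment_order_def, THEN conjunct2, rule_format, OF assms(2)] by auto
  then show ?thesis by (intro that) auto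
qed

lemma moment_order_le:
  assumes g: "moment_order M T a g" and B: "B \<ge> 0"
    and f: "\<And>t0 t. 0 \<le> t0 \<Longrightarrow> t0 < t \<Longrightarrow> t \<le> T \<Longrightarrow> f t0 t \<in> borel_measurable M"
      "\<And>t0 t \<omega>. 0 \<le> t0 \<Longrightarrow> t0 < t \<Longrightarrow> t \<le> T \<Longrightarrow> \<omega> \<in> space M \<Longrightarrow> 0 \<le> f t0 t \<omega>"
      "\<And>t0 t. 0 \<le> t0 \<Longrightarrow> t0 < t \<Longrightarrow> t \<le> T \<Longrightarrow> AE \<omega> in M. f t0 t \<omega> \<le> B * g t0 t \<omega>"
  shows "moment_order M T a f"
  unfolding moment_order_def
proof (intro conjI allI impI)
  fix n :: nat assume n: "n \<ge> 1"
  obtain C where C: "C \<ge> 0" "\<And>t0 t. 0 \<le> t0 \<Longrightarrow> t0 < t \<Longrightarrow> t \<le> T \<Longrightarrow>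
        moment M n (g t0 t) \<le> ennreal (C * (t - t0) powr (a * real n))"
    using moment_order_bound[OF g n] by blast
  show "\<exists>C\<ge>0. \<forall>t0 t. 0 \<le> t0 \<and> t0 < t \<and> t \<le> T \<longrightarrow>
        moment M n (f t0 t) \<le> ennreal (C * (t - t0) powr (a * real n))"
  proof (intro exI[of _ "B ^ n * C"] conjI allI impI)
    fix t0 t assume t: "0 \<le> t0 \<and> t0 < t \<and> t \<le> T"
    note [measurable] = moment_orderD(1)[OF g, of t0 t]
    have "moment M n (f t0 t) \<le> (\<integral>\<^sup>+\<omega>. ennreal (B ^ n) * ennreal (g t0 t \<omega> ^ n) \<partial>M)"
    proof (rule nn_integral_mono_AE)
      have "AE \<omega> in M. f t0 t \<omega> \<le> B * g t0 t \<omega>" using f(3) t by simp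
      then show "AE \<omega> in M. ennreal (f t0 t \<omega> ^ n) \<le> ennreal (B ^ n) * ennreal (g t0 t \<omega> ^ n)"
        using AE_space
      proof eventually_elim
        case (elim \<omega>)
        have "f t0 t \<omega> ^ n \<le> (B * g t0 t \<omega>) ^ n" using elim f(2) t by (intro power_mono) auto
        then show ?case using B by (simp add: ennreal_mult'[symmetric] power_mult_distrib ennreal_leI)
      qed
    qed
    also have "\<dots> = ennreal (B ^ n) * moment M n (g t0 t)"
      using t by (intro nn_integral_cmult) simp
    also have "\<dots> \<le> ennreal (B ^ n) * ennreal (C * (t - t0) powr (a * real n))"
      using C t by (intro mult_left_mono) auto
    also have "\<dots> = ennreal (B ^ n * C * (t - t0) powr (a * real n))"
      using B by (simp add: ennreal_mult'[symmetric] mult_ac)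
    finally show "moment M n (f t0 t) \<le> ennreal (B ^ n * C * (t - t0) powr (a * real n))" .
  qed (use B C in simp)
qed (use f in auto)

lemma power_add_le: "0 \<le> x \<Longrightarrow> 0 \<le> y \<Longrightarrow> (x + y) ^ n \<le> 2 ^ n * (x ^ n + (y::real) ^ n)"
proof -
  assume "0 \<le> x" "0 \<le> y"
  then have "(x + y) ^ n \<le> (2 * max x y) ^ n" by (intro power_mono) auto
  also have "\<dots> \<le> 2 ^ n * (x ^ n + y ^ n)"
    using \<open>0 \<le> x\<close> \<open>0 \<le> y\<close> by (auto simp: power_mult_distrib max_def)
  finally show ?thesis .
qed

lemma moment_order_add:
  assumes g: "moment_order M T a g" and h: "moment_order M T a h"
  shows "moment_order M T a (\<lambda>t0 t \<omega>. g t0 t \<omega> + h t0 t \<omega>)"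
  unfolding moment_order_def
proof (intro conjI allI impI)
  fix n :: nat assume n: "n \<ge> 1"
  obtain C where C: "C \<ge> 0" "\<And>t0 t. 0 \<le> t0 \<Longrightarrow> t0 < t \<Longrightarrow> t \<le> T \<Longrightarrow>
        moment M n (g t0 t) \<le> ennreal (C * (t - t0) powr (a * real n))"
    using moment_order_bound[OF g n] by blast
  obtain C' where C': "C' \<ge> 0" "\<And>t0 t. 0 \<le> t0 \<Longrightarrow> t0 < t \<Longrightarrow> t \<le> T \<Longrightarrow>
        moment M n (h t0 t) \<le> ennreal (C' * (t - t0) powr (a * real n))"
    using moment_order_bound[OF h n] by blast
  show "\<exists>C\<ge>0. \<forall>t0 t. 0 \<le> t0 \<and> t0 < t \<and> t \<le> T \<longrightarrow>
        (\<integral>\<^sup>+\<omega>. ennreal ((g t0 t \<omega> + h t0 t \<omega>) ^ n) \<partial>M) \<le> ennreal (C * (t - t0) powr (a * real n))"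
  proof (intro exI[of _ "2 ^ n * (C + C')"] conjI allI impI)
    fix t0 t assume t: "0 \<le> t0 \<and> t0 < t \<and> t \<le> T"
    note [measurable] = moment_orderD(1)[OF g, of t0 t] moment_orderD(1)[OF h, of t0 t]
    have "(\<integral>\<^sup>+\<omega>. ennreal ((g t0 t \<omega> + h t0 t \<omega>) ^ n) \<partial>M) \<le> (\<integral>\<^sup>+\<omega>. ennreal (2 ^ n) * (ennreal (g t0 t \<omega> ^ n) + ennreal (h t0 t \<omega> ^ n)) \<partial>M)"
    proof (rule nn_integral_mono)
      fix \<omega> assume "\<omega> \<in> space M"
      then have "0 \<le> g t0 t \<omega>" "0 \<le> h t0 t \<omega>" using moment_orderD(2)[OF g] moment_orderD(2)[OF h] t by auto
      then show "ennreal ((g t0 t \<omega> + h t0 t \<omega>) ^ n) \<le> ennreal (2 ^ n) * (ennreal (g t0 t \<omega> ^ n) + ennreal (h t0 t \<omega> ^ n))"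
        using power_add_le[of "g t0 t \<omega>" "h t0 t \<omega>" n]
        by (simp add: ennreal_mult'[symmetric] ennreal_plus[symmetric] del: ennreal_plus)
    qed
    also have "\<dots> = ennreal (2 ^ n) * (moment M n (g t0 t) + moment M n (h t0 t))"
      using t by (subst nn_integral_cmult) (auto simp: nn_integral_add)
    also have "\<dots> \<le> ennreal (2 ^ n) * (ennreal (C * (t - t0) powr (a * real n)) + ennreal (C' * (t - t0) powr (a * real n)))"
      using C C' t by (intro mult_left_mono add_mono) auto
    also have "\<dots> = ennreal (2 ^ n * (C + C') * (t - t0) powr (a * real n))"
      using C C' by (simp add: ennreal_mult'[symmetric] ennreal_plus[symmetric] algebra_simps del: ennreal_plus)
    finally show "(\<integral>\<^sup>+\<omega>. ennreal ((g t0 t \<omega> + h t0 t \<omega>) ^ n) \<partial>M) \<le> ennreal (2 ^ n * (C + C') * (t - t0) powr (a * real n))" .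
  qed (use C C' in simp)
qed (use moment_orderD[OF g] moment_orderD[OF h] in auto)

text \<open>Orders add up under multiplication, at the price of doubling the exponent of the moments; this is why
  the order is defined with all moments at once.\<close>

lemma moment_order_mult:
  assumes g: "moment_order M T a g" and h: "moment_order M T b h"
  shows "moment_order M T (a + b) (\<lambda>t0 t \<omega>. g t0 t \<omega> * h t0 t \<omega>)"
  unfolding moment_order_def
proof (intro conjI allI impI)
  fix n :: nat assume n: "n \<ge> 1"
  then have n2: "2 * n \<ge> 1" by simp
  obtain C where C: "C \<ge> 0" "\<And>t0 t. 0 \<le> t0 \<Longrightarrow> t0 < t \<Longrightarrow> t \<le> T \<Longrightarrow>
        moment M (2 * n) (g t0 t) \<le> ennreal (C * (t - t0) powr (a * real (2 * n)))"
    using moment_order_bound[OF g n2] by blast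
  obtain C' where C': "C' \<ge> 0" "\<And>t0 t. 0 \<le> t0 \<Longrightarrow> t0 < t \<Longrightarrow> t \<le> T \<Longrightarrow>
        moment M (2 * n) (h t0 t) \<le> ennreal (C' * (t - t0) powr (b * real (2 * n)))"
    using moment_order_bound[OF h n2] by blast
  show "\<exists>C\<ge>0. \<forall>t0 t. 0 \<le> t0 \<and> t0 < t \<and> t \<le> T \<longrightarrow>
        (\<integral>\<^sup>+\<omega>. ennreal ((g t0 t \<omega> * h t0 t \<omega>) ^ n) \<partial>M) \<le> ennreal (C * (t - t0) powr ((a + b) * real n))"
  proof (intro exI[of _ "C + C'"] conjI allI impI)
    fix t0 t assume t: "0 \<le> t0 \<and> t0 < t \<and> t \<le> T"
    note [measurable] = moment_orderD(1)[OF g, of t0 t] moment_orderD(1)[OF h, of t0 t]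
    \<comment> \<open>Young's inequality, with the weight that balances the two orders\<close>
    define l where "l = (t - t0) powr ((b - a) * real n)"
    have l: "l > 0" using t by (simp add: l_def)
    have "(\<integral>\<^sup>+\<omega>. ennreal ((g t0 t \<omega> * h t0 t \<omega>) ^ n) \<partial>M)
       \<le> (\<integral>\<^sup>+\<omega>. ennreal l * ennreal (g t0 t \<omega> ^ (2 * n)) + ennreal (1 / l) * ennreal (h t0 t \<omega> ^ (2 * n)) \<partial>M)"
    proof (rule nn_integral_mono)
      fix \<omega> assume "\<omega> \<in> space M"
      then have "0 \<le> g t0 t \<omega>" "0 \<le> h t0 t \<omega>" using moment_orderD(2)[OF g] moment_orderD(2)[OF h] t by auto
      define u v where "u = g t0 t \<omega> ^ n" and "v = h t0 t \<omega> ^ n"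
      have "u * v \<le> l * u\<^sup>2 + (1 / l) * v\<^sup>2"
      proof -
        have "0 \<le> (l * u - v)\<^sup>2 / l + (l * u\<^sup>2 + v\<^sup>2 / l)" using l by (intro add_nonneg_nonneg) auto
        also have "\<dots> = 2 * (l * u\<^sup>2 + (1 / l) * v\<^sup>2 - u * v)"
          using l by (simp add: field_simps power2_eq_square)
        finally show ?thesis by simp
      qed
      then have "(g t0 t \<omega> * h t0 t \<omega>) ^ n \<le> l * g t0 t \<omega> ^ (2 * n) + (1 / l) * h t0 t \<omega> ^ (2 * n)"
        by (simp add: u_def v_def power_mult_distrib power_mult[symmetric] mult.commute[of n])
      then show "ennreal ((g t0 t \<omega> * h t0 t \<omega>) ^ n) \<le> ennreal l * ennreal (g t0 t \<omega> ^ (2 * n)) + ennreal (1 / l) * ennreal (h t0 t \<omega> ^ (2 * n))"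
        using l by (simp add: ennreal_mult'[symmetric] ennreal_plus[symmetric] zero_le_even_power del: ennreal_plus)
    qed
    also have "\<dots> = ennreal l * moment M (2 * n) (g t0 t) + ennreal (1 / l) * moment M (2 * n) (h t0 t)"
      using t by (simp add: nn_integral_add nn_integral_cmult)
    also have "\<dots> \<le> ennreal l * ennreal (C * (t - t0) powr (a * real (2 * n))) + ennreal (1 / l) * ennreal (C' * (t - t0) powr (b * real (2 * n)))"
      using C C' t by (intro mult_left_mono add_mono) auto
    also have "\<dots> = ennreal (C * (l * (t - t0) powr (a * real (2 * n))) + C' * ((1 / l) * (t - t0) powr (b * real (2 * n))))"
      using C C' l by (simp add: ennreal_mult'[symmetric] ennreal_plus[symmetric] mult_ac del: ennreal_plus)
    also have "l * (t - t0) powr (a * real (2 * n)) = (t - t0) powr ((a + b) * real n)"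
      unfolding l_def powr_add[symmetric] by (simp add: algebra_simps)
    also have "(1 / l) * (t - t0) powr (b * real (2 * n)) = (t - t0) powr ((a + b) * real n)"
      unfolding l_def powr_minus_divide[symmetric] powr_add[symmetric] by (simp add: algebra_simps)
    finally show "(\<integral>\<^sup>+\<omega>. ennreal ((g t0 t \<omega> * h t0 t \<omega>) ^ n) \<partial>M) \<le> ennreal ((C + C') * (t - t0) powr ((a + b) * real n))"
      by (simp add: algebra_simps)
  qed (use C C' in simp)
qed (use moment_orderD[OF g] moment_orderD[OF h] in auto)

lemma (in prob_space) moment_order_const:
  assumes "c \<ge> 0" shows "moment_order M T 0 (\<lambda>_ _ _. c)"
  unfolding moment_order_def
proof (intro conjI allI impI)
  fix n :: nat
  show "\<exists>C\<ge>0. \<forall>t0 t. 0 \<le> t0 \<and> t0 < t \<and> t \<le> T \<longrightarrow> (\<integral>\<^sup>+\<omega>. ennreal (c ^ n) \<partial>M) \<le> ennreal (C * (t - t0) powr (0 * real n))"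
    using assms emeasure_space_1 by (intro exI[of _ "c ^ n"]) auto
qed (use assms in auto)

lemma (in prob_space) moment_order_prod:
  assumes "\<And>c. c \<in> set cs \<Longrightarrow> moment_order M T (a c) (g c)"
  shows "moment_order M T (\<Sum>c\<leftarrow>cs. a c) (\<lambda>t0 t \<omega>. \<Prod>c\<leftarrow>cs. g c t0 t \<omega>)"
  using assms
proof (induction cs)
  case Nil
  then show ?case using moment_order_const[of 1 T] by simp
next
  case (Cons c cs)
  then show ?case using moment_order_mult[of M T "a c" "g c"] by simp
qed

text \<open>Even moments suffice: \<open>y\<^sup>n \<le> 1 + y\<^bsup>2n\<^esup>\<close>, applied to the rescaled variable.\<close>

lemma (in prob_space) moment_order_of_even:
  assumes g: "\<And>t0 t. 0 \<le> t0 \<Longrightarrow> t0 < t \<Longrightarrow> t \<le> T \<Longrightarrow> g t0 t \<in> borel_measurable M"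
      "\<And>t0 t \<omega>. 0 \<le> t0 \<Longrightarrow> t0 < t \<Longrightarrow> t \<le> T \<Longrightarrow> \<omega> \<in> space M \<Longrightarrow> 0 \<le> g t0 t \<omega>"
    and even: "\<And>m. m \<ge> 1 \<Longrightarrow> \<exists>C\<ge>0. \<forall>t0 t. 0 \<le> t0 \<and> t0 < t \<and> t \<le> T \<longrightarrow>
        moment M (2 * m) (g t0 t) \<le> ennreal (C * (t - t0) powr (a * real (2 * m)))"
  shows "moment_order M T a g"
  unfolding moment_order_def
proof (intro conjI allI impI)
  fix n :: nat assume n: "n \<ge> 1"
  obtain C where C: "C \<ge> 0" "\<And>t0 t. 0 \<le> t0 \<Longrightarrow> t0 < t \<Longrightarrow> t \<le> T \<Longrightarrow>
        moment M (2 * n) (g t0 t) \<le> ennreal (C * (t - t0) powr (a * real (2 * n)))"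
    using even[OF n] by blast
  show "\<exists>C\<ge>0. \<forall>t0 t. 0 \<le> t0 \<and> t0 < t \<and> t \<le> T \<longrightarrow>
        moment M n (g t0 t) \<le> ennreal (C * (t - t0) powr (a * real n))"
  proof (intro exI[of _ "1 + C"] conjI allI impI)
    fix t0 t assume t: "0 \<le> t0 \<and> t0 < t \<and> t \<le> T"
    \<comment> \<open>the scale on which \<open>y\<close> to the power \<open>n\<close> lives\<close>
    define l where "l = (t - t0) powr (a * real n)"
    have l: "l > 0" using t by (simp add: l_def)
    have l2: "(t - t0) powr (a * real (2 * n)) = l * l"
      by (simp add: l_def powr_add[symmetric] algebra_simps)
    note [measurable] = g(1)[of t0 t]
    have "moment M n (g t0 t) \<le> (\<integral>\<^sup>+\<omega>. ennreal l + ennreal (1 / l) * ennreal (g t0 t \<omega> ^ (2 * n)) \<partial>M)"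
    proof (rule nn_integral_mono)
      fix \<omega> assume \<omega>: "\<omega> \<in> space M"
      define u where "u = g t0 t \<omega> ^ n"
      have "u \<le> l + (1 / l) * u\<^sup>2"
      proof -
        have "0 \<le> (l - u)\<^sup>2 / l + (l + u\<^sup>2 / l)" using l by (intro add_nonneg_nonneg) auto
        also have "\<dots> = 2 * (l + (1 / l) * u\<^sup>2 - u)" using l by (simp add: field_simps power2_eq_square)
        finally show ?thesis by simp
      qed
      then have "g t0 t \<omega> ^ n \<le> l + (1 / l) * g t0 t \<omega> ^ (2 * n)"
        by (simp add: u_def power_mult[symmetric] mult.commute[of n])
      then show "ennreal (g t0 t \<omega> ^ n) \<le> ennreal l + ennreal (1 / l) * ennreal (g t0 t \<omega> ^ (2 * n))"
        using l by (simp add: ennreal_mult'[symmetric] ennreal_plus[symmetric] zero_le_even_power del: ennreal_plus)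
    qed
    also have "\<dots> = ennreal l + ennreal (1 / l) * moment M (2 * n) (g t0 t)"
      using t emeasure_space_1 by (simp add: nn_integral_add nn_integral_cmult)
    also have "\<dots> \<le> ennreal l + ennreal (1 / l) * ennreal (C * (l * l))"
      using C(2)[of t0 t] t unfolding l2 by (intro add_left_mono mult_left_mono) auto
    also have "\<dots> = ennreal ((1 + C) * l)"
      using l C by (simp add: ennreal_mult'[symmetric] ennreal_plus[symmetric] algebra_simps del: ennreal_plus)
    finally show "moment M n (g t0 t) \<le> ennreal ((1 + C) * (t - t0) powr (a * real n))"
      by (simp add: l_def)
  qed (use C in simp)
qed (use g in auto)

lemma nn_integral_set_integral_eq:
  fixes f :: "real \<Rightarrow> real"
  assumes "continuous_on {a..b} f" "\<And>s. s \<in> {a..b} \<Longrightarrow> 0 \<le> f s"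
  shows "(\<integral>\<^sup>+s. indicator {a..b} s * ennreal (f s) \<partial>lborel) = ennreal (LBINT s:{a..b}. f s)"
proof -
  have "(\<integral>\<^sup>+s. ennreal (indicator {a..b} s *\<^sub>R f s) \<partial>lborel) = ennreal (LBINT s:{a..b}. f s)"
    unfolding set_lebesgue_integral_def
    using set_integrable_continuous_Icc[OF assms(1)] assms(2)
    by (intro nn_integral_eq_integral) (auto simp: set_integrable_def indicator_def)
  then show ?thesis by (subst (asm) nn_integral_cong[where v = "\<lambda>s. indicator {a..b} s * ennreal (f s)"]) (auto simp: indicator_def)
qed

lemma set_integral_nonneg:
  fixes f :: "'a \<Rightarrow> real"
  shows "(\<And>s. s \<in> A \<Longrightarrow> 0 \<le> f s) \<Longrightarrow> 0 \<le> (LINT s:A|N. f s)"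
  unfolding set_lebesgue_integral_def
  by (intro Bochner_Integration.integral_nonneg) (auto simp: indicator_def)

text \<open>The additional order is the length of the interval, contributed by Jensen's inequality; since
  \<open>a \<ge> 0\<close>, the bound of the integrand at the final time holds at all earlier times.\<close>

lemma (in prob_space) moment_order_integral:
  assumes g: "moment_order M T a g" and a: "a \<ge> 0"
    and cont: "\<And>t0. 0 \<le> t0 \<Longrightarrow> t0 < T \<Longrightarrow> continuous_process M t0 T (g t0)"
      "\<And>t0 \<omega>. 0 \<le> t0 \<Longrightarrow> t0 < T \<Longrightarrow> \<omega> \<in> space M \<Longrightarrow> 0 \<le> g t0 t0 \<omega>"
  shows "moment_order M T (a + 1) (\<lambda>t0 t \<omega>. LBINT s:{t0..t}. g t0 s \<omega>)"
  unfolding moment_order_def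
proof (intro conjI allI impI)
  have nonneg: "0 \<le> g t0 s \<omega>" if "0 \<le> t0" "t0 < T" "s \<in> {t0..T}" "\<omega> \<in> space M" for t0 s \<omega>
    using moment_orderD(2)[OF g, of t0 s \<omega>] cont(2)[of t0 \<omega>] that by (cases "s = t0") auto
  have eq: "ennreal (LBINT s:{t0..t}. g t0 s \<omega>) = (\<integral>\<^sup>+s. indicator {t0..t} s * ennreal (g t0 s \<omega>) \<partial>lborel)"
    if t: "0 \<le> t0 \<and> t0 < t \<and> t \<le> T" and "\<omega> \<in> space M" for t0 t \<omega>
    using cont(1)[of t0] nonneg[of t0] that
    by (intro nn_integral_set_integral_eq[symmetric]) (auto simp: continuous_process_def intro: continuous_on_subset)
  have joint: "(\<lambda>w. indicator {t0..t} (snd w) *\<^sub>R g t0 (snd w) (fst w)) \<in> borel_measurable (M \<Otimes>\<^sub>M lborel)"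
    if t: "0 \<le> t0 \<and> t0 < t \<and> t \<le> T" for t0 t
    using that by (intro continuous_process_joint continuous_process_subset[OF cont(1)]) auto
  show "(\<lambda>\<omega>. LBINT s:{t0..t}. g t0 s \<omega>) \<in> borel_measurable M" if t: "0 \<le> t0 \<and> t0 < t \<and> t \<le> T" for t0 t
    unfolding set_lebesgue_integral_def
    by (intro lborel.borel_measurable_lebesgue_integral) (use joint[OF that] in \<open>simp add: split_beta'\<close>)
  show "\<forall>\<omega>\<in>space M. 0 \<le> (LBINT s:{t0..t}. g t0 s \<omega>)" if t: "0 \<le> t0 \<and> t0 < t \<and> t \<le> T" for t0 t
    using nonneg[of t0] t by (auto intro!: set_integral_nonneg)
  fix n :: nat assume n: "n \<ge> 1"
  obtain C where C: "C \<ge> 0" "\<And>t0 t. 0 \<le> t0 \<Longrightarrow> t0 < t \<Longrightarrow> t \<le> T \<Longrightarrow>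
        moment M n (g t0 t) \<le> ennreal (C * (t - t0) powr (a * real n))"
    using moment_order_bound[OF g n] by blast
  show "\<exists>C\<ge>0. \<forall>t0 t. 0 \<le> t0 \<and> t0 < t \<and> t \<le> T \<longrightarrow>
        (\<integral>\<^sup>+\<omega>. ennreal ((LBINT s:{t0..t}. g t0 s \<omega>) ^ n) \<partial>M) \<le> ennreal (C * (t - t0) powr ((a + 1) * real n))"
  proof (intro exI[of _ C] conjI allI impI)
    fix t0 t assume t: "0 \<le> t0 \<and> t0 < t \<and> t \<le> T"
    \<comment> \<open>the weight omits \<open>s = t0\<close>, where the order of \<open>g\<close> says nothing\<close>
    have "(\<integral>\<^sup>+\<omega>. ennreal ((LBINT s:{t0..t}. g t0 s \<omega>) ^ n) \<partial>M)
        = (\<integral>\<^sup>+\<omega>. (\<integral>\<^sup>+s. indicator {t0<..t} s * ennreal (indicator {t0..t} s *\<^sub>R g t0 s \<omega>) \<partial>lborel) ^ n \<partial>M)"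
    proof (rule nn_integral_cong)
      fix \<omega> assume \<omega>: "\<omega> \<in> space M"
      have "ennreal ((LBINT s:{t0..t}. g t0 s \<omega>) ^ n) = ennreal (LBINT s:{t0..t}. g t0 s \<omega>) ^ n"
        using nonneg[of t0] t \<omega> by (intro ennreal_power[symmetric] set_integral_nonneg) auto
      also have "ennreal (LBINT s:{t0..t}. g t0 s \<omega>) = (\<integral>\<^sup>+s. indicator {t0<..t} s * ennreal (indicator {t0..t} s *\<^sub>R g t0 s \<omega>) \<partial>lborel)"
        unfolding eq[OF t \<omega>]
        by (rule nn_integral_cong_AE) (use AE_lborel_singleton[of t0] in \<open>auto elim!: eventually_mono simp: indicator_def\<close>)
      finally show "ennreal ((LBINT s:{t0..t}. g t0 s \<omega>) ^ n) = (\<integral>\<^sup>+s. indicator {t0<..t} s * ennreal (indicator {t0..t} s *\<^sub>R g t0 s \<omega>) \<partial>lborel) ^ n" .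
    qed
    also have "\<dots> \<le> ennreal (t - t0) ^ n * ennreal (C * (t - t0) powr (a * real n))"
    proof (rule moment_weighted_integral)
      show "(\<lambda>p. ennreal (indicator {t0..t} (snd p) *\<^sub>R g t0 (snd p) (fst p))) \<in> borel_measurable (M \<Otimes>\<^sub>M lborel)"
        by (rule measurable_compose[OF joint[OF t] measurable_ennreal])
      show "(\<integral>\<^sup>+s. indicator {t0<..t} s \<partial>lborel) \<le> ennreal (t - t0)"
        using t by (simp)
      fix s assume "indicator {t0<..t} s \<noteq> (0::ennreal)"
      then have s: "t0 < s" "s \<le> t" by (auto simp: indicator_def split: if_splits)
      have "(\<integral>\<^sup>+\<omega>. ennreal (indicator {t0..t} s *\<^sub>R g t0 s \<omega>) ^ n \<partial>M) = moment M n (g t0 s)"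
        using s t nonneg[of t0 s] by (intro nn_integral_cong) (simp add: ennreal_power)
      also have "\<dots> \<le> ennreal (C * (s - t0) powr (a * real n))" using s t by (intro C) auto
      also have "\<dots> \<le> ennreal (C * (t - t0) powr (a * real n))"
        using s t C a by (intro ennreal_leI mult_left_mono powr_mono2) auto
      finally show "(\<integral>\<^sup>+\<omega>. ennreal (indicator {t0..t} s *\<^sub>R g t0 s \<omega>) ^ n \<partial>M) \<le> ennreal (C * (t - t0) powr (a * real n))" .
    qed (use n in \<open>auto intro: sigma_finite_measure_axioms\<close>)
    also have "\<dots> = ennreal (C * (t - t0) powr ((a + 1) * real n))"
    proof -
      have "(t - t0) ^ n = (t - t0) powr real n" using t by (simp add: powr_realpow)
      then have "(t - t0) ^ n * (C * (t - t0) powr (a * real n)) = C * (t - t0) powr ((a + 1) * real n)"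
        by (simp add: powr_add[symmetric] algebra_simps)
      then show ?thesis using t C by (simp add: ennreal_power ennreal_mult'[symmetric])
    qed
    finally show "(\<integral>\<^sup>+\<omega>. ennreal ((LBINT s:{t0..t}. g t0 s \<omega>) ^ n) \<partial>M) \<le> ennreal (C * (t - t0) powr ((a + 1) * real n))" .
  qed (use C in simp)
qed


text \<open>The mild equation holds almost surely at each time, hence almost surely at all rational times, and by
  continuity at all times.\<close>

lemma continuous_zero_of_rationals:
  fixes f :: "real \<Rightarrow> 'b::t1_space"
  assumes f: "continuous_on {0..T} f" and T: "T > 0" and z: "\<And>t. t \<in> {0..T} \<inter> \<rat> \<Longrightarrow> f t = a" and t: "t \<in> {0..T}"
  shows "f t = a"
proof -
  have cl: "closure ({0<..<T} \<inter> \<rat>) = {0..T}"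
    using closure_open_Int_superset[of "{0<..<T}" \<rat>] T by (simp add: Rats_closure_real)
  show ?thesis
    by (rule continuous_constant_on_closure[of "{0<..<T} \<inter> \<rat>"]) (use f z t in \<open>auto simp: cl\<close>)
qed

text \<open>Gronwall's lemma in integrated form. The right hand side involves \<open>a\<close> only through its integral, whose
  moments are easily bounded, so no maximal inequality for the noise is needed.\<close>

lemma gronwall:
  fixes y a :: "real \<Rightarrow> real"
  assumes y: "continuous_on {0..T} y" and a: "continuous_on {0..T} a" "\<And>t. t \<in> {0..T} \<Longrightarrow> 0 \<le> a t" and C: "C \<ge> 0"
    and le: "\<And>t. t \<in> {0..T} \<Longrightarrow> y t \<le> a t + C * (LBINT s:{0..t}. y s)" and t: "t \<in> {0..T}"
  shows "(LBINT s:{0..t}. y s) \<le> exp (C * t) * (LBINT s:{0..t}. a s)"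
proof -
  define \<phi> A where "\<phi> t = (LBINT s:{0..t}. y s)" and "A t = (LBINT s:{0..t}. a s)" for t
  have eq: "(LBINT s:{0..t}. f s) = integral {0..t} f" if "continuous_on {0..T} f" "t \<in> {0..T}" for f :: "real \<Rightarrow> real" and t
    using that by (intro set_borel_integral_eq_integral(2) set_integrable_continuous_Icc) (auto intro: continuous_on_subset)
  have deriv: "((\<lambda>t. LBINT s:{0..t}. f s) has_real_derivative f t) (at t within {0..T})" if "continuous_on {0..T} f" "t \<in> {0..T}" for f :: "real \<Rightarrow> real" and t
    by (rule has_field_derivative_transform_within[OF integral_has_real_derivative[OF that] zero_less_one that(2)]) (simp add: eq that)
  have d\<phi>: "(\<phi> has_real_derivative y t) (at t within {0..T})" and dA: "(A has_real_derivative a t) (at t within {0..T})"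
    if "t \<in> {0..T}" for t
    unfolding \<phi>_def [abs_def] A_def [abs_def] by (intro deriv y a that)+
  \<comment> \<open>the integrating factor; dropping it in front of \<open>a\<close> only increases the right hand side\<close>
  define \<Phi> where "\<Phi> t = exp (- C * t) * \<phi> t - A t" for t
  have d\<Phi>: "(\<Phi> has_real_derivative exp (- C * t) * (y t - C * \<phi> t) - a t) (at t within {0..T})" if "t \<in> {0..T}" for t
    unfolding \<Phi>_def [abs_def]
    by (rule derivative_eq_intros d\<phi> dA that refl)+ (simp add: algebra_simps)
  have "\<Phi> t \<le> \<Phi> 0"
  proof (rule DERIV_nonpos_imp_decreasing_open[where f = \<Phi> and a = 0 and b = t])
    show "continuous_on {0..t} \<Phi>"
      by (rule continuous_on_subset[of "{0..T}"], rule DERIV_continuous_on[OF d\<Phi>]) (use t in auto)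
    fix s assume s: "0 < s" "s < t"
    then have sT: "s \<in> {0..T}" using t by auto
    have "(\<Phi> has_real_derivative exp (- C * s) * (y s - C * \<phi> s) - a s) (at s)"
      using d\<Phi>[OF sT] s t by (simp add: at_within_Icc_at)
    moreover have "exp (- C * s) * (y s - C * \<phi> s) \<le> 1 * a s"
    proof (cases "0 \<le> y s - C * \<phi> s")
      case True
      then show ?thesis using le[OF sT] C s by (intro mult_mono) (auto simp: \<phi>_def)
    next
      case False
      then have "exp (- C * s) * (y s - C * \<phi> s) \<le> 0" by (intro mult_nonneg_nonpos) auto
      then show ?thesis using a(2)[OF sT] by simp
    qed
    ultimately show "\<exists>y. DERIV \<Phi> s :> y \<and> y \<le> 0" by force
  qed (use t in auto)
  also have "\<Phi> 0 = 0"
  proof -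
    have "(LBINT s:{0..0::real}. f s) = (0::real)" for f
      unfolding set_lebesgue_integral_def
    proof (rule integral_eq_zero_AE)
      show "AE s in lborel. indicator {0..0::real} s *\<^sub>R f s = 0"
        using AE_lborel_singleton[of "0::real"] by eventually_elim auto
    qed
    then show ?thesis by (simp add: \<Phi>_def \<phi>_def A_def)
  qed
  finally have "exp (- C * t) * \<phi> t \<le> A t" by (simp add: \<Phi>_def)
  then have "exp (C * t) * (exp (- C * t) * \<phi> t) \<le> exp (C * t) * A t" by (intro mult_left_mono) auto
  moreover have "exp (C * t) * (exp (- C * t) * \<phi> t) = \<phi> t"
    unfolding mult.assoc[symmetric] exp_add[symmetric] by simp
  ultimately show ?thesis unfolding \<phi>_def A_def by linarith
qed

lemma ennreal_enn2real_le: "ennreal (enn2real x) \<le> x"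
  by (cases x rule: ennreal_cases) auto

context prob_space
begin

lemma moment_order_uniform:
  fixes g :: "real \<Rightarrow> 'a \<Rightarrow> real"
  assumes g: "\<And>t. t \<in> {0..T} \<Longrightarrow> g t \<in> borel_measurable M" "\<And>t \<omega>. t \<in> {0..T} \<Longrightarrow> \<omega> \<in> space M \<Longrightarrow> 0 \<le> g t \<omega>"
    and bound: "\<And>m. m \<ge> 1 \<Longrightarrow> \<exists>C\<ge>0. \<forall>t\<in>{0..T}. moment M (2 * m) (g t) \<le> ennreal C"
  shows "moment_order M T 0 (\<lambda>t0 t. g t)" "moment_order M T 0 (\<lambda>t0 t. g t0)"
proof -
  have b: "\<exists>C\<ge>0. \<forall>t0 t. 0 \<le> t0 \<and> t0 < t \<and> t \<le> T \<longrightarrow>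
      moment M (2 * m) (g t) \<le> ennreal (C * (t - t0) powr (0 * real (2 * m))) \<and>
      moment M (2 * m) (g t0) \<le> ennreal (C * (t - t0) powr (0 * real (2 * m)))" if m: "m \<ge> 1" for m
  proof -
    obtain C where "C \<ge> 0" "\<forall>t\<in>{0..T}. moment M (2 * m) (g t) \<le> ennreal C" using bound[OF m] by blast
    then show ?thesis by (intro exI[of _ C]) auto
  qed
  have b1: "\<exists>C\<ge>0. \<forall>t0 t. 0 \<le> t0 \<and> t0 < t \<and> t \<le> T \<longrightarrow>
      moment M (2 * m) (g t) \<le> ennreal (C * (t - t0) powr (0 * real (2 * m)))"
    and b2: "\<exists>C\<ge>0. \<forall>t0 t. 0 \<le> t0 \<and> t0 < t \<and> t \<le> T \<longrightarrow>
      moment M (2 * m) (g t0) \<le> ennreal (C * (t - t0) powr (0 * real (2 * m)))" if "m \<ge> 1" for m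
    using b[OF that] by blast+
  show "moment_order M T 0 (\<lambda>t0 t. g t)" by (rule moment_order_of_even[OF _ _ b1]) (use g in auto)
  show "moment_order M T 0 (\<lambda>t0 t. g t0)" by (rule moment_order_of_even[OF _ _ b2]) (use g in auto)
qed

lemma moment_order_powr: "moment_order M T a (\<lambda>t0 t \<omega>. (t - t0) powr a)"
  unfolding moment_order_def
proof (intro conjI allI impI)
  fix n :: nat
  show "\<exists>C\<ge>0. \<forall>t0 t. 0 \<le> t0 \<and> t0 < t \<and> t \<le> T \<longrightarrow>
      (\<integral>\<^sup>+\<omega>. ennreal (((t - t0) powr a) ^ n) \<partial>M) \<le> ennreal (C * (t - t0) powr (a * real n))"
    using emeasure_space_1
    by (intro exI[of _ 1]) (auto simp: powr_powr[symmetric] powr_realpow[symmetric])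
qed auto

lemma moment_order_weaken:
  assumes g: "moment_order M T b g" and ab: "a \<le> b"
  shows "moment_order M T a g"
proof -
  have le: "(t - t0) powr (b * real n) \<le> (T powr ((b - a) * real n)) * (t - t0) powr (a * real n)"
    if "0 \<le> t0" "t0 < t" "t \<le> T" for t0 t and n :: nat
  proof -
    have "(t - t0) powr (b * real n) = (t - t0) powr ((b - a) * real n) * (t - t0) powr (a * real n)"
      by (simp add: powr_add[symmetric] algebra_simps)
    also have "\<dots> \<le> T powr ((b - a) * real n) * (t - t0) powr (a * real n)"
      using that ab by (intro mult_right_mono powr_mono2) auto
    finally show ?thesis .
  qed
  show ?thesis
    unfolding moment_order_def
  proof (intro conjI allI impI)
    fix n :: nat assume n: "n \<ge> 1"
    obtain C where C: "C \<ge> 0" "\<And>t0 t. 0 \<le> t0 \<Longrightarrow> t0 < t \<Longrightarrow> t \<le> T \<Longrightarrow>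
        moment M n (g t0 t) \<le> ennreal (C * (t - t0) powr (b * real n))"
      using moment_order_bound[OF g n] by blast
    show "\<exists>C\<ge>0. \<forall>t0 t. 0 \<le> t0 \<and> t0 < t \<and> t \<le> T \<longrightarrow>
        moment M n (g t0 t) \<le> ennreal (C * (t - t0) powr (a * real n))"
    proof (intro exI[of _ "C * T powr ((b - a) * real n)"] conjI allI impI)
      fix t0 t assume t: "0 \<le> t0 \<and> t0 < t \<and> t \<le> T"
      have "moment M n (g t0 t) \<le> ennreal (C * (t - t0) powr (b * real n))" using C t by auto
      also have "\<dots> \<le> ennreal (C * ((T powr ((b - a) * real n)) * (t - t0) powr (a * real n)))"
        using C(1) le t by (intro ennreal_leI mult_left_mono) auto
      finally show "moment M n (g t0 t) \<le> ennreal (C * T powr ((b - a) * real n) * (t - t0) powr (a * real n))"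
        by (simp add: mult.assoc)
    qed (use C in simp)
  qed (use moment_orderD[OF g] in auto)
qed

lemma moment_order_sum_list:
  assumes "\<And>c. c \<in> set cs \<Longrightarrow> moment_order M T a (g c)"
  shows "moment_order M T a (\<lambda>t0 t \<omega>. \<Sum>c\<leftarrow>cs. g c t0 t \<omega>)"
  using assms
proof (induction cs)
  case Nil
  show ?case by (rule moment_order_le[OF moment_order_powr[of T a], of 0]) auto
next
  case (Cons c cs)
  then show ?case using moment_order_add[of M T a "g c"] by simp
qed

text \<open>From powers to the exponents of the theorem: \<open>y\<^sup>p \<le> 1 + y\<^sup>n\<close> for \<open>n \<ge> p\<close>.\<close>

lemma moment_order_Lp:
  assumes Y: "moment_order M T a Y" and p: "p \<ge> 1"
  obtains C where "C > 0" "\<And>t0 t. 0 \<le> t0 \<Longrightarrow> t0 < t \<Longrightarrow> t \<le> T \<Longrightarrow>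
     integrable M (\<lambda>\<omega>. Y t0 t \<omega> powr p) \<and> (\<integral>\<omega>. Y t0 t \<omega> powr p \<partial>M) powr (1 / p) \<le> C * (t - t0) powr a"
proof -
  define n where "n = nat \<lceil>p\<rceil>"
  have n: "n \<ge> 1" "p \<le> real n" using p by (auto simp: n_def le_nat_iff)
  obtain C where C: "C \<ge> 0" "\<And>t0 t. 0 \<le> t0 \<Longrightarrow> t0 < t \<Longrightarrow> t \<le> T \<Longrightarrow>
      moment M n (Y t0 t) \<le> ennreal (C * (t - t0) powr (a * real n))"
    using moment_order_bound[OF Y n(1)] by blast
  show ?thesis
  proof (rule that[of "1 + C"])
    fix t0 t assume t: "0 \<le> t0" "t0 < t" "t \<le> T"
    note [measurable] = moment_orderD(1)[OF Y t] and nonneg = moment_orderD(2)[OF Y t]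
    define A where "A = (t - t0) powr a"
    have A: "A > 0" using t by (simp add: A_def)
    have An: "(t - t0) powr (a * real n) = A ^ n" using A by (simp add: A_def powr_powr[symmetric] powr_realpow[symmetric])
    have pw: "y powr p \<le> A powr p + A powr p / A ^ n * y ^ n" if "y \<ge> 0" for y
    proof (cases "y \<le> A")
      case True
      then have "y powr p \<le> A powr p" using p that by (intro powr_mono2) auto
      then show ?thesis using A that by (simp add: add_increasing2)
    next
      case False
      then have yA: "1 \<le> y / A" using A by simp
      have "y powr p = A powr p * (y / A) powr p" using A that by (simp add: powr_divide)
      also have "\<dots> \<le> A powr p * (y / A) powr real n"
        using n yA by (intro mult_left_mono powr_mono) auto
      also have "\<dots> = A powr p / A ^ n * y ^ n" using A False by (simp add: powr_realpow power_divide)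
      finally show ?thesis using A by (simp add: add_increasing)
    qed
    have "(\<integral>\<^sup>+\<omega>. ennreal (Y t0 t \<omega> powr p) \<partial>M) \<le> (\<integral>\<^sup>+\<omega>. ennreal (A powr p) + ennreal (A powr p / A ^ n) * ennreal (Y t0 t \<omega> ^ n) \<partial>M)"
    proof (rule nn_integral_mono)
      fix \<omega> assume "\<omega> \<in> space M"
      then show "ennreal (Y t0 t \<omega> powr p) \<le> ennreal (A powr p) + ennreal (A powr p / A ^ n) * ennreal (Y t0 t \<omega> ^ n)"
        using pw[of "Y t0 t \<omega>"] nonneg A
        by (simp add: ennreal_mult'[symmetric] ennreal_plus[symmetric] ennreal_leI del: ennreal_plus)
    qed
    also have "\<dots> = ennreal (A powr p) + ennreal (A powr p / A ^ n) * moment M n (Y t0 t)"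
      using emeasure_space_1 by (simp add: nn_integral_add nn_integral_cmult)
    also have "\<dots> \<le> ennreal (A powr p) + ennreal (A powr p / A ^ n) * ennreal (C * A ^ n)"
      using C(2)[OF t] unfolding An by (intro add_left_mono mult_left_mono) auto
    also have "\<dots> = ennreal ((1 + C) * A powr p)"
      using A C(1) by (simp add: ennreal_mult'[symmetric] ennreal_plus[symmetric] algebra_simps del: ennreal_plus)
    finally have le: "(\<integral>\<^sup>+\<omega>. ennreal (Y t0 t \<omega> powr p) \<partial>M) \<le> ennreal ((1 + C) * A powr p)" .
    have int: "integrable M (\<lambda>\<omega>. Y t0 t \<omega> powr p)"
      by (rule integrableI_bounded) (use le in \<open>auto intro: order_le_less_trans\<close>)
    have "(\<integral>\<omega>. Y t0 t \<omega> powr p \<partial>M) \<le> (1 + C) * A powr p"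
    proof -
      have "ennreal (\<integral>\<omega>. Y t0 t \<omega> powr p \<partial>M) \<le> ennreal ((1 + C) * A powr p)"
        using le nn_integral_eq_integral[OF int] by simp
      then show ?thesis using C(1) by (subst (asm) ennreal_le_iff) auto
    qed
    then have "(\<integral>\<omega>. Y t0 t \<omega> powr p \<partial>M) powr (1 / p) \<le> ((1 + C) * A powr p) powr (1 / p)"
      using p by (intro powr_mono2 Bochner_Integration.integral_nonneg) auto
    also have "\<dots> = (1 + C) powr (1 / p) * A"
      using C(1) A p by (simp add: powr_mult powr_powr)
    also have "\<dots> \<le> (1 + C) powr 1 * A"
      using C(1) A p by (intro mult_right_mono powr_mono) auto
    finally show "integrable M (\<lambda>\<omega>. Y t0 t \<omega> powr p) \<and> (\<integral>\<omega>. Y t0 t \<omega> powr p \<partial>M) powr (1 / p) \<le> (1 + C) * (t - t0) powr a"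
      using int C(1) by (simp add: A_def)
  qed (use C in simp)
qed

end

section \<open>The stochastic convolution and the initial value\<close>

locale spde = mild_setting I lam e \<kappa> c F D + wiener M \<F> T W
  for I :: "'i set" and lam and e :: "'i \<Rightarrow> 'h::{real_inner, banach, second_countable_topology}" and \<kappa> c
    and F :: "'h \<Rightarrow> 'h" and D
    and M :: "'a measure" and \<F> T and W :: "real \<Rightarrow> 'k::{real_inner, banach, second_countable_topology} \<Rightarrow> 'a \<Rightarrow> real" +
  fixes B :: "'k \<Rightarrow> 'h" and \<gamma> \<delta> :: real and u0 :: "'a \<Rightarrow> 'h" and Z X :: "real \<Rightarrow> 'a \<Rightarrow> 'h"
  assumes params: "0 < \<gamma>" "\<gamma> < 1" "0 < \<delta>"
    and A3_gamma: "(\<integral>\<^sup>+s\<in>{0..T}. hs_norm_sq (\<lambda>k. fpow \<gamma> (S s (B k))) \<partial>lborel) < \<infinity>"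
    and A3_delta: "\<exists>C>0. \<forall>t\<in>{0..1}. (\<integral>\<^sup>+s\<in>{0..t}. hs_norm_sq (\<lambda>k. S s (B k)) \<partial>lborel) \<le> ennreal (C * t powr (2 * \<delta>))"
    and A4_meas: "u0 \<in> measurable (\<F> 0) (frac_borel I lam e \<kappa> \<gamma>)"
    and A4_mom: "\<forall>p::real\<ge>1. (\<integral>\<^sup>+\<omega>. ennreal (norm (fpow \<gamma> (u0 \<omega>)) powr p) \<partial>M) < \<infinity>"
    and Z: "continuous_stochastic_convolution M T W S B Z"
    and X: "mild_solution M \<F> T S F u0 Z X"
begin

lemma continuous_process_X: "0 \<le> t0 \<Longrightarrow> continuous_process M t0 T X"
proof -
  have "X s \<in> borel_measurable M" if "s \<in> {0..T}" for s
    using X that by (intro measurable_from_subalg[OF subalg[OF that]]) (auto simp: mild_solution_def)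
  then show "0 \<le> t0 \<Longrightarrow> continuous_process M t0 T X"
    using X unfolding continuous_process_def mild_solution_def by (auto intro: continuous_on_subset)
qed

lemma continuous_process_Z: "0 \<le> t0 \<Longrightarrow> continuous_process M t0 T Z"
  using Z unfolding continuous_process_def continuous_stochastic_convolution_def is_stochastic_integral_def
  by (auto intro: continuous_on_subset)

lemma X_measurable: "t \<in> {0..T} \<Longrightarrow> X t \<in> borel_measurable M"
  and X_continuous: "\<omega> \<in> space M \<Longrightarrow> continuous_on {0..T} (\<lambda>t. X t \<omega>)"
  and Z_measurable: "t \<in> {0..T} \<Longrightarrow> Z t \<in> borel_measurable M"
  and Z_continuous: "\<omega> \<in> space M \<Longrightarrow> continuous_on {0..T} (\<lambda>t. Z t \<omega>)"
  using continuous_process_X[of 0] continuous_process_Z[of 0] by (auto simp: continuous_process_def)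

lemma hs_integrand_forward:
  fixes R :: "'h \<Rightarrow> 'h"
  assumes R: "bounded_linear R"
  shows "hs_integrand t (\<lambda>s x. R (S s (B x)))"
proof (rule hs_integrand_linear[OF _ R])
  show "hs_integrand t (\<lambda>s x. S s (B x))"
    unfolding hs_integrand_def by (intro allI borel_measurable_continuous_on_indicator S_continuous_on) auto
qed

lemma hs_integrand_backward:
  fixes R :: "'h \<Rightarrow> 'h"
  assumes R: "bounded_linear R"
  shows "hs_integrand t (\<lambda>s x. R (S (t - s) (B x)))"
proof (rule hs_integrand_linear[OF _ R])
  show "hs_integrand t (\<lambda>s x. S (t - s) (B x))"
    unfolding hs_integrand_def
    by (intro allI borel_measurable_continuous_on_indicator conv_integrand_continuous) auto
qed

lemma hs_reverse:
  fixes R :: "'h \<Rightarrow> 'h"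
  assumes R: "bounded_linear R"
  shows "(\<integral>\<^sup>+s\<in>{a..t}. hs_norm_sq (\<lambda>x. R (S (t - s) (B x))) \<partial>lborel) = (\<integral>\<^sup>+s\<in>{0..t - a}. hs_norm_sq (\<lambda>x. R (S s (B x))) \<partial>lborel)"
proof -
  have "(\<integral>\<^sup>+s\<in>{0..t - a}. hs_norm_sq (\<lambda>x. R (S s (B x))) \<partial>lborel)
      = ennreal \<bar>- 1\<bar> * (\<integral>\<^sup>+s. hs_norm_sq (\<lambda>x. R (S (t + (- 1) * s) (B x))) * indicator {0..t - a} (t + (- 1) * s) \<partial>lborel)"
    by (rule nn_integral_real_affine[OF hs_integrand_measurable[OF hs_integrand_forward[OF R]]]) simp
  also have "\<dots> = (\<integral>\<^sup>+s\<in>{a..t}. hs_norm_sq (\<lambda>x. R (S (t - s) (B x))) \<partial>lborel)"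
    by (simp, intro nn_integral_cong) (auto simp: indicator_def)
  finally show ?thesis by simp
qed

definition noise_energy :: real where "noise_energy = 1 + enn2real (\<integral>\<^sup>+s\<in>{0..T}. hs_norm_sq (\<lambda>k. fpow \<gamma> (S s (B k))) \<partial>lborel)"

lemma noise_energy: "noise_energy > 0" "(\<integral>\<^sup>+s\<in>{0..T}. hs_norm_sq (\<lambda>k. fpow \<gamma> (S s (B k))) \<partial>lborel) \<le> ennreal noise_energy"
proof -
  show "noise_energy > 0" by (simp add: noise_energy_def add_pos_nonneg)
  have "(\<integral>\<^sup>+s\<in>{0..T}. hs_norm_sq (\<lambda>k. fpow \<gamma> (S s (B k))) \<partial>lborel)
      = ennreal (enn2real (\<integral>\<^sup>+s\<in>{0..T}. hs_norm_sq (\<lambda>k. fpow \<gamma> (S s (B k))) \<partial>lborel))"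
    using A3_gamma by simp
  also have "\<dots> \<le> ennreal noise_energy" by (intro ennreal_leI) (simp add: noise_energy_def)
  finally show "(\<integral>\<^sup>+s\<in>{0..T}. hs_norm_sq (\<lambda>k. fpow \<gamma> (S s (B k))) \<partial>lborel) \<le> ennreal noise_energy" .
qed

text \<open>The assumption on \<open>\<gamma>\<close> concerns an integrand that is not known to be measurable, hence its integral may
  only be used as an upper bound; this is why the constant is moved to the measurable side.\<close>

lemma hs_smooth_bound:
  fixes R :: "'h \<Rightarrow> 'h"
  assumes R: "bounded_linear R" and K: "K > 0"
    and le: "\<And>s y. 0 < s \<Longrightarrow> s \<le> T \<Longrightarrow> norm (R (S s y)) \<le> K * norm (fpow \<gamma> (S s y))" and t: "t \<le> T"
  shows "(\<integral>\<^sup>+s\<in>{0..t}. hs_norm_sq (\<lambda>x. R (S s (B x))) \<partial>lborel) \<le> ennreal (K\<^sup>2 * noise_energy)"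
proof -
  let ?f = "\<lambda>s. hs_norm_sq (\<lambda>x. R (S s (B x))) * indicator {0..t} s"
  have m: "?f \<in> borel_measurable lborel"
    using hs_integrand_measurable[OF hs_integrand_forward[OF R]] by simp
  have pos: "ennreal (1 / K\<^sup>2) * ennreal (K\<^sup>2) = 1" using K by (simp add: ennreal_mult'[symmetric])
  have "ennreal (1 / K\<^sup>2) * (\<integral>\<^sup>+s. ?f s \<partial>lborel) = (\<integral>\<^sup>+s. ennreal (1 / K\<^sup>2) * ?f s \<partial>lborel)"
    by (rule nn_integral_cmult[symmetric, OF m])
  also have "\<dots> \<le> (\<integral>\<^sup>+s\<in>{0..T}. hs_norm_sq (\<lambda>k. fpow \<gamma> (S s (B k))) \<partial>lborel)"
  proof (rule nn_integral_mono_AE)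
    show "AE s in lborel. ennreal (1 / K\<^sup>2) * ?f s \<le> hs_norm_sq (\<lambda>k. fpow \<gamma> (S s (B k))) * indicator {0..T} s"
      using AE_lborel_singleton[of "0::real"]
    proof eventually_elim
      case (elim s)
      show ?case
      proof (cases "s \<in> {0..t}")
        case True
        have "hs_norm_sq (\<lambda>x. R (S s (B x))) \<le> ennreal (K\<^sup>2) * hs_norm_sq (\<lambda>k. fpow \<gamma> (S s (B k)))"
          using True elim t K by (intro hs_norm_sq_mono le) auto
        then have "ennreal (1 / K\<^sup>2) * hs_norm_sq (\<lambda>x. R (S s (B x))) \<le> ennreal (1 / K\<^sup>2) * (ennreal (K\<^sup>2) * hs_norm_sq (\<lambda>k. fpow \<gamma> (S s (B k))))"
          by (rule mult_left_mono) simp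
        also have "\<dots> = hs_norm_sq (\<lambda>k. fpow \<gamma> (S s (B k)))" by (simp only: mult.assoc[symmetric] pos) simp
        finally show ?thesis using True t by simp
      qed simp
    qed
  qed
  also have "\<dots> \<le> ennreal noise_energy" by (rule noise_energy)
  finally have "ennreal (K\<^sup>2) * (ennreal (1 / K\<^sup>2) * (\<integral>\<^sup>+s. ?f s \<partial>lborel)) \<le> ennreal (K\<^sup>2) * ennreal noise_energy"
    by (rule mult_left_mono) simp
  moreover have "ennreal (K\<^sup>2) * (ennreal (1 / K\<^sup>2) * (\<integral>\<^sup>+s. ?f s \<partial>lborel)) = (\<integral>\<^sup>+s. ?f s \<partial>lborel)"
    using pos by (simp only: mult.assoc[symmetric] mult.commute[of "ennreal (K\<^sup>2)"]) simp
  ultimately show ?thesis using noise_energy(1) by (simp add: ennreal_mult'[symmetric])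
qed

lemma norm_S_le_fpow:
  assumes "0 < s" shows "norm (S s y) \<le> c powr (- \<gamma>) * norm (fpow \<gamma> (S s y))"
  using assms params by (intro norm_le_fpow S_in_fdom) auto

lemma c_powr_pos: "c powr (- \<gamma>) > 0"
  using c by simp

lemma hs_S_bound: "t \<le> T \<Longrightarrow> (\<integral>\<^sup>+s\<in>{0..t}. hs_norm_sq (\<lambda>x. S s (B x)) \<partial>lborel) \<le> ennreal ((c powr (- \<gamma>))\<^sup>2 * noise_energy)"
  using hs_smooth_bound[of "\<lambda>x. x", OF bounded_linear_ident c_powr_pos norm_S_le_fpow] by simp

lemma Z_wiener_integral: "t \<in> {0..T} \<Longrightarrow> is_stochastic_integral M W t (\<lambda>s x. S (t - s) (B x)) (Z t)"
  using Z by (simp add: continuous_stochastic_convolution_def)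

lemma moment_order_Z: "moment_order M T 0 (\<lambda>t0 t \<omega>. norm (Z t \<omega>))" "moment_order M T 0 (\<lambda>t0 t \<omega>. norm (Z t0 \<omega>))"
proof -
  have "\<exists>C\<ge>0. \<forall>t\<in>{0..T}. moment M (2 * m) (\<lambda>\<omega>. norm (Z t \<omega>)) \<le> ennreal C" if m: "m \<ge> 1" for m
  proof (intro exI conjI ballI)
    let ?V = "(c powr (- \<gamma>))\<^sup>2 * noise_energy"
    show "0 \<le> gauss_const m * (4 * ?V) ^ m" using gauss_const_pos[of m] noise_energy(1) by simp
    fix t assume t: "t \<in> {0..T}"
    show "moment M (2 * m) (\<lambda>\<omega>. norm (Z t \<omega>)) \<le> ennreal (gauss_const m * (4 * ?V) ^ m)"
    proof (rule wiener_integral_moment[OF Z_wiener_integral[OF t] _ t _ _ m])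
      show "hs_integrand t (\<lambda>s x. S (t - s) (B x))" using hs_integrand_backward[OF bounded_linear_ident] by simp
      show "?V > 0" using noise_energy(1) c_powr_pos by simp
      show "(\<integral>\<^sup>+s\<in>{0..t}. hs_norm_sq (\<lambda>x. S (t - s) (B x)) \<partial>lborel) \<le> ennreal ?V"
        using hs_reverse[OF bounded_linear_ident, where a = 0 and t = t] hs_S_bound[of t] t by simp
    qed
  qed
  from moment_order_uniform[where g = "\<lambda>t \<omega>. norm (Z t \<omega>)" and T = T, OF _ _ this] Z_measurable
  show "moment_order M T 0 (\<lambda>t0 t \<omega>. norm (Z t \<omega>))" "moment_order M T 0 (\<lambda>t0 t \<omega>. norm (Z t0 \<omega>))" by auto
qed

lemma increment_bounded_linear: "t \<ge> 0 \<Longrightarrow> bounded_linear (\<lambda>y. S t y - y)"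
  by (intro bounded_linear_sub S_bounded_linear bounded_linear_ident)

lemma increment_const:
  obtains C where "C > 0" "\<And>t v. 0 \<le> t \<Longrightarrow> t \<le> T \<Longrightarrow> v \<in> fdom \<gamma> \<Longrightarrow> norm (S t v - v) \<le> C * t powr \<gamma> * norm (fpow \<gamma> v)"
  using S_increment_norm[of \<gamma> T] params by auto

text \<open>The increment of the semigroup maps the stochastic convolution to the stochastic integral of
  \<open>(S (t - t0) - 1) S (t0 - s) B\<close>, whose Hilbert--Schmidt norm has order \<open>\<gamma>\<close>.\<close>

lemma moment_order_increment_Z: "moment_order M T \<gamma> (\<lambda>t0 t \<omega>. norm (S (t - t0) (Z t0 \<omega>) - Z t0 \<omega>))"
proof (rule moment_order_of_even)
  have [measurable]: "S (t - t0) \<in> borel_measurable borel" if "t0 < t" for t0 t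
    using that by (intro borel_measurable_continuous_onI linear_continuous_on S_bounded_linear) auto
  show "(\<lambda>\<omega>. norm (S (t - t0) (Z t0 \<omega>) - Z t0 \<omega>)) \<in> borel_measurable M" if "0 \<le> t0" "t0 < t" "t \<le> T" for t0 t
    using Z_measurable[of t0] that by simp
  fix m :: nat assume m: "m \<ge> 1"
  obtain C where C: "C > 0" "\<And>t v. 0 \<le> t \<Longrightarrow> t \<le> T \<Longrightarrow> v \<in> fdom \<gamma> \<Longrightarrow> norm (S t v - v) \<le> C * t powr \<gamma> * norm (fpow \<gamma> v)"
    using increment_const by blast
  show "\<exists>C\<ge>0. \<forall>t0 t. 0 \<le> t0 \<and> t0 < t \<and> t \<le> T \<longrightarrow>
     moment M (2 * m) (\<lambda>\<omega>. norm (S (t - t0) (Z t0 \<omega>) - Z t0 \<omega>)) \<le> ennreal (C * (t - t0) powr (\<gamma> * real (2 * m)))"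
  proof (intro exI conjI allI impI)
    show "0 \<le> gauss_const m * (4 * (C\<^sup>2 * noise_energy)) ^ m" using gauss_const_pos[of m] noise_energy(1) by simp
    fix t0 t assume t: "0 \<le> t0 \<and> t0 < t \<and> t \<le> T"
    let ?R = "\<lambda>y. S (t - t0) y - y"
    let ?K = "C * (t - t0) powr \<gamma>"
    have R: "bounded_linear ?R" using t by (intro increment_bounded_linear) simp
    have t0: "t0 \<in> {0..T}" using t by auto
    have K: "?K > 0" using C t by simp
    have V: "?K\<^sup>2 * noise_energy > 0" by (intro mult_pos_pos zero_less_power K noise_energy(1))
    have hsb: "hs_integrand t0 (\<lambda>s x. S (t0 - s) (B x))" using hs_integrand_backward[OF bounded_linear_ident] by simp
    have "moment M (2 * m) (\<lambda>\<omega>. norm (?R (Z t0 \<omega>))) \<le> ennreal (gauss_const m * (4 * (?K\<^sup>2 * noise_energy)) ^ m)"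
    proof (rule wiener_integral_moment[OF wiener_integral_linear[OF Z_wiener_integral[OF t0] hsb t0 R] hs_integrand_backward[OF R] t0 V _ m])
      show "(\<integral>\<^sup>+s\<in>{0..t0}. hs_norm_sq (\<lambda>x. ?R (S (t0 - s) (B x))) \<partial>lborel) \<le> ennreal (?K\<^sup>2 * noise_energy)"
        unfolding hs_reverse[OF R]
        using t params by (intro hs_smooth_bound[OF R K]) (auto intro!: C(2) S_in_fdom)
    qed
    also have "gauss_const m * (4 * (?K\<^sup>2 * noise_energy)) ^ m = gauss_const m * (4 * (C\<^sup>2 * noise_energy)) ^ m * (t - t0) powr (\<gamma> * real (2 * m))"
    proof -
      have "(t - t0) powr (\<gamma> * real (2 * m)) = ((t - t0) powr \<gamma>) powr real (2 * m)" by (simp only: powr_powr)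
      also have "\<dots> = ((t - t0) powr \<gamma>) ^ (2 * m)" using t by (intro powr_realpow) simp
      also have "\<dots> = (((t - t0) powr \<gamma>)\<^sup>2) ^ m" by (rule power_mult)
      finally have "(t - t0) powr (\<gamma> * real (2 * m)) = (((t - t0) powr \<gamma>)\<^sup>2) ^ m" .
      then show ?thesis by (simp add: power_mult_distrib mult_ac)
    qed
    finally show "moment M (2 * m) (\<lambda>\<omega>. norm (?R (Z t0 \<omega>)))
        \<le> ennreal (gauss_const m * (4 * (C\<^sup>2 * noise_energy)) ^ m * (t - t0) powr (\<gamma> * real (2 * m)))" .
  qed
qed auto

text \<open>The assumption on \<open>\<delta>\<close> covers times up to 1; for longer times the integral is bounded, by the assumption on
  \<open>\<gamma>\<close>, and the power of \<open>t\<close> is at least 1.\<close>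

lemma hs_delta_bound:
  obtains C where "C > 0" "\<And>t. 0 < t \<Longrightarrow> t \<le> T \<Longrightarrow> (\<integral>\<^sup>+s\<in>{0..t}. hs_norm_sq (\<lambda>x. S s (B x)) \<partial>lborel) \<le> ennreal (C * t powr (2 * \<delta>))"
proof -
  obtain C where C: "C > 0" "\<forall>t\<in>{0..1}. (\<integral>\<^sup>+s\<in>{0..t}. hs_norm_sq (\<lambda>k. S s (B k)) \<partial>lborel) \<le> ennreal (C * t powr (2 * \<delta>))"
    using A3_delta by blast
  let ?K = "(c powr (- \<gamma>))\<^sup>2 * noise_energy"
  have K: "?K > 0" using noise_energy(1) c_powr_pos by simp
  show ?thesis
  proof (rule that[of "C + ?K"])
    fix t assume t: "0 < t" "t \<le> T"
    show "(\<integral>\<^sup>+s\<in>{0..t}. hs_norm_sq (\<lambda>x. S s (B x)) \<partial>lborel) \<le> ennreal ((C + ?K) * t powr (2 * \<delta>))"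
    proof (cases "t \<le> 1")
      case True
      then have "(\<integral>\<^sup>+s\<in>{0..t}. hs_norm_sq (\<lambda>x. S s (B x)) \<partial>lborel) \<le> ennreal (C * t powr (2 * \<delta>))"
        using C(2) t by auto
      also have "\<dots> \<le> ennreal ((C + ?K) * t powr (2 * \<delta>))"
        using C(1) K by (intro ennreal_leI mult_right_mono) auto
      finally show ?thesis .
    next
      case False
      then have "1 \<le> t powr (2 * \<delta>)" using params by (intro ge_one_powr_ge_zero) auto
      then have "?K * 1 \<le> (C + ?K) * t powr (2 * \<delta>)"
        using C(1) K by (intro mult_mono) auto
      then show ?thesis using hs_S_bound[OF t(2)] by (auto intro: order_trans ennreal_leI)
    qed
  qed (use C K in simp)
qed

text \<open>The difference is the stochastic integral of \<open>S (t - s) B\<close> over \<open>[t0, t]\<close>: on \<open>[0, t0]\<close> the two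
  integrands cancel by the semigroup law.\<close>

lemma moment_order_Z_delta: "moment_order M T \<delta> (\<lambda>t0 t \<omega>. norm (Z t \<omega> - S (t - t0) (Z t0 \<omega>)))"
proof (rule moment_order_of_even)
  have [measurable]: "S (t - t0) \<in> borel_measurable borel" if "t0 < t" for t0 t
    using that by (intro borel_measurable_continuous_onI linear_continuous_on S_bounded_linear) auto
  show "(\<lambda>\<omega>. norm (Z t \<omega> - S (t - t0) (Z t0 \<omega>))) \<in> borel_measurable M" if "0 \<le> t0" "t0 < t" "t \<le> T" for t0 t
    using Z_measurable[of t0] Z_measurable[of t] that by simp
  fix m :: nat assume m: "m \<ge> 1"
  obtain C where C: "C > 0" "\<And>t. 0 < t \<Longrightarrow> t \<le> T \<Longrightarrow> (\<integral>\<^sup>+s\<in>{0..t}. hs_norm_sq (\<lambda>x. S s (B x)) \<partial>lborel) \<le> ennreal (C * t powr (2 * \<delta>))"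
    using hs_delta_bound by blast
  show "\<exists>C\<ge>0. \<forall>t0 t. 0 \<le> t0 \<and> t0 < t \<and> t \<le> T \<longrightarrow>
     moment M (2 * m) (\<lambda>\<omega>. norm (Z t \<omega> - S (t - t0) (Z t0 \<omega>))) \<le> ennreal (C * (t - t0) powr (\<delta> * real (2 * m)))"
  proof (intro exI conjI allI impI)
    show "0 \<le> gauss_const m * (4 * C) ^ m" using gauss_const_pos[of m] C(1) by simp
    fix t0 t assume t: "0 \<le> t0 \<and> t0 < t \<and> t \<le> T"
    let ?R = "\<lambda>y. - S (t - t0) y"
    let ?V = "C * (t - t0) powr (2 * \<delta>)"
    have R: "bounded_linear ?R" using t by (intro bounded_linear_minus S_bounded_linear) simp
    have t0: "t0 \<in> {0..T}" and tT: "t \<in> {0..T}" using t by auto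
    have V: "?V > 0" using C t by simp
    have hsb: "hs_integrand t (\<lambda>s x. S (t - s) (B x))" for t using hs_integrand_backward[OF bounded_linear_ident] by simp
    let ?G = "\<lambda>s x. if s \<le> t0 then ?R (S (t0 - s) (B x)) else 0"
    have siR: "is_stochastic_integral M W t ?G (\<lambda>\<omega>. ?R (Z t0 \<omega>))"
      using wiener_integral_extend[OF wiener_integral_linear[OF Z_wiener_integral[OF t0] hsb t0 R], of t] t by simp
    have hG: "hs_integrand t ?G"
      unfolding hs_integrand_def
    proof
      fix x
      have eq: "(\<lambda>s. indicator {0..t} s *\<^sub>R ?G s x) = (\<lambda>s. indicator {0..t0} s *\<^sub>R ?R (S (t0 - s) (B x)))"
        using t by (auto simp: indicator_def fun_eq_iff)
      show "(\<lambda>s. indicator {0..t} s *\<^sub>R ?G s x) \<in> borel_measurable borel"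
        unfolding eq using hs_integrand_backward[OF R, of t0] unfolding hs_integrand_def by blast
    qed
    let ?H = "\<lambda>s x. S (t - s) (B x) + ?G s x"
    have hH: "hs_integrand t ?H"
      using hsb[of t] hG by (auto simp: hs_integrand_def scaleR_add_right intro!: borel_measurable_add simp del: scaleR_minus_right)
    have "moment M (2 * m) (\<lambda>\<omega>. norm (Z t \<omega> + ?R (Z t0 \<omega>))) \<le> ennreal (gauss_const m * (4 * ?V) ^ m)"
    proof (rule wiener_integral_moment[OF wiener_integral_add[OF Z_wiener_integral[OF tT] siR hsb hG tT] hH tT V _ m])
      \<comment> \<open>the integrand vanishes before \<open>t0\<close>, by the semigroup property\<close>
      have "hs_norm_sq (?H s) * indicator {0..t} s \<le> hs_norm_sq (\<lambda>x. S (t - s) (B x)) * indicator {t0..t} s" for s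
      proof (cases "s \<in> {0..t0}")
        case True
        then have "?H s x = 0" for x using t by (simp add: S_add)
        then show ?thesis by (simp add: hs_norm_sq_eq)
      qed (use t in \<open>auto simp: indicator_def\<close>)
      then have "(\<integral>\<^sup>+s\<in>{0..t}. hs_norm_sq (?H s) \<partial>lborel) \<le> (\<integral>\<^sup>+s\<in>{t0..t}. hs_norm_sq (\<lambda>x. S (t - s) (B x)) \<partial>lborel)"
        by (intro nn_integral_mono)
      also have "\<dots> = (\<integral>\<^sup>+s\<in>{0..t - t0}. hs_norm_sq (\<lambda>x. S s (B x)) \<partial>lborel)"
        using hs_reverse[OF bounded_linear_ident] by simp
      also have "\<dots> \<le> ennreal ?V" using t by (intro C) auto
      finally show "(\<integral>\<^sup>+s\<in>{0..t}. hs_norm_sq (?H s) \<partial>lborel) \<le> ennreal ?V" .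
    qed
    also have "gauss_const m * (4 * ?V) ^ m = gauss_const m * (4 * C) ^ m * (t - t0) powr (\<delta> * real (2 * m))"
    proof -
      have "(t - t0) powr (\<delta> * real (2 * m)) = ((t - t0) powr (2 * \<delta>)) ^ m"
        using t by (simp add: powr_powr powr_realpow[symmetric] mult_ac)
      then show ?thesis by (simp add: power_mult_distrib mult_ac)
    qed
    finally show "moment M (2 * m) (\<lambda>\<omega>. norm (Z t \<omega> - S (t - t0) (Z t0 \<omega>)))
        \<le> ennreal (gauss_const m * (4 * C) ^ m * (t - t0) powr (\<delta> * real (2 * m)))" by simp
  qed
qed auto

lemma space_F0: "space (\<F> 0) = space M"
  using subalg[of 0] T by (simp add: subalgebra_def)

lemma fdom_zero: "0 \<in> fdom \<gamma>"
  by (simp add: frac_dom_def)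

lemma fdom_diff:
  assumes "v \<in> fdom r" "w \<in> fdom r" shows "v - w \<in> fdom r"
proof -
  have i: "inner (e i) (fpow r v - fpow r w) = (\<kappa> + lam i) powr r * inner (e i) (v - w)" if "i \<in> I" for i
    using that assms by (simp add: fpow_coeff inner_diff_right right_diff_distrib)
  have "(\<lambda>i. (inner (e i) (fpow r v - fpow r w))\<^sup>2) summable_on I" by (rule bessel[OF is_onb_orthonormal[OF onb]])
  then show ?thesis by (simp add: frac_dom_def i cong: summable_on_cong)
qed

lemma fpow_diff: "v \<in> fdom r \<Longrightarrow> w \<in> fdom r \<Longrightarrow> fpow r (v - w) = fpow r v - fpow r w"
  by (rule onb_eqI[OF onb]) (simp add: fpow_coeff fdom_diff inner_diff_right right_diff_distrib)

text \<open>The initial value is measurable for the topology of this metric, and only balls are needed to see that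
  its norm is measurable.\<close>

lemma frac_metric: "Metric_space (fdom \<gamma>) (\<lambda>v w. norm (fpow \<gamma> (v - w)))"
proof
  fix v w x
  show "norm (fpow \<gamma> (v - w)) = norm (fpow \<gamma> (w - v))"
  proof -
    have "fpow \<gamma> (v - w) = - fpow \<gamma> (w - v)"
      unfolding frac_pow_def infsum_uminus[symmetric]
      by (intro infsum_cong) (simp add: inner_diff_right algebra_simps)
    then show ?thesis by simp
  qed
  show "v \<in> fdom \<gamma> \<Longrightarrow> w \<in> fdom \<gamma> \<Longrightarrow> norm (fpow \<gamma> (v - w)) = 0 \<longleftrightarrow> v = w"
    using norm_le_fpow[OF fdom_diff, of v \<gamma> w] params by (auto simp: frac_pow_def)
  assume "v \<in> fdom \<gamma>" "w \<in> fdom \<gamma>" "x \<in> fdom \<gamma>"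
  then show "norm (fpow \<gamma> (v - x)) \<le> norm (fpow \<gamma> (v - w)) + norm (fpow \<gamma> (w - x))"
    using norm_triangle_ineq[of "fpow \<gamma> v - fpow \<gamma> w" "fpow \<gamma> w - fpow \<gamma> x"] by (simp add: fpow_diff)
qed simp

lemma space_frac_borel: "space (frac_borel I lam e \<kappa> \<gamma>) = fdom \<gamma>"
  by (simp add: frac_borel_def space_measure_of_conv)

lemma u0_fdom: "\<omega> \<in> space M \<Longrightarrow> u0 \<omega> \<in> fdom \<gamma>"
  using measurable_space[OF A4_meas] by (simp add: space_F0 space_frac_borel)

lemma u0_norm_measurable [measurable]: "(\<lambda>\<omega>. norm (fpow \<gamma> (u0 \<omega>))) \<in> borel_measurable M"
proof -
  interpret Q: Metric_space "fdom \<gamma>" "\<lambda>v w. norm (fpow \<gamma> (v - w))" by (rule frac_metric)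
  have minus: "norm (fpow \<gamma> (- v)) = norm (fpow \<gamma> v)" for v using Q.commute[of 0 v] by simp
  have "(\<lambda>\<omega>. norm (fpow \<gamma> (u0 \<omega>))) \<in> borel_measurable (\<F> 0)"
  proof (rule borel_measurable_iff_less[THEN iffD2], intro allI)
    fix a
    have "Q.mball 0 a \<in> sets (frac_borel I lam e \<kappa> \<gamma>)"
      unfolding frac_borel_def
      using openin_subset[of Q.mtopology] by (subst sets_measure_of) auto
    moreover have "{\<omega> \<in> space (\<F> 0). norm (fpow \<gamma> (u0 \<omega>)) < a} = u0 -` Q.mball 0 a \<inter> space (\<F> 0)"
      using u0_fdom fdom_zero by (auto simp: Q.in_mball space_F0 minus)
    ultimately show "{\<omega> \<in> space (\<F> 0). norm (fpow \<gamma> (u0 \<omega>)) < a} \<in> sets (\<F> 0)"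
      using measurable_sets[OF A4_meas] by simp
  qed
  then show ?thesis using T by (intro measurable_from_subalg[OF subalg]) auto
qed

lemma moment_order_u0: "moment_order M T 0 (\<lambda>t0 t \<omega>. norm (fpow \<gamma> (u0 \<omega>)))"
proof (rule moment_order_uniform(1)[of T "\<lambda>t \<omega>. norm (fpow \<gamma> (u0 \<omega>))"])
  fix m :: nat assume m: "m \<ge> 1"
  have "(\<integral>\<^sup>+\<omega>. ennreal (norm (fpow \<gamma> (u0 \<omega>)) powr real (2 * m)) \<partial>M) < \<infinity>" using A4_mom m by simp
  moreover have "norm (fpow \<gamma> (u0 \<omega>)) powr real (2 * m) = norm (fpow \<gamma> (u0 \<omega>)) ^ (2 * m)" for \<omega>
    using m by (cases "norm (fpow \<gamma> (u0 \<omega>)) = 0") (auto simp: powr_realpow[symmetric])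
  ultimately have "moment M (2 * m) (\<lambda>\<omega>. norm (fpow \<gamma> (u0 \<omega>))) < \<infinity>" by simp
  then show "\<exists>C\<ge>0. \<forall>t\<in>{0..T}. moment M (2 * m) (\<lambda>\<omega>. norm (fpow \<gamma> (u0 \<omega>))) \<le> ennreal C"
    by (intro exI[of _ "enn2real (moment M (2 * m) (\<lambda>\<omega>. norm (fpow \<gamma> (u0 \<omega>))))"]) auto
qed auto

end


context spde
begin

section \<open>The mild equation and moments of the solution\<close>

lemma F_continuous: "continuous_on UNIV F"
proof -
  have "(F has_derivative (\<lambda>h. D 1 v [h])) (at v)" for v
    using D_derivative[of "[]" 0 v] unfolding D_0 by simp
  then show ?thesis by (meson continuous_at_imp_continuous_on has_derivative_continuous)
qed

lemma F_path_continuous: "\<omega> \<in> space M \<Longrightarrow> continuous_on {0..T} (\<lambda>s. F (X s \<omega>))"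
  by (rule continuous_on_compose2[OF F_continuous X_continuous]) auto

definition mild_at :: "'a \<Rightarrow> bool" where
  "mild_at \<omega> \<longleftrightarrow> \<omega> \<in> space M \<and> (\<forall>t\<in>{0..T}. X t \<omega> = S t (u0 \<omega>) + conv 0 (\<lambda>s. F (X s \<omega>)) t + Z t \<omega>)"

lemma AE_mild_at: "AE \<omega> in M. mild_at \<omega>"
proof -
  have "AE \<omega> in M. \<forall>t\<in>{0..T} \<inter> \<rat>. X t \<omega> = S t (u0 \<omega>) + conv 0 (\<lambda>s. F (X s \<omega>)) t + Z t \<omega>"
    using X by (subst AE_ball_countable) (auto simp: mild_solution_def conv_def intro: countable_Int2 countable_rat)
  then show ?thesis
    using AE_space
  proof eventually_elim
    case (elim \<omega>)
    have "X t \<omega> - (S t (u0 \<omega>) + conv 0 (\<lambda>s. F (X s \<omega>)) t + Z t \<omega>) = 0" if t: "t \<in> {0..T}" for t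
      by (rule continuous_zero_of_rationals[OF _ T _ t, where f = "\<lambda>t. X t \<omega> - (S t (u0 \<omega>) + conv 0 (\<lambda>s. F (X s \<omega>)) t + Z t \<omega>)"])
        (use elim in \<open>auto intro!: continuous_intros X_continuous Z_continuous S_continuous_on conv_continuous F_path_continuous\<close>)
    then show ?case using elim by (auto simp: mild_at_def)
  qed
qed

lemma path_increment:
  assumes \<omega>: "mild_at \<omega>" and t: "0 \<le> t0" "t0 \<le> t" "t \<le> T"
  shows "X t \<omega> - X t0 \<omega> = tree_process X Z t0 (RNode L0 []) t \<omega> + tree_process X Z t0 (RNode L1star []) t \<omega>
    + tree_process X Z t0 (RNode L2 []) t \<omega>"
proof -
  have sp: "\<omega> \<in> space M" and eq: "\<And>t. t \<in> {0..T} \<Longrightarrow> X t \<omega> = S t (u0 \<omega>) + conv 0 (\<lambda>s. F (X s \<omega>)) t + Z t \<omega>"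
    using \<omega> by (auto simp: mild_at_def)
  have lin: "linear (S (t - t0))" using t by (intro bounded_linear.linear S_bounded_linear) simp
  have "conv 0 (\<lambda>s. F (X s \<omega>)) t = S (t - t0) (conv 0 (\<lambda>s. F (X s \<omega>)) t0) + conv t0 (\<lambda>s. F (X s \<omega>)) t"
    using t by (intro conv_split continuous_on_subset[OF F_path_continuous[OF sp]]) auto
  moreover have "S t (u0 \<omega>) = S (t - t0) (S t0 (u0 \<omega>))" using t by (simp add: S_add)
  moreover have "S (t - t0) (X t0 \<omega>) = S (t - t0) (S t0 (u0 \<omega>)) + S (t - t0) (conv 0 (\<lambda>s. F (X s \<omega>)) t0) + S (t - t0) (Z t0 \<omega>)"
    using eq[of t0] t by (simp add: linear_add[OF lin])
  ultimately show ?thesis using eq[of t] t by simp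
qed

abbreviation S_bound :: real where "S_bound \<equiv> exp (\<kappa> * T)"

text \<open>A pathwise bound of the solution by random variables with moments of all orders.\<close>

lemma mild_gronwall:
  obtains K where "K \<ge> 0" "\<And>\<omega> t. mild_at \<omega> \<Longrightarrow> t \<in> {0..T} \<Longrightarrow>
    norm (X t \<omega>) \<le> K * ((1 + norm (fpow \<gamma> (u0 \<omega>))) + (norm (Z t \<omega>) + (LBINT s:{0..T}. norm (Z s \<omega>))))"
proof -
  define f0 where "f0 = norm (F 0)"
  define L where "L = deriv_bound 1"
  have L: "L \<ge> 0" "f0 \<ge> 0" by (auto simp: L_def f0_def deriv_bound_nonneg)
  define C where "C = S_bound * L"
  define a0 where "a0 = S_bound * c powr (- \<gamma>) + S_bound * T * f0"
  have C: "C \<ge> 0" using L by (simp add: C_def)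
  have a0: "a0 \<ge> 0" using L T by (simp add: a0_def)
  define K where "K = (1 + a0) * (1 + C * exp (C * T) * (1 + T))"
  have bound: "norm (X t \<omega>) \<le> K * ((1 + norm (fpow \<gamma> (u0 \<omega>))) + (norm (Z t \<omega>) + (LBINT s:{0..T}. norm (Z s \<omega>))))"
    if \<omega>: "mild_at \<omega>" and t: "t \<in> {0..T}" for \<omega> t
  proof -
    have sp: "\<omega> \<in> space M" and eq: "\<And>t. t \<in> {0..T} \<Longrightarrow> X t \<omega> = S t (u0 \<omega>) + conv 0 (\<lambda>s. F (X s \<omega>)) t + Z t \<omega>"
      using \<omega> by (auto simp: mild_at_def)
    define U where "U = norm (fpow \<gamma> (u0 \<omega>))"
    define J where "J = (LBINT s:{0..T}. norm (Z s \<omega>))"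
    define a where "a t = a0 * (1 + U) + norm (Z t \<omega>)" for t
    have U: "U \<ge> 0" by (simp add: U_def)
    have J: "J \<ge> 0" by (simp add: J_def set_integral_nonneg)
    have cX: "continuous_on {0..t} (\<lambda>s. X s \<omega>)" "continuous_on {0..t} (\<lambda>s. F (X s \<omega>))" if "t \<in> {0..T}" for t
      using X_continuous[OF sp] F_path_continuous[OF sp] that by (auto intro: continuous_on_subset)
    have pre: "norm (X t \<omega>) \<le> a t + C * (LBINT s:{0..t}. norm (X s \<omega>))" if t: "t \<in> {0..T}" for t
    proof -
      have "norm (S t (u0 \<omega>)) \<le> S_bound * norm (u0 \<omega>)" using t by (intro S_norm_le) auto
      also have "\<dots> \<le> S_bound * (c powr (- \<gamma>) * U)"
        unfolding U_def using u0_fdom[OF sp] params by (intro mult_left_mono norm_le_fpow) auto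
      finally have 1: "norm (S t (u0 \<omega>)) \<le> S_bound * c powr (- \<gamma>) * U" by simp
      have "(LBINT s:{0..t}. norm (F (X s \<omega>))) \<le> (LBINT s:{0..t}. f0 + L * norm (X s \<omega>))"
        using F_growth by (intro set_integral_mono set_integrable_continuous_Icc continuous_intros cX t) (auto simp: f0_def L_def)
      also have "\<dots> = (LBINT s:{0..t}. f0) + (LBINT s:{0..t}. L * norm (X s \<omega>))"
        by (intro set_integral_add set_integrable_continuous_Icc continuous_intros cX t)
      also have "(LBINT s:{0..t}. f0) = t * f0" using t by (simp add: set_lebesgue_integral_def)
      also have "t * f0 \<le> T * f0" using t L by (intro mult_right_mono) auto
      finally have "(LBINT s:{0..t}. norm (F (X s \<omega>))) \<le> T * f0 + L * (LBINT s:{0..t}. norm (X s \<omega>))" by simp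
      then have "S_bound * (LBINT s:{0..t}. norm (F (X s \<omega>))) \<le> S_bound * (T * f0 + L * (LBINT s:{0..t}. norm (X s \<omega>)))"
        by (intro mult_left_mono) auto
      moreover have "norm (conv 0 (\<lambda>s. F (X s \<omega>)) t) \<le> S_bound * (LBINT s:{0..t}. norm (F (X s \<omega>)))"
        using t by (intro conv_norm_le cX) auto
      ultimately have 2: "norm (conv 0 (\<lambda>s. F (X s \<omega>)) t) \<le> S_bound * T * f0 + C * (LBINT s:{0..t}. norm (X s \<omega>))"
        by (simp add: C_def algebra_simps)
      have "norm (X t \<omega>) \<le> norm (S t (u0 \<omega>)) + norm (conv 0 (\<lambda>s. F (X s \<omega>)) t) + norm (Z t \<omega>)"
        using eq[OF t] norm_triangle_ineq[of "S t (u0 \<omega>) + conv 0 (\<lambda>s. F (X s \<omega>)) t" "Z t \<omega>"]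
          norm_triangle_ineq[of "S t (u0 \<omega>)" "conv 0 (\<lambda>s. F (X s \<omega>)) t"] by simp
      moreover have "S_bound * c powr (- \<gamma>) * U + S_bound * T * f0 \<le> a0 * (1 + U)"
      proof -
        have "a0 * (1 + U) = S_bound * c powr (- \<gamma>) * U + S_bound * T * f0 + (S_bound * c powr (- \<gamma>) + S_bound * T * f0 * U)"
          by (simp add: a0_def algebra_simps)
        moreover have "0 \<le> S_bound * c powr (- \<gamma>) + S_bound * T * f0 * U" using L T U by simp
        ultimately show ?thesis by linarith
      qed
      ultimately show ?thesis using 1 2 by (simp add: a_def)
    qed
    have ca: "continuous_on {0..T} a" unfolding a_def [abs_def] by (intro continuous_intros Z_continuous[OF sp])
    have ap: "0 \<le> a s" for s using a0 U by (simp add: a_def)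
    have "(LBINT s:{0..t}. norm (X s \<omega>)) \<le> exp (C * t) * (LBINT s:{0..t}. a s)"
      using ca ap C pre t by (intro gronwall[where T = T]) (auto intro!: continuous_intros X_continuous[OF sp])
    also have "\<dots> \<le> exp (C * T) * (LBINT s:{0..T}. a s)"
    proof (rule mult_mono)
      show "exp (C * t) \<le> exp (C * T)" using C t by (simp add: mult_left_mono)
      show "(LBINT s:{0..t}. a s) \<le> (LBINT s:{0..T}. a s)"
        unfolding set_lebesgue_integral_def
      proof (rule integral_mono)
        show "integrable lborel (\<lambda>s. indicator {0..t} s *\<^sub>R a s)"
          using set_integrable_continuous_Icc[OF continuous_on_subset[OF ca], of 0 t] t by (simp add: set_integrable_def)
        show "integrable lborel (\<lambda>s. indicator {0..T} s *\<^sub>R a s)"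
          using set_integrable_continuous_Icc[OF ca] by (simp add: set_integrable_def)
        show "indicator {0..t} s *\<^sub>R a s \<le> indicator {0..T} s *\<^sub>R a s" for s
          using t ap[of s] by (auto simp: indicator_def)
      qed
    qed (auto intro: set_integral_nonneg ap)
    also have "(LBINT s:{0..T}. a s) = T * (a0 * (1 + U)) + J"
    proof -
      have "(LBINT s:{0..T}. a s) = (LBINT s:{0..T}. a0 * (1 + U)) + J"
        unfolding a_def [abs_def] J_def
        by (intro set_integral_add set_integrable_continuous_Icc continuous_intros Z_continuous[OF sp])
      then show ?thesis using T by (simp add: set_lebesgue_integral_def)
    qed
    finally have "C * (LBINT s:{0..t}. norm (X s \<omega>)) \<le> C * (exp (C * T) * (T * (a0 * (1 + U)) + J))"
      using C by (intro mult_left_mono) auto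
    then have "norm (X t \<omega>) \<le> a0 * (1 + U) + norm (Z t \<omega>) + C * exp (C * T) * (T * (a0 * (1 + U)) + J)"
      using pre[OF t] by (simp add: a_def mult.assoc)
    also have "\<dots> \<le> (1 + a0) * ((1 + U) + (norm (Z t \<omega>) + J)) + C * exp (C * T) * ((1 + T) * ((1 + a0) * ((1 + U) + (norm (Z t \<omega>) + J))))"
    proof (intro add_mono mult_left_mono)
      let ?P = "(1 + U) + (norm (Z t \<omega>) + J)"
      have P: "1 + U \<le> ?P" "J \<le> ?P" "0 \<le> ?P" using U J by auto
      have "a0 * (1 + U) \<le> a0 * ?P" using P(1) a0 by (rule mult_left_mono)
      moreover have "norm (Z t \<omega>) \<le> ?P" using U J by simp
      ultimately have "a0 * (1 + U) + norm (Z t \<omega>) \<le> a0 * ?P + ?P" by (rule add_mono)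
      then show "a0 * (1 + U) + norm (Z t \<omega>) \<le> (1 + a0) * ?P" by (simp add: algebra_simps)
      have "T * (a0 * (1 + U)) + J \<le> T * ((1 + a0) * ?P) + (1 + a0) * ?P"
      proof (intro add_mono mult_left_mono)
        show "a0 * (1 + U) \<le> (1 + a0) * ?P" using P a0 U by (intro mult_mono) auto
        show "J \<le> (1 + a0) * ?P" using mult_mono[of 1 "1 + a0" J ?P] P a0 J by simp
      qed (use T in auto)
      then show "T * (a0 * (1 + U)) + J \<le> (1 + T) * ((1 + a0) * ?P)" by (simp add: algebra_simps)
    qed (use C in auto)
    also have "\<dots> = K * ((1 + U) + (norm (Z t \<omega>) + J))" by (simp add: K_def algebra_simps)
    finally show ?thesis by (simp add: U_def J_def)
  qed
  show ?thesis by (rule that[OF _ bound]) (use a0 C T in \<open>simp add: K_def\<close>)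
qed

lemma moment_order_Z_integral: "moment_order M T 0 (\<lambda>t0 t \<omega>. LBINT s:{0..T}. norm (Z s \<omega>))"
proof -
  have o: "moment_order M T (0 + 1) (\<lambda>t0 t \<omega>. LBINT s:{t0..t}. norm (Z s \<omega>))"
  proof (rule moment_order_integral[OF moment_order_Z(1)])
    show "continuous_process M t0 T (\<lambda>s \<omega>. norm (Z s \<omega>))" if "0 \<le> t0" for t0
      using continuous_process_Z[OF that] by (auto simp: continuous_process_def intro!: continuous_intros)
  qed auto
  have meas: "(\<lambda>\<omega>. LBINT s:{0..T}. norm (Z s \<omega>)) \<in> borel_measurable M" using moment_orderD(1)[OF o, of 0 T] T by simp
  show ?thesis
  proof (rule moment_order_uniform(1)[of T "\<lambda>t \<omega>. LBINT s:{0..T}. norm (Z s \<omega>)"])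
    fix m :: nat assume m: "m \<ge> 1"
    then have m2: "2 * m \<ge> 1" by simp
    obtain C where C: "C \<ge> 0" "\<And>t0 t. 0 \<le> t0 \<Longrightarrow> t0 < t \<Longrightarrow> t \<le> T \<Longrightarrow>
        (\<integral>\<^sup>+\<omega>. ennreal ((LBINT s:{t0..t}. norm (Z s \<omega>)) ^ (2 * m)) \<partial>M) \<le> ennreal (C * (t - t0) powr ((0 + 1) * real (2 * m)))"
      using moment_order_bound[OF o m2] by blast
    show "\<exists>C\<ge>0. \<forall>t\<in>{0..T}. (\<integral>\<^sup>+\<omega>. ennreal ((LBINT s:{0..T}. norm (Z s \<omega>)) ^ (2 * m)) \<partial>M) \<le> ennreal C"
      using C(1) C(2)[of 0 T] T by (intro exI[of _ "C * T powr real (2 * m)"]) auto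
  qed (use meas in \<open>auto intro: set_integral_nonneg\<close>)
qed

lemma moment_order_X: "moment_order M T 0 (\<lambda>t0 t \<omega>. norm (X t \<omega>))" "moment_order M T 0 (\<lambda>t0 t \<omega>. norm (X t0 \<omega>))"
proof -
  obtain K where K: "K \<ge> 0" "\<And>\<omega> t. mild_at \<omega> \<Longrightarrow> t \<in> {0..T} \<Longrightarrow>
    norm (X t \<omega>) \<le> K * ((1 + norm (fpow \<gamma> (u0 \<omega>))) + (norm (Z t \<omega>) + (LBINT s:{0..T}. norm (Z s \<omega>))))"
    using mild_gronwall by blast
  have AEK: "AE \<omega> in M. norm (X t \<omega>) \<le> K * ((1 + norm (fpow \<gamma> (u0 \<omega>))) + (norm (Z t \<omega>) + (LBINT s:{0..T}. norm (Z s \<omega>))))"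
    if "t \<in> {0..T}" for t
    using AE_mild_at by eventually_elim (rule K(2)[OF _ that])
  have s: "moment_order M T 0 (\<lambda>t0 t \<omega>. (1 + norm (fpow \<gamma> (u0 \<omega>))) + (norm (Z t \<omega>) + (LBINT s:{0..T}. norm (Z s \<omega>))))"
    "moment_order M T 0 (\<lambda>t0 t \<omega>. (1 + norm (fpow \<gamma> (u0 \<omega>))) + (norm (Z t0 \<omega>) + (LBINT s:{0..T}. norm (Z s \<omega>))))"
    by (intro moment_order_add moment_order_const moment_order_u0 moment_order_Z moment_order_Z_integral; simp)+
  show "moment_order M T 0 (\<lambda>t0 t \<omega>. norm (X t \<omega>))"
    by (rule moment_order_le[OF s(1) K(1)]) (use AEK X_measurable in auto)
  show "moment_order M T 0 (\<lambda>t0 t \<omega>. norm (X t0 \<omega>))"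
    by (rule moment_order_le[OF s(2) K(1)]) (use AEK X_measurable in auto)
qed

section \<open>Temporal regularity of the solution\<close>

text \<open>The end points are left out: at \<open>s = t0\<close> the power is singular, and at \<open>s = 0\<close> the definition of
  \<open>moment_order\<close> gives no bound of the integrand.\<close>

definition singular_weight :: "real \<Rightarrow> real \<Rightarrow> ennreal" where
  "singular_weight t0 s = ennreal ((t0 - s) powr (- \<gamma>)) * indicator {0<..<t0} s"

lemma singular_weight_measurable [measurable]: "singular_weight t0 \<in> borel_measurable borel"
  unfolding singular_weight_def [abs_def] by measurable

lemma singular_weight_integral:
  assumes "0 \<le> t0" "t0 \<le> T"
  shows "(\<integral>\<^sup>+s. singular_weight t0 s \<partial>lborel) \<le> ennreal (T powr (1 - \<gamma>) / (1 - \<gamma>))"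
proof -
  have "((\<lambda>s. if s \<in> {0..t0} then s powr (- \<gamma>) else 0) has_integral (t0 powr (- \<gamma> + 1) / (- \<gamma> + 1))) UNIV"
    unfolding has_integral_restrict_UNIV using assms params by (intro has_integral_powr_from_0) auto
  then have I: "(\<integral>\<^sup>+s. ennreal (if s \<in> {0..t0} then s powr (- \<gamma>) else 0) \<partial>lborel) = ennreal (t0 powr (- \<gamma> + 1) / (- \<gamma> + 1))"
    by (intro nn_integral_has_integral_lborel) auto
  have "(\<integral>\<^sup>+s. ennreal (if s \<in> {0..t0} then s powr (- \<gamma>) else 0) \<partial>lborel)
      = ennreal \<bar>- 1\<bar> * (\<integral>\<^sup>+s. ennreal (if t0 + (- 1) * s \<in> {0..t0} then (t0 + (- 1) * s) powr (- \<gamma>) else 0) \<partial>lborel)"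
    by (rule nn_integral_real_affine) auto
  moreover have "(\<integral>\<^sup>+s. singular_weight t0 s \<partial>lborel) \<le> (\<integral>\<^sup>+s. ennreal (if t0 + (- 1) * s \<in> {0..t0} then (t0 + (- 1) * s) powr (- \<gamma>) else 0) \<partial>lborel)"
    by (intro nn_integral_mono) (auto simp: singular_weight_def indicator_def)
  ultimately have "(\<integral>\<^sup>+s. singular_weight t0 s \<partial>lborel) \<le> ennreal (t0 powr (1 - \<gamma>) / (1 - \<gamma>))" using I by simp
  also have "\<dots> \<le> ennreal (T powr (1 - \<gamma>) / (1 - \<gamma>))"
    using assms params by (intro ennreal_leI divide_right_mono powr_mono2) auto
  finally show ?thesis .
qed

definition growth :: "real \<Rightarrow> 'a \<Rightarrow> real" where
  "growth s \<omega> = norm (F 0) + deriv_bound 1 * norm (X s \<omega>)"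

lemma growth_nonneg: "0 \<le> growth s \<omega>"
  using deriv_bound_nonneg[of 1] by (simp add: growth_def)

lemma continuous_process_growth: "0 \<le> t0 \<Longrightarrow> continuous_process M t0 T growth"
  using continuous_process_X[of t0] by (auto simp: continuous_process_def growth_def [abs_def] intro!: continuous_intros)

lemma moment_order_growth: "moment_order M T 0 (\<lambda>t0 t. growth t)" "moment_order M T 0 (\<lambda>t0 t. growth t0)"
proof -
  have "moment_order M T (0 + 0) (\<lambda>t0 t \<omega>. deriv_bound 1 * norm (X t \<omega>))" "moment_order M T (0 + 0) (\<lambda>t0 t \<omega>. deriv_bound 1 * norm (X t0 \<omega>))"
    by (intro moment_order_mult moment_order_const moment_order_X deriv_bound_nonneg; simp)+
  then show "moment_order M T 0 (\<lambda>t0 t. growth t)" "moment_order M T 0 (\<lambda>t0 t. growth t0)"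
    unfolding growth_def [abs_def] by (auto intro!: moment_order_add moment_order_const)
qed

text \<open>The smoothing effect of the semigroup costs a singularity at \<open>s = t0\<close>, which is integrable as \<open>\<gamma> < 1\<close>.\<close>

definition singular_drift :: "real \<Rightarrow> 'a \<Rightarrow> ennreal" where
  "singular_drift t0 \<omega> = (\<integral>\<^sup>+s. singular_weight t0 s * ennreal (indicator {0..T} s *\<^sub>R growth s \<omega>) \<partial>lborel)"

lemma singular_drift_measurable: "singular_drift t0 \<in> borel_measurable M"
  and singular_drift_joint: "(\<lambda>p. ennreal (indicator {0..T} (snd p) *\<^sub>R growth (snd p) (fst p))) \<in> borel_measurable (M \<Otimes>\<^sub>M lborel)"
proof -
  have "(\<lambda>p. indicator {0..T} (snd p) *\<^sub>R growth (snd p) (fst p)) \<in> borel_measurable (M \<Otimes>\<^sub>M lborel)"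
    using T by (intro continuous_process_joint continuous_process_growth) auto
  then show [measurable]: "(\<lambda>p. ennreal (indicator {0..T} (snd p) *\<^sub>R growth (snd p) (fst p))) \<in> borel_measurable (M \<Otimes>\<^sub>M lborel)"
    by (rule measurable_compose[OF _ measurable_ennreal])
  have "(\<lambda>p. singular_weight t0 (snd p) * ennreal (indicator {0..T} (snd p) *\<^sub>R growth (snd p) (fst p))) \<in> borel_measurable (M \<Otimes>\<^sub>M lborel)"
    by measurable
  then show "singular_drift t0 \<in> borel_measurable M"
    unfolding singular_drift_def [abs_def]
    by (intro lborel.borel_measurable_nn_integral) (simp add: split_beta')
qed

lemma singular_drift_finite:
  assumes \<omega>: "\<omega> \<in> space M" and t0: "0 \<le> t0" "t0 \<le> T"
  shows "singular_drift t0 \<omega> < \<infinity>"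
proof -
  have "continuous_on {0..T} (\<lambda>s. growth s \<omega>)" using continuous_process_growth[of 0] \<omega> by (simp add: continuous_process_def)
  then have "bounded ((\<lambda>s. growth s \<omega>) ` {0..T})" by (intro compact_imp_bounded compact_continuous_image) auto
  then obtain b where "\<forall>y\<in>(\<lambda>s. growth s \<omega>) ` {0..T}. norm y \<le> b" unfolding bounded_iff by blast
  then have b: "indicator {0..T} s *\<^sub>R growth s \<omega> \<le> \<bar>b\<bar>" for s by (force simp: indicator_def)
  have "singular_drift t0 \<omega> \<le> (\<integral>\<^sup>+s. singular_weight t0 s * ennreal \<bar>b\<bar> \<partial>lborel)"
    unfolding singular_drift_def by (intro nn_integral_mono mult_left_mono ennreal_leI b) auto
  also have "\<dots> = (\<integral>\<^sup>+s. singular_weight t0 s \<partial>lborel) * ennreal \<bar>b\<bar>" by (simp add: nn_integral_multc)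
  also have "\<dots> \<le> ennreal (T powr (1 - \<gamma>) / (1 - \<gamma>)) * ennreal \<bar>b\<bar>"
    by (intro mult_right_mono singular_weight_integral t0) auto
  also have "\<dots> < \<infinity>" by (simp add: ennreal_mult_less_top)
  finally show ?thesis .
qed

lemma moment_order_singular_drift: "moment_order M T 0 (\<lambda>t0 t \<omega>. enn2real (singular_drift t0 \<omega>))"
proof (rule moment_order_uniform(2)[of T "\<lambda>t \<omega>. enn2real (singular_drift t \<omega>)"])
  fix m :: nat assume m: "m \<ge> 1"
  then have m2: "2 * m \<ge> 1" by simp
  obtain C where C: "C \<ge> 0" "\<And>t0 t. 0 \<le> t0 \<Longrightarrow> t0 < t \<Longrightarrow> t \<le> T \<Longrightarrow>
      moment M (2 * m) (growth t) \<le> ennreal (C * (t - t0) powr (0 * real (2 * m)))"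
    using moment_order_bound[OF moment_order_growth(1) m2] by blast
  let ?A = "T powr (1 - \<gamma>) / (1 - \<gamma>)"
  have A: "?A \<ge> 0" using params by simp
  show "\<exists>C\<ge>0. \<forall>t\<in>{0..T}. (\<integral>\<^sup>+\<omega>. ennreal (enn2real (singular_drift t \<omega>) ^ (2 * m)) \<partial>M) \<le> ennreal C"
  proof (intro exI[of _ "?A ^ (2 * m) * C"] conjI ballI)
    fix t0 assume t0: "t0 \<in> {0..T}"
    have "(\<integral>\<^sup>+\<omega>. ennreal (enn2real (singular_drift t0 \<omega>) ^ (2 * m)) \<partial>M) \<le> (\<integral>\<^sup>+\<omega>. singular_drift t0 \<omega> ^ (2 * m) \<partial>M)"
      by (intro nn_integral_mono) (simp add: ennreal_power[symmetric] power_mono ennreal_enn2real_le)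
    also have "\<dots> \<le> ennreal ?A ^ (2 * m) * ennreal C"
      unfolding singular_drift_def
    proof (rule moment_weighted_integral[OF _ singular_drift_joint])
      show "(\<integral>\<^sup>+s. singular_weight t0 s \<partial>lborel) \<le> ennreal ?A" using t0 by (intro singular_weight_integral) auto
      fix s assume "singular_weight t0 s \<noteq> 0"
      then have s: "0 < s" "s < t0" by (auto simp: singular_weight_def indicator_def split: if_splits)
      have "(\<integral>\<^sup>+\<omega>. ennreal (indicator {0..T} s *\<^sub>R growth s \<omega>) ^ (2 * m) \<partial>M) = moment M (2 * m) (growth s)"
        using s t0 growth_nonneg by (intro nn_integral_cong) (simp add: ennreal_power)
      also have "\<dots> \<le> ennreal C" using C(2)[of 0 s] s t0 by simp
      finally show "(\<integral>\<^sup>+\<omega>. ennreal (indicator {0..T} s *\<^sub>R growth s \<omega>) ^ (2 * m) \<partial>M) \<le> ennreal C" .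
    qed (use m2 in \<open>auto intro: sigma_finite_measure_axioms\<close>)
    also have "\<dots> = ennreal (?A ^ (2 * m) * C)" using A C(1) by (simp only: ennreal_power ennreal_mult'[symmetric] zero_le_power)
    finally show "(\<integral>\<^sup>+\<omega>. ennreal (enn2real (singular_drift t0 \<omega>) ^ (2 * m)) \<partial>M) \<le> ennreal (?A ^ (2 * m) * C)" .
  qed (use A C in simp)
qed (use singular_drift_measurable in auto)

lemma drift_increment:
  obtains K where "K \<ge> 0" "\<And>\<omega> t0 t. \<omega> \<in> space M \<Longrightarrow> 0 \<le> t0 \<Longrightarrow> t0 < t \<Longrightarrow> t \<le> T \<Longrightarrow>
    norm (S (t - t0) (conv 0 (\<lambda>s. F (X s \<omega>)) t0) - conv 0 (\<lambda>s. F (X s \<omega>)) t0)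
      \<le> K * ((t - t0) powr \<gamma> * enn2real (singular_drift t0 \<omega>))"
proof -
  obtain C where C: "C > 0" "\<And>t v. 0 \<le> t \<Longrightarrow> t \<le> T \<Longrightarrow> v \<in> fdom \<gamma> \<Longrightarrow> norm (S t v - v) \<le> C * t powr \<gamma> * norm (fpow \<gamma> v)"
    using increment_const by blast
  show ?thesis
  proof (rule that[of "C * S_bound"])
    fix \<omega> t0 t assume \<omega>: "\<omega> \<in> space M" and t: "0 \<le> t0" "t0 < t" "t \<le> T"
    let ?R = "\<lambda>y. S (t - t0) y - y"
    let ?k = "C * (t - t0) powr \<gamma> * S_bound"
    have k: "?k \<ge> 0" using C(1) by simp
    have R: "bounded_linear ?R" using t by (intro increment_bounded_linear) simp
    have cF: "continuous_on {0..t0} (\<lambda>s. F (X s \<omega>))" using t by (intro continuous_on_subset[OF F_path_continuous[OF \<omega>]]) auto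
    have int: "integrable lborel (\<lambda>s. indicator {0..t0} s *\<^sub>R S (t0 - s) (F (X s \<omega>)))"
      using conv_integrable[OF cF] by (simp add: set_integrable_def)
    have "?R (conv 0 (\<lambda>s. F (X s \<omega>)) t0) = (LINT s|lborel. ?R (indicator {0..t0} s *\<^sub>R S (t0 - s) (F (X s \<omega>))))"
      unfolding conv_def set_lebesgue_integral_def by (rule integral_bounded_linear[OF R int, symmetric])
    then have "ennreal (norm (?R (conv 0 (\<lambda>s. F (X s \<omega>)) t0))) \<le> (\<integral>\<^sup>+s. norm (?R (indicator {0..t0} s *\<^sub>R S (t0 - s) (F (X s \<omega>)))) \<partial>lborel)"
      using integral_norm_bound_ennreal[OF integrable_bounded_linear[OF R int]] by simp
    also have "\<dots> \<le> (\<integral>\<^sup>+s. ennreal ?k * (singular_weight t0 s * ennreal (indicator {0..T} s *\<^sub>R growth s \<omega>)) \<partial>lborel)"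
    proof (rule nn_integral_mono_AE)
      show "AE s in lborel. ennreal (norm (?R (indicator {0..t0} s *\<^sub>R S (t0 - s) (F (X s \<omega>)))))
          \<le> ennreal ?k * (singular_weight t0 s * ennreal (indicator {0..T} s *\<^sub>R growth s \<omega>))"
        using AE_lborel_singleton[of "0::real"] AE_lborel_singleton[of t0]
      proof eventually_elim
        case (elim s)
        show ?case
        proof (cases "s \<in> {0..t0}")
          case True
          then have s: "0 < s" "s < t0" using elim by auto
          let ?y = "S (t0 - s) (F (X s \<omega>))"
          have "norm (?R ?y) \<le> C * (t - t0) powr \<gamma> * norm (fpow \<gamma> ?y)"
            using s t params by (intro C(2) S_in_fdom) auto
          also have "\<dots> \<le> C * (t - t0) powr \<gamma> * (S_bound * (t0 - s) powr (- \<gamma>) * norm (F (X s \<omega>)))"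
            using s t params C(1) by (intro mult_left_mono fpow_S_norm) auto
          also have "\<dots> \<le> C * (t - t0) powr \<gamma> * (S_bound * (t0 - s) powr (- \<gamma>) * growth s \<omega>)"
            using F_growth[of "X s \<omega>"] C(1) by (intro mult_left_mono) (auto simp: growth_def)
          finally have "norm (?R ?y) \<le> ?k * ((t0 - s) powr (- \<gamma>) * growth s \<omega>)" by (simp add: mult_ac)
          then show ?thesis
            using s t k growth_nonneg[of s \<omega>]
            by (simp add: singular_weight_def ennreal_mult'[symmetric] ennreal_leI)
        next
          case False
          then show ?thesis by (simp add: linear_0[OF bounded_linear.linear[OF S_bounded_linear]] t less_imp_le)
        qed
      qed
    qed
    also have "\<dots> = ennreal ?k * singular_drift t0 \<omega>"
      unfolding singular_drift_def
    proof (rule nn_integral_cmult)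
      have "(\<lambda>s. ennreal (indicator {0..T} s *\<^sub>R growth s \<omega>)) \<in> borel_measurable lborel"
        using measurable_compose[OF measurable_Pair1'[OF \<omega>] singular_drift_joint] by simp
      then show "(\<lambda>s. singular_weight t0 s * ennreal (indicator {0..T} s *\<^sub>R growth s \<omega>)) \<in> borel_measurable lborel" by measurable
    qed
    also have "\<dots> = ennreal (?k * enn2real (singular_drift t0 \<omega>))"
      using singular_drift_finite[OF \<omega>, of t0] t k by (simp add: ennreal_mult')
    finally have "norm (?R (conv 0 (\<lambda>s. F (X s \<omega>)) t0)) \<le> ?k * enn2real (singular_drift t0 \<omega>)"
      using k by (subst (asm) ennreal_le_iff) auto
    then show "norm (?R (conv 0 (\<lambda>s. F (X s \<omega>)) t0)) \<le> C * S_bound * ((t - t0) powr \<gamma> * enn2real (singular_drift t0 \<omega>))"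
      by (simp add: mult_ac)
  qed (use C in simp)
qed

text \<open>The increment of the semigroup is applied to each of the three terms of the mild equation, and each
  time a factor of order \<open>\<gamma>\<close> is gained: from the regularity of the initial value, from the smoothing of
  the drift convolution, and from that of the stochastic convolution. Thus no fractional power of a random
  vector other than the initial value is ever formed.\<close>

lemma moment_order_L0: "moment_order M T \<gamma> (\<lambda>t0 t \<omega>. norm (S (t - t0) (X t0 \<omega>) - X t0 \<omega>))"
proof -
  obtain K where K: "K \<ge> 0" "\<And>\<omega> t0 t. \<omega> \<in> space M \<Longrightarrow> 0 \<le> t0 \<Longrightarrow> t0 < t \<Longrightarrow> t \<le> T \<Longrightarrow>
    norm (S (t - t0) (conv 0 (\<lambda>s. F (X s \<omega>)) t0) - conv 0 (\<lambda>s. F (X s \<omega>)) t0)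
      \<le> K * ((t - t0) powr \<gamma> * enn2real (singular_drift t0 \<omega>))"
    using drift_increment by blast
  obtain C where C: "C > 0" "\<And>t v. 0 \<le> t \<Longrightarrow> t \<le> T \<Longrightarrow> v \<in> fdom \<gamma> \<Longrightarrow> norm (S t v - v) \<le> C * t powr \<gamma> * norm (fpow \<gamma> v)"
    using increment_const by blast
  define B0 where "B0 = K + C * S_bound + 1"
  have B0: "K \<le> B0" "C * S_bound \<le> B0" "1 \<le> B0" "0 \<le> B0" using K C by (auto simp: B0_def)
  have s: "moment_order M T (\<gamma> + 0) (\<lambda>t0 t \<omega>. (t - t0) powr \<gamma> * norm (fpow \<gamma> (u0 \<omega>)))"
    "moment_order M T (\<gamma> + 0) (\<lambda>t0 t \<omega>. (t - t0) powr \<gamma> * enn2real (singular_drift t0 \<omega>))"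
    by (intro moment_order_mult moment_order_powr moment_order_u0 moment_order_singular_drift)+
  have "moment_order M T \<gamma> (\<lambda>t0 t \<omega>. (t - t0) powr \<gamma> * norm (fpow \<gamma> (u0 \<omega>)) +
     ((t - t0) powr \<gamma> * enn2real (singular_drift t0 \<omega>) + norm (S (t - t0) (Z t0 \<omega>) - Z t0 \<omega>)))"
    using s by (intro moment_order_add moment_order_increment_Z) auto
  then show ?thesis
  proof (rule moment_order_le[OF _ B0(4)])
    fix t0 t assume t: "0 \<le> t0" "t0 < t" "t \<le> T"
    have [measurable]: "S (t - t0) \<in> borel_measurable borel"
      using t by (intro borel_measurable_continuous_onI linear_continuous_on S_bounded_linear) auto
    show "(\<lambda>\<omega>. norm (S (t - t0) (X t0 \<omega>) - X t0 \<omega>)) \<in> borel_measurable M"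
      using X_measurable[of t0] t by simp
    show "AE \<omega> in M. norm (S (t - t0) (X t0 \<omega>) - X t0 \<omega>) \<le> B0 * ((t - t0) powr \<gamma> * norm (fpow \<gamma> (u0 \<omega>)) +
     ((t - t0) powr \<gamma> * enn2real (singular_drift t0 \<omega>) + norm (S (t - t0) (Z t0 \<omega>) - Z t0 \<omega>)))"
      using AE_mild_at
    proof eventually_elim
      case (elim \<omega>)
      then have sp: "\<omega> \<in> space M" and eq: "X t0 \<omega> = S t0 (u0 \<omega>) + conv 0 (\<lambda>s. F (X s \<omega>)) t0 + Z t0 \<omega>"
        using t by (auto simp: mild_at_def)
      let ?R = "\<lambda>y. S (t - t0) y - y"
      let ?p = "(t - t0) powr \<gamma>"
      have lin: "linear ?R" using t by (intro bounded_linear.linear increment_bounded_linear) simp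
      have "?R (X t0 \<omega>) = ?R (S t0 (u0 \<omega>)) + ?R (conv 0 (\<lambda>s. F (X s \<omega>)) t0) + ?R (Z t0 \<omega>)"
        using linear_add[OF lin] unfolding eq by simp
      then have "norm (?R (X t0 \<omega>)) \<le> norm (?R (S t0 (u0 \<omega>))) + norm (?R (conv 0 (\<lambda>s. F (X s \<omega>)) t0)) + norm (?R (Z t0 \<omega>))"
        using norm_triangle_ineq[of "?R (S t0 (u0 \<omega>)) + ?R (conv 0 (\<lambda>s. F (X s \<omega>)) t0)" "?R (Z t0 \<omega>)"]
          norm_triangle_ineq[of "?R (S t0 (u0 \<omega>))" "?R (conv 0 (\<lambda>s. F (X s \<omega>)) t0)"] by simp
      also have "norm (?R (S t0 (u0 \<omega>))) \<le> B0 * (?p * norm (fpow \<gamma> (u0 \<omega>)))"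
      proof -
        have "norm (?R (S t0 (u0 \<omega>))) \<le> C * ?p * norm (fpow \<gamma> (S t0 (u0 \<omega>)))"
          using t u0_fdom[OF sp] by (intro C(2) S_fdom) auto
        also have "\<dots> = C * ?p * norm (S t0 (fpow \<gamma> (u0 \<omega>)))" using t u0_fdom[OF sp] by (simp add: fpow_S_commute)
        also have "\<dots> \<le> C * ?p * (S_bound * norm (fpow \<gamma> (u0 \<omega>)))" using t C(1) by (intro mult_left_mono S_norm_le) auto
        also have "\<dots> = C * S_bound * (?p * norm (fpow \<gamma> (u0 \<omega>)))" by (simp add: mult_ac)
        also have "\<dots> \<le> B0 * (?p * norm (fpow \<gamma> (u0 \<omega>)))" using B0 by (intro mult_right_mono) auto
        finally show ?thesis .
      qed
      also have "norm (?R (conv 0 (\<lambda>s. F (X s \<omega>)) t0)) \<le> B0 * (?p * enn2real (singular_drift t0 \<omega>))"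
        by (rule order_trans[OF K(2)[OF sp t] mult_right_mono[OF B0(1)]]) auto
      also have "norm (?R (Z t0 \<omega>)) \<le> B0 * norm (?R (Z t0 \<omega>))" using B0(3) by (simp add: mult_le_cancel_right1)
      finally show ?case by (simp add: distrib_left)
    qed
  qed simp
qed

section \<open>Orders of trees and woods\<close>

lemma tree_order_nonneg: "0 \<le> tree_order \<gamma> \<delta> r"
proof (induction r)
  case (RNode q cs)
  have "0 \<le> weight \<gamma> \<delta> q" using params by (cases q) auto
  then show ?case using RNode.IH by (auto intro!: add_nonneg_nonneg sum_list_nonneg)
qed

text \<open>Leaves of type \<open>0\<close> and \<open>2\<close> have order \<open>\<gamma>\<close> and \<open>\<delta>\<close>. An integral node multiplies the processes of its
  children, adding their orders, and gains one order by integration in time. A childless integral node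
  is bounded by the linear growth of \<open>F\<close>, all other kernels by bounded derivatives.\<close>

lemma moment_order_tree:
  "leaves_wf r \<Longrightarrow> moment_order M T (tree_order \<gamma> \<delta> r) (\<lambda>t0 t \<omega>. norm (tree_process X Z t0 r t \<omega>))"
proof (induction r)
  case (RNode q cs)
  consider "q = L0" | "q = L2" | "q \<in> {L1, L1star}" by (cases q) auto
  then show ?case
  proof cases
    case 1
    then show ?thesis using RNode.prems moment_order_L0 by simp
  next
    case 2
    then show ?thesis using RNode.prems moment_order_Z_delta by simp
  next
    case 3
    let ?n = "length cs"
    let ?a = "\<Sum>c\<leftarrow>cs. tree_order \<gamma> \<delta> c"
    have a: "?a \<ge> 0" by (auto intro!: sum_list_nonneg tree_order_nonneg)
    define g where "g t0 t \<omega> = (if cs = [] then growth t0 \<omega> + growth t \<omega> else deriv_bound ?n * (\<Prod>c\<leftarrow>cs. norm (tree_process X Z t0 c t \<omega>)))" for t0 t \<omega>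
    have cp: "continuous_process M t0 T (tree_process X Z t0 r)" if "0 \<le> t0" for t0 r
      using that by (intro continuous_process_tree_process continuous_process_X continuous_process_Z)
    have "moment_order M T ?a g"
    proof (cases "cs = []")
      case True
      then show ?thesis unfolding g_def [abs_def] by (simp add: moment_order_add moment_order_growth)
    next
      case False
      have "moment_order M T (0 + ?a) (\<lambda>t0 t \<omega>. deriv_bound ?n * (\<Prod>c\<leftarrow>cs. norm (tree_process X Z t0 c t \<omega>)))"
        using False RNode.prems
        by (intro moment_order_mult moment_order_const moment_order_prod RNode.IH deriv_bound_nonneg) (auto simp: Suc_le_eq)
      then show ?thesis using False unfolding g_def [abs_def] by simp
    qed
    moreover have g_cont: "continuous_process M t0 T (g t0)" if "0 \<le> t0" "t0 < T" for t0
    proof (cases "cs = []")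
      case True
      have m: "growth s \<in> borel_measurable M" if "s \<in> {t0..T}" for s
        using continuous_process_growth[of t0] that \<open>0 \<le> t0\<close> by (simp add: continuous_process_def)
      have "(\<lambda>\<omega>. growth t0 \<omega> + growth s \<omega>) \<in> borel_measurable M" if "s \<in> {t0..T}" for s
        using that \<open>t0 < T\<close> by (intro borel_measurable_add m) auto
      then show ?thesis using True continuous_process_growth[of t0] that
        by (auto simp: continuous_process_def g_def [abs_def] intro!: continuous_intros)
    next
      case False
      have tm: "tree_process X Z t0 c t \<in> borel_measurable M" if "t \<in> {t0..T}" for c t
        using cp[OF \<open>0 \<le> t0\<close>, of c] that by (simp add: continuous_process_def)
      have "(\<lambda>\<omega>. \<Prod>c\<leftarrow>cs'. norm (tree_process X Z t0 c t \<omega>)) \<in> borel_measurable M" if "t \<in> {t0..T}" for t cs'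
        by (induction cs') (auto intro!: borel_measurable_times measurable_compose[OF tm[OF that] borel_measurable_norm])
      moreover have "continuous_on {t0..T} (\<lambda>t. \<Prod>c\<leftarrow>cs'. norm (tree_process X Z t0 c t \<omega>))" if "\<omega> \<in> space M" for \<omega> cs'
        using cp[OF \<open>0 \<le> t0\<close>] that by (induction cs') (auto simp: continuous_process_def intro!: continuous_intros)
      ultimately show ?thesis using False by (auto simp: continuous_process_def g_def [abs_def] intro!: continuous_intros)
    qed
    moreover have g_nonneg: "0 \<le> g t0 t \<omega>" for t0 t \<omega>
      by (auto simp: g_def growth_nonneg Suc_le_eq intro!: add_nonneg_nonneg mult_nonneg_nonneg deriv_bound_nonneg prod_list_nonneg)
    ultimately have "moment_order M T (?a + 1) (\<lambda>t0 t \<omega>. LBINT s:{t0..t}. g t0 s \<omega>)"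
      using a by (intro moment_order_integral) auto
    then have "moment_order M T (?a + 1) (\<lambda>t0 t \<omega>. norm (tree_process X Z t0 (RNode q cs) t \<omega>))"
    proof (rule moment_order_le[where B = S_bound])
      fix t0 t assume t: "0 \<le> t0" "t0 < t" "t \<le> T"
      have "tree_process X Z t0 (RNode q cs) t \<in> borel_measurable M"
        using cp[OF t(1), of "RNode q cs"] t by (simp add: continuous_process_def)
      then show "(\<lambda>\<omega>. norm (tree_process X Z t0 (RNode q cs) t \<omega>)) \<in> borel_measurable M"
        by (rule measurable_compose[OF _ borel_measurable_norm])
      show "AE \<omega> in M. norm (tree_process X Z t0 (RNode q cs) t \<omega>) \<le> S_bound * (LBINT s:{t0..t}. g t0 s \<omega>)"
        using AE_space
      proof eventually_elim
        case (elim \<omega>)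
        let ?k = "\<lambda>s. kernel q ?n (X t0 \<omega>) (X s \<omega> - X t0 \<omega>) (map (\<lambda>c. tree_process X Z t0 c s \<omega>) cs)"
        have kc: "continuous_on {t0..t} ?k"
          using continuous_process_X[OF t(1)] continuous_process_Z[OF t(1)] elim t
          by (intro continuous_on_subset[OF tree_value_integrand_continuous[OF _ _ 3, of t0 T]]) (auto simp: continuous_process_def)
        have "norm (tree_process X Z t0 (RNode q cs) t \<omega>) \<le> S_bound * (LBINT s:{t0..t}. norm (?k s))"
          unfolding tree_value_integral[OF 3] using t by (intro conv_norm_le kc) auto
        also have "\<dots> \<le> S_bound * (LBINT s:{t0..t}. g t0 s \<omega>)"
        proof (intro mult_left_mono set_integral_mono set_integrable_continuous_Icc continuous_intros kc)
          show "continuous_on {t0..t} (\<lambda>s. g t0 s \<omega>)"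
            using g_cont[of t0] elim t by (auto simp: continuous_process_def intro: continuous_on_subset)
          show "norm (?k s) \<le> g t0 s \<omega>" for s
          proof (cases "cs = []")
            case True
            have "norm (?k s) \<le> norm (F 0) + deriv_bound 1 * (norm (X t0 \<omega>) + norm (X s \<omega>))"
              using kernel_0_bound[OF 3, of "X t0 \<omega>" "X s \<omega> - X t0 \<omega>"] True by simp
            also have "\<dots> \<le> g t0 s \<omega>" using True by (simp add: g_def growth_def distrib_left)
            finally show ?thesis .
          next
            case False
            have "norm (?k s) \<le> deriv_bound ?n * prod_list (map norm (map (\<lambda>c. tree_process X Z t0 c s \<omega>) cs))"
              using False by (intro kernel_bound 3) (auto simp: Suc_le_eq)
            then show ?thesis using False by (simp add: g_def comp_def)
          qed
        qed simp
        finally show ?case .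
      qed
    qed auto
    moreover have "tree_order \<gamma> \<delta> (RNode q cs) = ?a + 1" using 3 by auto
    ultimately show ?thesis by (simp only:)
  qed
qed

lemma wood_identity:
  assumes w: "w \<in> SW'" and \<omega>: "mild_at \<omega>" and t: "0 \<le> t0" "t0 \<le> t" "t \<le> T"
  shows "X t \<omega> = X t0 \<omega> + Phi_wood S F D X Z t0 w t \<omega>"
proof -
  have sp: "\<omega> \<in> space M" using \<omega> by (simp add: mild_at_def)
  have "(\<Sum>tr\<leftarrow>w. tree_process X Z t0 (rose tr 1) t \<omega>) = X t \<omega> - X t0 \<omega>"
  proof (rule wood_expansion[where b = T, OF _ _ _ w])
    show "X t \<omega> - X t0 \<omega> = tree_process X Z t0 (RNode L0 []) t \<omega> + tree_process X Z t0 (RNode L1star []) t \<omega>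
       + tree_process X Z t0 (RNode L2 []) t \<omega>" if "t \<in> {t0..T}" for t
      using that t by (intro path_increment[OF \<omega>]) auto
  qed (use continuous_process_X[OF t(1)] continuous_process_Z[OF t(1)] sp t in \<open>auto simp: continuous_process_def\<close>)
  moreover have "Phi_wood S F D X Z t0 w t \<omega> = (\<Sum>tr\<leftarrow>w. tree_process X Z t0 (rose tr 1) t \<omega>)"
    unfolding Phi_wood_def
    by (intro arg_cong[of _ _ sum_list] map_cong refl Phi_eq_tree_value) (use SW'_subset_SW w in \<open>auto simp: SW_def\<close>)
  ultimately show ?thesis by simp
qed

text \<open>The norm of the sum of the processes of all active trees of \<open>w\<close>, almost surely.\<close>

definition remainder :: "stree list \<Rightarrow> real \<Rightarrow> real \<Rightarrow> 'a \<Rightarrow> real" where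
  "remainder w t0 t \<omega> = norm (X t \<omega> - X t0 \<omega> - Psi_wood S F D X Z t0 w t \<omega>)"

lemma Psi_eq_tree_value: "tr \<in> ST \<Longrightarrow> Psi S F D X Z t0 tr t \<omega> = (if active tr then 0 else tree_process X Z t0 (rose tr 1) t \<omega>)"
  by (simp add: Psi_def Phi_eq_tree_value)

lemma remainder_start: "w \<in> SW' \<Longrightarrow> remainder w t0 t0 \<omega> = 0"
proof -
  assume "w \<in> SW'"
  then have "Psi S F D X Z t0 tr t0 \<omega> = 0" if "tr \<in> set w" for tr
    using SW'_subset_SW that by (subst Psi_eq_tree_value) (auto simp: SW_def)
  then have "Psi_wood S F D X Z t0 w t0 \<omega> = (\<Sum>tr\<leftarrow>w. 0)"
    unfolding Psi_wood_def by (intro arg_cong[of _ _ sum_list] map_cong) auto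
  then show ?thesis by (simp add: remainder_def)
qed

text \<open>Each active tree has at least the order of the wood.\<close>

lemma moment_order_remainder:
  assumes w: "w \<in> SW'"
  shows "moment_order M T (ord_wood \<gamma> \<delta> w) (remainder w)"
proof -
  have ST: "tr \<in> ST" if "tr \<in> set w" for tr using SW'_subset_SW w that by (auto simp: SW_def)
  have good: "good_tree \<gamma> \<delta> tr" if "tr \<in> set w" for tr using SW'_good[OF w] that by blast
  let ?A = "filter active w"
  have "moment_order M T (ord_wood \<gamma> \<delta> w) (\<lambda>t0 t \<omega>. \<Sum>tr\<leftarrow>?A. norm (tree_process X Z t0 (rose tr 1) t \<omega>))"
  proof (rule moment_order_sum_list)
    fix tr assume tr: "tr \<in> set ?A"
    have "ord_wood \<gamma> \<delta> w \<le> ord_tree \<gamma> \<delta> tr"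
      unfolding ord_wood_def using tr by (intro Min_le) auto
    moreover have "moment_order M T (ord_tree \<gamma> \<delta> tr) (\<lambda>t0 t \<omega>. norm (tree_process X Z t0 (rose tr 1) t \<omega>))"
      using good[of tr] tr moment_order_tree[of "rose tr 1"] leaves_wf_rose[of tr 1] by (simp add: good_tree_def)
    ultimately show "moment_order M T (ord_wood \<gamma> \<delta> w) (\<lambda>t0 t \<omega>. norm (tree_process X Z t0 (rose tr 1) t \<omega>))"
      by (rule moment_order_weaken[rotated])
  qed
  then show ?thesis
  proof (rule moment_order_le[where B = 1])
    fix t0 t assume t: "0 \<le> t0" "t0 < t" "t \<le> T"
    have cp: "tree_process X Z t0 r t \<in> borel_measurable M" for r
      using continuous_process_tree_process[OF continuous_process_X[OF t(1)] continuous_process_Z[OF t(1)], of r] t by (simp add: continuous_process_def)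
    have "Psi S F D X Z t0 tr t \<in> borel_measurable M" if "tr \<in> set w" for tr
      using cp[of "rose tr 1"] Psi_eq_tree_value[OF ST[OF that], of t0 t] by (cases "active tr") (auto cong: measurable_cong)
    then have "Psi_wood S F D X Z t0 w t \<in> borel_measurable M"
      unfolding Psi_wood_def [abs_def] by (rule borel_measurable_sum_list)
    then show "remainder w t0 t \<in> borel_measurable M"
      unfolding remainder_def [abs_def] using X_measurable[of t] X_measurable[of t0] t by simp
    show "AE \<omega> in M. remainder w t0 t \<omega> \<le> 1 * (\<Sum>tr\<leftarrow>?A. norm (tree_process X Z t0 (rose tr 1) t \<omega>))"
      using AE_mild_at
    proof eventually_elim
      case (elim \<omega>)
      let ?p = "\<lambda>tr. tree_process X Z t0 (rose tr 1) t \<omega>"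
      have "X t \<omega> - X t0 \<omega> - Psi_wood S F D X Z t0 w t \<omega> = (\<Sum>tr\<leftarrow>w. ?p tr) - (\<Sum>tr\<leftarrow>w. if active tr then 0 else ?p tr)"
      proof -
        have "Phi_wood S F D X Z t0 w t \<omega> = (\<Sum>tr\<leftarrow>w. ?p tr)"
          unfolding Phi_wood_def by (intro arg_cong[of _ _ sum_list] map_cong refl Phi_eq_tree_value ST)
        moreover have "Psi_wood S F D X Z t0 w t \<omega> = (\<Sum>tr\<leftarrow>w. if active tr then 0 else ?p tr)"
          unfolding Psi_wood_def by (intro arg_cong[of _ _ sum_list] map_cong refl Psi_eq_tree_value ST)
        ultimately show ?thesis using wood_identity[OF w elim t(1) less_imp_le[OF t(2)] t(3)] by simp
      qed
      also have "\<dots> = (\<Sum>tr\<leftarrow>?A. ?p tr)" by (induction w) auto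
      finally have "remainder w t0 t \<omega> = norm (\<Sum>tr\<leftarrow>?A. ?p tr)" by (simp add: remainder_def)
      also have "\<dots> \<le> (\<Sum>tr\<leftarrow>?A. norm (?p tr))"
      proof -
        have "norm (\<Sum>x\<leftarrow>xs. ?p x) \<le> (\<Sum>x\<leftarrow>xs. norm (?p x))" for xs
          by (induction xs) (auto intro: order_trans[OF norm_triangle_ineq])
        then show ?thesis .
      qed
      finally show ?case by simp
    qed
  qed (auto simp: remainder_def)
qed

end

theorem theorem1:
  fixes M :: "'a measure" and \<F> :: "real \<Rightarrow> 'a measure" and T :: real
    and W :: "real \<Rightarrow> 'k::{real_inner, banach, second_countable_topology} \<Rightarrow> 'a \<Rightarrow> real"
    and B :: "'k \<Rightarrow> 'h::{real_inner, banach, second_countable_topology}"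
    and I :: "'i set" and lam :: "'i \<Rightarrow> real" and e :: "'i \<Rightarrow> 'h"
    and DA :: "'h set" and A :: "'h \<Rightarrow> 'h" and S :: "real \<Rightarrow> 'h \<Rightarrow> 'h"
    and F :: "'h \<Rightarrow> 'h" and D :: "nat \<Rightarrow> 'h \<Rightarrow> 'h list \<Rightarrow> 'h"
    and \<kappa> \<gamma> \<delta> :: real
    and u0 :: "'a \<Rightarrow> 'h" and Z X :: "real \<Rightarrow> 'a \<Rightarrow> 'h"
    and w :: "stree list"
  assumes T: "T > 0"
    and prob: "prob_space M"
    and filt: "normal_filtration M T \<F>"
    and wiener: "cylindrical_wiener M \<F> T W"
    and B: "bounded_linear B"
    and A1: "diagonal_operator I lam e DA A"
    and S: "S = semigroup_exp I lam e"
    and kappa: "\<kappa> \<ge> 0" "\<exists>c>0. \<forall>i\<in>I. \<kappa> + lam i \<ge> c"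
    and A2: "frechet_derivatives F D" "\<forall>i\<ge>1. bdd_above (range (\<lambda>v. multilinear_norm i (D i v)))"
    and A3_params: "0 < \<gamma>" "\<gamma> < 1" "0 < \<delta>" "\<delta> \<le> 1/2"
    and A3_gamma: "(\<integral>\<^sup>+s\<in>{0..T}. hs_norm_sq (\<lambda>k. frac_pow I lam e \<kappa> \<gamma> (S s (B k))) \<partial>lborel) < \<infinity>"
    and A3_delta: "\<exists>C>0. \<forall>t\<in>{0..1}.
          (\<integral>\<^sup>+s\<in>{0..t}. hs_norm_sq (\<lambda>k. S s (B k)) \<partial>lborel) \<le> ennreal (C * t powr (2 * \<delta>))"
    and A4_meas: "u0 \<in> measurable (\<F> 0) (frac_borel I lam e \<kappa> \<gamma>)"
    and A4_mom: "\<forall>p::real\<ge>1. (\<integral>\<^sup>+\<omega>. ennreal (norm (frac_pow I lam e \<kappa> \<gamma> (u0 \<omega>)) powr p) \<partial>M) < \<infinity>"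
    and Z: "continuous_stochastic_convolution M T W S B Z"
    and X: "mild_solution M \<F> T S F u0 Z X"
    and w: "w \<in> SW'"
  shows "\<forall>p::real\<ge>1. \<exists>C>0. \<forall>t0\<in>{0..<T}.
           (AE \<omega> in M. \<forall>t\<in>{t0..T}. X t \<omega> = X t0 \<omega> + Phi_wood S F D X Z t0 w t \<omega>) \<and>
           (\<forall>t\<in>{t0..T}.
              integrable M (\<lambda>\<omega>. norm (X t \<omega> - X t0 \<omega> - Psi_wood S F D X Z t0 w t \<omega>) powr p) \<and>
              (\<integral>\<omega>. norm (X t \<omega> - X t0 \<omega> - Psi_wood S F D X Z t0 w t \<omega>) powr p \<partial>M) powr (1 / p)
                \<le> C * (t - t0) powr ord_wood \<gamma> \<delta> w)"
proof (intro allI impI)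
  fix p :: real assume p: "p \<ge> 1"
  obtain c where c: "c > 0" "\<forall>i\<in>I. \<kappa> + lam i \<ge> c" using kappa(2) by blast
  interpret prob_space M by (rule prob)
  interpret P: spde I lam e \<kappa> c F D M \<F> T W B \<gamma> \<delta> u0 Z X
  proof unfold_locales
    show "is_onb I e" using A1 by (simp add: diagonal_operator_def)
  qed (use assms c in auto)
  let ?S = "semigroup_exp I lam e"
  obtain C where C: "C > 0" "\<And>t0 t. 0 \<le> t0 \<Longrightarrow> t0 < t \<Longrightarrow> t \<le> T \<Longrightarrow>
     integrable M (\<lambda>\<omega>. P.remainder w t0 t \<omega> powr p) \<and>
     (\<integral>\<omega>. P.remainder w t0 t \<omega> powr p \<partial>M) powr (1 / p) \<le> C * (t - t0) powr ord_wood \<gamma> \<delta> w"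
    using moment_order_Lp[OF P.moment_order_remainder[OF w] p] by blast
  show "\<exists>C>0. \<forall>t0\<in>{0..<T}.
           (AE \<omega> in M. \<forall>t\<in>{t0..T}. X t \<omega> = X t0 \<omega> + Phi_wood S F D X Z t0 w t \<omega>) \<and>
           (\<forall>t\<in>{t0..T}.
              integrable M (\<lambda>\<omega>. norm (X t \<omega> - X t0 \<omega> - Psi_wood S F D X Z t0 w t \<omega>) powr p) \<and>
              (\<integral>\<omega>. norm (X t \<omega> - X t0 \<omega> - Psi_wood S F D X Z t0 w t \<omega>) powr p \<partial>M) powr (1 / p)
                \<le> C * (t - t0) powr ord_wood \<gamma> \<delta> w)"
    unfolding S
  proof (intro exI[of _ C] conjI ballI C(1))
    fix t0 assume t0: "t0 \<in> {0..<T}"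
    show "AE \<omega> in M. \<forall>t\<in>{t0..T}. X t \<omega> = X t0 \<omega> + Phi_wood ?S F D X Z t0 w t \<omega>"
      using P.AE_mild_at
    proof eventually_elim
      case (elim \<omega>)
      then show ?case using t0 by (intro ballI P.wood_identity[OF w]) auto
    qed
    fix t assume t: "t \<in> {t0..T}"
    have "integrable M (\<lambda>\<omega>. P.remainder w t0 t \<omega> powr p) \<and>
     (\<integral>\<omega>. P.remainder w t0 t \<omega> powr p \<partial>M) powr (1 / p) \<le> C * (t - t0) powr ord_wood \<gamma> \<delta> w"
    proof (cases "t = t0")
      case True
      then show ?thesis by (simp add: P.remainder_start[OF w])
    next
      case False
      then show ?thesis using t0 t by (intro C(2)) auto
    qed
    then show "integrable M (\<lambda>\<omega>. norm (X t \<omega> - X t0 \<omega> - Psi_wood ?S F D X Z t0 w t \<omega>) powr p)"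
      "(\<integral>\<omega>. norm (X t \<omega> - X t0 \<omega> - Psi_wood ?S F D X Z t0 w t \<omega>) powr p \<partial>M) powr (1 / p)
         \<le> C * (t - t0) powr ord_wood \<gamma> \<delta> w"
      by (simp_all add: P.remainder_def)
  qed
qed

end
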